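(* Let $1<p<\infty$, let $\Omega_1,\Omega_2\subset\mathbb{C}$ be bounded Dini-smooth domains and let $\phi:\Omega_1\to\Omega_2$ be analytic with $\phi\in W^{1,\infty}(\Omega_1)$. Let $\alpha_1,\alpha_2\in L^\infty(\Omega_2)$ and $\widetilde\alpha_i=(\alpha_i\circ\phi)\overline{\partial\phi}$ for $i\in\{1,2\}$. Then the composition operator $C_\phi:f\mapsto f\circ\phi$ is compact from $G^p_{\alpha_1}(\Omega_2)$ to $G^p_{\widetilde\alpha_1}(\Omega_1)$ if and only if it is compact from $G^p_{\alpha_2}(\Omega_2)$ to $G^p_{\widetilde\alpha_2}(\Omega_1)$. In particular, when $\Omega_1=\Omega_2=\mathbb{D}$ (the unit disc), if $\alpha\in L^\infty(\mathbb{D})$ and $\widetilde\alpha=(\alpha\circ\phi)\overline{\partial\phi}$, then $C_\phi:G^p_\alpha(\mathbb{D})\to G^p_{\widetilde\alpha}(\mathbb{D})$ is compact if and only if $C_\phi:H^p(\mathbb{D})\to H^p(\mathbb{D})$ is compact.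
   Context: A bounded domain (connected open set) is Dini-smooth if its boundary is a finite union of pairwise disjoint Jordan curves, each with a non-singular parametrization whose derivative is Dini-continuous, i.e. has modulus of continuity $\omega$ with $\int_0^\varepsilon \omega(t)\,dt/t<\infty$ for some $\varepsilon>0$. For a bounded Dini-smooth domain $\Omega$ and $\alpha\in L^\infty(\Omega)$ (complex-valued), $G^p_\alpha(\Omega)$ is the real Banach space of measurable $w:\Omega\to\mathbb{C}$ solving $\overline\partial w=\alpha\overline w$ in the sense of distributions on $\Omega$ with $\|w\|_{G^p_\alpha(\Omega)}:=\sup_n\|w\|_{L^p(\partial\Delta_n)}<\infty$. Here $(\Delta_n)_n$ is a fixed sequence of domains with $\overline{\Delta_n}\subset\Omega$, $\partial\Delta_n$ a finite union of rectifiable Jordan curves of uniformly bounded length, and each compact subset of $\Omega$ contained in $\Delta_n$ for $n$ large. Recalled facts: functions in $G^p_\alpha(\Omega)$ are continuous in $\Omega$ (after modification on a null set); equivalently (with equivalent norms) $G^p_\alpha(\Omega)$ is the space of solutions $w$ for which $|w|^p\le u$ a.e. for some harmonic $u:\Omega\to[0,\infty)$, normed by $\inf u(z_0)^{1/p}$ over such $u$, for a fixed $z_0\in\Omega$. $H^p(\mathbb{D})=G^p_0(\mathbb{D})$ is the classical analytic Hardy space. If $\phi$ is constant, $\widetilde\alpha_i$ is understood to be $0$. *)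

theory Defs
  imports "HOL-Complex_Analysis.Complex_Analysis"
begin

section \<open>Arc length\<close>

text \<open>Arc length on a subset of the plane is the one-dimensional Hausdorff measure. Coverings
  consist of bounded sets because \<^const>\<open>diameter\<close> is meaningless on unbounded ones.\<close>

definition length_premeasure :: "real \<Rightarrow> complex set \<Rightarrow> ennreal" where
  "length_premeasure \<delta> A =
     (INF C \<in> {C :: nat \<Rightarrow> complex set. A \<subseteq> (\<Union>i. C i) \<and> (\<forall>i. bounded (C i) \<and> diameter (C i) \<le> \<delta>)}.
        \<Sum>i. ennreal (diameter (C i)))"

definition outer_length :: "complex set \<Rightarrow> ennreal" where
  "outer_length A = (SUP \<delta> \<in> {0<..}. length_premeasure \<delta> A)"

definition arc_length :: "complex measure" where
  "arc_length = measure_of UNIV (sets borel) outer_length"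

text \<open>\<^const>\<open>measure_of\<close> returns the null measure when its argument is not countably additive; the
  following facts, ending in \<open>emeasure_arc_length\<close>, exclude this.\<close>

lemma length_premeasure_mono:
  "A \<subseteq> B \<Longrightarrow> length_premeasure \<delta> A \<le> length_premeasure \<delta> B"
  unfolding length_premeasure_def by (intro INF_superset_mono) auto

lemma length_premeasure_antimono:
  "\<delta> \<le> \<epsilon> \<Longrightarrow> length_premeasure \<epsilon> A \<le> length_premeasure \<delta> A"
  unfolding length_premeasure_def by (intro INF_superset_mono) (auto intro: order_trans)

lemma length_premeasure_empty: "0 < \<delta> \<Longrightarrow> length_premeasure \<delta> {} = 0"
proof -
  assume "0 < \<delta>"
  then have "length_premeasure \<delta> {} \<le> (\<Sum>i::nat. ennreal (diameter ({}::complex set)))"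
    unfolding length_premeasure_def by (intro INF_lower) auto
  then show ?thesis by simp
qed

lemma length_premeasure_subadditive:
  assumes "0 < \<delta>"
  shows "length_premeasure \<delta> (\<Union>n. A n) \<le> (\<Sum>n::nat. length_premeasure \<delta> (A n))"
proof (rule ennreal_le_epsilon)
  fix e :: real
  assume fin: "(\<Sum>n. length_premeasure \<delta> (A n)) < top" and e: "0 < e"
  have "\<exists>C. A n \<subseteq> (\<Union>i::nat. C i) \<and> (\<forall>i. bounded (C i) \<and> diameter (C i) \<le> \<delta>) \<and>
      (\<Sum>i. ennreal (diameter (C i))) \<le> length_premeasure \<delta> (A n) + ennreal (e * (1/2) ^ Suc n)" for n
  proof -
    have "length_premeasure \<delta> (A n) < top"
      using fin ennreal_suminf_lessD by (metis less_top)
    then have "length_premeasure \<delta> (A n) < length_premeasure \<delta> (A n) + ennreal (e * (1/2) ^ Suc n)"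
      using e by (simp add: ennreal_add_left_cancel_less[of _ 0, simplified] less_top)
    from this[unfolded length_premeasure_def[of \<delta> "A n"], unfolded INF_less_iff]
    show ?thesis unfolding length_premeasure_def by (blast intro: less_imp_le)
  qed
  then obtain C where C: "\<And>n. A n \<subseteq> (\<Union>i::nat. C n i)" "\<And>n i. bounded (C n i)"
      "\<And>n i. diameter (C n i) \<le> \<delta>"
      "\<And>n. (\<Sum>i. ennreal (diameter (C n i))) \<le> length_premeasure \<delta> (A n) + ennreal (e * (1/2) ^ Suc n)"
    by metis
  define D where "D k = (case prod_decode k of (n, i) \<Rightarrow> C n i)" for k
  have "(\<Union>n. A n) \<subseteq> (\<Union>k. D k)"
  proof
    fix x assume "x \<in> (\<Union>n. A n)"
    then obtain n i where "x \<in> C n i" using C(1) by blast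
    then have "x \<in> D (prod_encode (n, i))" by (simp add: D_def)
    then show "x \<in> (\<Union>k. D k)" by blast
  qed
  then have "length_premeasure \<delta> (\<Union>n. A n) \<le> (\<Sum>k. ennreal (diameter (D k)))"
    unfolding length_premeasure_def
    by (intro INF_lower) (auto simp: D_def C split: prod.split)
  also have "\<dots> = (\<Sum>k. (\<lambda>(n, i). ennreal (diameter (C n i))) (prod_decode k))"
    by (simp add: D_def case_prod_unfold)
  also have "\<dots> = (\<Sum>n. \<Sum>i. ennreal (diameter (C n i)))"
    by (rule suminf_ennreal_2dimen) simp
  also have "\<dots> \<le> (\<Sum>n. length_premeasure \<delta> (A n) + ennreal (e * (1/2) ^ Suc n))"
    by (intro suminf_le C) auto
  also have "\<dots> = (\<Sum>n. length_premeasure \<delta> (A n)) + (\<Sum>n. ennreal (e * (1/2) ^ Suc n))"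
    by (rule suminf_add[symmetric]) auto
  also have "(\<Sum>n. ennreal (e * (1/2) ^ Suc n)) = ennreal e"
    using e sums_mult[OF power_half_series, of e] by (intro suminf_ennreal_eq) auto
  finally show "length_premeasure \<delta> (\<Union>n. A n) \<le> (\<Sum>n. length_premeasure \<delta> (A n)) + ennreal e" .
qed

lemma outer_length_mono: "A \<subseteq> B \<Longrightarrow> outer_length A \<le> outer_length B"
  unfolding outer_length_def by (intro SUP_mono) (auto intro: length_premeasure_mono)

lemma outer_length_empty: "outer_length {} = 0"
  unfolding outer_length_def by (auto simp: length_premeasure_empty cong: SUP_cong_simp)

lemma outer_length_subadditive:
  "outer_length (\<Union>n. A n) \<le> (\<Sum>n::nat. outer_length (A n))"
proof -
  have "length_premeasure \<delta> (\<Union>n. A n) \<le> (\<Sum>n. outer_length (A n))" if "0 < \<delta>" for \<delta>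
  proof -
    have "length_premeasure \<delta> (\<Union>n. A n) \<le> (\<Sum>n. length_premeasure \<delta> (A n))"
      by (rule length_premeasure_subadditive[OF that])
    also have "\<dots> \<le> (\<Sum>n. outer_length (A n))"
      using that by (intro suminf_le) (auto simp: outer_length_def intro: SUP_upper)
    finally show ?thesis .
  qed
  then show ?thesis unfolding outer_length_def[of "\<Union>n. A n"] by (intro SUP_least) auto
qed

lemma outer_length_Un: "outer_length (A \<union> B) \<le> outer_length A + outer_length B"
proof -
  define S where "S n = (if n = 0 then A else if n = Suc 0 then B else {})" for n :: nat
  have "A \<union> B \<subseteq> (\<Union>n. S n)"
    by (auto simp: S_def intro: exI[of _ 0] exI[of _ "Suc 0"])
  then have "outer_length (A \<union> B) \<le> (\<Sum>n. outer_length (S n))"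
    using outer_length_mono outer_length_subadditive order_trans by blast
  also have "\<dots> = (\<Sum>n\<in>{0, Suc 0}. outer_length (S n))"
    by (rule suminf_finite) (auto simp: S_def outer_length_empty)
  finally show ?thesis by (simp add: S_def)
qed

lemma outer_length_separated:
  assumes d: "0 < d" and sep: "\<And>x y. x \<in> A \<Longrightarrow> y \<in> B \<Longrightarrow> d \<le> dist x y"
  shows "outer_length A + outer_length B \<le> outer_length (A \<union> B)"
proof -
  have key: "length_premeasure \<delta> A + length_premeasure \<delta> B \<le> length_premeasure \<delta> (A \<union> B)"
    if \<delta>: "0 < \<delta>" "\<delta> < d" for \<delta>
  proof -
    have "length_premeasure \<delta> A + length_premeasure \<delta> B \<le> (\<Sum>i. ennreal (diameter (C i)))"
      if C: "A \<union> B \<subseteq> (\<Union>i::nat. C i)" "\<And>i. bounded (C i)" "\<And>i. diameter (C i) \<le> \<delta>" for C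
    proof -
      define P where "P i = (if C i \<inter> A = {} then {} else C i)" for i
      define Q where "Q i = (if C i \<inter> B = {} then {} else C i)" for i
      have "length_premeasure \<delta> A \<le> (\<Sum>i. ennreal (diameter (P i)))"
        unfolding length_premeasure_def using C \<delta>
        by (intro INF_lower) (fastforce simp: P_def)
      moreover have "length_premeasure \<delta> B \<le> (\<Sum>i. ennreal (diameter (Q i)))"
        unfolding length_premeasure_def using C \<delta>
        by (intro INF_lower) (fastforce simp: Q_def)
      moreover have "ennreal (diameter (P i)) + ennreal (diameter (Q i)) \<le> ennreal (diameter (C i))" for i
      proof -
        have "C i \<inter> A = {} \<or> C i \<inter> B = {}"
        proof (rule ccontr)
          assume "\<not> ?thesis"
          then obtain x y where xy: "x \<in> C i" "x \<in> A" "y \<in> C i" "y \<in> B" by blast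
          then have "dist x y \<le> diameter (C i)" by (intro diameter_bounded_bound C)
          with sep[of x y] xy C(3)[of i] \<delta> show False by simp
        qed
        then show ?thesis by (auto simp: P_def Q_def)
      qed
      then have "(\<Sum>i. ennreal (diameter (P i))) + (\<Sum>i. ennreal (diameter (Q i)))
          \<le> (\<Sum>i. ennreal (diameter (C i)))"
        by (subst suminf_add) (auto intro!: suminf_le)
      ultimately show ?thesis by (meson add_mono order_trans)
    qed
    then show ?thesis unfolding length_premeasure_def[of _ "A \<union> B"] by (intro INF_greatest) auto
  qed
  have "length_premeasure \<delta>1 A + length_premeasure \<delta>2 B \<le> outer_length (A \<union> B)"
    if "0 < \<delta>1" "0 < \<delta>2" for \<delta>1 \<delta>2
  proof -
    define \<delta> where "\<delta> = min (d/2) (min \<delta>1 \<delta>2)"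
    have \<delta>: "0 < \<delta>" "\<delta> < d" "\<delta> \<le> \<delta>1" "\<delta> \<le> \<delta>2" using that d by (auto simp: \<delta>_def)
    have "length_premeasure \<delta>1 A + length_premeasure \<delta>2 B
        \<le> length_premeasure \<delta> A + length_premeasure \<delta> B"
      using \<delta> by (intro add_mono length_premeasure_antimono)
    also have "\<dots> \<le> length_premeasure \<delta> (A \<union> B)" using \<delta> by (intro key)
    also have "\<dots> \<le> outer_length (A \<union> B)"
      unfolding outer_length_def using \<delta> by (intro SUP_upper) auto
    finally show ?thesis .
  qed
  then show ?thesis
    unfolding outer_length_def[of A] outer_length_def[of B]
    by (simp add: ennreal_SUP_add_left[symmetric] ennreal_SUP_add_right SUP_le_iff)
qed

lemma outer_length_closed_splits:
  assumes "closed F"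
  shows "outer_length (A \<inter> F) + outer_length (A - F) \<le> outer_length A"
proof (cases "F = {} \<or> outer_length A = top")
  case True
  then show ?thesis by (auto simp: outer_length_empty)
next
  case False
  then have F: "F \<noteq> {}" and fin: "outer_length A < top" by (auto simp: less_top)
  define r where "r k = 1 / real (Suc k)" for k
  have r: "0 < r k" "r (Suc k) < r k" for k by (auto simp: r_def field_simps)
  have r_mono: "r j \<le> r i" if "i \<le> j" for i j
    using that by (auto simp: r_def field_simps)
  define E where "E k = {x \<in> A. r k \<le> infdist x F}" for k
  define R where "R k = {x \<in> A. r (Suc k) \<le> infdist x F \<and> infdist x F < r k}" for k
  have EF: "outer_length (A \<inter> F) + outer_length (E k) \<le> outer_length A" for k
  proof -
    have "r k \<le> dist x y" if "x \<in> A \<inter> F" "y \<in> E k" for x y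
      using that infdist_le[of x F y] by (auto simp: E_def dist_commute)
    then have "outer_length (A \<inter> F) + outer_length (E k) \<le> outer_length ((A \<inter> F) \<union> E k)"
      using r by (intro outer_length_separated[of "r k"]) blast+
    also have "\<dots> \<le> outer_length A" by (intro outer_length_mono) (auto simp: E_def)
    finally show ?thesis .
  qed
  have sep: "outer_length (R j) + outer_length S \<le> outer_length (R j \<union> S)"
    if S: "\<And>x. x \<in> S \<Longrightarrow> r i \<le> infdist x F" and "i < j" for S i j
  proof -
    have "r i - r j \<le> dist x y" if "x \<in> R j" "y \<in> S" for x y
    proof -
      have "infdist y F \<le> infdist x F + dist y x" by (rule infdist_triangle)
      with that S[of y] show ?thesis by (auto simp: R_def dist_commute)
    qed
    moreover have "r j < r i" using \<open>i < j\<close> by (simp add: r_def field_simps)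
    ultimately show ?thesis by (intro outer_length_separated[of "r i - r j"]) auto
  qed
  have par: "(\<Sum>k<n. outer_length (R (2 * k + b))) \<le> outer_length (\<Union>k<n. R (2 * k + b))"
    for n b
  proof (induction n)
    case 0
    then show ?case by simp
  next
    case (Suc n)
    show ?case
    proof (cases n)
      case 0
      then show ?thesis by (simp add: lessThan_Suc)
    next
      case (Suc m)
      let ?S = "\<Union>k<n. R (2 * k + b)"
      have low: "r (2 * m + b + 1) \<le> infdist x F" if "x \<in> ?S" for x
      proof -
        from that obtain k where "k \<le> m" "r (Suc (2 * k + b)) \<le> infdist x F"
          using Suc by (auto simp: R_def less_Suc_eq_le)
        then show ?thesis using r_mono[of "Suc (2 * k + b)" "2 * m + b + 1"] by simp
      qed
      have "(\<Sum>k<Suc n. outer_length (R (2 * k + b)))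
          \<le> outer_length (R (2 * n + b)) + outer_length ?S"
        using Suc.IH by (simp add: add.commute add_left_mono)
      also have "\<dots> \<le> outer_length (R (2 * n + b) \<union> ?S)"
        using low Suc by (intro sep[of _ "2 * m + b + 1"]) (auto simp: R_def)
      also have "R (2 * n + b) \<union> ?S = (\<Union>k<Suc n. R (2 * k + b))"
        by (auto simp: less_Suc_eq)
      finally show ?thesis .
    qed
  qed
  have "(\<Sum>k<n. outer_length (R k)) \<le> outer_length A + outer_length A" for n
  proof -
    have "(\<Sum>k<n. outer_length (R k)) \<le> (\<Sum>k<2 * n. outer_length (R k))"
      by (intro sum_mono2) auto
    also have "\<dots> = (\<Sum>k<n. outer_length (R (2 * k + 0))) + (\<Sum>k<n. outer_length (R (2 * k + 1)))"
      by (induction n) (auto simp: algebra_simps)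
    also have "\<dots> \<le> outer_length A + outer_length A"
      by (intro add_mono order_trans[OF par outer_length_mono]) (auto simp: R_def)
    finally show ?thesis .
  qed
  then have "(\<Sum>k. outer_length (R k)) \<le> outer_length A + outer_length A"
    by (intro suminf_le_const) auto
  also have "\<dots> < top" using fin by simp
  finally have Rfin: "(\<Sum>k. outer_length (R k)) \<noteq> top" by simp
  have AF: "outer_length (A \<inter> F) + outer_length (A - F)
      \<le> outer_length A + (\<Sum>k. outer_length (R (k + n)))" for n
  proof -
    have "A - F \<subseteq> E n \<union> (\<Union>k. R (k + n))"
    proof
      fix x assume x: "x \<in> A - F"
      then have pos: "0 < infdist x F"
        using assms F in_closed_iff_infdist_zero[of F x] infdist_nonneg[of x F] by fastforce
      show "x \<in> E n \<union> (\<Union>k. R (k + n))"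
      proof (cases "r n \<le> infdist x F")
        case True
        then show ?thesis using x by (simp add: E_def)
      next
        case False
        obtain m where "r m \<le> infdist x F"
          using pos unfolding r_def by (metis less_imp_le nat_approx_posE)
        define m where "m = (LEAST m. r m \<le> infdist x F)"
        have m: "r m \<le> infdist x F" and least: "\<And>i. i < m \<Longrightarrow> infdist x F < r i"
          unfolding m_def using \<open>r _ \<le> infdist x F\<close>
          by (auto intro: LeastI dest: not_less_Least)
        have "n < m" using False m r_mono[of m n] by (meson not_less order_trans)
        then obtain k where "m = Suc (k + n)" by (metis add.commute less_imp_Suc_add)
        with m least[of "k + n"] x have "x \<in> R (k + n)" by (simp add: R_def)
        then show ?thesis by blast
      qed
    qed
    then have "outer_length (A - F) \<le> outer_length (E n) + outer_length (\<Union>k. R (k + n))"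
      using outer_length_mono outer_length_Un order_trans by blast
    also have "\<dots> \<le> outer_length (E n) + (\<Sum>k. outer_length (R (k + n)))"
      by (intro add_left_mono outer_length_subadditive)
    finally have "outer_length (A \<inter> F) + outer_length (A - F)
        \<le> outer_length (A \<inter> F) + outer_length (E n) + (\<Sum>k. outer_length (R (k + n)))"
      by (simp add: add.assoc add_left_mono)
    also have "\<dots> \<le> outer_length A + (\<Sum>k. outer_length (R (k + n)))"
      by (intro add_right_mono EF)
    finally show ?thesis .
  qed
  have "outer_length (A \<inter> F) + outer_length (A - F) + (\<Sum>k<n. outer_length (R k))
      \<le> outer_length A + (\<Sum>k. outer_length (R k))" for n
  proof -
    have "outer_length (A \<inter> F) + outer_length (A - F) + (\<Sum>k<n. outer_length (R k))
        \<le> outer_length A + (\<Sum>k. outer_length (R (k + n))) + (\<Sum>k<n. outer_length (R k))"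
      by (intro add_right_mono AF)
    also have "\<dots> = outer_length A + (\<Sum>k. outer_length (R k))"
      using suminf_offset[of "\<lambda>k. outer_length (R k)" n] by (simp add: ac_simps)
    finally show ?thesis .
  qed
  then have "outer_length (A \<inter> F) + outer_length (A - F) + (\<Sum>k. outer_length (R k))
      \<le> outer_length A + (\<Sum>k. outer_length (R k))"
    unfolding suminf_eq_SUP[of "\<lambda>k. outer_length (R k)"]
    by (simp add: ennreal_SUP_add_right SUP_le_iff)
  with Rfin show ?thesis by (simp add: ennreal_add_left_cancel_le add.commute)
qed

lemma measure_space_outer_length: "measure_space UNIV (sets borel) outer_length"
proof -
  interpret P: sigma_algebra UNIV "UNIV :: complex set set" by (metis sigma_algebra_Pow Pow_UNIV)
  let ?L = "lambda_system UNIV UNIV outer_length"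
  have "outer_measure_space UNIV outer_length"
    unfolding outer_measure_space_def
    by (auto simp: positive_def increasing_def countably_subadditive_def outer_length_empty
        outer_length_mono outer_length_subadditive)
  from P.caratheodory_lemma[OF this] have L: "measure_space UNIV ?L outer_length" .
  then interpret L: sigma_algebra UNIV ?L by (simp add: measure_space_def)
  have "sets borel \<subseteq> ?L"
    unfolding borel_eq_closed
  proof (subst sets_measure_of, simp, intro L.sigma_sets_subset subsetI)
    fix F :: "complex set" assume "F \<in> {S. closed S}"
    then have "outer_length (A \<inter> F) + outer_length (A - F) = outer_length A" for A
      using outer_length_closed_splits[of F A] outer_length_Un[of "A \<inter> F" "A - F"]
      by (simp add: Int_Diff_Un antisym)
    then show "F \<in> ?L" by (simp add: P.lambda_system_eq)
  qed
  with L show ?thesis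
    unfolding measure_space_def positive_def countably_additive_def
    using sets.sigma_algebra_axioms[of "borel :: complex measure"]
    by (auto simp: subset_iff)
qed

lemma space_arc_length [simp]: "space arc_length = UNIV"
  and sets_arc_length [simp, measurable_cong]: "sets arc_length = sets borel"
  using sets.sigma_sets_eq[of "borel :: complex measure"]
  by (auto simp: arc_length_def)

lemma emeasure_arc_length: "A \<in> sets borel \<Longrightarrow> emeasure arc_length A = outer_length A"
  using measure_space_outer_length
  by (intro emeasure_measure_of[OF arc_length_def]) (auto simp: measure_space_def)

definition lp_norm :: "real \<Rightarrow> (complex \<Rightarrow> complex) \<Rightarrow> complex set \<Rightarrow> real" where
  "lp_norm p w C = (LINT z:C|arc_length. cmod (w z) powr p) powr (1 / p)"


section \<open>Domains and their exhaustions\<close>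

definition domain_set :: "complex set \<Rightarrow> bool" where
  "domain_set \<Omega> \<longleftrightarrow> open \<Omega> \<and> connected \<Omega> \<and> \<Omega> \<noteq> {}"

definition modulus_of_continuity :: "(real \<Rightarrow> complex) \<Rightarrow> real \<Rightarrow> ennreal" where
  "modulus_of_continuity g t = (SUP (x, y) \<in> {(x, y). \<bar>x - y\<bar> \<le> t}. ennreal (dist (g x) (g y)))"

definition dini_continuous :: "(real \<Rightarrow> complex) \<Rightarrow> bool" where
  "dini_continuous g \<longleftrightarrow>
     (\<exists>\<epsilon>>0. (\<integral>\<^sup>+ t \<in> {0<..\<epsilon>}. modulus_of_continuity g t / ennreal t \<partial>lborel) < \<infinity>)"

text \<open>The parametrization is extended periodically to the line, so that regularity is also required
  at the point where the curve closes up.\<close>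

definition dini_smooth_jordan_curve :: "complex set \<Rightarrow> bool" where
  "dini_smooth_jordan_curve C \<longleftrightarrow>
     (\<exists>\<gamma> \<gamma>'. simple_path \<gamma> \<and> path_image \<gamma> = C \<and> (\<forall>t. \<gamma> (t + 1) = \<gamma> t) \<and>
        (\<forall>t. (\<gamma> has_vector_derivative \<gamma>' t) (at t) \<and> \<gamma>' t \<noteq> 0) \<and> dini_continuous \<gamma>')"

definition dini_smooth_domain :: "complex set \<Rightarrow> bool" where
  "dini_smooth_domain \<Omega> \<longleftrightarrow> domain_set \<Omega> \<and> bounded \<Omega> \<and>
     (\<exists>\<Gamma>. finite \<Gamma> \<and> (\<forall>C\<in>\<Gamma>. dini_smooth_jordan_curve C) \<and> disjoint \<Gamma> \<and> frontier \<Omega> = \<Union>\<Gamma>)"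

definition rectifiable_path :: "(real \<Rightarrow> complex) \<Rightarrow> bool" where
  "rectifiable_path \<gamma> \<longleftrightarrow> path \<gamma> \<and>
     (\<exists>L. \<forall>n (t :: nat \<Rightarrow> real). mono_on {..n} t \<and> t ` {..n} \<subseteq> {0..1} \<longrightarrow>
        (\<Sum>i<n. dist (\<gamma> (t i)) (\<gamma> (t (Suc i)))) \<le> L)"

definition rectifiable_jordan_curve :: "complex set \<Rightarrow> bool" where
  "rectifiable_jordan_curve C \<longleftrightarrow>
     (\<exists>\<gamma>. simple_path \<gamma> \<and> pathfinish \<gamma> = pathstart \<gamma> \<and> rectifiable_path \<gamma> \<and> path_image \<gamma> = C)"

definition rectifiable_exhaustion :: "complex set \<Rightarrow> (nat \<Rightarrow> complex set) \<Rightarrow> bool" where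
  "rectifiable_exhaustion \<Omega> \<Delta> \<longleftrightarrow>
     (\<forall>n. domain_set (\<Delta> n) \<and> closure (\<Delta> n) \<subseteq> \<Omega> \<and>
        (\<exists>\<Gamma>. finite \<Gamma> \<and> (\<forall>C\<in>\<Gamma>. rectifiable_jordan_curve C) \<and> frontier (\<Delta> n) = \<Union>\<Gamma>)) \<and>
     (\<exists>L::real. \<forall>n. emeasure arc_length (frontier (\<Delta> n)) \<le> ennreal L) \<and>
     (\<forall>K. compact K \<and> K \<subseteq> \<Omega> \<longrightarrow> (\<forall>\<^sub>F n in sequentially. K \<subseteq> \<Delta> n))"


section \<open>Weak derivatives\<close>

definition dx :: "(complex \<Rightarrow> complex) \<Rightarrow> complex \<Rightarrow> complex" where
  "dx f z = frechet_derivative f (at z) 1"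

definition dy :: "(complex \<Rightarrow> complex) \<Rightarrow> complex \<Rightarrow> complex" where
  "dy f z = frechet_derivative f (at z) \<i>"

definition dbar :: "(complex \<Rightarrow> complex) \<Rightarrow> complex \<Rightarrow> complex" where
  "dbar f z = (dx f z + \<i> * dy f z) / 2"

primrec C_diff :: "nat \<Rightarrow> (complex \<Rightarrow> complex) \<Rightarrow> bool" where
  "C_diff 0 f \<longleftrightarrow> continuous_on UNIV f"
| "C_diff (Suc k) f \<longleftrightarrow> (\<forall>z. f differentiable at z) \<and> C_diff k (dx f) \<and> C_diff k (dy f)"

definition test_functions :: "complex set \<Rightarrow> (complex \<Rightarrow> complex) set" where
  "test_functions \<Omega> = {\<psi>. (\<forall>k. C_diff k \<psi>) \<and>
     compact (closure {z. \<psi> z \<noteq> 0}) \<and> closure {z. \<psi> z \<noteq> 0} \<subseteq> \<Omega>}"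

definition L_inf :: "complex set \<Rightarrow> (complex \<Rightarrow> complex) set" where
  "L_inf \<Omega> = {f \<in> borel_measurable (lebesgue_on \<Omega>). \<exists>M. AE z in lebesgue_on \<Omega>. cmod (f z) \<le> M}"

definition W1_inf :: "complex set \<Rightarrow> (complex \<Rightarrow> complex) set" where
  "W1_inf \<Omega> = {f \<in> L_inf \<Omega>. \<exists>g\<in>L_inf \<Omega>. \<exists>h\<in>L_inf \<Omega>. \<forall>\<psi>\<in>test_functions \<Omega>.
     (LINT z|lebesgue_on \<Omega>. f z * dx \<psi> z) = - (LINT z|lebesgue_on \<Omega>. g z * \<psi> z) \<and>
     (LINT z|lebesgue_on \<Omega>. f z * dy \<psi> z) = - (LINT z|lebesgue_on \<Omega>. h z * \<psi> z)}"

definition solves_dbar_eq ::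
    "complex set \<Rightarrow> (complex \<Rightarrow> complex) \<Rightarrow> (complex \<Rightarrow> complex) \<Rightarrow> bool" where
  "solves_dbar_eq \<Omega> \<alpha> w \<longleftrightarrow> (\<forall>\<psi>\<in>test_functions \<Omega>.
     (LINT z|lebesgue_on \<Omega>. w z * dbar \<psi> z) = - (LINT z|lebesgue_on \<Omega>. \<alpha> z * cnj (w z) * \<psi> z))"


section \<open>Hardy spaces\<close>

text \<open>Every locally integrable solution agrees almost everywhere with a continuous one. The space
  \<open>G_space\<close> consists of the continuous representatives: the traces on the curves
  \<open>frontier (\<Delta> n)\<close> and the composition with a constant map refer to them. Values outside \<open>\<Omega>\<close>
  are irrelevant, and so \<open>G_norm\<close> is only a seminorm on functions on the whole plane.\<close>

definition G_norm :: "real \<Rightarrow> (nat \<Rightarrow> complex set) \<Rightarrow> (complex \<Rightarrow> complex) \<Rightarrow> real" where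
  "G_norm p \<Delta> w = (SUP n. lp_norm p w (frontier (\<Delta> n)))"

definition G_space :: "real \<Rightarrow> complex set \<Rightarrow> (nat \<Rightarrow> complex set) \<Rightarrow> (complex \<Rightarrow> complex)
    \<Rightarrow> (complex \<Rightarrow> complex) set" where
  "G_space p \<Omega> \<Delta> \<alpha> = {w. continuous_on \<Omega> w \<and> solves_dbar_eq \<Omega> \<alpha> w \<and>
     bdd_above (range (\<lambda>n. lp_norm p w (frontier (\<Delta> n))))}"

definition circle_mean :: "real \<Rightarrow> (complex \<Rightarrow> complex) \<Rightarrow> real \<Rightarrow> real" where
  "circle_mean p f r =
     ((LBINT \<theta>:{0..2 * pi}. cmod (f (complex_of_real r * cis \<theta>)) powr p) / (2 * pi)) powr (1 / p)"

definition hardy_norm :: "real \<Rightarrow> (complex \<Rightarrow> complex) \<Rightarrow> real" where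
  "hardy_norm p f = (SUP r \<in> {0..<1}. circle_mean p f r)"

definition hardy_space :: "real \<Rightarrow> (complex \<Rightarrow> complex) set" where
  "hardy_space p = {f. f holomorphic_on ball 0 1 \<and> bdd_above (circle_mean p f ` {0..<1})}"

definition equivalently_normed ::
    "'a set \<Rightarrow> ('a \<Rightarrow> real) \<Rightarrow> 'a set \<Rightarrow> ('a \<Rightarrow> real) \<Rightarrow> bool" where
  "equivalently_normed X nX Y nY \<longleftrightarrow>
     X = Y \<and> (\<exists>c>0. \<exists>C. \<forall>f\<in>X. c * nX f \<le> nY f \<and> nY f \<le> C * nX f)"


section \<open>Composition operators\<close>

definition compact_operator ::
    "(complex \<Rightarrow> complex) set \<Rightarrow> ((complex \<Rightarrow> complex) \<Rightarrow> real) \<Rightarrow>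
     (complex \<Rightarrow> complex) set \<Rightarrow> ((complex \<Rightarrow> complex) \<Rightarrow> real) \<Rightarrow>
     ((complex \<Rightarrow> complex) \<Rightarrow> (complex \<Rightarrow> complex)) \<Rightarrow> bool" where
  "compact_operator X nX Y nY T \<longleftrightarrow> T ` X \<subseteq> Y \<and>
     (\<forall>f :: nat \<Rightarrow> complex \<Rightarrow> complex. range f \<subseteq> X \<and> bdd_above (range (\<lambda>k. nX (f k))) \<longrightarrow>
        (\<exists>g\<in>Y. \<exists>r. strict_mono r \<and> (\<lambda>k. nY (\<lambda>z. T (f (r k)) z - g z)) \<longlonglongrightarrow> 0))"

definition composition_operator ::
    "(complex \<Rightarrow> complex) \<Rightarrow> (complex \<Rightarrow> complex) \<Rightarrow> (complex \<Rightarrow> complex)" where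
  "composition_operator \<phi> f = f \<circ> \<phi>"

text \<open>For constant \<open>\<phi>\<close> the derivative, hence also the coefficient, vanishes on the domain.\<close>

definition pullback_coeff :: "(complex \<Rightarrow> complex) \<Rightarrow> (complex \<Rightarrow> complex) \<Rightarrow> complex \<Rightarrow> complex" where
  "pullback_coeff \<phi> \<alpha> z = \<alpha> (\<phi> z) * cnj (deriv \<phi> z)"

end

theory Submission
  imports Defs "HOL-Analysis.Bounded_Continuous_Function"
begin

text \<open>
  Write \<open>T f\<close> for the Cauchy transform of a bounded density of bounded support, normalized so that \<open>dbar (T f) = f\<close>. By the
  similarity principle the solutions of \<open>dbar w = \<alpha> * cnj w\<close> on a bounded open set are the functions \<open>exp (T \<beta>) * F\<close>, where \<open>F\<close> is
  holomorphic and \<open>\<beta> * w = \<alpha> * cnj w\<close> (\<open>solution_factorization\<close>, \<open>factored_weak_solution\<close>). Conversely every holomorphic \<open>F\<close>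
  occurs for every bounded coefficient (\<open>conjugate_equation_solvable\<close>). Keeping \<open>F\<close> and changing the exponential therefore converts
  solutions for \<open>\<alpha>1\<close> into solutions for \<open>\<alpha>2\<close> (\<open>exchange_coefficients\<close>). The two solutions differ by a factor \<open>exp (T \<beta>)\<close> with
  \<open>\<beta>\<close> bounded in terms of the coefficients only. Such factors are bounded above and below, so they preserve the generalized Hardy
  spaces, and they form an equicontinuous family.

  This is the reason why compactness of a composition operator does not depend on the coefficient
  (\<open>compactness_transfer\<close>). Given a bounded sequence of solutions for \<open>\<alpha>1\<close>, write it as \<open>exp (T (\<beta> k)) * w k\<close> with solutions \<open>w k\<close> for
  \<open>\<alpha>2\<close>. Along a subsequence \<open>w k \<circ> \<phi>\<close> converges in norm by hypothesis, and \<open>T (\<beta> k)\<close> converges uniformly by the theorem of Arzela and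
  Ascoli. Hence the compositions of the given solutions converge in norm to the product of the limits. The product solves the
  right equation, because norm convergence implies pointwise convergence: point evaluations are bounded
  (\<open>point_evaluation_bounded\<close>), and weak solutions are stable under locally bounded pointwise convergence. The statement about the
  classical Hardy space is the case of coefficient 0, as compactness is not affected by passing to an equivalent norm.

  Three ingredients carry the argument. The calculus of Cauchy transforms rests on the product formula
  \<open>T f * T g = T (f * T g + g * T f)\<close> (\<open>cauchy_transform_prod\<close>), which comes from partial fractions and replaces differentiation of
  functions that are only weakly differentiable, and on the Cauchy-Pompeiu formula. Composition with \<open>\<phi>\<close> preserves solutions
  because \<open>T \<beta> \<circ> \<phi>\<close> and the transform of the pulled back density \<open>(\<beta> \<circ> \<phi>) * cnj (deriv \<phi>)\<close> differ by a holomorphic function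
  (\<open>cauchy_transform_chain_rule\<close>). Finally, the estimate of a holomorphic function by its mean over the frontier of a domain with
  respect to arc length (\<open>boundary_mean_estimate\<close>) is obtained from the Cauchy-Pompeiu formula after cutting the function off near the
  frontier along a cover by small discs, the sum of whose radii is controlled by the length.
\<close>

section \<open>The Cauchy transform\<close>

text \<open>The exponent lies strictly between 1 and 2: the weight dominates the Cauchy kernel near 0 with half
  a power to spare, which becomes the Hoelder exponent of the Cauchy transform, and it is still
  locally integrable in the plane.\<close>

definition singular_weight :: "complex \<Rightarrow> real" where
  "singular_weight z = cmod z powr (-3/2)"

lemma singular_weight_measurable [measurable]: "singular_weight \<in> borel_measurable borel"
  unfolding singular_weight_def by measurable

lemma singular_weight_nonneg [simp]: "0 \<le> singular_weight z"
  by (simp add: singular_weight_def)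

lemma emeasure_disc_pow2:
  "emeasure lborel (ball (0::complex) ((1/2) ^ k)) = ennreal (pi * (1/4) ^ k)"
proof -
  have "((1/2::real) ^ k)\<^sup>2 = (1/4) ^ k" by (simp add: power2_eq_square flip: power_mult_distrib)
  then show ?thesis by (simp add: emeasure_ball unit_ball_vol_2)
qed

text \<open>Dyadic annuli: the weight is at most of order $8^{k/2}$ on the annulus of radius $2^{-k}$, whose area
  is of order $4^{-k}$, and the resulting series is geometric.\<close>

lemma singular_weight_integrable_disc:
  "(\<integral>\<^sup>+ z \<in> ball 0 1. ennreal (singular_weight z) \<partial>lborel) < \<infinity>"
proof -
  define c :: "nat \<Rightarrow> real" where "c k = 2 powr (3/2 * real (Suc k))" for k
  have bd: "ennreal (singular_weight z) * indicator (ball 0 1) z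
      \<le> (\<Sum>k. ennreal (c k) * indicator (ball 0 ((1/2) ^ k)) z)" for z
  proof (cases "z = 0 \<or> cmod z \<ge> 1")
    case True
    then show ?thesis by (auto simp: singular_weight_def indicator_def)
  next
    case False
    then have z: "0 < cmod z" "cmod z < 1" by auto
    obtain n where n: "(1/2) ^ n < cmod z"
      using real_arch_pow_inv[of "cmod z" "1/2"] z by auto
    define m where "m = (LEAST n. (1/2) ^ n \<le> cmod z)"
    have m: "(1/2) ^ m \<le> cmod z" unfolding m_def by (rule LeastI[of _ n]) (use n in simp)
    have "m \<noteq> 0" using m z by (intro notI) simp
    then obtain k where k: "m = Suc k" by (cases m) auto
    have "\<not> (1/2) ^ k \<le> cmod z" using not_less_Least[of k "\<lambda>n. (1/2) ^ n \<le> cmod z"] k m_def by auto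
    then have zin: "z \<in> ball 0 ((1/2) ^ k)" by simp
    have "singular_weight z \<le> ((1/2) ^ m) powr (-3/2)"
      unfolding singular_weight_def using m by (intro powr_mono2') auto
    also have "\<dots> = (2 powr (- real m)) powr (-3/2)"
      by (simp add: powr_minus powr_realpow power_one_over inverse_eq_divide)
    also have "\<dots> = c k" unfolding c_def powr_powr k by (rule arg_cong[of _ _ "\<lambda>x. 2 powr x"]) (simp add: field_simps)
    finally have "ennreal (singular_weight z) * indicator (ball 0 1) z
        \<le> ennreal (c k) * indicator (ball 0 ((1/2) ^ k)) z"
      using zin z by (simp add: ennreal_leI)
    also have "\<dots> \<le> (\<Sum>k. ennreal (c k) * indicator (ball 0 ((1/2) ^ k)) z)"
      using sum_le_suminf[of "\<lambda>k. ennreal (c k) * indicator (ball 0 ((1/2) ^ k)) z" "{k}"]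
      by (simp del: sum_mult_indicator)
    finally show ?thesis .
  qed
  have cp: "c k * (pi * (1/4) ^ k) = (pi * 2 powr (3/2)) * (2 powr (-1/2)) ^ k" for k
  proof -
    have "(1/4::real) ^ k = 2 powr (-2 * real k)"
      by (simp add: powr_minus powr_powr[symmetric] powr_realpow power_one_over inverse_eq_divide)
    moreover have "(2 powr (-1/2)) ^ k = (2::real) powr (-1/2 * real k)"
      by (subst powr_realpow[symmetric]) (simp_all add: powr_powr)
    ultimately have "c k * (pi * (1/4) ^ k) = pi * 2 powr (3/2 * real (Suc k) + -2 * real k)"
      "(pi * 2 powr (3/2)) * (2 powr (-1/2)) ^ k = pi * 2 powr (3/2 + -1/2 * real k)"
      unfolding c_def powr_add by simp_all
    moreover have "3/2 * real (Suc k) + -2 * real k = 3/2 + -1/2 * real k" by (simp add: field_simps)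
    ultimately show ?thesis by metis
  qed
  have q: "2 powr (-1/2) < (1::real)" using powr_less_mono[of "-1/2" 0 "2::real"] by simp
  then have "summable (\<lambda>k. (pi * 2 powr (3/2)) * (2 powr (-1/2::real)) ^ k)"
    by (intro summable_mult summable_geometric) auto
  then have s: "(\<Sum>k. ennreal (c k * (pi * (1/4) ^ k))) < \<infinity>"
    unfolding cp by (subst suminf_ennreal2) auto
  have "(\<integral>\<^sup>+ z \<in> ball 0 1. ennreal (singular_weight z) \<partial>lborel)
      \<le> (\<integral>\<^sup>+ z. (\<Sum>k. ennreal (c k) * indicator (ball (0::complex) ((1/2) ^ k)) z) \<partial>lborel)"
    by (intro nn_integral_mono bd)
  also have "\<dots> = (\<Sum>k. \<integral>\<^sup>+ z. ennreal (c k) * indicator (ball (0::complex) ((1/2) ^ k)) z \<partial>lborel)"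
  proof (intro nn_integral_suminf)
    have [measurable]: "ball (0::complex) ((1/2) ^ k) \<in> sets borel" for k by simp
    show "(\<lambda>z. ennreal (c k) * indicator (ball (0::complex) ((1/2) ^ k)) z) \<in> borel_measurable lborel" for k
      by measurable
  qed
  also have "\<dots> = (\<Sum>k. ennreal (c k * (pi * (1/4) ^ k)))"
    by (simp add: nn_integral_cmult_indicator emeasure_disc_pow2 c_def ennreal_mult)
  finally show ?thesis using s by simp
qed

definition disc_weight :: real where
  "disc_weight = enn2real (\<integral>\<^sup>+ z \<in> ball 0 1. ennreal (singular_weight z) \<partial>lborel)"

lemma nn_integral_lborel_reflect:
  fixes f :: "complex \<Rightarrow> ennreal"
  assumes [measurable]: "f \<in> borel_measurable borel"
  shows "(\<integral>\<^sup>+ x. f (z - x) \<partial>lborel) = (\<integral>\<^sup>+ x. f x \<partial>lborel)"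
proof -
  have "(lborel :: complex measure) = distr lborel borel (\<lambda>x. z - x)"
    using lborel_affine[of "-1" z] by (simp add: density_1)
  then have "(\<integral>\<^sup>+ x. f x \<partial>lborel) = (\<integral>\<^sup>+ x. f x \<partial>distr lborel borel (\<lambda>x. z - x))" by simp
  also have "\<dots> = (\<integral>\<^sup>+ x. f (z - x) \<partial>lborel)" by (subst nn_integral_distr) auto
  finally show ?thesis by simp
qed

lemma disc_weight_measurable:
  "(\<lambda>\<zeta>. ennreal (singular_weight \<zeta>) * indicator (ball 0 1) \<zeta>) \<in> borel_measurable borel"
proof -
  have [measurable]: "ball (0::complex) 1 \<in> sets borel" by simp
  show ?thesis by measurable
qed

lemma nn_integral_lborel_reflect_disc:
  "(\<integral>\<^sup>+ \<zeta>. ennreal (singular_weight (z - \<zeta>)) * indicator (ball 0 1) (z - \<zeta>) \<partial>lborel)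
      = (\<integral>\<^sup>+ \<zeta>. ennreal (singular_weight \<zeta>) * indicator (ball 0 1) \<zeta> \<partial>lborel)"
  by (rule nn_integral_lborel_reflect[of "\<lambda>\<zeta>. ennreal (singular_weight \<zeta>) * indicator (ball 0 1) \<zeta>"])
    (rule disc_weight_measurable)

lemma singular_weight_le_1: "1 \<le> cmod z \<Longrightarrow> singular_weight z \<le> 1"
  unfolding singular_weight_def using powr_mono2'[of "3/2" 1 "cmod z"] 
  by (simp add: powr_minus inverse_le_1_iff ge_one_powr_ge_zero)

text \<open>The part of \<open>Z\<close> inside the unit disc about \<open>z\<close> contributes at most the mass of the weight on that
  disc, and outside it the weight is at most 1. The bound is uniform in \<open>z\<close>.\<close>

lemma nn_integral_singular_weight_le:
  assumes [measurable]: "Z \<in> sets borel" and fin: "emeasure lborel Z < \<infinity>"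
  shows "(\<integral>\<^sup>+ \<zeta>. ennreal (singular_weight (z - \<zeta>)) * indicator Z \<zeta> \<partial>lborel)
     \<le> ennreal (disc_weight + measure lborel Z)"
proof -
  have "(\<integral>\<^sup>+ \<zeta>. ennreal (singular_weight (z - \<zeta>)) * indicator Z \<zeta> \<partial>lborel)
     \<le> (\<integral>\<^sup>+ \<zeta>. (ennreal (singular_weight (z - \<zeta>)) * indicator (ball 0 1) (z - \<zeta>)) + indicator Z \<zeta> \<partial>lborel)"
  proof (intro nn_integral_mono)
    fix \<zeta>
    show "ennreal (singular_weight (z - \<zeta>)) * indicator Z \<zeta>
      \<le> (ennreal (singular_weight (z - \<zeta>)) * indicator (ball 0 1) (z - \<zeta>)) + indicator Z \<zeta>"
      using singular_weight_le_1[of "z - \<zeta>"]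
      by (auto simp: indicator_def not_less)
  qed
  also have "\<dots> = (\<integral>\<^sup>+ \<zeta>. ennreal (singular_weight (z - \<zeta>)) * indicator (ball 0 1) (z - \<zeta>) \<partial>lborel) + emeasure lborel Z"
  proof (subst nn_integral_add)
    show "(\<lambda>\<zeta>. ennreal (singular_weight (z - \<zeta>)) * indicator (ball 0 1) (z - \<zeta>)) \<in> borel_measurable lborel"
      by (rule measurable_compose[of "\<lambda>\<zeta>. z - \<zeta>" _ borel "\<lambda>\<zeta>. ennreal (singular_weight \<zeta>) * indicator (ball 0 1) \<zeta>"])
        (use disc_weight_measurable in auto)
  qed auto
  also have "(\<integral>\<^sup>+ \<zeta>. ennreal (singular_weight (z - \<zeta>)) * indicator (ball 0 1) (z - \<zeta>) \<partial>lborel)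
      = ennreal disc_weight"
    using singular_weight_integrable_disc unfolding disc_weight_def nn_integral_lborel_reflect_disc
    by (simp add: less_top)
  also have "emeasure lborel Z = ennreal (measure lborel Z)"
    using fin by (simp add: emeasure_eq_ennreal_measure less_top)
  finally show ?thesis by (simp add: disc_weight_def)
qed

lemma singular_weight_integral:
  assumes "Z \<in> sets borel" "emeasure lborel Z < \<infinity>"
  shows "integrable lborel (\<lambda>\<zeta>. indicator Z \<zeta> * singular_weight (z - \<zeta>))"
    and "(LINT \<zeta>|lborel. indicator Z \<zeta> * singular_weight (z - \<zeta>)) \<le> disc_weight + measure lborel Z"
proof -
  note [measurable] = assms(1)
  have eq: "ennreal (indicator Z \<zeta> * singular_weight (z - \<zeta>)) = ennreal (singular_weight (z - \<zeta>)) * indicator Z \<zeta>" for \<zeta>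
    by (auto simp: indicator_def)
  show *: "integrable lborel (\<lambda>\<zeta>. indicator Z \<zeta> * singular_weight (z - \<zeta>))"
    using nn_integral_singular_weight_le[OF assms, of z]
    by (intro integrableI_nonneg) (auto simp: eq intro: le_less_trans)
  show "(LINT \<zeta>|lborel. indicator Z \<zeta> * singular_weight (z - \<zeta>)) \<le> disc_weight + measure lborel Z"
    using nn_integral_singular_weight_le[OF assms, of z] nn_integral_eq_integral[OF *]
    by (simp add: eq disc_weight_def flip: ennreal_plus)
qed

lemma inverse_norm_le_singular_weight: "1 / cmod z \<le> 1 + singular_weight z"
proof (cases "z = 0 \<or> cmod z \<ge> 1")
  case True
  then show ?thesis by (auto simp: divide_le_eq_1 intro: order_trans[of _ 1])
next
  case False
  then have "cmod z powr (-1) \<le> singular_weight z"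
    unfolding singular_weight_def by (intro powr_mono') auto
  then show ?thesis using False by (simp add: powr_minus_divide)
qed

text \<open>Interpolates between the trivial bound for the difference and the bound by
  \<open>cmod (a - b) / (cmod a * cmod b)\<close>, keeping half a power of \<open>cmod (a - b)\<close>.\<close>

lemma cauchy_kernel_diff_le:
  "cmod (1 / a - 1 / b) \<le> 2 * sqrt (cmod (a - b)) * (singular_weight a + singular_weight b)"
proof -
  have nz: "cmod (1 / a - 1 / b) \<le> 2 * sqrt (cmod (a - b)) * singular_weight a"
    if "a \<noteq> 0" "b \<noteq> 0" "cmod a \<le> cmod b" for a b
  proof -
    let ?d = "cmod (a - b)" and ?x = "cmod a" and ?y = "cmod b"
    have p: "?x > 0" "?y > 0" using that by auto
    have "?d \<le> 2 * ?y" using that norm_triangle_ineq4[of a b] by simp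
    then have "sqrt ?d \<le> 2 * sqrt ?y"
      using real_sqrt_le_mono[of ?d "4 * ?y"] p by (simp add: real_sqrt_mult)
    have "cmod (1 / a - 1 / b) = sqrt ?d * sqrt ?d / (?x * ?y)"
      using that by (simp add: diff_frac_eq norm_divide norm_mult norm_minus_commute)
    also have "\<dots> \<le> sqrt ?d * (2 * sqrt ?y) / (?x * ?y)"
      using \<open>sqrt ?d \<le> 2 * sqrt ?y\<close> p by (intro divide_right_mono mult_left_mono) auto
    also have "\<dots> = 2 * sqrt ?d * (1 / (?x * sqrt ?y))"
    proof -
      have "sqrt ?y / ?y = 1 / sqrt ?y" using p by (simp add: real_div_sqrt field_simps)
      then show ?thesis using p by (simp add: field_simps)
    qed
    also have "\<dots> \<le> 2 * sqrt ?d * (1 / (?x * sqrt ?x))"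
      using p that by (intro mult_left_mono divide_left_mono) auto
    also have "1 / (?x * sqrt ?x) = singular_weight a"
    proof -
      have "?x powr (1 + 1/2) = ?x powr 1 * ?x powr (1/2)" by (rule powr_add)
      then show ?thesis using p by (simp add: singular_weight_def powr_minus_divide powr_half_sqrt)
    qed
    finally show ?thesis .
  qed
  have z: "cmod (1 / a) \<le> 2 * sqrt (cmod a) * singular_weight a" for a
  proof (cases "a = 0")
    case False
    then have p: "cmod a > 0" by simp
    have "cmod a powr (1/2) * cmod a powr (-3/2) = cmod a powr (-1)" by (simp flip: powr_add)
    then have "1 / cmod a = sqrt (cmod a) * singular_weight a"
      using p by (simp add: singular_weight_def powr_half_sqrt powr_minus_divide)
    then show ?thesis using p by (simp add: norm_divide)
  qed simp
  consider "a = 0" | "b = 0" | "a \<noteq> 0" "b \<noteq> 0" "cmod a \<le> cmod b" | "a \<noteq> 0" "b \<noteq> 0" "cmod b \<le> cmod a"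
    by linarith
  then show ?thesis
  proof cases
    case 1 then show ?thesis using z[of b] by (simp add: singular_weight_def norm_divide)
  next
    case 2 then show ?thesis using z[of a] by (simp add: singular_weight_def norm_divide)
  next
    case 3 then show ?thesis using nz[of a b]
      by (smt (verit) mult_left_mono singular_weight_nonneg real_sqrt_ge_zero norm_ge_zero)
  next
    case 4 then show ?thesis using nz[of b a]
      by (smt (verit) mult_left_mono singular_weight_nonneg real_sqrt_ge_zero norm_ge_zero norm_minus_commute)
  qed
qed

text \<open>This is the constant \<open>pi\<close>, written as the total mass that \<open>dbar\<close> of the regularized Cauchy kernel
  \<open>cnj z / (cmod z ^ 2 + 1)\<close> spreads over the plane; in this form it appears in the
  Cauchy-Pompeiu formula.\<close>

definition cauchy_mass :: real where
  "cauchy_mass = (LINT z|lborel. 1 / (1 + (cmod z)\<^sup>2)\<^sup>2)"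

lemma cauchy_mass_integrable: "integrable lborel (\<lambda>z::complex. 1 / (1 + (cmod z)\<^sup>2)\<^sup>2)"
proof -
  have bd: "ennreal (1 / (1 + (cmod z)\<^sup>2)\<^sup>2)
      \<le> (\<Sum>k. ennreal ((1/16) ^ k) * indicator (ball 0 (2 ^ Suc k)) z)" for z
  proof -
    obtain n where n: "cmod z < 2 ^ n" using real_arch_pow[of 2 "cmod z"] by auto
    define m where "m = (LEAST n. cmod z < 2 ^ Suc n)"
    have m: "cmod z < 2 ^ Suc m" unfolding m_def by (rule LeastI[of _ n]) (use n in \<open>simp add: order_less_le_trans\<close>)
    have "1 / (1 + (cmod z)\<^sup>2)\<^sup>2 \<le> (1/16) ^ m"
    proof (cases m)
      case 0
      then show ?thesis by (simp add: divide_le_eq_1 add_pos_nonneg)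
    next
      case (Suc k)
      then have "\<not> cmod z < 2 ^ Suc k"
        using not_less_Least[of k "\<lambda>n. cmod z < 2 ^ Suc n"] m_def by auto
      then have "2 ^ m \<le> cmod z" using Suc by simp
      then have "(2 ^ m)\<^sup>2 \<le> 1 + (cmod z)\<^sup>2" by (smt (verit) power_mono zero_le_power)
      then have "((2 ^ m)\<^sup>2)\<^sup>2 \<le> (1 + (cmod z)\<^sup>2)\<^sup>2" by (intro power_mono) auto
      then have "(16::real) ^ m \<le> (1 + (cmod z)\<^sup>2)\<^sup>2"
      proof -
        have "((2 ^ m)\<^sup>2)\<^sup>2 = ((2::real) ^ 4) ^ m" by (simp only: power_mult[symmetric]) (simp add: mult.commute)
        also have "(2::real) ^ 4 = 16" by simp
        finally show "((2 ^ m)\<^sup>2)\<^sup>2 \<le> (1 + (cmod z)\<^sup>2)\<^sup>2 \<Longrightarrow> ?thesis" by simp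
      qed
      then have "1 / (1 + (cmod z)\<^sup>2)\<^sup>2 \<le> 1 / 16 ^ m" by (intro frac_le) auto
      then show ?thesis by (simp add: power_one_over)
    qed
    then have "ennreal (1 / (1 + (cmod z)\<^sup>2)\<^sup>2) \<le> ennreal ((1/16) ^ m) * indicator (ball 0 (2 ^ Suc m)) z"
      using m by (simp add: ennreal_leI)
    also have "\<dots> \<le> (\<Sum>k. ennreal ((1/16) ^ k) * indicator (ball 0 (2 ^ Suc k)) z)"
      using sum_le_suminf[of "\<lambda>k. ennreal ((1/16) ^ k) * indicator (ball 0 (2 ^ Suc k)) z" "{m}"]
      by (simp del: sum_mult_indicator)
    finally show ?thesis .
  qed
  have em: "emeasure lborel (ball (0::complex) (2 ^ Suc k)) = ennreal (4 * pi * 4 ^ k)" for k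
  proof -
    have "((2::real) ^ k)\<^sup>2 = 4 ^ k" by (simp add: power2_eq_square flip: power_mult_distrib)
    then show ?thesis
      by (simp add: emeasure_ball unit_ball_vol_2 power_mult_distrib mult.commute)
  qed
  have cp: "(1/16) ^ k * (4 * pi * 4 ^ k) = 4 * pi * (1/4::real) ^ k" for k
    by (simp add: power_one_over field_simps flip: power_mult_distrib)
  have "summable (\<lambda>k. 4 * pi * (1/4::real) ^ k)"
    by (intro summable_mult summable_geometric) auto
  then have s: "(\<Sum>k. ennreal ((1/16) ^ k * (4 * pi * 4 ^ k))) < \<infinity>"
    unfolding cp by (subst suminf_ennreal2) auto
  have "(\<integral>\<^sup>+ z. ennreal (1 / (1 + (cmod z)\<^sup>2)\<^sup>2) \<partial>lborel)
      \<le> (\<integral>\<^sup>+ z. (\<Sum>k. ennreal ((1/16) ^ k) * indicator (ball (0::complex) (2 ^ Suc k)) z) \<partial>lborel)"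
    by (intro nn_integral_mono bd)
  also have "\<dots> = (\<Sum>k. \<integral>\<^sup>+ z. ennreal ((1/16) ^ k) * indicator (ball (0::complex) (2 ^ Suc k)) z \<partial>lborel)"
  proof (intro nn_integral_suminf)
    have [measurable]: "ball (0::complex) (2 ^ Suc k) \<in> sets borel" for k by simp
    show "(\<lambda>z. ennreal ((1/16) ^ k) * indicator (ball (0::complex) (2 ^ Suc k)) z) \<in> borel_measurable lborel" for k
      by measurable
  qed
  also have "\<dots> = (\<Sum>k. ennreal ((1/16) ^ k * (4 * pi * 4 ^ k)))"
    by (simp only: nn_integral_cmult_indicator sets_lborel borel_open open_ball em ennreal_mult zero_le_power
        zero_le_mult_iff) (simp add: ennreal_mult)
  finally show ?thesis using s by (intro integrableI_nonneg) (auto intro: le_less_trans)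
qed

lemma cauchy_mass_pos: "0 < cauchy_mass"
proof -
  have "\<not> (AE z in lborel. 1 / (1 + (cmod z)\<^sup>2)\<^sup>2 = 0)"
  proof
    assume "AE z in (lborel::complex measure). 1 / (1 + (cmod z)\<^sup>2)\<^sup>2 = 0"
    then have "AE z in (lborel::complex measure). False"
      by eventually_elim (auto simp: add_nonneg_eq_0_iff power2_eq_square)
    then show False by (simp add: AE_iff_null null_sets_def)
  qed
  then have "cauchy_mass \<noteq> 0" unfolding cauchy_mass_def
    using cauchy_mass_integrable by (subst integral_nonneg_eq_0_iff_AE) auto
  then show ?thesis unfolding cauchy_mass_def
    by (metis (no_types, lifting) Bochner_Integration.integral_nonneg less_eq_real_def zero_le_divide_1_iff zero_le_power2)
qed

text \<open>Densities are Borel and are bounded, and vanish off \<open>Z\<close>, at every point instead of almost every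
  point. Each class of \<open>L_inf Z\<close> has such a representative, and products and quotients
  of representatives can then be formed without exceptional null sets.\<close>

definition density_on :: "complex set \<Rightarrow> real \<Rightarrow> (complex \<Rightarrow> complex) set" where
  "density_on Z M = {f \<in> borel_measurable borel. \<forall>z. cmod (f z) \<le> M \<and> (z \<notin> Z \<longrightarrow> f z = 0)}"

definition cauchy_transform :: "(complex \<Rightarrow> complex) \<Rightarrow> complex \<Rightarrow> complex" where
  "cauchy_transform f z = (LINT \<zeta>|lborel. f \<zeta> / (z - \<zeta>)) / of_real cauchy_mass"

lemma density_on_measurable: "f \<in> density_on Z M \<Longrightarrow> f \<in> borel_measurable borel"
  and density_on_bound: "f \<in> density_on Z M \<Longrightarrow> cmod (f z) \<le> M"
  and density_on_zero: "f \<in> density_on Z M \<Longrightarrow> z \<notin> Z \<Longrightarrow> f z = 0"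
  and density_on_nonneg: "f \<in> density_on Z M \<Longrightarrow> 0 \<le> M"
  unfolding density_on_def using norm_ge_zero order_trans by blast+

lemmas density_onD = density_on_measurable density_on_bound density_on_zero density_on_nonneg

lemma density_onI:
  assumes "f \<in> borel_measurable borel" "\<And>z. cmod (f z) \<le> M" "\<And>z. z \<notin> Z \<Longrightarrow> f z = 0"
  shows "f \<in> density_on Z M"
  using assms unfolding density_on_def by auto

lemma density_on_mono: "f \<in> density_on Z M \<Longrightarrow> Z \<subseteq> Z' \<Longrightarrow> M \<le> M' \<Longrightarrow> f \<in> density_on Z' M'"
  unfolding density_on_def by (auto intro: order_trans)

lemma density_on_mult:
  assumes f: "f \<in> density_on Z M" and g: "g \<in> borel_measurable borel" "\<And>z. z \<in> Z \<Longrightarrow> cmod (g z) \<le> N"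
    and N: "0 \<le> N"
  shows "(\<lambda>z. f z * g z) \<in> density_on Z (M * N)"
proof (rule density_onI)
  show "(\<lambda>z. f z * g z) \<in> borel_measurable borel"
    using density_on_measurable[OF f] g(1) by measurable
  show "cmod (f z * g z) \<le> M * N" for z
    using density_onD[OF f] g(2)[of z] N by (cases "z \<in> Z") (auto simp: norm_mult intro: mult_mono)
  show "f z * g z = 0" if "z \<notin> Z" for z using density_on_zero[OF f that] by simp
qed

lemma density_on_add:
  "f \<in> density_on Z M \<Longrightarrow> g \<in> density_on Z N \<Longrightarrow> (\<lambda>z. f z + g z) \<in> density_on Z (M + N)"
  unfolding density_on_def by (auto intro: norm_triangle_mono)

lemma density_on_cmult:
  "f \<in> density_on Z M \<Longrightarrow> (\<lambda>z. c * f z) \<in> density_on Z (cmod c * M)"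
  unfolding density_on_def by (auto simp: norm_mult intro: mult_left_mono)

lemma disc_weight_nonneg: "0 \<le> disc_weight" by (simp add: disc_weight_def)

lemma density_kernel_bound:
  assumes f: "f \<in> density_on Z M"
  shows "cmod (f \<zeta> / (z - \<zeta>)) \<le> M * (indicator Z \<zeta> + indicator Z \<zeta> * singular_weight (z - \<zeta>))"
proof (cases "\<zeta> \<in> Z")
  case True
  have "cmod (f \<zeta> / (z - \<zeta>)) = cmod (f \<zeta>) * (1 / cmod (z - \<zeta>))" by (simp add: norm_divide)
  also have "\<dots> \<le> M * (1 + singular_weight (z - \<zeta>))"
    using density_onD[OF f] inverse_norm_le_singular_weight by (intro mult_mono) auto
  finally show ?thesis using True by simp
qed (use density_onD[OF f] in simp)

lemma emeasure_lborel_bounded_finite: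
  fixes Z :: "complex set" assumes "bounded Z" shows "emeasure lborel Z < \<infinity>"
  by (rule emeasure_bounded_finite[OF assms])

context
  fixes Z :: "complex set"
  assumes Z [measurable]: "Z \<in> sets borel" and bZ: "bounded Z"
begin

lemma weight_integral:
  "integrable lborel (\<lambda>\<zeta>. indicator Z \<zeta> + indicator Z \<zeta> * singular_weight (z - \<zeta>))"
  "(LINT \<zeta>|lborel. indicator Z \<zeta> + indicator Z \<zeta> * singular_weight (z - \<zeta>)) \<le> disc_weight + 2 * measure lborel Z"
proof -
  have i: "integrable lborel (indicator Z :: complex \<Rightarrow> real)"
    using emeasure_lborel_bounded_finite[OF bZ] by (intro integrable_real_indicator) auto
  note s = singular_weight_integral[OF Z emeasure_lborel_bounded_finite[OF bZ], of z]
  show "integrable lborel (\<lambda>\<zeta>. indicator Z \<zeta> + indicator Z \<zeta> * singular_weight (z - \<zeta>))"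
    using i s by auto
  show "(LINT \<zeta>|lborel. indicator Z \<zeta> + indicator Z \<zeta> * singular_weight (z - \<zeta>)) \<le> disc_weight + 2 * measure lborel Z"
    using i s by (simp add: Bochner_Integration.integral_add)
qed

lemma cauchy_integrable:
  assumes f: "f \<in> density_on Z M"
  shows "integrable lborel (\<lambda>\<zeta>. f \<zeta> / (z - \<zeta>))"
proof (rule Bochner_Integration.integrable_bound)
  show "integrable lborel (\<lambda>\<zeta>. M * (indicator Z \<zeta> + indicator Z \<zeta> * singular_weight (z - \<zeta>)))"
    using weight_integral(1) by (intro integrable_mult_right)
  show "(\<lambda>\<zeta>. f \<zeta> / (z - \<zeta>)) \<in> borel_measurable lborel" using density_on_measurable[OF f] by measurable
  show "AE \<zeta> in lborel. norm (f \<zeta> / (z - \<zeta>)) \<le> norm (M * (indicator Z \<zeta> + indicator Z \<zeta> * singular_weight (z - \<zeta>)))"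
    using density_kernel_bound[OF f, of _ z] density_on_nonneg[OF f] by (intro AE_I2) auto
qed

lemma density_integrable: "f \<in> density_on Z M \<Longrightarrow> integrable lborel f"
proof (rule integrableI_bounded_set[of Z _ _ M])
  assume f: "f \<in> density_on Z M"
  show "f \<in> borel_measurable lborel" using density_on_measurable[OF f] by simp
  show "AE z in lborel. z \<in> Z \<longrightarrow> cmod (f z) \<le> M" using density_on_bound[OF f] by simp
  show "AE z in lborel. z \<notin> Z \<longrightarrow> f z = 0" using density_on_zero[OF f] by simp
qed (use emeasure_lborel_bounded_finite[OF bZ] in auto)

definition transform_bound :: real where
  "transform_bound = 4 * (disc_weight + measure lborel Z) / cauchy_mass"

lemma transform_bound_nonneg: "0 \<le> transform_bound"
  unfolding transform_bound_def disc_weight_def using cauchy_mass_pos by simp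

lemma cauchy_transform_bound:
  assumes f: "f \<in> density_on Z M"
  shows "cmod (cauchy_transform f z) \<le> M * transform_bound"
proof -
  have "cmod (LINT \<zeta>|lborel. f \<zeta> / (z - \<zeta>))
      \<le> (LINT \<zeta>|lborel. M * (indicator Z \<zeta> + indicator Z \<zeta> * singular_weight (z - \<zeta>)))"
    using cauchy_integrable[OF f] weight_integral(1) density_kernel_bound[OF f]
    by (intro Bochner_Integration.integral_norm_bound_integral) auto
  also have "\<dots> = M * (LINT \<zeta>|lborel. indicator Z \<zeta> + indicator Z \<zeta> * singular_weight (z - \<zeta>))"
    by simp
  also have "\<dots> \<le> M * (4 * (disc_weight + measure lborel Z))"
  proof (rule mult_left_mono[OF _ density_on_nonneg[OF f]])
    have "disc_weight + 2 * measure lborel Z \<le> 4 * (disc_weight + measure lborel Z)"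
      using disc_weight_nonneg measure_nonneg[of lborel Z] by argo
    then show "(LINT \<zeta>|lborel. indicator Z \<zeta> + indicator Z \<zeta> * singular_weight (z - \<zeta>))
       \<le> 4 * (disc_weight + measure lborel Z)"
      using weight_integral(2)[of z] by linarith
  qed
  finally show ?thesis
    using cauchy_mass_pos unfolding cauchy_transform_def transform_bound_def
    by (simp add: norm_divide divide_right_mono)
qed

text \<open>Integrates the pointwise estimate of the difference of two Cauchy kernels. The estimate depends on the density only through its
  bound, so that a bounded family of densities has equicontinuous transforms.\<close>

lemma cauchy_transform_holder:
  assumes f: "f \<in> density_on Z M"
  shows "cmod (cauchy_transform f z - cauchy_transform f w) \<le> M * transform_bound * sqrt (cmod (z - w))"
proof -
  let ?g = "\<lambda>z \<zeta>. indicator Z \<zeta> * singular_weight (z - \<zeta>)"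
  note s = singular_weight_integral[OF Z emeasure_lborel_bounded_finite[OF bZ]]
  have "cmod ((LINT \<zeta>|lborel. f \<zeta> / (z - \<zeta>)) - (LINT \<zeta>|lborel. f \<zeta> / (w - \<zeta>)))
      = cmod (LINT \<zeta>|lborel. f \<zeta> / (z - \<zeta>) - f \<zeta> / (w - \<zeta>))"
    using cauchy_integrable[OF f] by simp
  also have "\<dots> \<le> (LINT \<zeta>|lborel. M * (2 * sqrt (cmod (z - w))) * (?g z \<zeta> + ?g w \<zeta>))"
  proof (rule Bochner_Integration.integral_norm_bound_integral)
    fix \<zeta>
    show "norm (f \<zeta> / (z - \<zeta>) - f \<zeta> / (w - \<zeta>)) \<le> M * (2 * sqrt (cmod (z - w))) * (?g z \<zeta> + ?g w \<zeta>)"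
    proof (cases "\<zeta> \<in> Z")
      case True
      have "norm (f \<zeta> / (z - \<zeta>) - f \<zeta> / (w - \<zeta>)) = cmod (f \<zeta>) * cmod (1 / (z - \<zeta>) - 1 / (w - \<zeta>))"
        by (simp add: right_diff_distrib flip: norm_mult)
      also have "\<dots> \<le> M * (2 * sqrt (cmod (z - w)) * (singular_weight (z - \<zeta>) + singular_weight (w - \<zeta>)))"
        using density_onD[OF f] cauchy_kernel_diff_le[of "z - \<zeta>" "w - \<zeta>"] by (intro mult_mono) auto
      finally show ?thesis using True by (simp add: mult.assoc)
    qed (use density_onD[OF f] in simp)
  qed (use cauchy_integrable[OF f] s in auto)
  also have "\<dots> = M * (2 * sqrt (cmod (z - w))) * ((LINT \<zeta>|lborel. ?g z \<zeta>) + (LINT \<zeta>|lborel. ?g w \<zeta>))"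
    using s by simp
  also have "\<dots> \<le> M * (2 * sqrt (cmod (z - w))) * (2 * (disc_weight + measure lborel Z))"
    using s(2)[of z] s(2)[of w] density_on_nonneg[OF f] by (intro mult_left_mono) auto
  finally show ?thesis
    using cauchy_mass_pos unfolding cauchy_transform_def transform_bound_def
    by (simp add: norm_divide divide_right_mono algebra_simps flip: diff_divide_distrib)
qed

lemma cauchy_transform_continuous:
  assumes f: "f \<in> density_on Z M"
  shows "continuous_on UNIV (cauchy_transform f)"
proof (rule continuous_at_imp_continuous_on, rule ballI)
  fix x
  define B where "B = M * transform_bound"
  have "((\<lambda>y. B * sqrt (cmod (y - x))) \<longlongrightarrow> B * sqrt (cmod (x - x))) (at x)"
    by (intro tendsto_intros)
  then have lim: "((\<lambda>y. B * sqrt (cmod (y - x))) \<longlongrightarrow> 0) (at x)" by simp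
  have "\<forall>\<^sub>F y in at x. norm (cauchy_transform f y - cauchy_transform f x) \<le> B * sqrt (cmod (y - x))"
    using cauchy_transform_holder[OF f] unfolding B_def by (intro always_eventually) blast
  then have "((\<lambda>y. cauchy_transform f y - cauchy_transform f x) \<longlongrightarrow> 0) (at x)"
    by (rule Lim_null_comparison[OF _ lim])
  then show "isCont (cauchy_transform f) x" unfolding isCont_def by (rule LIM_zero_cancel)
qed

lemma cauchy_transform_measurable:
  "f \<in> density_on Z M \<Longrightarrow> cauchy_transform f \<in> borel_measurable borel"
  by (intro borel_measurable_continuous_onI cauchy_transform_continuous)

lemma cauchy_transform_add:
  assumes "f \<in> density_on Z M" "g \<in> density_on Z N"
  shows "cauchy_transform (\<lambda>z. f z + g z) z = cauchy_transform f z + cauchy_transform g z"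
  using assms[THEN cauchy_integrable, of z] unfolding cauchy_transform_def 
  by (simp add: add_divide_distrib)

lemma cauchy_transform_cmult:
  "cauchy_transform (\<lambda>z. c * f z) z = c * cauchy_transform f z"
  unfolding cauchy_transform_def by (simp flip: times_divide_eq_right)

lemma cauchy_transform_tendsto:
  assumes f: "\<And>n. f n \<in> density_on Z M" and lim: "\<And>z. (\<lambda>n. f n z) \<longlonglongrightarrow> g z"
  shows "g \<in> density_on Z M" "(\<lambda>n. cauchy_transform (f n) z) \<longlonglongrightarrow> cauchy_transform g z"
proof -
  have g: "g \<in> borel_measurable borel" using density_on_measurable[OF f] lim by (rule borel_measurable_LIMSEQ_metric)
  show "g \<in> density_on Z M"
  proof (rule density_onI[OF g])
    show "cmod (g z) \<le> M" for z
      by (rule Lim_bounded[OF tendsto_norm[OF lim]]) (use density_on_bound[OF f] in auto)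
    show "g z = 0" if "z \<notin> Z" for z
      using lim[of z] density_on_zero[OF f that] by (simp add: LIMSEQ_const_iff)
  qed
  have "(\<lambda>n. LINT \<zeta>|lborel. f n \<zeta> / (z - \<zeta>)) \<longlonglongrightarrow> (LINT \<zeta>|lborel. g \<zeta> / (z - \<zeta>))"
  proof (rule integral_dominated_convergence)
    show "integrable lborel (\<lambda>\<zeta>. M * (indicator Z \<zeta> + indicator Z \<zeta> * singular_weight (z - \<zeta>)))"
      using weight_integral(1) by (intro integrable_mult_right)
    show "AE \<zeta> in lborel. (\<lambda>n. f n \<zeta> / (z - \<zeta>)) \<longlonglongrightarrow> g \<zeta> / (z - \<zeta>)"
      using AE_lborel_singleton[of z]
      by eventually_elim (auto intro!: tendsto_divide lim)
    show "AE \<zeta> in lborel. norm (f n \<zeta> / (z - \<zeta>)) \<le> M * (indicator Z \<zeta> + indicator Z \<zeta> * singular_weight (z - \<zeta>))" for n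
      using density_kernel_bound[OF f] by (intro AE_I2) auto
  qed (use g density_on_measurable[OF f] in measurable)
  then show "(\<lambda>n. cauchy_transform (f n) z) \<longlonglongrightarrow> cauchy_transform g z"
    unfolding cauchy_transform_def using cauchy_mass_pos by (intro tendsto_divide) auto
qed

text \<open>Fubini applied to the partial fraction identity
  \<open>1 / ((z - a) * (z - b)) = 1 / ((z - a) * (a - b)) + 1 / ((z - b) * (b - a))\<close>. In terms of derivatives
  this is the Leibniz rule for \<open>dbar\<close>; as an identity between integrals it makes sense for densities
  that are merely bounded, and all later calculus with transforms is derived from it.\<close>

lemma cauchy_transform_prod:
  assumes f: "f \<in> density_on Z M" and g: "g \<in> density_on Z N"
  shows "cauchy_transform f z * cauchy_transform g z =
    cauchy_transform (\<lambda>\<zeta>. f \<zeta> * cauchy_transform g \<zeta> + g \<zeta> * cauchy_transform f \<zeta>) z"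
proof -
  let ?C = "complex_of_real cauchy_mass"
  have C: "?C \<noteq> 0" using cauchy_mass_pos by simp
  note [measurable] = density_on_measurable[OF f] density_on_measurable[OF g]
  note Tm = cauchy_transform_measurable[OF f] cauchy_transform_measurable[OF g]
  define K where "K h k a b = h a / (z - a) * (k b / (a - b))" for h k :: "complex \<Rightarrow> complex" and a b
  let ?W = "disc_weight + 2 * measure lborel Z"
  have int: "integrable (lborel \<Otimes>\<^sub>M lborel) (\<lambda>(a, b). K h k a b)"
    if h: "h \<in> density_on Z M'" and k: "k \<in> density_on Z N'" for h k M' N'
  proof (rule lborel_pair.Fubini_integrable)
    note [measurable] = density_on_measurable[OF h] density_on_measurable[OF k]
    have kn: "integrable lborel (\<lambda>b. k b / (a - b))" for a by (rule cauchy_integrable[OF k])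
    show m: "(\<lambda>(a, b). K h k a b) \<in> borel_measurable (lborel \<Otimes>\<^sub>M lborel)" unfolding K_def by measurable
    show "AE a in lborel. integrable lborel (\<lambda>b. case (a, b) of (a, b) \<Rightarrow> K h k a b)"
      unfolding K_def prod.case by (intro AE_I2 integrable_mult_right impI kn)
    show "integrable lborel (\<lambda>a. LINT b|lborel. norm (case (a, b) of (a, b) \<Rightarrow> K h k a b))"
    proof (rule Bochner_Integration.integrable_bound)
      show "integrable lborel (\<lambda>a. N' * ?W * norm (h a / (z - a)))"
        using cauchy_integrable[OF h] by (intro integrable_mult_right integrable_norm)
      show "(\<lambda>a. LINT b|lborel. norm (case (a, b) of (a, b) \<Rightarrow> K h k a b)) \<in> borel_measurable lborel"
        unfolding K_def by measurable
      show "AE a in lborel. norm (LINT b|lborel. norm (case (a, b) of (a, b) \<Rightarrow> K h k a b)) \<le> norm (N' * ?W * norm (h a / (z - a)))"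
      proof (rule AE_I2)
        fix a
        have "(LINT b|lborel. norm (k b / (a - b))) \<le> (LINT b|lborel. N' * (indicator Z b + indicator Z b * singular_weight (a - b)))"
          using kn weight_integral(1) density_kernel_bound[OF k]
          by (intro integral_mono integrable_norm integrable_mult_right) auto
        also have "\<dots> = N' * (LINT b|lborel. indicator Z b + indicator Z b * singular_weight (a - b))"
          by simp
        also have "\<dots> \<le> N' * ?W"
          using weight_integral(2)[of a] density_on_nonneg[OF k] by (rule mult_left_mono)
        finally have *: "(LINT b|lborel. norm (k b / (a - b))) \<le> N' * ?W" .
        have "norm (LINT b|lborel. norm (K h k a b)) = norm (h a / (z - a)) * (LINT b|lborel. norm (k b / (a - b)))"
          unfolding K_def norm_mult integral_mult_right_zero
          by (simp only: real_norm_def abs_norm_cancel abs_of_nonneg[OF Bochner_Integration.integral_nonneg] norm_ge_zero)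
        also have "\<dots> \<le> norm (h a / (z - a)) * (N' * ?W)"
          using * by (intro mult_left_mono) auto
        also have "\<dots> \<le> norm (N' * ?W * norm (h a / (z - a)))"
          by (simp only: mult.commute[of "norm (h a / (z - a))"] real_norm_def abs_ge_self)
        finally show "norm (LINT b|lborel. norm (case (a, b) of (a, b) \<Rightarrow> K h k a b)) \<le> norm (N' * ?W * norm (h a / (z - a)))"
          by simp
      qed
    qed
  qed
  have iter: "(LINT a|lborel. LINT b|lborel. K h k a b) = ?C * ?C * cauchy_transform (\<lambda>a. h a * cauchy_transform k a) z" for h k
  proof -
    have "(LINT b|lborel. K h k a b) = ?C * (h a * cauchy_transform k a / (z - a))" for a
      unfolding K_def integral_mult_right_zero cauchy_transform_def using C by simp
    then show ?thesis using C by (simp only: integral_mult_right_zero) (simp add: cauchy_transform_def)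
  qed
  define P where "P a b = f a / (z - a) * (g b / (z - b))" for a b
  have pint: "integrable (lborel \<Otimes>\<^sub>M lborel) (\<lambda>(a, b). P a b)"
  proof (rule lborel_pair.Fubini_integrable)
    show "(\<lambda>(a, b). P a b) \<in> borel_measurable (lborel \<Otimes>\<^sub>M lborel)" unfolding P_def by measurable
    show "integrable lborel (\<lambda>a. LINT b|lborel. norm (case (a, b) of (a, b) \<Rightarrow> P a b))"
      unfolding P_def prod.case norm_mult integral_mult_right_zero
      by (intro integrable_mult_left impI integrable_norm cauchy_integrable[OF f])
    show "AE a in lborel. integrable lborel (\<lambda>b. case (a, b) of (a, b) \<Rightarrow> P a b)"
      unfolding P_def prod.case by (intro AE_I2 integrable_mult_right impI cauchy_integrable[OF g])
  qed
  have swap: "integrable (lborel \<Otimes>\<^sub>M lborel) (\<lambda>(a, b). K g f b a)"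
    using lborel_pair.integrable_product_swap[OF int[OF g f]] by (simp only: prod.case)
  have split: "AE p in lborel \<Otimes>\<^sub>M lborel. (case p of (a, b) \<Rightarrow> P a b) =
     (case p of (a, b) \<Rightarrow> K f g a b) + (case p of (a, b) \<Rightarrow> K g f b a)"
  proof (rule lborel_pair.AE_pair_measure)
    show "{p \<in> space (lborel \<Otimes>\<^sub>M lborel). (case p of (a, b) \<Rightarrow> P a b) =
     (case p of (a, b) \<Rightarrow> K f g a b) + (case p of (a, b) \<Rightarrow> K g f b a)} \<in> sets (lborel \<Otimes>\<^sub>M lborel)"
    proof -
      have m: "(\<lambda>p. (case p of (a, b) \<Rightarrow> P a b) -
         ((case p of (a, b) \<Rightarrow> K f g a b) + (case p of (a, b) \<Rightarrow> K g f b a))) \<in> borel_measurable (lborel \<Otimes>\<^sub>M lborel)"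
        using pint int[OF f g] swap by (intro borel_measurable_diff borel_measurable_add borel_measurable_integrable)
      from measurable_sets[OF m, of "{0}"] show ?thesis
        by (auto simp: vimage_def Int_def conj_commute)
    qed
    have eq: "P a b = K f g a b + K g f b a" if "a \<noteq> z" "b \<noteq> z" "b \<noteq> a" for a b
    proof -
      have "z - a \<noteq> 0" "z - b \<noteq> 0" "a - b \<noteq> 0" "b - a \<noteq> 0" using that by auto
      then have "1 / (z - a) * (1 / (z - b)) = 1 / (z - a) * (1 / (a - b)) + 1 / (z - b) * (1 / (b - a))"
        by (simp add: divide_simps) (simp add: algebra_simps)
      from arg_cong[OF this, of "\<lambda>x. f a * g b * x"] show ?thesis
        by (simp add: K_def P_def distrib_left mult_ac)
    qed
    show "AE a in lborel. AE b in lborel. (case (a, b) of (a, b) \<Rightarrow> P a b) =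
     (case (a, b) of (a, b) \<Rightarrow> K f g a b) + (case (a, b) of (a, b) \<Rightarrow> K g f b a)"
    proof (rule AE_mp[OF AE_lborel_singleton[of z]], rule AE_I2, rule impI)
      fix a :: complex assume "a \<noteq> z"
      show "AE b in lborel. (case (a, b) of (a, b) \<Rightarrow> P a b) =
     (case (a, b) of (a, b) \<Rightarrow> K f g a b) + (case (a, b) of (a, b) \<Rightarrow> K g f b a)"
        using AE_lborel_singleton[of z] AE_lborel_singleton[of a]
        by eventually_elim (simp add: eq \<open>a \<noteq> z\<close>)
    qed
  qed
  have "?C * ?C * (cauchy_transform f z * cauchy_transform g z)
      = (LINT a|lborel. f a / (z - a)) * (LINT b|lborel. g b / (z - b))"
    using C by (simp add: cauchy_transform_def)
  also have "\<dots> = (LINT a|lborel. LINT b|lborel. P a b)"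
    unfolding P_def integral_mult_right_zero integral_mult_left_zero by (rule refl)
  also have "\<dots> = integral\<^sup>L (lborel \<Otimes>\<^sub>M lborel) (\<lambda>(a, b). P a b)"
    using lborel_pair.integral_fst[OF pint] by simp
  also have "\<dots> = (LINT p|(lborel \<Otimes>\<^sub>M lborel). (case p of (a, b) \<Rightarrow> K f g a b) + (case p of (a, b) \<Rightarrow> K g f b a))"
    by (rule integral_cong_AE[OF _ _ split]) (use pint int[OF f g] swap in \<open>auto intro!: borel_measurable_add dest: borel_measurable_integrable\<close>)
  also have "\<dots> = integral\<^sup>L (lborel \<Otimes>\<^sub>M lborel) (\<lambda>(a, b). K f g a b) + integral\<^sup>L (lborel \<Otimes>\<^sub>M lborel) (\<lambda>(a, b). K g f b a)"
    by (rule Bochner_Integration.integral_add[OF int[OF f g] swap])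
  also have "\<dots> = (LINT a|lborel. LINT b|lborel. K f g a b) + (LINT b|lborel. LINT a|lborel. K g f b a)"
    using lborel_pair.integral_fst[OF int[OF f g]] lborel_pair.integral_snd[OF swap] by simp
  also have "\<dots> = ?C * ?C * cauchy_transform (\<lambda>a. f a * cauchy_transform g a) z
     + ?C * ?C * cauchy_transform (\<lambda>a. g a * cauchy_transform f a) z"
    by (simp only: iter)
  finally have "cauchy_transform f z * cauchy_transform g z =
     cauchy_transform (\<lambda>a. f a * cauchy_transform g a) z + cauchy_transform (\<lambda>a. g a * cauchy_transform f a) z"
    using C by (simp flip: distrib_left)
  also have "\<dots> = cauchy_transform (\<lambda>\<zeta>. f \<zeta> * cauchy_transform g \<zeta> + g \<zeta> * cauchy_transform f \<zeta>) z"
  proof (rule cauchy_transform_add[symmetric])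
    show "(\<lambda>a. f a * cauchy_transform g a) \<in> density_on Z (M * (N * transform_bound))"
      using cauchy_transform_bound[OF g] density_on_nonneg[OF g] transform_bound_nonneg
      by (intro density_on_mult[OF f Tm(2)]) auto
    show "(\<lambda>a. g a * cauchy_transform f a) \<in> density_on Z (N * (M * transform_bound))"
      using cauchy_transform_bound[OF f] density_on_nonneg[OF f] transform_bound_nonneg
      by (intro density_on_mult[OF g Tm(1)]) auto
  qed
  finally show ?thesis .
qed

end

section \<open>Smooth test functions\<close>

text \<open>The functions \<open>exp (- 1/t) / t ^ n\<close>, extended by 0 to \<open>t \<le> 0\<close>. Differentiation maps their linear span to
  itself, which gives smoothness of all orders in one step.\<close>

definition flat_power :: "nat \<Rightarrow> real \<Rightarrow> real" where
  "flat_power n t = (if t \<le> 0 then 0 else inverse t ^ n * exp (- inverse t))"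

lemma power_le_fact_exp:
  fixes x :: real assumes "0 \<le> x" shows "x ^ k \<le> fact k * exp x"
proof -
  have "(\<Sum>n\<in>{k}. x ^ n /\<^sub>R fact n) \<le> (\<Sum>n. x ^ n /\<^sub>R fact n)"
    using assms by (intro sum_le_suminf summable_exp_generic) auto
  then have "x ^ k / fact k \<le> exp x" by (simp add: exp_def divide_inverse mult.commute)
  then show ?thesis by (simp add: field_simps)
qed

text \<open>The exponential series bounds \<open>exp (- 1/t)\<close> by every power of \<open>t\<close>; two powers more than \<open>n\<close> make the derivative at 0 vanish.\<close>

lemma flat_power_le: "\<bar>flat_power n t\<bar> \<le> fact (n + 2) * t\<^sup>2"
proof (cases "t \<le> 0")
  case False
  then have t: "0 < t" by simp
  have "inverse t ^ (n + 2) \<le> fact (n + 2) * exp (inverse t)"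
    using t by (intro power_le_fact_exp) simp
  then have "inverse t ^ (n + 2) * exp (- inverse t) * t\<^sup>2 \<le> fact (n + 2) * exp (inverse t) * exp (- inverse t) * t\<^sup>2"
    by (intro mult_right_mono) auto
  also have "\<dots> = fact (n + 2) * t\<^sup>2" by (simp add: mult_exp_exp)
  also have "inverse t ^ (n + 2) * exp (- inverse t) * t\<^sup>2 = flat_power n t"
    using t by (simp add: flat_power_def power_add field_simps power2_eq_square)
  finally show ?thesis using t by (simp add: flat_power_def)
qed (simp add: flat_power_def)

lemma flat_power_deriv:
  "(flat_power n has_real_derivative (flat_power (n + 2) t - real n * flat_power (n + 1) t)) (at t)"
proof -
  consider "t < 0" | "t = 0" | "t > 0" by linarith
  then show ?thesis
  proof cases
    case 1
    have "((\<lambda>_. 0) has_real_derivative 0) (at t)" by simp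
    from has_field_derivative_transform_within_open[OF this, of "{..<0}" "flat_power n"]
    have "(flat_power n has_real_derivative 0) (at t)"
      using 1 by (auto simp: flat_power_def)
    then show ?thesis using 1 by (simp add: flat_power_def)
  next
    case 2
    have lim: "((\<lambda>y. fact (n + 2) * \<bar>y\<bar>) \<longlongrightarrow> fact (n + 2) * \<bar>0\<bar>) (at (0::real))"
      by (intro tendsto_intros)
    have "norm ((flat_power n y - flat_power n 0) / (y - 0)) \<le> fact (n + 2) * \<bar>y\<bar>" for y
    proof -
      have "\<bar>flat_power n y\<bar> \<le> (fact (n + 2) * \<bar>y\<bar>) * \<bar>y\<bar>"
        using flat_power_le[of n y] by (simp only: mult.assoc abs_mult_self_eq power2_eq_square)
      then have "y \<noteq> 0 \<Longrightarrow> \<bar>flat_power n y\<bar> / \<bar>y\<bar> \<le> fact (n + 2) * \<bar>y\<bar>"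
        by (subst pos_divide_le_eq) auto
      then show ?thesis by (cases "y = 0") (simp_all only: flat_power_def[of _ 0] real_norm_def abs_divide diff_zero, simp_all)
    qed
    then have ev: "\<forall>\<^sub>F y in at 0. norm ((flat_power n y - flat_power n 0) / (y - 0)) \<le> fact (n + 2) * \<bar>y\<bar>"
      by (intro always_eventually allI)
    have "((\<lambda>y. (flat_power n y - flat_power n 0) / (y - 0)) \<longlongrightarrow> 0) (at 0)"
      by (rule Lim_null_comparison[OF ev]) (use lim in simp)
    then show ?thesis using 2 by (simp add: has_field_derivative_iff flat_power_def[of _ 0])
  next
    case 3
    have "((\<lambda>t. inverse t ^ n * exp (- inverse t)) has_real_derivative
      (flat_power (n + 2) t - real n * flat_power (n + 1) t)) (at t)"
    proof -
      have i: "(inverse has_real_derivative - (inverse t ^ 2)) (at t)"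
        using DERIV_inverse[of t] 3 by (simp add: numeral_2_eq_2)
      have "((\<lambda>t. inverse t ^ n * exp (- inverse t)) has_real_derivative
        inverse t ^ n * (exp (- inverse t) * - (- (inverse t ^ 2))) + (of_nat n * (- (inverse t ^ 2) * inverse t ^ (n - 1))) * exp (- inverse t)) (at t)"
        using DERIV_mult'[OF DERIV_power[OF i, of n] DERIV_fun_exp[OF DERIV_minus[OF i]]] by simp
      moreover have "u ^ n * (e * - (- (u ^ 2))) + (of_nat n * (- (u ^ 2) * u ^ (n - 1))) * e
        = u ^ (n + 2) * e - real n * (u ^ (n + 1) * e)" for u e :: real
        by (cases n) (simp_all add: algebra_simps power2_eq_square)
      ultimately show ?thesis using 3 by (simp add: flat_power_def)
    qed
    from has_field_derivative_transform_within_open[OF this, of "{0<..}" "flat_power n"]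
    show ?thesis using 3 by (auto simp: flat_power_def)
  qed
qed

inductive_set smooth_real :: "(complex \<Rightarrow> real) set" where
  smooth_const: "(\<lambda>_. c) \<in> smooth_real"
| smooth_Re: "Re \<in> smooth_real"
| smooth_Im: "Im \<in> smooth_real"
| smooth_add: "f \<in> smooth_real \<Longrightarrow> g \<in> smooth_real \<Longrightarrow> (\<lambda>z. f z + g z) \<in> smooth_real"
| smooth_mult: "f \<in> smooth_real \<Longrightarrow> g \<in> smooth_real \<Longrightarrow> (\<lambda>z. f z * g z) \<in> smooth_real"
| smooth_inverse: "f \<in> smooth_real \<Longrightarrow> (\<And>z. f z \<noteq> 0) \<Longrightarrow> (\<lambda>z. inverse (f z)) \<in> smooth_real"
| smooth_flat: "f \<in> smooth_real \<Longrightarrow> (\<lambda>z. flat_power n (f z)) \<in> smooth_real"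

lemma smooth_diff: "f \<in> smooth_real \<Longrightarrow> g \<in> smooth_real \<Longrightarrow> (\<lambda>z. f z - g z) \<in> smooth_real"
  using smooth_add[OF _ smooth_mult[OF smooth_const[of "-1"]]] by auto

lemma smooth_derivativeI:
  assumes "fx \<in> smooth_real" "fy \<in> smooth_real" "\<And>z. (f has_derivative (\<lambda>h. Re h * fx z + Im h * fy z)) (at z)"
  shows "\<exists>fx\<in>smooth_real. \<exists>fy\<in>smooth_real. \<forall>z. (f has_derivative (\<lambda>h. Re h * fx z + Im h * fy z)) (at z)"
  using assms by blast

lemma smooth_real_derivative:
  assumes "f \<in> smooth_real"
  shows "\<exists>fx\<in>smooth_real. \<exists>fy\<in>smooth_real. \<forall>z. (f has_derivative (\<lambda>h. Re h * fx z + Im h * fy z)) (at z)"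
  using assms
proof induction
  case (smooth_const c)
  show ?case
    by (rule smooth_derivativeI[of "\<lambda>_. 0" "\<lambda>_. 0"])
      (auto intro!: derivative_eq_intros smooth_real.smooth_const)
next
  case smooth_Re
  show ?case
    by (rule smooth_derivativeI[of "\<lambda>_. 1" "\<lambda>_. 0"])
      (auto intro!: derivative_eq_intros smooth_real.smooth_const)
next
  case smooth_Im
  show ?case
    by (rule smooth_derivativeI[of "\<lambda>_. 0" "\<lambda>_. 1"])
      (auto intro!: derivative_eq_intros smooth_real.smooth_const)
next
  case (smooth_add f g)
  then obtain fx fy gx gy where S: "fx \<in> smooth_real" "fy \<in> smooth_real" "gx \<in> smooth_real" "gy \<in> smooth_real"
    and D: "\<And>z. (f has_derivative (\<lambda>h. Re h * fx z + Im h * fy z)) (at z)"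
      "\<And>z. (g has_derivative (\<lambda>h. Re h * gx z + Im h * gy z)) (at z)" by blast
  have "((\<lambda>z. f z + g z) has_derivative (\<lambda>h. Re h * (fx z + gx z) + Im h * (fy z + gy z))) (at z)" for z
    by (rule has_derivative_eq_rhs[OF has_derivative_add[OF D]]) (auto simp: algebra_simps)
  then show ?case by (rule smooth_derivativeI[rotated 2]) (intro smooth_real.smooth_add S)+
next
  case (smooth_mult f g)
  then obtain fx fy gx gy where S: "fx \<in> smooth_real" "fy \<in> smooth_real" "gx \<in> smooth_real" "gy \<in> smooth_real"
    and D: "\<And>z. (f has_derivative (\<lambda>h. Re h * fx z + Im h * fy z)) (at z)"
      "\<And>z. (g has_derivative (\<lambda>h. Re h * gx z + Im h * gy z)) (at z)" by blast
  have "((\<lambda>z. f z * g z) has_derivative (\<lambda>h. Re h * (f z * gx z + fx z * g z) + Im h * (f z * gy z + fy z * g z))) (at z)" for z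
    by (rule has_derivative_eq_rhs[OF has_derivative_mult[OF D]]) (auto simp: algebra_simps)
  then show ?case
    by (rule smooth_derivativeI[rotated 2]) (intro smooth_real.smooth_add smooth_real.smooth_mult S smooth_mult.hyps)+
next
  case (smooth_inverse f)
  then obtain fx fy where S: "fx \<in> smooth_real" "fy \<in> smooth_real"
    and D: "\<And>z. (f has_derivative (\<lambda>h. Re h * fx z + Im h * fy z)) (at z)" by blast
  have "((\<lambda>z. inverse (f z)) has_derivative (\<lambda>h. Re h * (-1 * (inverse (f z) * (inverse (f z) * fx z)))
      + Im h * (-1 * (inverse (f z) * (inverse (f z) * fy z))))) (at z)" for z
    by (rule has_derivative_eq_rhs[OF Deriv.has_derivative_inverse[OF smooth_inverse.hyps(2) D]]) (auto simp: algebra_simps)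
  moreover have "(\<lambda>z. -1 * (inverse (f z) * (inverse (f z) * gx z))) \<in> smooth_real" if "gx \<in> smooth_real" for gx
    using smooth_inverse.hyps that
    by (intro smooth_real.smooth_mult[OF smooth_real.smooth_const] smooth_real.smooth_mult[OF smooth_real.smooth_inverse])
       auto
  ultimately show ?case using S by (intro smooth_derivativeI)
next
  case (smooth_flat f n)
  then obtain fx fy where S: "fx \<in> smooth_real" "fy \<in> smooth_real"
    and D: "\<And>z. (f has_derivative (\<lambda>h. Re h * fx z + Im h * fy z)) (at z)" by blast
  let ?d = "\<lambda>z. flat_power (n + 2) (f z) - real n * flat_power (n + 1) (f z)"
  have "((\<lambda>z. flat_power n (f z)) has_derivative (\<lambda>h. Re h * (?d z * fx z) + Im h * (?d z * fy z))) (at z)" for z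
    by (rule has_derivative_eq_rhs[OF has_derivative_compose[OF D flat_power_deriv[unfolded has_field_derivative_def]]])
       (auto simp: algebra_simps)
  moreover have "(\<lambda>z. ?d z * gx z) \<in> smooth_real" if "gx \<in> smooth_real" for gx
    using smooth_flat.hyps that
    by (intro smooth_real.smooth_mult smooth_diff smooth_real.smooth_flat smooth_real.smooth_const)
  ultimately show ?case using S by (intro smooth_derivativeI)
qed

lemma dx_dy_eqI:
  assumes "(f has_derivative (\<lambda>h. of_real (Re h) * a + of_real (Im h) * b)) (at z)"
  shows "f differentiable at z" "dx f z = a" "dy f z = b" "dbar f z = (a + \<i> * b) / 2"
proof -
  show "f differentiable at z" using assms differentiable_def by blast
  have "frechet_derivative f (at z) = (\<lambda>h. of_real (Re h) * a + of_real (Im h) * b)"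
    using frechet_derivative_at[OF assms] by simp
  then show "dx f z = a" "dy f z = b" by (auto simp: dx_def dy_def)
  then show "dbar f z = (a + \<i> * b) / 2" by (simp add: dbar_def)
qed

lemma has_derivative_dx_dy:
  assumes "f differentiable at z"
  shows "(f has_derivative (\<lambda>h. of_real (Re h) * dx f z + of_real (Im h) * dy f z)) (at z)"
proof -
  have D: "(f has_derivative frechet_derivative f (at z)) (at z)" using assms frechet_derivative_works by blast
  then interpret linear "frechet_derivative f (at z)" by (rule has_derivative_linear)
  have "frechet_derivative f (at z) h = of_real (Re h) * dx f z + of_real (Im h) * dy f z" for h
  proof -
    have "h = Re h *\<^sub>R 1 + Im h *\<^sub>R \<i>" by (simp add: complex_eq_iff)
    then have "frechet_derivative f (at z) h = Re h *\<^sub>R dx f z + Im h *\<^sub>R dy f z"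
      unfolding dx_def dy_def by (metis add scale)
    then show ?thesis by (simp add: scaleR_conv_of_real)
  qed
  then have "frechet_derivative f (at z) = (\<lambda>h. of_real (Re h) * dx f z + of_real (Im h) * dy f z)" ..
  then show ?thesis using D by simp
qed

lemma dbar_mult:
  assumes "f differentiable at z" "g differentiable at z"
  shows "(\<lambda>z. f z * g z) differentiable at z"
    "dx (\<lambda>z. f z * g z) z = f z * dx g z + dx f z * g z"
    "dy (\<lambda>z. f z * g z) z = f z * dy g z + dy f z * g z"
    "dbar (\<lambda>z. f z * g z) z = f z * dbar g z + dbar f z * g z"
proof -
  have "((\<lambda>z. f z * g z) has_derivative (\<lambda>h. of_real (Re h) * (f z * dx g z + dx f z * g z) +
      of_real (Im h) * (f z * dy g z + dy f z * g z))) (at z)"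
    by (rule has_derivative_eq_rhs[OF has_derivative_mult[OF assms[THEN has_derivative_dx_dy]]]) (auto simp: algebra_simps)
  note * = dx_dy_eqI[OF this]
  show "(\<lambda>z. f z * g z) differentiable at z"
    "dx (\<lambda>z. f z * g z) z = f z * dx g z + dx f z * g z"
    "dy (\<lambda>z. f z * g z) z = f z * dy g z + dy f z * g z" using * by auto
  show "dbar (\<lambda>z. f z * g z) z = f z * dbar g z + dbar f z * g z"
    unfolding *(4) by (simp add: dbar_def algebra_simps add_divide_distrib)
qed

text \<open>The partial derivatives of a member of \<open>smooth_real\<close> stay in that class, so the induction on the order of
  differentiability closes.\<close>

lemma C_diff_smooth:
  assumes "f \<in> smooth_real" "g \<in> smooth_real"
  shows "C_diff k (\<lambda>z. Complex (f z) (g z))"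
  using assms
proof (induction k arbitrary: f g)
  have ex: "\<exists>fx\<in>smooth_real. \<exists>fy\<in>smooth_real. \<exists>gx\<in>smooth_real. \<exists>gy\<in>smooth_real.
     \<forall>z. ((\<lambda>z. Complex (f z) (g z)) has_derivative
        (\<lambda>h. of_real (Re h) * Complex (fx z) (gx z) + of_real (Im h) * Complex (fy z) (gy z))) (at z)"
    if fg: "f \<in> smooth_real" "g \<in> smooth_real" for f g
  proof -
    obtain fx fy gx gy where S: "fx \<in> smooth_real" "fy \<in> smooth_real" "gx \<in> smooth_real" "gy \<in> smooth_real"
      and D: "\<And>z. (f has_derivative (\<lambda>h. Re h * fx z + Im h * fy z)) (at z)"
        "\<And>z. (g has_derivative (\<lambda>h. Re h * gx z + Im h * gy z)) (at z)"
      using smooth_real_derivative fg by meson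
    have "((\<lambda>z. of_real (f z) + \<i> * of_real (g z)) has_derivative
        (\<lambda>h. of_real (Re h) * Complex (fx z) (gx z) + of_real (Im h) * Complex (fy z) (gy z))) (at z)" for z
      by (rule has_derivative_eq_rhs, (rule derivative_intros D)+) (auto simp: complex_eq_iff algebra_simps)
    moreover have "(\<lambda>z. of_real (f z) + \<i> * of_real (g z)) = (\<lambda>z. Complex (f z) (g z))"
      by (simp add: fun_eq_iff complex_eq_iff)
    ultimately show ?thesis using S by auto
  qed
  {
    case 0
    obtain fx gx fy gy where "\<And>z. ((\<lambda>z. Complex (f z) (g z)) has_derivative
        (\<lambda>h. of_real (Re h) * Complex (fx z) (gx z) + of_real (Im h) * Complex (fy z) (gy z))) (at z)"
      using ex[OF 0] by blast
    then have "isCont (\<lambda>z. Complex (f z) (g z)) z" for z by (rule has_derivative_continuous)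
    then show ?case by (simp add: continuous_at_imp_continuous_on)
  next
    case (Suc k)
    obtain fx fy gx gy where S: "fx \<in> smooth_real" "fy \<in> smooth_real" "gx \<in> smooth_real" "gy \<in> smooth_real"
      and D: "\<And>z. ((\<lambda>z. Complex (f z) (g z)) has_derivative
        (\<lambda>h. of_real (Re h) * Complex (fx z) (gx z) + of_real (Im h) * Complex (fy z) (gy z))) (at z)"
      using ex[OF Suc.prems] by blast
    have "dx (\<lambda>z. Complex (f z) (g z)) = (\<lambda>z. Complex (fx z) (gx z))"
      "dy (\<lambda>z. Complex (f z) (g z)) = (\<lambda>z. Complex (fy z) (gy z))"
      using dx_dy_eqI[OF D] by auto
    then show ?case using dx_dy_eqI(1)[OF D] Suc.IH S by simp
  }
qed

text \<open>A plateau: the inner \<open>flat_power\<close> vanishes on the disc of radius \<open>\<rho>\<close>, where the outer one takes the value by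
  which it is normalized; at distance \<open>sqrt 2 * \<rho>\<close> and beyond, the inner one has reached \<open>exp (-1)\<close> and the outer one vanishes.\<close>

definition bump :: "complex \<Rightarrow> real \<Rightarrow> complex \<Rightarrow> real" where
  "bump a \<rho> z = flat_power 0 (exp (-1) - flat_power 0 (((Re z - Re a)\<^sup>2 + (Im z - Im a)\<^sup>2) * inverse (\<rho>\<^sup>2) - 1))
     * inverse (flat_power 0 (exp (-1)))"

lemma bump_eq: "bump a \<rho> z = flat_power 0 (exp (-1) - flat_power 0 ((cmod (z - a))\<^sup>2 / \<rho>\<^sup>2 - 1)) / flat_power 0 (exp (-1))"
  by (simp add: bump_def cmod_power2 divide_inverse)

lemma smooth_bump: "bump a \<rho> \<in> smooth_real"
  unfolding bump_def[abs_def] power2_eq_square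
  by (intro smooth_real.intros smooth_diff)

lemma flat_power_0_pos: "0 < flat_power 0 (exp (-1))" and flat_power_0_nonneg: "0 \<le> flat_power 0 t"
  and flat_power_0_mono: "s \<le> t \<Longrightarrow> flat_power 0 s \<le> flat_power 0 t"
  by (auto simp: flat_power_def not_le)

lemma bump_range: "0 \<le> bump a \<rho> z" "bump a \<rho> z \<le> 1"
proof -
  show "0 \<le> bump a \<rho> z" unfolding bump_eq using flat_power_0_pos flat_power_0_nonneg by (simp add: divide_nonneg_pos)
  have "flat_power 0 (exp (-1) - flat_power 0 ((cmod (z - a))\<^sup>2 / \<rho>\<^sup>2 - 1)) \<le> flat_power 0 (exp (-1))"
    using flat_power_0_nonneg by (intro flat_power_0_mono) simp
  then show "bump a \<rho> z \<le> 1" unfolding bump_eq using flat_power_0_pos by (simp add: divide_le_eq_1)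
qed

lemma bump_eq_1:
  assumes "0 < \<rho>" "dist a z \<le> \<rho>" shows "bump a \<rho> z = 1"
proof -
  have "(cmod (z - a))\<^sup>2 \<le> \<rho>\<^sup>2" using assms by (intro power_mono) (auto simp: dist_norm norm_minus_commute)
  then have "(cmod (z - a))\<^sup>2 / \<rho>\<^sup>2 - 1 \<le> 0" using assms by (simp add: field_simps)
  then have "flat_power 0 ((cmod (z - a))\<^sup>2 / \<rho>\<^sup>2 - 1) = 0" by (simp add: flat_power_def)
  then show ?thesis unfolding bump_eq using flat_power_0_pos by simp
qed

lemma bump_eq_0:
  assumes "0 < \<rho>" "3/2 * \<rho> \<le> dist a z" shows "bump a \<rho> z = 0"
proof -
  have "(3/2 * \<rho>)\<^sup>2 \<le> (cmod (z - a))\<^sup>2" using assms by (intro power_mono) (auto simp: dist_norm norm_minus_commute)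
  moreover have "(3/2 * \<rho>)\<^sup>2 = 9/4 * \<rho>\<^sup>2" by (simp add: power_mult_distrib power_divide)
  ultimately have "2 * \<rho>\<^sup>2 \<le> (cmod (z - a))\<^sup>2" using zero_le_power2[of \<rho>] by linarith
  then have "1 \<le> (cmod (z - a))\<^sup>2 / \<rho>\<^sup>2 - 1" using assms by (simp add: field_simps)
  then have "flat_power 0 1 \<le> flat_power 0 ((cmod (z - a))\<^sup>2 / \<rho>\<^sup>2 - 1)" by (rule flat_power_0_mono)
  then show ?thesis unfolding bump_eq by (simp add: flat_power_def)
qed

section \<open>The Cauchy-Pompeiu formula\<close>

definition C1_compact :: "(complex \<Rightarrow> complex) set" where
  "C1_compact = {\<psi>. C_diff (Suc 0) \<psi> \<and> bounded {z. \<psi> z \<noteq> 0}}"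

lemma C1_compactD:
  assumes "\<psi> \<in> C1_compact"
  shows "\<psi> differentiable at z" "continuous_on UNIV (dx \<psi>)" "continuous_on UNIV (dy \<psi>)"
    "continuous_on UNIV \<psi>" "continuous_on UNIV (dbar \<psi>)"
proof -
  show d: "\<psi> differentiable at z" for z using assms by (simp add: C1_compact_def)
  show c: "continuous_on UNIV (dx \<psi>)" "continuous_on UNIV (dy \<psi>)" using assms by (simp_all add: C1_compact_def)
  show "continuous_on UNIV \<psi>"
    using d by (intro continuous_at_imp_continuous_on ballI differentiable_imp_continuous_within) auto
  show "continuous_on UNIV (dbar \<psi>)" unfolding dbar_def[abs_def] by (intro continuous_intros c) simp
qed

lemma dx_dy_zero:
  assumes "open S" "z \<in> S" "\<And>w. w \<in> S \<Longrightarrow> f w = 0"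
  shows "f differentiable at z" "dx f z = 0" "dy f z = 0" "dbar f z = 0"
proof -
  have "((\<lambda>_. 0::complex) has_derivative (\<lambda>h. of_real (Re h) * 0 + of_real (Im h) * 0)) (at z)" by simp
  then have "(f has_derivative (\<lambda>h. of_real (Re h) * 0 + of_real (Im h) * 0)) (at z)"
    by (rule has_derivative_transform_within_open[OF _ assms(1,2)]) (simp add: assms(3))
  from dx_dy_eqI[OF this] show "f differentiable at z" "dx f z = 0" "dy f z = 0" "dbar f z = 0" by auto
qed

lemma continuous_bounded_support_bound:
  fixes f :: "complex \<Rightarrow> 'b::real_normed_vector"
  assumes "continuous_on UNIV f" "\<And>z. R < cmod z \<Longrightarrow> f z = 0"
  obtains B where "0 \<le> B" "\<And>z. norm (f z) \<le> B"
proof -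
  have "compact (f ` cball 0 R)"
    by (intro compact_continuous_image continuous_on_subset[OF assms(1)]) auto
  then obtain B where B: "\<And>z. z \<in> cball 0 R \<Longrightarrow> norm (f z) \<le> B"
    by (meson compact_imp_bounded bounded_iff imageI)
  have "norm (f z) \<le> \<bar>B\<bar>" for z
    using B[of z] assms(2)[of z] by (cases "cmod z \<le> R") auto
  then show ?thesis using that[of "\<bar>B\<bar>"] by auto
qed

lemma integrable_bounded_support:
  fixes f :: "complex \<Rightarrow> complex"
  assumes "f \<in> borel_measurable borel" "\<And>z. R < cmod z \<Longrightarrow> f z = 0" "\<And>z. cmod (f z) \<le> B"
  shows "integrable lborel f"
proof (rule integrableI_bounded_set[of "cball 0 R" _ _ B])
  show "emeasure lborel (cball (0::complex) R) < \<infinity>" by (rule emeasure_bounded_finite) simp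
qed (use assms in \<open>auto simp: not_le\<close>)

lemma bounded_support_radius:
  assumes "bounded {z. \<psi> z \<noteq> (0::complex)}"
  obtains R where "0 < R" "\<And>z. R < cmod z \<Longrightarrow> \<psi> z = 0"
proof -
  obtain R where "\<And>z. \<psi> z \<noteq> 0 \<Longrightarrow> cmod z \<le> R" using assms by (auto simp: bounded_iff)
  then show ?thesis by (intro that[of "max R 1"]) force+
qed

text \<open>Fubini reduces this to the fundamental theorem of calculus on lines, on which the function has
  compact support.\<close>

lemma integral_directional_derivative:
  assumes \<psi>: "\<psi> \<in> C1_compact" and v: "v \<in> {1, \<i>}"
  shows "(LINT z|lborel. frechet_derivative \<psi> (at z) v) = 0"
    "integrable lborel (\<lambda>z. frechet_derivative \<psi> (at z) v)"
proof -
  define D where "D z = frechet_derivative \<psi> (at z) v" for z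
  have nv: "norm v = 1" using v by auto
  obtain R where R: "0 < R" "\<And>z. R < cmod z \<Longrightarrow> \<psi> z = 0"
    using \<psi> bounded_support_radius unfolding C1_compact_def by auto
  have "D = (if v = 1 then dx \<psi> else dy \<psi>)" using v by (auto simp: D_def dx_def dy_def)
  then have Dc: "continuous_on UNIV D" using C1_compactD[OF \<psi>] by auto
  have "open {z::complex. R < cmod z}" by (intro open_Collect_less continuous_intros)
  then have D0: "D z = 0" if "R < cmod z" for z
    using dx_dy_zero[of "{z. R < cmod z}" z \<psi>] R that v by (auto simp: D_def dx_def dy_def)
  obtain B where B: "0 \<le> B" "\<And>z. norm (D z) \<le> B"
    using continuous_bounded_support_bound[OF Dc D0] by auto
  have \<psi>c: "continuous_on UNIV \<psi>" by (rule C1_compactD[OF \<psi>])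
  obtain B' where B': "\<And>z. norm (\<psi> z) \<le> B'"
    using continuous_bounded_support_bound[OF \<psi>c, of R] R(2) by metis
  have \<psi>m: "\<psi> \<in> borel_measurable borel" by (rule borel_measurable_continuous_onI[OF \<psi>c])
  have \<psi>i: "integrable lborel \<psi>" by (rule integrable_bounded_support[OF \<psi>m R(2) B'])
  have Dm: "D \<in> borel_measurable borel" by (rule borel_measurable_continuous_onI[OF Dc])
  have Di: "integrable lborel D" by (rule integrable_bounded_support[OF Dm D0 B(2)])
  have has: "(\<psi> has_derivative frechet_derivative \<psi> (at z)) (at z)" for z
    using C1_compactD(1)[OF \<psi>] frechet_derivative_works by blast
  have lin: "frechet_derivative \<psi> (at z) (t *\<^sub>R v) = t *\<^sub>R D z" for z t
    unfolding D_def by (rule linear_scale[OF has_derivative_linear[OF has]])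
  define h where "h n = v /\<^sub>R real (Suc n)" for n
  define q where "q n z = real (Suc n) *\<^sub>R (\<psi> (h n + z) - \<psi> z)" for n z
  have qB: "norm (q n z) \<le> B" for n z
  proof -
    have "((\<lambda>t. \<psi> (z + t *\<^sub>R v)) has_derivative (\<lambda>s. s *\<^sub>R D (z + t *\<^sub>R v))) (at t within UNIV)" for t :: real
    proof -
      have "((\<lambda>t. \<psi> (z + t *\<^sub>R v)) has_derivative (\<lambda>s. frechet_derivative \<psi> (at (z + t *\<^sub>R v)) (s *\<^sub>R v))) (at t)"
        by (rule has_derivative_compose[OF _ has]) (auto intro!: derivative_eq_intros)
      then show ?thesis by (simp add: lin)
    qed
    moreover have "onorm (\<lambda>s::real. s *\<^sub>R D w) \<le> B" for w
    proof (rule onorm_le)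
      show "norm (s *\<^sub>R D w) \<le> B * norm s" for s
        using mult_right_mono[OF B(2)[of w], of "\<bar>s\<bar>"] by (simp add: mult.commute)
    qed
    ultimately have "norm (\<psi> (z + (1 / real (Suc n)) *\<^sub>R v) - \<psi> (z + 0 *\<^sub>R v)) \<le> B * norm (1 / real (Suc n) - 0)"
      by (intro differentiable_bound[of UNIV "\<lambda>t. \<psi> (z + t *\<^sub>R v)" "\<lambda>t s. s *\<^sub>R D (z + t *\<^sub>R v)"]) auto
    then have "norm (\<psi> (h n + z) - \<psi> z) \<le> B / real (Suc n)"
      by (simp add: h_def divide_inverse add.commute)
    then have "norm (\<psi> (h n + z) - \<psi> z) * real (Suc n) \<le> B" by (subst (asm) pos_le_divide_eq) auto
    then show ?thesis unfolding q_def norm_scaleR by (simp add: mult.commute del: of_nat_Suc)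
  qed
  have qlim: "(\<lambda>n. q n z) \<longlonglongrightarrow> D z" for z
  proof -
    have "(\<lambda>w. norm (\<psi> (z + w) - \<psi> z - frechet_derivative \<psi> (at z) w) / norm w) \<midarrow>0\<rightarrow> 0"
      using has[of z] by (simp add: has_derivative_at)
    moreover have "filterlim h (at 0) sequentially"
    proof (rule filterlim_atI)
      have "(\<lambda>n. inverse (real (Suc n)) *\<^sub>R v) \<longlonglongrightarrow> 0 *\<^sub>R v"
        by (intro tendsto_intros LIMSEQ_inverse_real_of_nat)
      then show "h \<longlonglongrightarrow> 0" by (simp add: h_def[abs_def])
      show "\<forall>\<^sub>F n in sequentially. h n \<noteq> 0" using nv by (auto simp: h_def)
    qed
    ultimately have "(\<lambda>n. norm (\<psi> (z + h n) - \<psi> z - frechet_derivative \<psi> (at z) (h n)) / norm (h n)) \<longlonglongrightarrow> 0"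
      by (rule filterlim_compose)
    also have "(\<lambda>n. norm (\<psi> (z + h n) - \<psi> z - frechet_derivative \<psi> (at z) (h n)) / norm (h n)) = (\<lambda>n. norm (q n z - D z))"
    proof
      fix n
      have "q n z - D z = real (Suc n) *\<^sub>R (\<psi> (z + h n) - \<psi> z - frechet_derivative \<psi> (at z) (h n))"
        by (simp add: q_def h_def lin scaleR_diff_right add.commute)
      moreover have "norm (h n) = 1 / real (Suc n)" using nv by (simp add: h_def divide_inverse)
      ultimately show "norm (\<psi> (z + h n) - \<psi> z - frechet_derivative \<psi> (at z) (h n)) / norm (h n) = norm (q n z - D z)"
        by (simp add: mult.commute)
    qed
    finally show ?thesis by (simp add: tendsto_norm_zero_iff LIM_zero_iff)
  qed
  have tr: "(LINT z|lborel. \<psi> (c + z)) = (LINT z|lborel. \<psi> z)" and tri: "integrable lborel (\<lambda>z. \<psi> (c + z))" for c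
    using \<psi>m \<psi>i integral_distr[of "(+) c" lborel borel \<psi>] integrable_distr_eq[of "(+) c" lborel borel \<psi>]
    by (simp_all add: lborel_distr_plus)
  have q0: "(LINT z|lborel. q n z) = 0" for n
    unfolding q_def using tr tri \<psi>i by simp
  have "(\<lambda>n. LINT z|lborel. q n z) \<longlonglongrightarrow> (LINT z|lborel. D z)"
  proof (rule integral_dominated_convergence[where w="\<lambda>z. B * indicator (cball 0 (R + 1)) z"])
    show "integrable lborel (\<lambda>z::complex. B * indicator (cball 0 (R + 1)) z)"
      using emeasure_bounded_finite[of "cball (0::complex) (R + 1)"]
      by (intro integrable_mult_right integrable_real_indicator) auto
    show "AE z in lborel. norm (q n z) \<le> B * indicator (cball 0 (R + 1)) z" for n
    proof (rule AE_I2)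
      fix z
      show "norm (q n z) \<le> B * indicator (cball 0 (R + 1)) z"
      proof (cases "cmod z \<le> R + 1")
        case False
        have "cmod (h n) \<le> 1" using nv by (simp add: h_def inverse_le_1_iff)
        then have "R < cmod (h n + z)" using False norm_triangle_ineq2[of z "- h n"] by (simp add: add.commute)
        then show ?thesis using R(2) False by (simp add: q_def)
      qed (use qB in simp)
    qed
    show "AE z in lborel. (\<lambda>n. q n z) \<longlonglongrightarrow> D z" using qlim by simp
    show "(\<lambda>z. q n z) \<in> borel_measurable lborel" for n
      unfolding q_def using \<psi>m tri[of "h n"] by (intro borel_measurable_scaleR borel_measurable_diff) auto
  qed (use Dm in simp)
  then have "(LINT z|lborel. D z) = 0" by (simp add: q0 LIMSEQ_const_iff)
  then show "(LINT z|lborel. frechet_derivative \<psi> (at z) v) = 0" by (simp add: D_def)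
  show "integrable lborel (\<lambda>z. frechet_derivative \<psi> (at z) v)" using Di by (simp add: D_def[abs_def])
qed

lemma integral_dx_dbar:
  assumes \<psi>: "\<psi> \<in> C1_compact"
  shows "integrable lborel (dx \<psi>)" "(LINT z|lborel. dx \<psi> z) = 0"
    "integrable lborel (dbar \<psi>)" "(LINT z|lborel. dbar \<psi> z) = 0"
  using integral_directional_derivative[OF assms, of 1] integral_directional_derivative[OF assms, of \<i>]
  unfolding dbar_def[abs_def] dx_def[abs_def] dy_def[abs_def] by simp_all

lemma holomorphic_dx_dy:
  assumes "F holomorphic_on S" "open S" "z \<in> S"
  shows "F differentiable at z" "dx F z = deriv F z" "dy F z = \<i> * deriv F z" "dbar F z = 0"
proof -
  have "(F has_field_derivative deriv F z) (at z)" by (rule holomorphic_derivI[OF assms])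
  then have "(F has_derivative (\<lambda>h. of_real (Re h) * deriv F z + of_real (Im h) * (\<i> * deriv F z))) (at z)"
    unfolding has_field_derivative_def
    by (rule has_derivative_eq_rhs) (auto simp: fun_eq_iff complex_eq_iff algebra_simps)
  from dx_dy_eqI[OF this] show "F differentiable at z" "dx F z = deriv F z" "dy F z = \<i> * deriv F z" "dbar F z = 0"
    by auto
qed

text \<open>Lets a holomorphic function be multiplied by a cut-off that vanishes near the frontier of its domain. As
  the factor \<open>F\<close> is annihilated by \<open>dbar\<close>, only the cut-off is differentiated.\<close>

lemma C_diff_glue_holomorphic:
  fixes F P :: "complex \<Rightarrow> complex"
  assumes F: "F holomorphic_on S" "open S" and P: "C_diff (Suc 0) P"
    and van: "\<And>z. z \<notin> S \<Longrightarrow> \<exists>e>0. \<forall>w\<in>ball z e \<inter> S. P w = 0"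
  defines "\<Psi> \<equiv> \<lambda>z. if z \<in> S then F z * P z else 0"
  shows "C_diff (Suc 0) \<Psi>"
    "\<And>z. dx \<Psi> z = (if z \<in> S then F z * dx P z + deriv F z * P z else 0)"
    "\<And>z. dbar \<Psi> z = (if z \<in> S then F z * dbar P z else 0)"
proof -
  have Pd: "P differentiable at z" for z using P by simp
  have inS: "\<Psi> differentiable at z" "dx \<Psi> z = F z * dx P z + deriv F z * P z"
    "dy \<Psi> z = F z * dy P z + \<i> * deriv F z * P z" "dbar \<Psi> z = F z * dbar P z" if z: "z \<in> S" for z
  proof -
    note m = dbar_mult[OF holomorphic_dx_dy(1)[OF F z] Pd] and h = holomorphic_dx_dy[OF F z]
    have "((\<lambda>z. F z * P z) has_derivative (\<lambda>h. of_real (Re h) * dx (\<lambda>z. F z * P z) z + of_real (Im h) * dy (\<lambda>z. F z * P z) z)) (at z)"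
      by (rule has_derivative_dx_dy[OF m(1)])
    then have "(\<Psi> has_derivative (\<lambda>h. of_real (Re h) * dx (\<lambda>z. F z * P z) z + of_real (Im h) * dy (\<lambda>z. F z * P z) z)) (at z)"
      by (rule has_derivative_transform_within_open[OF _ F(2) z]) (simp add: \<Psi>_def)
    from dx_dy_eqI[OF this] m h show "\<Psi> differentiable at z" "dx \<Psi> z = F z * dx P z + deriv F z * P z"
      "dy \<Psi> z = F z * dy P z + \<i> * deriv F z * P z" "dbar \<Psi> z = F z * dbar P z"
      by (auto simp: dbar_def algebra_simps)
  qed
  have loc: "\<exists>e>0. \<forall>w\<in>ball z e. \<Psi> w = 0" if z: "z \<notin> S" for z
    using van[OF z] unfolding \<Psi>_def by force
  have outS: "\<Psi> differentiable at z" "dx \<Psi> z = 0" "dy \<Psi> z = 0" "dbar \<Psi> z = 0" if z: "z \<notin> S" for z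
    using loc[OF z] dx_dy_zero[of "ball z _" z \<Psi>] by auto
  have cont: "continuous_on UNIV (d \<Psi>)"
    if d: "\<And>z. z \<in> S \<Longrightarrow> d \<Psi> z = F z * d P z + c * deriv F z * P z" "d = dx \<or> d = dy" for c d
  proof (rule continuous_at_imp_continuous_on, rule ballI)
    fix z
    show "isCont (d \<Psi>) z"
    proof (cases "z \<in> S")
      case True
      have "continuous_on S F" "continuous_on S (deriv F)"
        using F holomorphic_on_imp_continuous_on holomorphic_deriv by blast+
      moreover have "continuous_on S (d P)" using P d(2) by (auto intro: continuous_on_subset)
      moreover have "continuous_on S P"
        using Pd by (intro continuous_at_imp_continuous_on ballI differentiable_imp_continuous_within) auto
      ultimately have "continuous_on S (\<lambda>z. F z * d P z + c * deriv F z * P z)" by (intro continuous_intros)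
      then have "continuous_on S (d \<Psi>)" by (rule continuous_on_eq) (simp add: d)
      then show ?thesis using F(2) True continuous_on_eq_continuous_at by blast
    next
      case False
      then obtain e where e: "e > 0" "\<And>w. w \<in> ball z e \<Longrightarrow> \<Psi> w = 0" using loc by blast
      have "d \<Psi> w = 0" if "w \<in> ball z e" for w using dx_dy_zero[of "ball z e" w \<Psi>] e that d(2) by auto
      then have "continuous_on (ball z e) (d \<Psi>)" by (metis (no_types, lifting) continuous_on_const continuous_on_eq)
      then show ?thesis using e(1) continuous_on_eq_continuous_at[OF open_ball] centre_in_ball by blast
    qed
  qed
  have "continuous_on UNIV (dx \<Psi>)" using cont[of dx 1] inS by auto
  moreover have "continuous_on UNIV (dy \<Psi>)" using cont[of dy \<i>] inS by auto
  moreover have "\<Psi> differentiable at z" for z using inS outS by blast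
  ultimately show "C_diff (Suc 0) \<Psi>" by simp
  show "dx \<Psi> z = (if z \<in> S then F z * dx P z + deriv F z * P z else 0)" for z using inS outS by auto
  show "dbar \<Psi> z = (if z \<in> S then F z * dbar P z else 0)" for z using inS outS by auto
qed

text \<open>A smooth substitute for the Cauchy kernel \<open>1 / (\<zeta> - z)\<close>, which is its limit as \<open>\<epsilon>\<close> tends to 0. Its \<open>dbar\<close>
  derivative is an approximate identity at \<open>z\<close>, so that no discs have to be removed around the
  singularity.\<close>

definition regular_kernel :: "real \<Rightarrow> complex \<Rightarrow> complex \<Rightarrow> complex" where
  "regular_kernel \<epsilon> z \<zeta> = cnj (\<zeta> - z) / of_real ((cmod (\<zeta> - z))\<^sup>2 + \<epsilon>\<^sup>2)"

lemma regular_kernel_Complex: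
  "regular_kernel \<epsilon> z = (\<lambda>\<zeta>. Complex ((Re \<zeta> - Re z) * inverse ((Re \<zeta> - Re z)\<^sup>2 + (Im \<zeta> - Im z)\<^sup>2 + \<epsilon>\<^sup>2))
     ((Im z - Im \<zeta>) * inverse ((Re \<zeta> - Re z)\<^sup>2 + (Im \<zeta> - Im z)\<^sup>2 + \<epsilon>\<^sup>2)))"
  by (simp only: fun_eq_iff regular_kernel_def complex_eq_iff Re_divide_of_real Im_divide_of_real complex.sel)
     (simp add: cmod_power2 divide_inverse)

lemma smooth_regular_kernel:
  assumes "0 < \<epsilon>"
  shows "(\<lambda>\<zeta>. (Re \<zeta> - Re z) * inverse ((Re \<zeta> - Re z)\<^sup>2 + (Im \<zeta> - Im z)\<^sup>2 + \<epsilon>\<^sup>2)) \<in> smooth_real"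
    "(\<lambda>\<zeta>. (Im z - Im \<zeta>) * inverse ((Re \<zeta> - Re z)\<^sup>2 + (Im \<zeta> - Im z)\<^sup>2 + \<epsilon>\<^sup>2)) \<in> smooth_real"
proof -
  have inv: "(\<lambda>\<zeta>. inverse ((Re \<zeta> - Re z)\<^sup>2 + (Im \<zeta> - Im z)\<^sup>2 + \<epsilon>\<^sup>2)) \<in> smooth_real"
  proof (rule smooth_inverse)
    show "(\<lambda>\<zeta>. (Re \<zeta> - Re z)\<^sup>2 + (Im \<zeta> - Im z)\<^sup>2 + \<epsilon>\<^sup>2) \<in> smooth_real"
      unfolding power2_eq_square by (intro smooth_real.intros smooth_diff)
    show "(Re \<zeta> - Re z)\<^sup>2 + (Im \<zeta> - Im z)\<^sup>2 + \<epsilon>\<^sup>2 \<noteq> 0" for \<zeta>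
      using assms by (smt (verit) zero_le_power2 zero_less_power)
  qed
  show "(\<lambda>\<zeta>. (Re \<zeta> - Re z) * inverse ((Re \<zeta> - Re z)\<^sup>2 + (Im \<zeta> - Im z)\<^sup>2 + \<epsilon>\<^sup>2)) \<in> smooth_real"
    by (rule smooth_mult[OF smooth_diff[OF smooth_Re smooth_const] inv])
  show "(\<lambda>\<zeta>. (Im z - Im \<zeta>) * inverse ((Re \<zeta> - Re z)\<^sup>2 + (Im \<zeta> - Im z)\<^sup>2 + \<epsilon>\<^sup>2)) \<in> smooth_real"
    by (rule smooth_mult[OF smooth_diff[OF smooth_const smooth_Im] inv])
qed

lemma dbar_regular_kernel:
  assumes "0 < \<epsilon>"
  shows "regular_kernel \<epsilon> z differentiable at \<zeta>"
    "dbar (regular_kernel \<epsilon> z) \<zeta> = of_real (\<epsilon>\<^sup>2 / ((cmod (\<zeta> - z))\<^sup>2 + \<epsilon>\<^sup>2)\<^sup>2)"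
proof -
  let ?w = "\<zeta> - z"
  define N where "N = ?w * cnj ?w + of_real (\<epsilon>\<^sup>2)"
  have N: "N = of_real ((cmod ?w)\<^sup>2 + \<epsilon>\<^sup>2)" unfolding N_def by (simp only: complex_norm_square[symmetric] of_real_add)
  have "(cmod ?w)\<^sup>2 + \<epsilon>\<^sup>2 \<noteq> 0" using assms by (smt (verit) zero_le_power2 zero_less_power)
  then have N0: "N \<noteq> 0" using N by (metis of_real_eq_0_iff)
  have k: "regular_kernel \<epsilon> z = (\<lambda>\<zeta>. cnj (\<zeta> - z) / ((\<zeta> - z) * cnj (\<zeta> - z) + of_real (\<epsilon>\<^sup>2)))"
    by (simp only: fun_eq_iff regular_kernel_def complex_norm_square[symmetric] of_real_add simp_thms)
  have d1: "((\<lambda>\<zeta>. cnj (\<zeta> - z)) has_derivative cnj) (at \<zeta>)"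
    by (intro has_derivative_eq_rhs[OF bounded_linear.has_derivative[OF bounded_linear_cnj has_derivative_diff[OF has_derivative_ident has_derivative_const]]])
       auto
  have d2: "((\<lambda>\<zeta>. (\<zeta> - z) * cnj (\<zeta> - z) + of_real (\<epsilon>\<^sup>2)) has_derivative (\<lambda>h. ?w * cnj h + h * cnj ?w)) (at \<zeta>)"
    by (rule has_derivative_eq_rhs, (rule derivative_intros d1)+) auto
  have "(regular_kernel \<epsilon> z has_derivative
     (\<lambda>h. (cnj h * N - cnj ?w * (?w * cnj h + h * cnj ?w)) / N\<^sup>2)) (at \<zeta>)"
    unfolding k by (rule has_derivative_eq_rhs[OF has_derivative_divide'[OF d1 d2]]) (use N0 in \<open>auto simp: N_def power2_eq_square\<close>)
  then have "(regular_kernel \<epsilon> z has_derivative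
     (\<lambda>h. of_real (Re h) * ((of_real (\<epsilon>\<^sup>2) - cnj ?w * cnj ?w) / N\<^sup>2)
        + of_real (Im h) * (- \<i> * (of_real (\<epsilon>\<^sup>2) + cnj ?w * cnj ?w) / N\<^sup>2))) (at \<zeta>)"
  proof (rule has_derivative_eq_rhs, intro ext)
    fix h
    have "cnj h * N - cnj ?w * (?w * cnj h + h * cnj ?w) = cnj h * of_real (\<epsilon>\<^sup>2) - h * (cnj ?w * cnj ?w)"
      by (simp add: N_def algebra_simps)
    also have "cnj h * of_real E - h * Q = of_real (Re h) * (of_real E - Q) + of_real (Im h) * (- \<i> * (of_real E + Q))"
      for E Q by (simp add: complex_eq_iff algebra_simps)
    finally show "(cnj h * N - cnj ?w * (?w * cnj h + h * cnj ?w)) / N\<^sup>2 =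
      of_real (Re h) * ((of_real (\<epsilon>\<^sup>2) - cnj ?w * cnj ?w) / N\<^sup>2)
        + of_real (Im h) * (- \<i> * (of_real (\<epsilon>\<^sup>2) + cnj ?w * cnj ?w) / N\<^sup>2)"
      by (simp only: add_divide_distrib times_divide_eq_right)
  qed
  note * = dx_dy_eqI[OF this]
  show "regular_kernel \<epsilon> z differentiable at \<zeta>" by (rule *)
  have "dbar (regular_kernel \<epsilon> z) \<zeta> = of_real (\<epsilon>\<^sup>2) / N\<^sup>2"
    unfolding *(4) by (simp add: field_simps N0)
  then show "dbar (regular_kernel \<epsilon> z) \<zeta> = of_real (\<epsilon>\<^sup>2 / ((cmod (\<zeta> - z))\<^sup>2 + \<epsilon>\<^sup>2)\<^sup>2)"
    unfolding N by simp
qed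

lemma lborel_integral_affine:
  fixes f :: "complex \<Rightarrow> complex"
  assumes [measurable]: "f \<in> borel_measurable borel" and c: "c \<noteq> 0"
  shows "(LINT x|lborel. f x) = c\<^sup>2 *\<^sub>R (LINT x|lborel. f (t + c *\<^sub>R x))"
proof -
  have "(LINT x|lborel. f x) = (LINT x|density (distr lborel borel (\<lambda>x. t + c *\<^sub>R x)) (\<lambda>_. ennreal (\<bar>c\<bar> ^ 2)). f x)"
    using lborel_affine[of c t] c by simp
  also have "\<dots> = c\<^sup>2 *\<^sub>R (LINT x|lborel. f (t + c *\<^sub>R x))"
    by (subst integral_density) (auto simp: integral_distr)
  finally show ?thesis .
qed

text \<open>The limit \<open>\<epsilon> \<rightarrow> 0\<close>: the first integral is rescaled and tends to \<open>U z\<close> times \<open>cauchy_mass\<close> by continuity of \<open>U\<close>, the second one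
  tends to the Cauchy integral of \<open>V\<close> by dominated convergence.\<close>

lemma cauchy_transform_eqI_regularized:
  assumes U: "continuous_on UNIV U" "\<And>z. R < cmod z \<Longrightarrow> U z = 0"
    and Z: "Z \<in> sets borel" "bounded Z" and V: "V \<in> density_on Z M"
    and eq: "\<And>\<epsilon>. 0 < \<epsilon> \<Longrightarrow> (LINT \<zeta>|lborel. U \<zeta> * of_real (\<epsilon>\<^sup>2 / ((cmod (\<zeta> - z))\<^sup>2 + \<epsilon>\<^sup>2)\<^sup>2))
        + (LINT \<zeta>|lborel. V \<zeta> * regular_kernel \<epsilon> z \<zeta>) = 0"
  shows "U z = cauchy_transform V z"
proof -
  let ?C = "complex_of_real cauchy_mass"
  define e where "e n = inverse (real (Suc n))" for n
  have e: "0 < e n" for n by (simp add: e_def)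
  have e0: "e \<longlonglongrightarrow> 0" unfolding e_def by (rule LIMSEQ_inverse_real_of_nat)
  have Um [measurable]: "U \<in> borel_measurable borel" by (rule borel_measurable_continuous_onI[OF U(1)])
  note [measurable] = density_on_measurable[OF V]
  obtain B where B: "0 \<le> B" "\<And>z. norm (U z) \<le> B"
    using continuous_bounded_support_bound[OF U(1), of R] U(2) by metis
  have k_m [measurable]: "regular_kernel \<epsilon> z \<in> borel_measurable borel" for \<epsilon>
  proof -
    have [measurable]: "cnj \<in> borel_measurable borel" by (intro borel_measurable_continuous_onI continuous_intros)
    show ?thesis unfolding regular_kernel_def[abs_def] by measurable
  qed
  have first: "(\<lambda>n. LINT \<zeta>|lborel. U \<zeta> * of_real ((e n)\<^sup>2 / ((cmod (\<zeta> - z))\<^sup>2 + (e n)\<^sup>2)\<^sup>2)) \<longlonglongrightarrow> U z * ?C"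
  proof -
    have scaled: "(LINT \<zeta>|lborel. U \<zeta> * of_real (\<epsilon>\<^sup>2 / ((cmod (\<zeta> - z))\<^sup>2 + \<epsilon>\<^sup>2)\<^sup>2))
      = (LINT \<eta>|lborel. U (z + \<epsilon> *\<^sub>R \<eta>) * of_real (1 / (1 + (cmod \<eta>)\<^sup>2)\<^sup>2))" if "0 < \<epsilon>" for \<epsilon>
    proof -
      have "(LINT \<zeta>|lborel. U \<zeta> * of_real (\<epsilon>\<^sup>2 / ((cmod (\<zeta> - z))\<^sup>2 + \<epsilon>\<^sup>2)\<^sup>2))
        = (LINT \<eta>|lborel. \<epsilon>\<^sup>2 *\<^sub>R (U (z + \<epsilon> *\<^sub>R \<eta>) * of_real (\<epsilon>\<^sup>2 / ((cmod (\<epsilon> *\<^sub>R \<eta>))\<^sup>2 + \<epsilon>\<^sup>2)\<^sup>2)))"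
        using that by (subst lborel_integral_affine[of _ \<epsilon> z]) (auto simp del: integral_scaleR_right simp flip: integral_scaleR_right)
      also have "\<dots> = (LINT \<eta>|lborel. U (z + \<epsilon> *\<^sub>R \<eta>) * of_real (1 / (1 + (cmod \<eta>)\<^sup>2)\<^sup>2))"
      proof (rule Bochner_Integration.integral_cong[OF refl])
        fix \<eta> :: complex
        have "(cmod (\<epsilon> *\<^sub>R \<eta>))\<^sup>2 + \<epsilon>\<^sup>2 = \<epsilon>\<^sup>2 * (1 + (cmod \<eta>)\<^sup>2)"
          by (simp add: power_mult_distrib algebra_simps)
        then have c: "\<epsilon>\<^sup>2 * (\<epsilon>\<^sup>2 / ((cmod (\<epsilon> *\<^sub>R \<eta>))\<^sup>2 + \<epsilon>\<^sup>2)\<^sup>2) = 1 / (1 + (cmod \<eta>)\<^sup>2)\<^sup>2"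
          using that by (simp add: power_mult_distrib power2_eq_square)
        have gen: "a *\<^sub>R (u * of_real t) = u * of_real (a * t)" for a t :: real and u :: complex
          by (simp add: scaleR_conv_of_real)
        show "\<epsilon>\<^sup>2 *\<^sub>R (U (z + \<epsilon> *\<^sub>R \<eta>) * of_real (\<epsilon>\<^sup>2 / ((cmod (\<epsilon> *\<^sub>R \<eta>))\<^sup>2 + \<epsilon>\<^sup>2)\<^sup>2))
          = U (z + \<epsilon> *\<^sub>R \<eta>) * of_real (1 / (1 + (cmod \<eta>)\<^sup>2)\<^sup>2)"
          by (simp only: gen c)
      qed
      finally show ?thesis .
    qed
    have "(\<lambda>n. LINT \<eta>|lborel. U (z + e n *\<^sub>R \<eta>) * of_real (1 / (1 + (cmod \<eta>)\<^sup>2)\<^sup>2))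
      \<longlonglongrightarrow> (LINT \<eta>|lborel. U z * of_real (1 / (1 + (cmod \<eta>)\<^sup>2)\<^sup>2))"
    proof (rule integral_dominated_convergence[where w="\<lambda>\<eta>. B * (1 / (1 + (cmod \<eta>)\<^sup>2)\<^sup>2)"])
      show "integrable lborel (\<lambda>\<eta>::complex. B * (1 / (1 + (cmod \<eta>)\<^sup>2)\<^sup>2))"
        by (intro integrable_mult_right cauchy_mass_integrable)
      show "AE \<eta> in lborel. (\<lambda>n. U (z + e n *\<^sub>R \<eta>) * of_real (1 / (1 + (cmod \<eta>)\<^sup>2)\<^sup>2))
          \<longlonglongrightarrow> U z * of_real (1 / (1 + (cmod \<eta>)\<^sup>2)\<^sup>2)"
      proof (intro AE_I2 tendsto_mult tendsto_const)
        fix \<eta>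
        have "(\<lambda>n. z + e n *\<^sub>R \<eta>) \<longlonglongrightarrow> z + 0 *\<^sub>R \<eta>" by (intro tendsto_intros e0)
        then have a: "(\<lambda>n. z + e n *\<^sub>R \<eta>) \<longlonglongrightarrow> z" by simp
        have "isCont U z" using U(1) continuous_on_eq_continuous_at[OF open_UNIV] by auto
        then show "(\<lambda>n. U (z + e n *\<^sub>R \<eta>)) \<longlonglongrightarrow> U z" by (rule isCont_tendsto_compose[OF _ a])
      qed
      show "AE \<eta> in lborel. norm (U (z + e n *\<^sub>R \<eta>) * of_real (1 / (1 + (cmod \<eta>)\<^sup>2)\<^sup>2)) \<le> B * (1 / (1 + (cmod \<eta>)\<^sup>2)\<^sup>2)" for n
        using B by (intro AE_I2) (simp only: norm_mult norm_of_real, intro mult_mono, auto)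
    qed measurable
    moreover have "(LINT \<eta>|lborel. U z * of_real (1 / (1 + (cmod \<eta>)\<^sup>2)\<^sup>2)) = U z * ?C"
      by (simp only: integral_mult_right_zero integral_complex_of_real cauchy_mass_def)
    ultimately show ?thesis by (simp only: scaled[OF e])
  qed
  have second: "(\<lambda>n. LINT \<zeta>|lborel. V \<zeta> * regular_kernel (e n) z \<zeta>) \<longlonglongrightarrow> (LINT \<zeta>|lborel. - (V \<zeta> / (z - \<zeta>)))"
  proof (rule integral_dominated_convergence[where w="\<lambda>\<zeta>. norm (V \<zeta> / (z - \<zeta>))"])
    show "integrable lborel (\<lambda>\<zeta>. norm (V \<zeta> / (z - \<zeta>)))"
      by (intro integrable_norm cauchy_integrable[OF Z V])
    show "AE \<zeta> in lborel. (\<lambda>n. V \<zeta> * regular_kernel (e n) z \<zeta>) \<longlonglongrightarrow> - (V \<zeta> / (z - \<zeta>))"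
    proof (rule AE_mp[OF AE_lborel_singleton[of z]], rule AE_I2, rule impI)
      fix \<zeta> :: complex assume "\<zeta> \<noteq> z"
      then have nz: "\<zeta> - z \<noteq> 0" by simp
      have "(\<lambda>n. V \<zeta> * (cnj (\<zeta> - z) / of_real ((cmod (\<zeta> - z))\<^sup>2 + (e n)\<^sup>2)))
        \<longlonglongrightarrow> V \<zeta> * (cnj (\<zeta> - z) / of_real ((cmod (\<zeta> - z))\<^sup>2 + 0\<^sup>2))"
        using nz by (intro tendsto_intros e0) auto
      also have "V \<zeta> * (cnj (\<zeta> - z) / of_real ((cmod (\<zeta> - z))\<^sup>2 + 0\<^sup>2)) = V \<zeta> * (cnj (\<zeta> - z) / ((\<zeta> - z) * cnj (\<zeta> - z)))"
        by (simp only: complex_norm_square[symmetric]) simp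
      also have "\<dots> = - (V \<zeta> / (z - \<zeta>))"
      proof -
        have "v * (cnj w / (w * cnj w)) = - (v / (- w))" if "w \<noteq> 0" for v w :: complex
          using that by simp
        from this[OF nz, of "V \<zeta>"] show ?thesis by (simp only: minus_diff_eq)
      qed
      finally show "(\<lambda>n. V \<zeta> * regular_kernel (e n) z \<zeta>) \<longlonglongrightarrow> - (V \<zeta> / (z - \<zeta>))"
        by (simp only: regular_kernel_def)
    qed
    show "AE \<zeta> in lborel. norm (V \<zeta> * regular_kernel (e n) z \<zeta>) \<le> norm (V \<zeta> / (z - \<zeta>))" for n
    proof (rule AE_mp[OF AE_lborel_singleton[of z]], rule AE_I2, rule impI)
      fix \<zeta> :: complex assume "\<zeta> \<noteq> z"
      then have p: "0 < cmod (\<zeta> - z)" by simp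
      have "norm (regular_kernel (e n) z \<zeta>) = cmod (\<zeta> - z) / ((cmod (\<zeta> - z))\<^sup>2 + (e n)\<^sup>2)"
        unfolding regular_kernel_def norm_divide complex_mod_cnj norm_of_real by simp
      also have "\<dots> \<le> cmod (\<zeta> - z) / (cmod (\<zeta> - z))\<^sup>2"
        using p by (intro frac_le) auto
      also have "\<dots> = 1 / cmod (z - \<zeta>)" using p by (simp add: power2_eq_square norm_minus_commute)
      finally have "norm (regular_kernel (e n) z \<zeta>) \<le> 1 / cmod (z - \<zeta>)" .
      from mult_left_mono[OF this norm_ge_zero[of "V \<zeta>"]]
      show "norm (V \<zeta> * regular_kernel (e n) z \<zeta>) \<le> norm (V \<zeta> / (z - \<zeta>))"
        by (simp add: norm_mult norm_divide)
    qed
  qed measurable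
  have "(\<lambda>n. 0) \<longlonglongrightarrow> U z * ?C + (LINT \<zeta>|lborel. - (V \<zeta> / (z - \<zeta>)))"
    using tendsto_add[OF first second] by (simp only: eq[OF e])
  then have "U z * ?C + (LINT \<zeta>|lborel. - (V \<zeta> / (z - \<zeta>))) = 0" by (simp only: LIMSEQ_const_iff)
  then have "U z * ?C = (LINT \<zeta>|lborel. V \<zeta> / (z - \<zeta>))" by simp
  then show ?thesis using cauchy_mass_pos by (simp add: cauchy_transform_def field_simps)
qed

lemma regular_kernel_C_diff: "0 < \<epsilon> \<Longrightarrow> C_diff k (regular_kernel \<epsilon> z)"
  unfolding regular_kernel_Complex by (intro C_diff_smooth smooth_regular_kernel)

lemma C1_compact_mult:
  assumes f: "f \<in> C1_compact" and g: "C_diff (Suc 0) g"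
  shows "(\<lambda>z. f z * g z) \<in> C1_compact"
proof -
  have d: "f differentiable at z" "g differentiable at z" for z using C1_compactD(1)[OF f] g by auto
  have gc: "continuous_on UNIV g"
    using d by (intro continuous_at_imp_continuous_on ballI differentiable_imp_continuous_within) auto
  have "dx (\<lambda>z. f z * g z) = (\<lambda>z. f z * dx g z + dx f z * g z)"
    "dy (\<lambda>z. f z * g z) = (\<lambda>z. f z * dy g z + dy f z * g z)" using dbar_mult[OF d] by auto
  moreover have "continuous_on UNIV (\<lambda>z. f z * dx g z + dx f z * g z)" "continuous_on UNIV (\<lambda>z. f z * dy g z + dy f z * g z)"
    using g by (intro continuous_intros C1_compactD[OF f] gc; simp)+
  ultimately have "C_diff (Suc 0) (\<lambda>z. f z * g z)" using dbar_mult(1)[OF d] by simp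
  moreover have "bounded {z. f z * g z \<noteq> 0}"
    using f unfolding C1_compact_def by (auto elim!: bounded_subset)
  ultimately show ?thesis by (simp add: C1_compact_def)
qed

lemma dbar_density:
  assumes \<psi>: "\<psi> \<in> C1_compact"
  obtains R M where "0 < R" "\<And>z. R < cmod z \<Longrightarrow> \<psi> z = 0" "dbar \<psi> \<in> density_on (cball 0 R) M"
proof -
  obtain R where R: "0 < R" "\<And>z. R < cmod z \<Longrightarrow> \<psi> z = 0"
    using \<psi> bounded_support_radius unfolding C1_compact_def by auto
  have "open {z::complex. R < cmod z}" by (intro open_Collect_less continuous_intros)
  then have z: "dbar \<psi> z = 0" if "R < cmod z" for z
    using dx_dy_zero[of "{z. R < cmod z}" z \<psi>] R that by auto
  obtain B where "\<And>z. norm (dbar \<psi> z) \<le> B"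
    using continuous_bounded_support_bound[OF C1_compactD(5)[OF \<psi>], of R] z by metis
  then show ?thesis
    using R z by (intro that[of R B] density_onI borel_measurable_continuous_onI C1_compactD(5)[OF \<psi>]) (auto simp: not_le)
qed

text \<open>The integral of \<open>dbar (\<psi> * regular_kernel \<epsilon> z)\<close> vanishes for every \<open>\<epsilon>\<close>; its two Leibniz terms are those of
  the regularized identity.\<close>

theorem cauchy_pompeiu:
  assumes \<psi>: "\<psi> \<in> C1_compact"
  shows "\<psi> z = cauchy_transform (dbar \<psi>) z"
proof -
  obtain R M where R: "0 < R" "\<And>z. R < cmod z \<Longrightarrow> \<psi> z = 0" "dbar \<psi> \<in> density_on (cball 0 R) M"
    using dbar_density[OF \<psi>] by blast
  show ?thesis
  proof (rule cauchy_transform_eqI_regularized[OF C1_compactD(4)[OF \<psi>] R(2) _ _ R(3)])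
    fix \<epsilon> :: real assume \<epsilon>: "0 < \<epsilon>"
    let ?k = "regular_kernel \<epsilon> z" and ?d = "\<lambda>\<zeta>. complex_of_real (\<epsilon>\<^sup>2 / ((cmod (\<zeta> - z))\<^sup>2 + \<epsilon>\<^sup>2)\<^sup>2)"
    note dk = dbar_regular_kernel[OF \<epsilon>, of z]
    have kC: "C_diff (Suc 0) ?k" by (rule regular_kernel_C_diff[OF \<epsilon>])
    have k: "continuous_on UNIV ?k"
      using dk(1) by (intro continuous_at_imp_continuous_on ballI differentiable_imp_continuous_within) auto
    have d: "continuous_on UNIV ?d"
    proof -
      have "dbar ?k = ?d" using dk(2) by auto
      moreover have "continuous_on UNIV (dbar ?k)"
        using kC unfolding dbar_def[abs_def] by (intro continuous_intros) auto
      ultimately show ?thesis by simp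
    qed
    have i1: "integrable lborel (\<lambda>\<zeta>. \<psi> \<zeta> * ?d \<zeta>)"
    proof -
      have c: "continuous_on UNIV (\<lambda>\<zeta>. \<psi> \<zeta> * ?d \<zeta>)" by (intro continuous_on_mult C1_compactD(4)[OF \<psi>] d)
      obtain B where B: "\<And>\<zeta>. norm (\<psi> \<zeta> * ?d \<zeta>) \<le> B"
        using continuous_bounded_support_bound[OF c, of R] R(2) mult_zero_left by metis
      show ?thesis using R(2) by (intro integrable_bounded_support[OF borel_measurable_continuous_onI[OF c] _ B, of R]) simp
    qed
    have i2: "integrable lborel (\<lambda>\<zeta>. dbar \<psi> \<zeta> * ?k \<zeta>)"
    proof -
      have c: "continuous_on UNIV (\<lambda>\<zeta>. dbar \<psi> \<zeta> * ?k \<zeta>)" by (intro continuous_on_mult C1_compactD(5)[OF \<psi>] k)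
      have z: "R < cmod \<zeta> \<Longrightarrow> dbar \<psi> \<zeta> * ?k \<zeta> = 0" for \<zeta> using density_on_zero[OF R(3), of \<zeta>] by simp
      obtain B where B: "\<And>\<zeta>. norm (dbar \<psi> \<zeta> * ?k \<zeta>) \<le> B"
        using continuous_bounded_support_bound[OF c, of R] z by metis
      show ?thesis by (rule integrable_bounded_support[OF borel_measurable_continuous_onI[OF c] z B])
    qed
    have "0 = (LINT \<zeta>|lborel. dbar (\<lambda>\<zeta>. \<psi> \<zeta> * ?k \<zeta>) \<zeta>)"
      using integral_dx_dbar(4)[OF C1_compact_mult[OF \<psi> kC]] by simp
    also have "\<dots> = (LINT \<zeta>|lborel. \<psi> \<zeta> * ?d \<zeta> + dbar \<psi> \<zeta> * ?k \<zeta>)"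
      by (simp only: dbar_mult(4)[OF C1_compactD(1)[OF \<psi>] dk(1)] dk(2))
    also have "\<dots> = (LINT \<zeta>|lborel. \<psi> \<zeta> * ?d \<zeta>) + (LINT \<zeta>|lborel. dbar \<psi> \<zeta> * ?k \<zeta>)"
      by (rule Bochner_Integration.integral_add[OF i1 i2])
    finally show "(LINT \<zeta>|lborel. \<psi> \<zeta> * ?d \<zeta>) + (LINT \<zeta>|lborel. dbar \<psi> \<zeta> * ?k \<zeta>) = 0" by simp
  qed auto
qed

text \<open>Cauchy's inequality on a small circle turns the domination of the integrand into domination of its
  difference quotients, and dominated convergence does the rest.\<close>

lemma holomorphic_integral:
  fixes k :: "complex \<Rightarrow> 'a \<Rightarrow> complex"
  assumes U: "open U" and hol: "\<And>\<zeta>. \<zeta> \<in> space M \<Longrightarrow> (\<lambda>z. k z \<zeta>) holomorphic_on U"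
    and meas: "\<And>z. z \<in> U \<Longrightarrow> k z \<in> borel_measurable M"
    and bd: "\<And>z \<zeta>. z \<in> U \<Longrightarrow> \<zeta> \<in> space M \<Longrightarrow> cmod (k z \<zeta>) \<le> g \<zeta>" and g: "integrable M g"
  shows "(\<lambda>z. LINT \<zeta>|M. k z \<zeta>) holomorphic_on U"
proof -
  have "(\<lambda>z. LINT \<zeta>|M. k z \<zeta>) field_differentiable (at z0)" if z0: "z0 \<in> U" for z0
  proof -
    obtain r where r: "0 < r" "cball z0 r \<subseteq> U" using U z0 open_contains_cball by blast
    define d where "d = r / 2"
    have d: "0 < d" using r by (simp add: d_def)
    define k' where "k' \<zeta> = deriv (\<lambda>z. k z \<zeta>) z0" for \<zeta>
    have int: "integrable M (k z)" if "z \<in> U" for z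
      using bd[OF that] by (intro Bochner_Integration.integrable_bound[OF g meas[OF that]] AE_I2) force
    have lip: "cmod (k z \<zeta> - k z0 \<zeta>) \<le> g \<zeta> / d * cmod (z - z0)" if z: "z \<in> ball z0 d" and \<zeta>: "\<zeta> \<in> space M" for z \<zeta>
    proof (rule field_differentiable_bound[of "ball z0 d" "\<lambda>z. k z \<zeta>" "deriv (\<lambda>z. k z \<zeta>)"])
      have inU: "cball w d \<subseteq> U" if "w \<in> ball z0 d" for w
      proof
        fix v assume "v \<in> cball w d"
        then have "dist z0 v \<le> r" using that dist_triangle[of z0 v w] by (simp add: d_def)
        then show "v \<in> U" using r by auto
      qed
      fix w assume w: "w \<in> ball z0 d"
      then have "w \<in> U" using inU[OF w] d by auto
      then show "((\<lambda>z. k z \<zeta>) has_field_derivative deriv (\<lambda>z. k z \<zeta>) w) (at w within ball z0 d)"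
        by (intro DERIV_subset[OF holomorphic_derivI[OF hol[OF \<zeta>] U]]) auto
      have "cmod ((deriv ^^ 1) (\<lambda>z. k z \<zeta>) w) \<le> fact 1 * g \<zeta> / d ^ 1"
      proof (rule Cauchy_inequality[OF _ _ d])
        show "(\<lambda>z. k z \<zeta>) holomorphic_on ball w d" 
          using inU[OF w] by (intro holomorphic_on_subset[OF hol[OF \<zeta>]]) (auto dest: ball_subset_cball[THEN subsetD])
        show "continuous_on (cball w d) (\<lambda>z. k z \<zeta>)"
          by (rule continuous_on_subset[OF holomorphic_on_imp_continuous_on[OF hol[OF \<zeta>]] inU[OF w]])
        show "cmod (k x \<zeta>) \<le> g \<zeta>" if "cmod (w - x) = d" for x
          using that inU[OF w] by (intro bd \<zeta>) (auto simp: dist_norm)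
      qed
      then show "cmod (deriv (\<lambda>z. k z \<zeta>) w) \<le> g \<zeta> / d" by simp
    qed (use z d in auto)
    have zU: "z \<in> U" if "z \<in> ball z0 d" for z using that r by (auto simp: d_def)
    have "((\<lambda>z. ((LINT \<zeta>|M. k z \<zeta>) - (LINT \<zeta>|M. k z0 \<zeta>)) / (z - z0)) \<longlongrightarrow> (LINT \<zeta>|M. k' \<zeta>)) (at z0)"
      unfolding tendsto_at_iff_sequentially comp_def
    proof (intro allI impI)
      fix X :: "nat \<Rightarrow> complex"
      assume X: "\<forall>i. X i \<in> UNIV - {z0}" "X \<longlonglongrightarrow> z0"
      have "\<forall>\<^sub>F n in sequentially. X n \<in> ball z0 d"
        using X(2) d by (intro topological_tendstoD) auto
      then obtain N where N: "\<And>n. N \<le> n \<Longrightarrow> X n \<in> ball z0 d" by (auto simp: eventually_sequentially)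
      define Y where "Y n = X (n + N)" for n
      have Y: "Y n \<in> ball z0 d" "Y n \<noteq> z0" for n using N[of "n + N"] X(1) by (auto simp: Y_def)
      have Yl: "Y \<longlonglongrightarrow> z0" unfolding Y_def by (rule LIMSEQ_ignore_initial_segment[OF X(2)])
      define q where "q n \<zeta> = (k (Y n) \<zeta> - k z0 \<zeta>) / (Y n - z0)" for n \<zeta>
      have ql: "(\<lambda>n. q n \<zeta>) \<longlonglongrightarrow> k' \<zeta>" if "\<zeta> \<in> space M" for \<zeta>
      proof -
        have "((\<lambda>z. k z \<zeta>) has_field_derivative k' \<zeta>) (at z0)"
          unfolding k'_def by (rule holomorphic_derivI[OF hol[OF that] U z0])
        then have "((\<lambda>z. (k z \<zeta> - k z0 \<zeta>) / (z - z0)) \<longlongrightarrow> k' \<zeta>) (at z0)"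
          by (simp add: has_field_derivative_iff)
        then show ?thesis using Y(2) Yl unfolding tendsto_at_iff_sequentially comp_def q_def by auto
      qed
      have qm: "q n \<in> borel_measurable M" for n
        unfolding q_def using meas[OF zU[OF Y(1)]] meas[OF z0] by (intro borel_measurable_divide borel_measurable_diff) auto
      have "(\<lambda>n. LINT \<zeta>|M. q n \<zeta>) \<longlonglongrightarrow> (LINT \<zeta>|M. k' \<zeta>)"
      proof (rule integral_dominated_convergence[where w="\<lambda>\<zeta>. g \<zeta> / d"])
        show "k' \<in> borel_measurable M"
          by (rule borel_measurable_LIMSEQ_metric[OF qm ql])
        show "integrable M (\<lambda>\<zeta>. g \<zeta> / d)" using g by simp
        show "AE \<zeta> in M. (\<lambda>n. q n \<zeta>) \<longlonglongrightarrow> k' \<zeta>" using ql by (intro AE_I2)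
        show "AE \<zeta> in M. norm (q n \<zeta>) \<le> g \<zeta> / d" for n
        proof (rule AE_I2)
          fix \<zeta> assume "\<zeta> \<in> space M"
          then show "norm (q n \<zeta>) \<le> g \<zeta> / d"
            using lip[OF Y(1), of \<zeta> n] Y(2)[of n] by (simp add: q_def norm_divide divide_le_eq)
        qed
      qed (rule qm)
      moreover have "(LINT \<zeta>|M. q n \<zeta>) = ((LINT \<zeta>|M. k (Y n) \<zeta>) - (LINT \<zeta>|M. k z0 \<zeta>)) / (Y n - z0)" for n
        unfolding q_def using int[OF zU[OF Y(1)]] int[OF z0] by simp
      ultimately show "(\<lambda>n. ((LINT \<zeta>|M. k (X n) \<zeta>) - (LINT \<zeta>|M. k z0 \<zeta>)) / (X n - z0)) \<longlonglongrightarrow> (LINT \<zeta>|M. k' \<zeta>)"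
        using LIMSEQ_offset[of "\<lambda>n. ((LINT \<zeta>|M. k (X n) \<zeta>) - (LINT \<zeta>|M. k z0 \<zeta>)) / (X n - z0)" N]
        by (simp add: Y_def)
    qed
    then show ?thesis unfolding field_differentiable_def has_field_derivative_iff by blast
  qed
  then show ?thesis using U by (simp add: holomorphic_on_open field_differentiable_def)
qed

section \<open>Algebra of Cauchy transforms\<close>

lemma cauchy_transform_holomorphic:
  assumes Z: "Z \<in> sets borel" "bounded Z" and f: "f \<in> density_on Z M"
    and U: "open U" and f0: "\<And>\<zeta>. \<zeta> \<in> U \<Longrightarrow> f \<zeta> = 0"
  shows "cauchy_transform f holomorphic_on U"
proof -
  have "\<exists>e>0. ball z e \<subseteq> U \<and> cauchy_transform f holomorphic_on ball z e" if z: "z \<in> U" for z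
  proof -
    obtain r where r: "0 < r" "ball z r \<subseteq> U" using U z open_contains_ball by blast
    define d where "d = r / 2"
    have d: "0 < d" using r by (simp add: d_def)
    have far: "d \<le> dist w \<zeta>" if "w \<in> ball z d" "f \<zeta> \<noteq> 0" for w \<zeta>
    proof (rule ccontr)
      assume "\<not> ?thesis"
      then have "dist z \<zeta> < r" using that(1) dist_triangle[of z \<zeta> w] by (simp add: d_def)
      then show False using r f0 that(2) by auto
    qed
    have "(\<lambda>w. LINT \<zeta>|lborel. f \<zeta> / (w - \<zeta>)) holomorphic_on ball z d"
    proof (rule holomorphic_integral[where g="\<lambda>\<zeta>. cmod (f \<zeta>) / d"])
      show "(\<lambda>w. f \<zeta> / (w - \<zeta>)) holomorphic_on ball z d" for \<zeta>
      proof (cases "f \<zeta> = 0")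
        case False
        then show ?thesis using far[of _ \<zeta>] d by (intro holomorphic_intros) force
      qed simp
      show "(\<lambda>\<zeta>. f \<zeta> / (w - \<zeta>)) \<in> borel_measurable lborel" for w
        using density_on_measurable[OF f] by measurable
      show "cmod (f \<zeta> / (w - \<zeta>)) \<le> cmod (f \<zeta>) / d" if "w \<in> ball z d" for w \<zeta>
        using far[OF that, of \<zeta>] d by (cases "f \<zeta> = 0") (auto simp: norm_divide dist_norm intro!: frac_le)
      show "integrable lborel (\<lambda>\<zeta>. cmod (f \<zeta>) / d)"
        using density_integrable[OF Z f] by auto
    qed simp
    then have "cauchy_transform f holomorphic_on ball z d"
      unfolding cauchy_transform_def[abs_def] using cauchy_mass_pos by (intro holomorphic_intros) auto
    then show ?thesis using d r by (intro exI[of _ d]) (auto simp: d_def)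
  qed
  then show ?thesis
    by (metis U centre_in_ball holomorphic_on_imp_differentiable_at holomorphic_on_open field_differentiable_def open_ball)
qed

lemma cauchy_transform_cong: "(\<And>z. f z = g z) \<Longrightarrow> cauchy_transform f w = cauchy_transform g w"
  by (simp add: cauchy_transform_def)

context
  fixes Z :: "complex set"
  assumes Z: "Z \<in> sets borel" and bZ: "bounded Z"
begin

lemma density_mult_transform:
  assumes f: "f \<in> density_on Z M" and g: "g \<in> density_on Z N"
  shows "(\<lambda>\<zeta>. f \<zeta> * cauchy_transform g \<zeta>) \<in> density_on Z (M * (N * transform_bound Z))"
  using cauchy_transform_bound[OF Z bZ g] density_on_nonneg[OF g] transform_bound_nonneg[OF Z bZ]
  by (intro density_on_mult[OF f cauchy_transform_measurable[OF Z bZ g]]) auto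

lemma exp_transform_measurable:
  assumes \<beta>: "\<beta> \<in> density_on Z M"
  shows "(\<lambda>\<zeta>. exp (cauchy_transform \<beta> \<zeta>)) \<in> borel_measurable borel"
  using cauchy_transform_continuous[OF Z bZ \<beta>]
  by (intro borel_measurable_continuous_onI continuous_intros) (auto intro: continuous_on_subset)

lemma exp_transform_bound:
  assumes \<beta>: "\<beta> \<in> density_on Z M"
  shows "cmod (exp (cauchy_transform \<beta> z)) \<le> exp (M * transform_bound Z)"
    "cmod (exp (- cauchy_transform \<beta> z)) \<le> exp (M * transform_bound Z)"
  using cauchy_transform_bound[OF Z bZ \<beta>, of z] norm_exp[of "cauchy_transform \<beta> z"] norm_exp[of "- cauchy_transform \<beta> z"]
  by (auto intro: order_trans)

lemma density_mult_exp_transform: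
  assumes f: "f \<in> density_on Z N" and \<beta>: "\<beta> \<in> density_on Z M"
  shows "(\<lambda>\<zeta>. f \<zeta> * exp (cauchy_transform \<beta> \<zeta>)) \<in> density_on Z (N * exp (M * transform_bound Z))"
  by (intro density_on_mult[OF f exp_transform_measurable[OF \<beta>]] exp_transform_bound[OF \<beta>]) simp

lemma cauchy_transform_power:
  assumes \<beta>: "\<beta> \<in> density_on Z M"
  shows "(\<lambda>\<zeta>. \<beta> \<zeta> * cauchy_transform \<beta> \<zeta> ^ n) \<in> density_on Z (M * (M * transform_bound Z) ^ n)
     \<and> (\<forall>z. cauchy_transform \<beta> z ^ Suc n = cauchy_transform (\<lambda>\<zeta>. of_nat (Suc n) * (\<beta> \<zeta> * cauchy_transform \<beta> \<zeta> ^ n)) z)"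
proof (induction n)
  case 0
  then show ?case using \<beta> by simp
next
  case (Suc n)
  let ?h = "\<lambda>\<zeta>. of_nat (Suc n) * (\<beta> \<zeta> * cauchy_transform \<beta> \<zeta> ^ n)"
  have h: "?h \<in> density_on Z (cmod (of_nat (Suc n)) * (M * (M * transform_bound Z) ^ n))"
    using Suc by (intro density_on_cmult) auto
  have d: "(\<lambda>\<zeta>. \<beta> \<zeta> * cauchy_transform \<beta> \<zeta> ^ Suc n) \<in> density_on Z (M * (M * transform_bound Z) ^ Suc n)"
    using cauchy_transform_bound[OF Z bZ \<beta>] density_on_nonneg[OF \<beta>] transform_bound_nonneg[OF Z bZ] cauchy_transform_measurable[OF Z bZ \<beta>]
    by (intro density_on_mult[OF \<beta>] borel_measurable_power) (auto simp: norm_power simp del: power_Suc intro: power_mono)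
  have "cauchy_transform \<beta> z ^ Suc (Suc n) =
      cauchy_transform (\<lambda>\<zeta>. of_nat (Suc (Suc n)) * (\<beta> \<zeta> * cauchy_transform \<beta> \<zeta> ^ Suc n)) z" for z
  proof -
    have "cauchy_transform \<beta> z ^ Suc (Suc n) = cauchy_transform \<beta> z * cauchy_transform ?h z"
      using Suc by simp
    also have "\<dots> = cauchy_transform (\<lambda>\<zeta>. \<beta> \<zeta> * cauchy_transform ?h \<zeta> + ?h \<zeta> * cauchy_transform \<beta> \<zeta>) z"
      by (rule cauchy_transform_prod[OF Z bZ \<beta> h])
    also have "\<dots> = cauchy_transform (\<lambda>\<zeta>. of_nat (Suc (Suc n)) * (\<beta> \<zeta> * cauchy_transform \<beta> \<zeta> ^ Suc n)) z"
    proof (rule cauchy_transform_cong)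
      fix \<zeta>
      have "cauchy_transform ?h \<zeta> = cauchy_transform \<beta> \<zeta> ^ Suc n" using Suc by simp
      then show "\<beta> \<zeta> * cauchy_transform ?h \<zeta> + ?h \<zeta> * cauchy_transform \<beta> \<zeta> =
         of_nat (Suc (Suc n)) * (\<beta> \<zeta> * cauchy_transform \<beta> \<zeta> ^ Suc n)"
        by (simp add: algebra_simps)
    qed
    finally show ?thesis .
  qed
  then show ?case using d by blast
qed

text \<open>Sums the power rule over the exponential series. Formally, \<open>dbar\<close> of \<open>exp (T \<beta>)\<close> is \<open>\<beta> * exp (T \<beta>)\<close> and the value at infinity
  is 1.\<close>

lemma exp_cauchy_transform:
  assumes \<beta>: "\<beta> \<in> density_on Z M"
  shows "exp (cauchy_transform \<beta> z) = 1 + cauchy_transform (\<lambda>\<zeta>. \<beta> \<zeta> * exp (cauchy_transform \<beta> \<zeta>)) z"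
proof -
  let ?s = "cauchy_transform \<beta>" and ?A = "M * transform_bound Z"
  define P where "P N \<zeta> = (\<Sum>k<N. ?s \<zeta> ^ k /\<^sub>R fact k)" for N \<zeta>
  have A: "0 \<le> ?A" using density_on_nonneg[OF \<beta>] transform_bound_nonneg[OF Z bZ] by simp
  have Pb: "cmod (P N \<zeta>) \<le> exp ?A" for N \<zeta>
  proof -
    have "cmod (P N \<zeta>) \<le> (\<Sum>k<N. ?A ^ k /\<^sub>R fact k)"
      unfolding P_def using cauchy_transform_bound[OF Z bZ \<beta>, of \<zeta>]
      by (intro sum_norm_le) (auto simp: norm_power intro!: divide_right_mono power_mono mult_left_mono)
    also have "\<dots> \<le> exp ?A"
      unfolding exp_def using A by (intro sum_le_suminf summable_exp_generic) auto
    finally show ?thesis .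
  qed
  have Pm: "P N \<in> borel_measurable borel" for N
    unfolding P_def[abs_def] using cauchy_transform_measurable[OF Z bZ \<beta>]
    by (intro borel_measurable_sum borel_measurable_scaleR borel_measurable_power) auto
  have Pd: "(\<lambda>\<zeta>. \<beta> \<zeta> * P N \<zeta>) \<in> density_on Z (M * exp ?A)" for N
    by (intro density_on_mult[OF \<beta> Pm] Pb) simp
  have sum: "P (Suc N) z = 1 + cauchy_transform (\<lambda>\<zeta>. \<beta> \<zeta> * P N \<zeta>) z" for N
  proof (induction N)
    case 0
    then show ?case by (simp add: P_def cauchy_transform_def)
  next
    case (Suc N)
    let ?c = "of_real (inverse (fact N)) :: complex"
    note pw = cauchy_transform_power[OF \<beta>, of N]
    have t: "?s z ^ Suc N /\<^sub>R fact (Suc N) = cauchy_transform (\<lambda>\<zeta>. ?c * (\<beta> \<zeta> * ?s \<zeta> ^ N)) z"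
    proof -
      have "?s z ^ Suc N = of_nat (Suc N) * cauchy_transform (\<lambda>\<zeta>. \<beta> \<zeta> * ?s \<zeta> ^ N) z"
        using pw by (simp only: cauchy_transform_cmult[OF Z bZ])
      then show ?thesis unfolding cauchy_transform_cmult[OF Z bZ]
        by (simp add: scaleR_conv_of_real field_simps del: power_Suc of_nat_Suc)
    qed
    have cd: "(\<lambda>\<zeta>. ?c * (\<beta> \<zeta> * ?s \<zeta> ^ N)) \<in> density_on Z (cmod ?c * (M * ?A ^ N))"
      using pw by (intro density_on_cmult) auto
    have "P (Suc (Suc N)) z = P (Suc N) z + ?s z ^ Suc N /\<^sub>R fact (Suc N)" unfolding P_def by simp
    also have "\<dots> = 1 + (cauchy_transform (\<lambda>\<zeta>. \<beta> \<zeta> * P N \<zeta>) z + cauchy_transform (\<lambda>\<zeta>. ?c * (\<beta> \<zeta> * ?s \<zeta> ^ N)) z)"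
      unfolding Suc t by simp
    also have "\<dots> = 1 + cauchy_transform (\<lambda>\<zeta>. \<beta> \<zeta> * P N \<zeta> + ?c * (\<beta> \<zeta> * ?s \<zeta> ^ N)) z"
      by (simp only: cauchy_transform_add[OF Z bZ Pd cd])
    also have "(\<lambda>\<zeta>. \<beta> \<zeta> * P N \<zeta> + ?c * (\<beta> \<zeta> * ?s \<zeta> ^ N)) = (\<lambda>\<zeta>. \<beta> \<zeta> * P (Suc N) \<zeta>)"
      by (simp add: P_def fun_eq_iff scaleR_conv_of_real algebra_simps)
    finally show ?case .
  qed
  have lim: "(\<lambda>N. P N \<zeta>) \<longlonglongrightarrow> exp (?s \<zeta>)" for \<zeta>
    using exp_converges[of "?s \<zeta>"] unfolding P_def sums_def .
  have "(\<lambda>N. \<beta> \<zeta> * P N \<zeta>) \<longlonglongrightarrow> \<beta> \<zeta> * exp (?s \<zeta>)" for \<zeta>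
    by (intro tendsto_mult tendsto_const lim)
  from cauchy_transform_tendsto(2)[OF Z bZ Pd this]
  have "(\<lambda>N. 1 + cauchy_transform (\<lambda>\<zeta>. \<beta> \<zeta> * P N \<zeta>) z) \<longlonglongrightarrow> 1 + cauchy_transform (\<lambda>\<zeta>. \<beta> \<zeta> * exp (?s \<zeta>)) z"
    by (intro tendsto_add tendsto_const)
  moreover have "(\<lambda>N. P (Suc N) z) \<longlonglongrightarrow> exp (?s z)" using lim by (rule LIMSEQ_Suc)
  ultimately show ?thesis unfolding sum by (meson LIMSEQ_unique)
qed

text \<open>The product formula applied to \<open>T g\<close> and \<open>exp (T \<beta>) - 1\<close>: the integrated form of
  \<open>dbar (T g * exp (T \<beta>)) = (g + \<beta> * T g) * exp (T \<beta>)\<close>.\<close>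

lemma cauchy_transform_mult_exp:
  assumes g: "g \<in> density_on Z N" and \<beta>: "\<beta> \<in> density_on Z M"
  shows "cauchy_transform g z * exp (cauchy_transform \<beta> z) =
    cauchy_transform (\<lambda>\<zeta>. (g \<zeta> + \<beta> \<zeta> * cauchy_transform g \<zeta>) * exp (cauchy_transform \<beta> \<zeta>)) z"
proof -
  let ?b = "\<lambda>\<zeta>. \<beta> \<zeta> * exp (cauchy_transform \<beta> \<zeta>)"
  have b: "?b \<in> density_on Z (M * exp (M * transform_bound Z))" by (rule density_mult_exp_transform[OF \<beta> \<beta>])
  have "cauchy_transform g z * exp (cauchy_transform \<beta> z) = cauchy_transform g z + cauchy_transform g z * cauchy_transform ?b z"
    by (subst exp_cauchy_transform[OF \<beta>]) (simp add: distrib_left)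
  also have "\<dots> = cauchy_transform g z + cauchy_transform (\<lambda>\<zeta>. g \<zeta> * cauchy_transform ?b \<zeta> + ?b \<zeta> * cauchy_transform g \<zeta>) z"
    by (simp only: cauchy_transform_prod[OF Z bZ g b])
  also have "\<dots> = cauchy_transform (\<lambda>\<zeta>. g \<zeta> + (g \<zeta> * cauchy_transform ?b \<zeta> + ?b \<zeta> * cauchy_transform g \<zeta>)) z"
    by (rule cauchy_transform_add[OF Z bZ g density_on_add[OF density_mult_transform[OF g b] density_mult_transform[OF b g]], symmetric])
  also have "\<dots> = cauchy_transform (\<lambda>\<zeta>. (g \<zeta> + \<beta> \<zeta> * cauchy_transform g \<zeta>) * exp (cauchy_transform \<beta> \<zeta>)) z"
  proof (rule cauchy_transform_cong)
    fix \<zeta>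
    have e: "cauchy_transform ?b \<zeta> = exp (cauchy_transform \<beta> \<zeta>) - 1" using exp_cauchy_transform[OF \<beta>, of \<zeta>] by simp
    show "g \<zeta> + (g \<zeta> * cauchy_transform ?b \<zeta> + ?b \<zeta> * cauchy_transform g \<zeta>) =
        (g \<zeta> + \<beta> \<zeta> * cauchy_transform g \<zeta>) * exp (cauchy_transform \<beta> \<zeta>)"
      unfolding e by (simp add: algebra_simps)
  qed
  finally show ?thesis .
qed

text \<open>At infinity \<open>z * cauchy_transform g z\<close> tends to a multiple of the integral of \<open>g\<close>. This is how identities
  between transforms are converted into the weak formulation.\<close>

lemma cauchy_transform_compact_support:
  assumes g: "g \<in> density_on Z N" and 0: "\<And>z. R < cmod z \<Longrightarrow> cauchy_transform g z = 0"
  shows "(LINT \<zeta>|lborel. g \<zeta>) = 0"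
proof -
  obtain r where r: "\<And>\<zeta>. \<zeta> \<in> Z \<Longrightarrow> cmod \<zeta> \<le> r" using bZ by (auto simp: bounded_iff)
  define x :: "nat \<Rightarrow> real" where "x n = real n + 2 * \<bar>r\<bar> + \<bar>R\<bar> + 1" for n
  have x: "0 < x n" "R < x n" "2 * \<bar>r\<bar> \<le> x n" for n unfolding x_def by linarith+
  have "(\<lambda>n. LINT \<zeta>|lborel. of_real (x n) * (g \<zeta> / (of_real (x n) - \<zeta>))) \<longlonglongrightarrow> (LINT \<zeta>|lborel. g \<zeta>)"
  proof (rule integral_dominated_convergence[where w="\<lambda>\<zeta>. 2 * cmod (g \<zeta>)"])
    show "integrable lborel (\<lambda>\<zeta>. 2 * cmod (g \<zeta>))" using density_integrable[OF Z bZ g] by auto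
    show "AE \<zeta> in lborel. (\<lambda>n. of_real (x n) * (g \<zeta> / (of_real (x n) - \<zeta>))) \<longlonglongrightarrow> g \<zeta>"
    proof (rule AE_I2)
      fix \<zeta>
      have "filterlim x at_top sequentially"
        by (rule filterlim_at_top_mono[OF filterlim_real_sequentially always_eventually]) (simp add: x_def)
      then have "(\<lambda>n. inverse (x n)) \<longlonglongrightarrow> 0" by (rule tendsto_inverse_0_at_top)
      then have "(\<lambda>n. g \<zeta> / (1 - of_real (inverse (x n)) * \<zeta>)) \<longlonglongrightarrow> g \<zeta> / (1 - of_real 0 * \<zeta>)"
        by (intro tendsto_intros) auto
      moreover have "of_real (x n) * (g \<zeta> / (of_real (x n) - \<zeta>)) = g \<zeta> / (1 - of_real (inverse (x n)) * \<zeta>)" for n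
      proof -
        have "of_real (x n) - \<zeta> = of_real (x n) * (1 - of_real (inverse (x n)) * \<zeta>)"
          using x(1)[of n] by (simp add: right_diff_distrib)
        then show ?thesis using x(1)[of n] by simp
      qed
      ultimately show "(\<lambda>n. of_real (x n) * (g \<zeta> / (of_real (x n) - \<zeta>))) \<longlonglongrightarrow> g \<zeta>" by simp
    qed
    show "AE \<zeta> in lborel. norm (of_real (x n) * (g \<zeta> / (of_real (x n) - \<zeta>))) \<le> 2 * cmod (g \<zeta>)" for n
    proof (rule AE_I2)
      fix \<zeta>
      show "norm (of_real (x n) * (g \<zeta> / (of_real (x n) - \<zeta>))) \<le> 2 * cmod (g \<zeta>)"
      proof (cases "\<zeta> \<in> Z")
        case True
        have "x n \<le> 2 * cmod (of_real (x n) - \<zeta>)"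
          using r[OF True] x[of n] norm_triangle_ineq2[of "of_real (x n)" \<zeta>] by simp
        then have "x n * cmod (g \<zeta>) \<le> 2 * cmod (of_real (x n) - \<zeta>) * cmod (g \<zeta>)"
          by (rule mult_right_mono) simp
        moreover have "0 < cmod (of_real (x n) - \<zeta>)" using \<open>x n \<le> _\<close> x(1)[of n] by linarith
        ultimately show ?thesis
          using x(1)[of n] by (simp add: norm_mult norm_divide divide_le_eq mult_ac)
      qed (use density_on_zero[OF g] in simp)
    qed
  qed (use density_on_measurable[OF g] in measurable)
  moreover have "(LINT \<zeta>|lborel. of_real (x n) * (g \<zeta> / (of_real (x n) - \<zeta>))) = 0" for n
  proof -
    have "(LINT \<zeta>|lborel. g \<zeta> / (of_real (x n) - \<zeta>)) = 0"
      using 0[of "of_real (x n)"] x[of n] cauchy_mass_pos by (simp add: cauchy_transform_def)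
    then show ?thesis by (simp only: integral_mult_right_zero mult_zero_right)
  qed
  ultimately show ?thesis by (simp add: LIMSEQ_const_iff)
qed

end

section \<open>Weak solutions and their factorization\<close>

lemma borel_measurable_lebesgue_AE:
  fixes f g :: "complex \<Rightarrow> complex"
  assumes g: "g \<in> borel_measurable borel" and eq: "AE z in lborel. f z = g z"
  shows "f \<in> borel_measurable lebesgue"
proof -
  obtain N where N: "N \<in> null_sets lborel" "{z. f z \<noteq> g z} \<subseteq> N"
    using eq unfolding eventually_ae_filter by auto
  show ?thesis
  proof (rule measurableI)
    fix A :: "complex set" assume A: "A \<in> sets borel"
    have 1: "f -` A \<inter> N \<in> null_sets lebesgue"
      by (rule null_sets_completion_subset[of _ N]) (use N null_sets_completionI in auto)
    have 2: "g -` A - N \<in> sets lebesgue"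
      using measurable_sets_borel[OF g A] N by (intro sets.Diff sets_completionI_sets) auto
    have "f -` A \<inter> space lebesgue = (g -` A - N) \<union> (f -` A \<inter> N)" using N by auto
    then show "f -` A \<inter> space lebesgue \<in> sets lebesgue"
      using sets.Un[OF 2 null_setsD2[OF 1]] by (simp only:)
  qed simp
qed

lemma AE_lebesgue_on:
  assumes "S \<in> sets borel"
  shows "(AE z in lebesgue_on S. P z) \<longleftrightarrow> (AE z in lborel. z \<in> S \<longrightarrow> P z)"
  using assms by (subst AE_restrict_space_iff) (auto simp: AE_completion_iff)

lemma integral_lebesgue_on_AE_eq:
  fixes f g :: "complex \<Rightarrow> complex"
  assumes S: "S \<in> sets borel" and g: "g \<in> borel_measurable borel" and g0: "\<And>z. z \<notin> S \<Longrightarrow> g z = 0"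
    and eq: "AE z in lborel. z \<in> S \<longrightarrow> f z = g z"
  shows "(LINT z|lebesgue_on S. f z) = (LINT z|lborel. g z)"
proof -
  have ae: "AE z in lborel. indicator S z *\<^sub>R f z = g z"
    using eq by eventually_elim (auto simp: g0 indicator_def)
  have "(LINT z|lebesgue_on S. f z) = (LINT z|lebesgue. indicator S z *\<^sub>R f z)"
    using S by (intro integral_restrict_space) auto
  also have "\<dots> = (LINT z|lebesgue. g z)"
    using ae by (intro integral_cong_AE borel_measurable_lebesgue_AE[OF g ae] measurable_completion) (use g in \<open>auto simp: AE_completion\<close>)
  also have "\<dots> = (LINT z|lborel. g z)" using g by (intro integral_completion) auto
  finally show ?thesis .
qed

lemma L_inf_density:
  assumes \<alpha>: "\<alpha> \<in> L_inf S" and S: "S \<in> sets borel"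
  obtains \<alpha>' M where "\<alpha>' \<in> density_on S M" "AE z in lborel. z \<in> S \<longrightarrow> \<alpha> z = \<alpha>' z"
proof -
  obtain M where m: "\<alpha> \<in> borel_measurable (lebesgue_on S)" and M: "AE z in lebesgue_on S. cmod (\<alpha> z) \<le> M"
    using \<alpha> by (auto simp: L_inf_def)
  have m': "(\<lambda>z. indicator S z *\<^sub>R \<alpha> z) \<in> borel_measurable lebesgue"
    using m S by (subst borel_measurable_restrict_space_iff[symmetric]) auto
  have re: "(\<lambda>z. Re (indicator S z *\<^sub>R \<alpha> z)) \<in> borel_measurable lebesgue"
    and im: "(\<lambda>z. Im (indicator S z *\<^sub>R \<alpha> z)) \<in> borel_measurable lebesgue"
    by (rule measurable_compose[OF m' borel_measurable_Re]) (rule measurable_compose[OF m' borel_measurable_Im])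
  obtain a b where ab: "a \<in> borel_measurable lborel" "b \<in> borel_measurable lborel"
    "AE z in lborel. Re (indicator S z *\<^sub>R \<alpha> z) = a z" "AE z in lborel. Im (indicator S z *\<^sub>R \<alpha> z) = b z"
    using completion_ex_borel_measurable_real[OF re] completion_ex_borel_measurable_real[OF im] by blast
  define c where "c z = complex_of_real (a z) + \<i> * complex_of_real (b z)" for z
  have [measurable]: "c \<in> borel_measurable borel" unfolding c_def[abs_def] using ab by measurable
  note [measurable] = S
  define \<alpha>' where "\<alpha>' z = (if z \<in> S \<and> cmod (c z) \<le> \<bar>M\<bar> then c z else 0)" for z
  have "\<alpha>' \<in> density_on S \<bar>M\<bar>"
  proof (rule density_onI)
    show "\<alpha>' \<in> borel_measurable borel" unfolding \<alpha>'_def[abs_def] by measurable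
  qed (auto simp: \<alpha>'_def)
  moreover have "AE z in lborel. z \<in> S \<longrightarrow> \<alpha> z = \<alpha>' z"
    using ab(3,4) M[unfolded AE_lebesgue_on[OF S]]
  proof eventually_elim
    case (elim z)
    then have "z \<in> S \<Longrightarrow> c z = \<alpha> z" unfolding c_def by (auto simp: complex_eq_iff)
    then show ?case using elim by (auto simp: \<alpha>'_def)
  qed
  ultimately show ?thesis using that by blast
qed

lemma density_L_inf:
  assumes S: "S \<in> sets borel" and \<alpha>': "\<alpha>' \<in> density_on S M" and eq: "AE z in lborel. z \<in> S \<longrightarrow> \<alpha> z = \<alpha>' z"
  shows "\<alpha> \<in> L_inf S"
proof -
  have ae: "AE z in lborel. indicator S z *\<^sub>R \<alpha> z = \<alpha>' z"
    using eq by eventually_elim (auto simp: density_on_zero[OF \<alpha>'] indicator_def)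
  have "\<alpha> \<in> borel_measurable (lebesgue_on S)"
    using borel_measurable_lebesgue_AE[OF density_on_measurable[OF \<alpha>'] ae] S
    by (subst borel_measurable_restrict_space_iff) auto
  moreover have "AE z in lebesgue_on S. cmod (\<alpha> z) \<le> M"
    unfolding AE_lebesgue_on[OF S] using eq by eventually_elim (auto simp: density_on_bound[OF \<alpha>'])
  ultimately show ?thesis by (auto simp: L_inf_def)
qed

lemma test_functionsD:
  assumes "\<psi> \<in> test_functions S"
  shows "\<psi> \<in> C1_compact" "compact (closure {z. \<psi> z \<noteq> 0})" "closure {z. \<psi> z \<noteq> 0} \<subseteq> S"
    "z \<notin> closure {z. \<psi> z \<noteq> 0} \<Longrightarrow> \<psi> z = 0" "z \<notin> closure {z. \<psi> z \<noteq> 0} \<Longrightarrow> dbar \<psi> z = 0"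
    "z \<notin> closure {z. \<psi> z \<noteq> 0} \<Longrightarrow> dx \<psi> z = 0"
proof -
  show c: "compact (closure {z. \<psi> z \<noteq> 0})" "closure {z. \<psi> z \<noteq> 0} \<subseteq> S" using assms by (auto simp: test_functions_def)
  have "bounded {z. \<psi> z \<noteq> 0}" using c(1) by (rule bounded_subset[OF compact_imp_bounded closure_subset])
  then show "\<psi> \<in> C1_compact" using assms unfolding C1_compact_def test_functions_def by blast
  have out: "w \<in> - closure {z. \<psi> z \<noteq> 0} \<Longrightarrow> \<psi> w = 0" for w using closure_subset[of "{z. \<psi> z \<noteq> 0}"] by auto
  then show "z \<notin> closure {z. \<psi> z \<noteq> 0} \<Longrightarrow> \<psi> z = 0" by blast
  assume z: "z \<notin> closure {z. \<psi> z \<noteq> 0}"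
  have o: "open (- closure {z. \<psi> z \<noteq> 0})" by (rule open_Compl[OF closed_closure])
  have zin: "z \<in> - closure {z. \<psi> z \<noteq> 0}" using z by blast
  show "dbar \<psi> z = 0" by (rule dx_dy_zero(4)[OF o zin out])
  show "dx \<psi> z = 0" by (rule dx_dy_zero(2)[OF o zin out])
qed

lemma test_function_vanishes_near:
  assumes "\<psi> \<in> test_functions S" "z \<notin> S"
  shows "\<exists>e>0. \<forall>w\<in>ball z e \<inter> S. \<psi> w = 0"
proof -
  have "z \<in> - closure {z. \<psi> z \<noteq> 0}" using test_functionsD(3)[OF assms(1)] assms(2) by blast
  then obtain e where "e > 0" "ball z e \<subseteq> - closure {z. \<psi> z \<noteq> 0}"
    using open_contains_ball[of "- closure {z. \<psi> z \<noteq> 0}"] by auto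
  then show ?thesis using test_functionsD(4)[OF assms(1)] by blast
qed

lemma density_compact_product:
  assumes K: "compact K" "K \<subseteq> S" "open S" and u: "continuous_on S u"
    and \<kappa>: "\<kappa> \<in> density_on K B"
  obtains N where "(\<lambda>z. u z * \<kappa> z) \<in> density_on K N"
proof -
  have "compact (u ` K)" using u K by (intro compact_continuous_image) (auto intro: continuous_on_subset)
  then obtain N where N: "\<And>z. z \<in> K \<Longrightarrow> cmod (u z) \<le> N" by (meson compact_imp_bounded bounded_iff imageI)
  have m: "(\<lambda>z. if z \<in> S then u z else 0) \<in> borel_measurable borel"
    using K u by (intro borel_measurable_continuous_on_if continuous_on_const) auto
  have "(\<lambda>z. \<kappa> z * (if z \<in> S then u z else 0)) \<in> density_on K (B * \<bar>N\<bar>)"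
    using K N by (intro density_on_mult[OF \<kappa> m]) force+
  also have "(\<lambda>z. \<kappa> z * (if z \<in> S then u z else 0)) = (\<lambda>z. u z * \<kappa> z)"
    using density_on_zero[OF \<kappa>] K by (auto simp: fun_eq_iff)
  finally show ?thesis using that by blast
qed

lemma test_density:
  assumes "\<psi> \<in> test_functions S"
  obtains B where "\<psi> \<in> density_on (closure {z. \<psi> z \<noteq> 0}) B" "dbar \<psi> \<in> density_on (closure {z. \<psi> z \<noteq> 0}) B"
    "dx \<psi> \<in> density_on (closure {z. \<psi> z \<noteq> 0}) B"
proof -
  let ?K = "closure {z. \<psi> z \<noteq> 0}"
  note t = test_functionsD[OF assms] and c = C1_compactD[OF test_functionsD(1)[OF assms]]
  have ex: "\<exists>B. f \<in> density_on ?K B" if f: "continuous_on UNIV f" "\<And>z. z \<notin> ?K \<Longrightarrow> f z = 0" for f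
  proof -
    have "compact (f ` ?K)" by (intro compact_continuous_image continuous_on_subset[OF f(1)] t(2)) auto
    then obtain N where N: "\<And>z. z \<in> ?K \<Longrightarrow> cmod (f z) \<le> N" by (meson compact_imp_bounded bounded_iff imageI)
    have "cmod (f z) \<le> \<bar>N\<bar>" for z using N[of z] f(2)[of z] by (cases "z \<in> ?K") auto
    then show ?thesis using f by (intro exI[of _ "\<bar>N\<bar>"] density_onI borel_measurable_continuous_onI)
  qed
  obtain B1 B2 B3 where B: "\<psi> \<in> density_on ?K B1" "dbar \<psi> \<in> density_on ?K B2" "dx \<psi> \<in> density_on ?K B3"
    using ex[OF c(4) t(4)] ex[OF c(5) t(5)] ex[OF c(2) t(6)] by blast
  show ?thesis
    by (rule that[of "max B1 (max B2 B3)"])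
       (rule density_on_mono[OF B(1)] density_on_mono[OF B(2)] density_on_mono[OF B(3)]; simp)+
qed

text \<open>Passes from the almost everywhere defined coefficient and Lebesgue measure on \<open>S\<close> to a Borel density and Lebesgue-Borel measure on the plane.\<close>

lemma solves_dbar_eq_iff:
  assumes S: "open S" and w: "continuous_on S w" and \<alpha>': "\<alpha>' \<in> density_on S M"
    and ae: "AE z in lborel. z \<in> S \<longrightarrow> \<alpha> z * cnj (w z) = f z" and f: "\<And>z. z \<in> S \<Longrightarrow> f z = \<alpha>' z * w' z" "continuous_on S w'"
  shows "solves_dbar_eq S \<alpha> w \<longleftrightarrow> (\<forall>\<psi>\<in>test_functions S. (LINT z|lborel. w z * dbar \<psi> z + \<alpha>' z * w' z * \<psi> z) = 0)"
proof -
  have SB: "S \<in> sets borel" using S by simp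
  have "(LINT z|lebesgue_on S. w z * dbar \<psi> z) = - (LINT z|lebesgue_on S. \<alpha> z * cnj (w z) * \<psi> z)
      \<longleftrightarrow> (LINT z|lborel. w z * dbar \<psi> z + \<alpha>' z * w' z * \<psi> z) = 0" if \<psi>: "\<psi> \<in> test_functions S" for \<psi>
  proof -
    let ?K = "closure {z. \<psi> z \<noteq> 0}"
    note t = test_functionsD[OF \<psi>]
    obtain B where B: "\<psi> \<in> density_on ?K B" "dbar \<psi> \<in> density_on ?K B" using test_density[OF \<psi>] by blast
    obtain N1 where N1: "(\<lambda>z. w z * dbar \<psi> z) \<in> density_on ?K N1" using density_compact_product[OF t(2,3) S w B(2)] .
    obtain N2 where N2: "(\<lambda>z. w' z * \<psi> z) \<in> density_on ?K N2" using density_compact_product[OF t(2,3) S f(2) B(1)] .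
    have N3: "(\<lambda>z. w' z * \<psi> z * \<alpha>' z) \<in> density_on ?K (N2 * M)"
      using density_on_bound[OF \<alpha>'] density_on_nonneg[OF \<alpha>'] by (intro density_on_mult[OF N2 density_on_measurable[OF \<alpha>']]) auto
    have KB: "?K \<in> sets borel" "bounded ?K" using t(2) by (auto intro: compact_imp_bounded)
    have 1: "(LINT z|lebesgue_on S. w z * dbar \<psi> z) = (LINT z|lborel. w z * dbar \<psi> z)"
      using t(3) density_on_zero[OF N1] by (intro integral_lebesgue_on_AE_eq[OF SB density_on_measurable[OF N1]]) auto
    have 2: "(LINT z|lebesgue_on S. \<alpha> z * cnj (w z) * \<psi> z) = (LINT z|lborel. w' z * \<psi> z * \<alpha>' z)"
    proof (rule integral_lebesgue_on_AE_eq[OF SB density_on_measurable[OF N3]])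
      show "w' z * \<psi> z * \<alpha>' z = 0" if "z \<notin> S" for z using density_on_zero[OF \<alpha>' that] by simp
      show "AE z in lborel. z \<in> S \<longrightarrow> \<alpha> z * cnj (w z) * \<psi> z = w' z * \<psi> z * \<alpha>' z"
        using ae by eventually_elim (auto simp: f)
    qed
    have "(LINT z|lborel. w z * dbar \<psi> z + \<alpha>' z * w' z * \<psi> z) = (LINT z|lborel. w z * dbar \<psi> z) + (LINT z|lborel. w' z * \<psi> z * \<alpha>' z)"
      by (subst Bochner_Integration.integral_add[symmetric, OF density_integrable[OF KB N1] density_integrable[OF KB N3]])
         (simp add: mult_ac)
    then show ?thesis unfolding 1 2 by (simp add: add_eq_0_iff2)
  qed
  then show ?thesis unfolding solves_dbar_eq_def by auto
qed

lemma bump_test_function: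
  assumes \<rho>: "0 < \<rho>" and sub: "cball a (2 * \<rho>) \<subseteq> S" and f: "f \<in> smooth_real" and g: "g \<in> smooth_real"
  shows "(\<lambda>z. Complex (bump a \<rho> z * f z) (bump a \<rho> z * g z)) \<in> test_functions S"
proof -
  let ?\<psi> = "\<lambda>z. Complex (bump a \<rho> z * f z) (bump a \<rho> z * g z)"
  have "{z. ?\<psi> z \<noteq> 0} \<subseteq> cball a (2 * \<rho>)"
    using bump_eq_0[OF \<rho>, of a] \<rho> by (force simp: complex_eq_iff not_le)
  then have cl: "closure {z. ?\<psi> z \<noteq> 0} \<subseteq> cball a (2 * \<rho>)" by (rule closure_minimal) simp
  then have "compact (closure {z. ?\<psi> z \<noteq> 0})"
    by (meson bounded_cball bounded_subset closed_closure compact_eq_bounded_closed)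
  moreover have "C_diff k ?\<psi>" for k by (intro C_diff_smooth smooth_mult smooth_bump f g)
  ultimately show ?thesis using cl sub by (auto simp: test_functions_def)
qed

lemma bump_as_test_function:
  assumes "0 < \<rho>" "cball a (2 * \<rho>) \<subseteq> S"
  shows "(\<lambda>z. complex_of_real (bump a \<rho> z)) \<in> test_functions S"
  using bump_test_function[OF assms smooth_const[of 1] smooth_const[of 0]]
  by (simp add: complex_of_real_def)

text \<open>Multiplied by a plateau function, a weak solution becomes the transform of its formal \<open>dbar\<close> derivative.
  Testing the equation with the product of the plateau and the real and imaginary parts of the regularized kernel gives
  the regularized form of this identity.\<close>

lemma localized_representation:
  assumes S: "open S" and w: "continuous_on S w" and \<alpha>': "\<alpha>' \<in> density_on S M"
    and weak: "\<And>\<psi>. \<psi> \<in> test_functions S \<Longrightarrow> (LINT z|lborel. w z * dbar \<psi> z + \<alpha>' z * cnj (w z) * \<psi> z) = 0"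
    and \<rho>: "0 < \<rho>" "cball a (2 * \<rho>) \<subseteq> S"
  defines "\<kappa> \<equiv> \<lambda>z. complex_of_real (bump a \<rho> z)"
  defines "g \<equiv> \<lambda>z. w z * dbar \<kappa> z + \<alpha>' z * cnj (w z) * \<kappa> z"
  shows "\<exists>N. g \<in> density_on (cball a (2 * \<rho>)) N" "w z * \<kappa> z = cauchy_transform g z"
proof -
  let ?K = "closure {z. \<kappa> z \<noteq> 0}" and ?Z = "cball a (2 * \<rho>)"
  have \<kappa>: "\<kappa> \<in> test_functions S" unfolding \<kappa>_def by (rule bump_as_test_function[OF \<rho>])
  note t = test_functionsD[OF \<kappa>]
  have KZ: "?K \<subseteq> ?Z"
    using test_functionsD(3)[OF bump_as_test_function[OF \<rho>(1) order_refl]] unfolding \<kappa>_def .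
  obtain B where B: "\<kappa> \<in> density_on ?K B" "dbar \<kappa> \<in> density_on ?K B" using test_density[OF \<kappa>] by blast
  obtain N1 where N1: "(\<lambda>z. w z * dbar \<kappa> z) \<in> density_on ?K N1" using density_compact_product[OF t(2,3) S w B(2)] .
  have cw: "continuous_on S (\<lambda>z. cnj (w z))" by (intro continuous_intros w)
  obtain N2 where N2: "(\<lambda>z. cnj (w z) * \<kappa> z) \<in> density_on ?K N2" using density_compact_product[OF t(2,3) S cw B(1)] .
  obtain N0 where N0: "(\<lambda>z. w z * \<kappa> z) \<in> density_on ?K N0" using density_compact_product[OF t(2,3) S w B(1)] .
  have N3: "(\<lambda>z. cnj (w z) * \<kappa> z * \<alpha>' z) \<in> density_on ?K (N2 * M)"
    using density_on_bound[OF \<alpha>'] density_on_nonneg[OF \<alpha>'] by (intro density_on_mult[OF N2 density_on_measurable[OF \<alpha>']]) auto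
  have "g \<in> density_on ?K (N1 + N2 * M)"
    using density_on_add[OF N1 N3] by (simp add: g_def[abs_def] mult_ac)
  then have gd: "g \<in> density_on ?Z (N1 + N2 * M)" using KZ by (rule density_on_mono) simp
  then show "\<exists>N. g \<in> density_on ?Z N" by blast
  define R where "R = cmod a + 2 * \<rho>"
  have out: "z \<notin> ?K" if "R < cmod z" for z
  proof
    assume "z \<in> ?K"
    then have "dist a z \<le> 2 * \<rho>" using KZ by auto
    then show False using that norm_triangle_ineq2[of z a] by (simp add: R_def dist_norm norm_minus_commute)
  qed
  show "w z * \<kappa> z = cauchy_transform g z"
  proof (rule cauchy_transform_eqI_regularized[where U="\<lambda>z. w z * \<kappa> z" and R=R and Z="?Z", OF _ _ _ _ gd])
    show "continuous_on UNIV (\<lambda>z. w z * \<kappa> z)"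
    proof (rule continuous_at_imp_continuous_on, rule ballI)
      fix x
      show "isCont (\<lambda>z. w z * \<kappa> z) x"
      proof (cases "x \<in> S")
        case True
        have "continuous_on S (\<lambda>z. w z * \<kappa> z)"
          by (intro continuous_on_mult w continuous_on_subset[OF C1_compactD(4)[OF t(1)]]) simp
        then show ?thesis using S True continuous_on_eq_continuous_at by blast
      next
        case False
        then have "x \<in> - ?K" using t(3) by blast
        have z: "0 = w y * \<kappa> y" if "y \<in> - ?K" for y using t(4)[of y] that by simp
        have "continuous_on (- ?K) (\<lambda>z. w z * \<kappa> z)"
          by (rule continuous_on_eq[OF continuous_on_const[of _ 0] z])
        then show ?thesis
          using \<open>x \<in> - ?K\<close> continuous_on_eq_continuous_at[OF open_Compl[OF closed_closure]] by blast
      qed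
    qed
    show "w z * \<kappa> z = 0" if "R < cmod z" for z using t(4)[OF out[OF that]] by simp
    fix \<epsilon> :: real assume \<epsilon>: "0 < \<epsilon>"
    let ?k = "regular_kernel \<epsilon> z" and ?d = "\<lambda>\<zeta>. complex_of_real (\<epsilon>\<^sup>2 / ((cmod (\<zeta> - z))\<^sup>2 + \<epsilon>\<^sup>2)\<^sup>2)"
    note dk = dbar_regular_kernel[OF \<epsilon>, of z]
    have kd: "C_diff (Suc 0) ?k" by (rule regular_kernel_C_diff[OF \<epsilon>])
    have kc: "continuous_on S ?k"
      using dk(1) by (intro continuous_at_imp_continuous_on ballI differentiable_imp_continuous_within) auto
    have dc: "continuous_on S ?d"
    proof -
      have "dbar ?k = ?d" using dk(2) by auto
      moreover have "continuous_on S (dbar ?k)"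
        using kd unfolding dbar_def[abs_def] by (intro continuous_intros continuous_on_subset[of UNIV _ S]) auto
      ultimately show ?thesis by simp
    qed
    let ?\<psi> = "\<lambda>\<zeta>. \<kappa> \<zeta> * ?k \<zeta>"
    have \<psi>: "?\<psi> \<in> test_functions S"
    proof -
      have "(\<lambda>\<zeta>. Complex (bump a \<rho> \<zeta> * p \<zeta>) (bump a \<rho> \<zeta> * q \<zeta>)) = (\<lambda>\<zeta>. \<kappa> \<zeta> * Complex (p \<zeta>) (q \<zeta>))" for p q
        by (simp add: fun_eq_iff \<kappa>_def complex_eq_iff)
      from bump_test_function[OF \<rho> smooth_regular_kernel[OF \<epsilon>, of z], unfolded this]
      show ?thesis by (simp only: regular_kernel_Complex)
    qed
    obtain N4 where N4: "(\<lambda>\<zeta>. ?d \<zeta> * (w \<zeta> * \<kappa> \<zeta>)) \<in> density_on ?K N4"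
      using density_compact_product[OF t(2,3) S dc N0] .
    have gK: "g \<in> density_on ?K (N1 + N2 * M)" by fact
    obtain N5 where N5: "(\<lambda>\<zeta>. ?k \<zeta> * g \<zeta>) \<in> density_on ?K N5"
      using density_compact_product[OF t(2,3) S kc gK] .
    have KB: "?K \<in> sets borel" "bounded ?K" using t(2) by (auto intro: compact_imp_bounded)
    have "(LINT \<zeta>|lborel. w \<zeta> * \<kappa> \<zeta> * ?d \<zeta>) + (LINT \<zeta>|lborel. g \<zeta> * ?k \<zeta>)
      = (LINT \<zeta>|lborel. ?d \<zeta> * (w \<zeta> * \<kappa> \<zeta>) + ?k \<zeta> * g \<zeta>)"
      by (subst Bochner_Integration.integral_add[OF density_integrable[OF KB N4] density_integrable[OF KB N5]])
         (simp only: mult.commute)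
    also have "\<dots> = (LINT \<zeta>|lborel. w \<zeta> * dbar ?\<psi> \<zeta> + \<alpha>' \<zeta> * cnj (w \<zeta>) * ?\<psi> \<zeta>)"
    proof (rule Bochner_Integration.integral_cong[OF refl])
      fix \<zeta>
      have "dbar ?\<psi> \<zeta> = \<kappa> \<zeta> * ?d \<zeta> + dbar \<kappa> \<zeta> * ?k \<zeta>"
        using dbar_mult(4)[OF C1_compactD(1)[OF t(1)] dk(1)] dk(2) by simp
      then show "?d \<zeta> * (w \<zeta> * \<kappa> \<zeta>) + ?k \<zeta> * g \<zeta> = w \<zeta> * dbar ?\<psi> \<zeta> + \<alpha>' \<zeta> * cnj (w \<zeta>) * ?\<psi> \<zeta>"
        by (simp only: g_def) (simp only: algebra_simps)
    qed
    also have "\<dots> = 0" by (rule weak[OF \<psi>])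
    finally show "(LINT \<zeta>|lborel. w \<zeta> * \<kappa> \<zeta> * ?d \<zeta>) + (LINT \<zeta>|lborel. g \<zeta> * ?k \<zeta>) = 0" .
  qed auto
qed

lemma holomorphic_onI_local:
  assumes "open S" "\<And>z. z \<in> S \<Longrightarrow> \<exists>e>0. f holomorphic_on ball z e"
  shows "f holomorphic_on S"
  unfolding holomorphic_on_def
proof
  fix z assume "z \<in> S"
  then obtain e where "e > 0" "f holomorphic_on ball z e" using assms by blast
  then have "f field_differentiable at z" by (intro holomorphic_on_imp_differentiable_at[of _ "ball z e"]) auto
  then show "f field_differentiable at z within S" by (rule field_differentiable_at_within)
qed

lemma cauchy_transform_uminus: "cauchy_transform (\<lambda>\<zeta>. - f \<zeta>) z = - cauchy_transform f z"
  unfolding cauchy_transform_def by simp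

lemma density_on_uminus: "f \<in> density_on Z M \<Longrightarrow> (\<lambda>\<zeta>. - f \<zeta>) \<in> density_on Z M"
  using density_on_cmult[of f Z M "-1"] by simp

lemma borel_extend_continuous:
  fixes u :: "complex \<Rightarrow> complex"
  assumes "open S" "continuous_on S u" shows "(\<lambda>z. if z \<in> S then u z else 0) \<in> borel_measurable borel"
  using assms by (intro borel_measurable_continuous_on_if continuous_on_const) auto

lemma conj_quotient_density:
  assumes S: "open S" and u: "continuous_on S u" and \<gamma>: "\<gamma> \<in> density_on S M"
  shows "(\<lambda>z. \<gamma> z * cnj (u z) / u z) \<in> density_on S M"
proof (rule density_onI)
  let ?u = "\<lambda>z. if z \<in> S then u z else 0"
  have [measurable]: "cnj \<in> borel_measurable borel" by (intro borel_measurable_continuous_onI continuous_intros)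
  have [measurable]: "?u \<in> borel_measurable borel" by (rule borel_extend_continuous[OF S u])
  note [measurable] = density_on_measurable[OF \<gamma>]
  have "(\<lambda>z. \<gamma> z * cnj (u z) / u z) = (\<lambda>z. \<gamma> z * cnj (?u z) / ?u z)"
    using density_on_zero[OF \<gamma>] by (auto simp: fun_eq_iff)
  also have "\<dots> \<in> borel_measurable borel" by measurable
  finally show "(\<lambda>z. \<gamma> z * cnj (u z) / u z) \<in> borel_measurable borel" .
  show "cmod (\<gamma> z * cnj (u z) / u z) \<le> M" for z
    using density_on_bound[OF \<gamma>, of z] density_on_nonneg[OF \<gamma>] by (cases "u z = 0") (auto simp: norm_mult norm_divide)
  show "\<gamma> z * cnj (u z) / u z = 0" if "z \<notin> S" for z using density_on_zero[OF \<gamma> that] by simp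
qed

text \<open>The similarity principle. A solution of \<open>dbar w = \<alpha> * cnj w\<close> also solves the complex-linear equation
  \<open>dbar w = \<beta> * w\<close>, whose integrating factor is \<open>exp (- T \<beta>)\<close>. Near each point, the localized representation and the
  product formula exhibit \<open>w * exp (- T \<beta>)\<close> as the transform of a density that vanishes there. On the zero set of
  \<open>w\<close> the convention \<open>x / 0 = 0\<close> gives \<open>\<beta> = 0\<close>, in agreement with the equation.\<close>

theorem solution_factorization:
  assumes S: "open S" "bounded S" and w: "continuous_on S w" and \<alpha>': "\<alpha>' \<in> density_on S M"
    and weak: "\<And>\<psi>. \<psi> \<in> test_functions S \<Longrightarrow> (LINT z|lborel. w z * dbar \<psi> z + \<alpha>' z * cnj (w z) * \<psi> z) = 0"
  defines "\<beta> \<equiv> \<lambda>z. \<alpha>' z * cnj (w z) / w z"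
  shows "\<beta> \<in> density_on S M" "(\<lambda>z. exp (- cauchy_transform \<beta> z) * w z) holomorphic_on S"
    "\<And>z. \<beta> z * w z = \<alpha>' z * cnj (w z)"
proof -
  have SB: "S \<in> sets borel" using S by simp
  show \<beta>: "\<beta> \<in> density_on S M" unfolding \<beta>_def by (rule conj_quotient_density[OF S(1) w \<alpha>'])
  show \<beta>w: "\<beta> z * w z = \<alpha>' z * cnj (w z)" for z by (cases "w z = 0") (auto simp: \<beta>_def)
  let ?b = "\<lambda>z. - \<beta> z"
  have b: "?b \<in> density_on S M" by (rule density_on_uminus[OF \<beta>])
  show "(\<lambda>z. exp (- cauchy_transform \<beta> z) * w z) holomorphic_on S"
  proof (rule holomorphic_onI_local[OF S(1)])
    fix a assume a: "a \<in> S"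
    obtain r where r: "0 < r" "cball a r \<subseteq> S" using S a open_contains_cball by blast
    define \<rho> where "\<rho> = r / 2"
    have \<rho>: "0 < \<rho>" "cball a (2 * \<rho>) \<subseteq> S" using r by (auto simp: \<rho>_def)
    define \<kappa> where "\<kappa> z = complex_of_real (bump a \<rho> z)" for z
    define g where "g z = w z * dbar \<kappa> z + \<alpha>' z * cnj (w z) * \<kappa> z" for z
    have \<kappa>t: "\<kappa> \<in> test_functions S" unfolding \<kappa>_def[abs_def] by (rule bump_as_test_function[OF \<rho>])
    have rep: "\<exists>N. g \<in> density_on (cball a (2 * \<rho>)) N" "\<And>z. w z * \<kappa> z = cauchy_transform g z"
      using localized_representation[OF S(1) w \<alpha>' weak \<rho>] unfolding \<kappa>_def[abs_def] g_def[abs_def] by auto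
    obtain N where "g \<in> density_on (cball a (2 * \<rho>)) N" using rep(1) ..
    then have g: "g \<in> density_on S N" using \<rho>(2) by (rule density_on_mono) simp
    obtain B where B: "dbar \<kappa> \<in> density_on (closure {z. \<kappa> z \<noteq> 0}) B" using test_density[OF \<kappa>t] by blast
    obtain N' where "(\<lambda>z. w z * dbar \<kappa> z) \<in> density_on (closure {z. \<kappa> z \<noteq> 0}) N'"
      using density_compact_product[OF test_functionsD(2,3)[OF \<kappa>t] S(1) w B] .
    then have wd: "(\<lambda>z. w z * dbar \<kappa> z) \<in> density_on S N'"
      using test_functionsD(3)[OF \<kappa>t] by (rule density_on_mono) simp
    let ?h = "\<lambda>z. (w z * dbar \<kappa> z) * exp (cauchy_transform ?b z)"
    have h: "?h \<in> density_on S (N' * exp (M * transform_bound S))" by (rule density_mult_exp_transform[OF SB S(2) wd b])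
    have eq: "w z * \<kappa> z * exp (cauchy_transform ?b z) = cauchy_transform ?h z" for z
    proof -
      have "w z * \<kappa> z * exp (cauchy_transform ?b z) =
        cauchy_transform (\<lambda>\<zeta>. (g \<zeta> + ?b \<zeta> * cauchy_transform g \<zeta>) * exp (cauchy_transform ?b \<zeta>)) z"
        unfolding rep(2) by (rule cauchy_transform_mult_exp[OF SB S(2) g b])
      also have "\<dots> = cauchy_transform ?h z"
      proof (rule cauchy_transform_cong)
        fix \<zeta>
        have "g \<zeta> + ?b \<zeta> * cauchy_transform g \<zeta> = g \<zeta> - (\<beta> \<zeta> * w \<zeta>) * \<kappa> \<zeta>"
          by (simp only: rep(2)[symmetric]) simp
        also have "\<dots> = w \<zeta> * dbar \<kappa> \<zeta>" unfolding \<beta>w g_def by simp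
        finally show "(g \<zeta> + ?b \<zeta> * cauchy_transform g \<zeta>) * exp (cauchy_transform ?b \<zeta>) = ?h \<zeta>" by simp
      qed
      finally show ?thesis .
    qed
    have one: "\<kappa> z = 1" if "z \<in> ball a \<rho>" for z using bump_eq_1[OF \<rho>(1), of a z] that by (simp add: \<kappa>_def)
    have d0: "dbar \<kappa> z = 0" if z: "z \<in> ball a \<rho>" for z
    proof -
      have "((\<lambda>_. 1::complex) has_derivative (\<lambda>h. of_real (Re h) * 0 + of_real (Im h) * 0)) (at z)" by simp
      then have "(\<kappa> has_derivative (\<lambda>h. of_real (Re h) * 0 + of_real (Im h) * 0)) (at z)"
        by (rule has_derivative_transform_within_open[OF _ open_ball z]) (simp add: one)
      from dx_dy_eqI(4)[OF this] show ?thesis by simp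
    qed
    have "cauchy_transform ?h holomorphic_on ball a \<rho>"
      by (rule cauchy_transform_holomorphic[OF SB S(2) h]) (auto simp: d0)
    moreover have "cauchy_transform ?h z = exp (- cauchy_transform \<beta> z) * w z" if "z \<in> ball a \<rho>" for z
      using eq[of z] one[OF that] by (simp add: cauchy_transform_uminus mult.commute)
    ultimately have "(\<lambda>z. exp (- cauchy_transform \<beta> z) * w z) holomorphic_on ball a \<rho>"
      by (rule holomorphic_transform)
    then show "\<exists>e>0. (\<lambda>z. exp (- cauchy_transform \<beta> z) * w z) holomorphic_on ball a e" using \<rho>(1) by blast
  qed
qed

lemma exp_transform_continuous:
  assumes "S \<in> sets borel" "bounded S" "\<beta> \<in> density_on S M"
  shows "continuous_on A (\<lambda>z. exp (cauchy_transform \<beta> z))"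
  using cauchy_transform_continuous[OF assms] by (intro continuous_intros) (auto intro: continuous_on_subset)

text \<open>Converse of the similarity principle. For a test function \<open>\<psi>\<close>, the product \<open>F * \<psi>\<close> is the transform of \<open>F * dbar \<psi>\<close>
  by Cauchy-Pompeiu, hence \<open>F * \<psi> * exp (T \<beta>)\<close> is the transform of the integrand below. It vanishes far out, so
  the integral of its density is 0.\<close>

theorem factored_weak_solution:
  assumes S: "open S" "bounded S" and \<beta>: "\<beta> \<in> density_on S M" and F: "F holomorphic_on S"
    and w: "\<And>z. z \<in> S \<Longrightarrow> w z = exp (cauchy_transform \<beta> z) * F z" and \<psi>: "\<psi> \<in> test_functions S"
  shows "(LINT z|lborel. w z * dbar \<psi> z + \<beta> z * w z * \<psi> z) = 0"
proof -
  have SB: "S \<in> sets borel" using S by simp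
  let ?e = "\<lambda>z. exp (cauchy_transform \<beta> z)"
  define \<Psi> where "\<Psi> z = (if z \<in> S then F z * \<psi> z else 0)" for z
  have C1: "C_diff (Suc 0) \<psi>" using \<psi> unfolding test_functions_def by blast
  have \<Psi>_eq: "\<Psi> = (\<lambda>z. if z \<in> S then F z * \<psi> z else 0)" by (simp add: fun_eq_iff \<Psi>_def)
  have glue1: "C_diff (Suc 0) \<Psi>"
    unfolding \<Psi>_eq by (rule C_diff_glue_holomorphic(1)[OF F S(1) C1 test_function_vanishes_near[OF \<psi>]])
  have glue: "dbar \<Psi> z = (if z \<in> S then F z * dbar \<psi> z else 0)" for z
    unfolding \<Psi>_eq by (rule C_diff_glue_holomorphic(3)[OF F S(1) C1 test_function_vanishes_near[OF \<psi>]])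
  have \<Psi>0: "\<Psi> z = 0" if "z \<notin> S" for z using that by (simp add: \<Psi>_def)
  then have "{z. \<Psi> z \<noteq> 0} \<subseteq> S" by blast
  then have \<Psi>: "\<Psi> \<in> C1_compact" using glue1 bounded_subset[OF S(2)] by (simp add: C1_compact_def)
  obtain R M' where g0: "dbar \<Psi> \<in> density_on (cball 0 R) M'" using dbar_density[OF \<Psi>] by blast
  have g: "dbar \<Psi> \<in> density_on S M'"
    using density_onD(1,2)[OF g0] glue by (intro density_onI) auto
  have cp: "\<Psi> z = cauchy_transform (dbar \<Psi>) z" for z by (rule cauchy_pompeiu[OF \<Psi>])
  let ?G = "\<lambda>\<zeta>. (dbar \<Psi> \<zeta> + \<beta> \<zeta> * cauchy_transform (dbar \<Psi>) \<zeta>) * ?e \<zeta>"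
  have G: "?G \<in> density_on S ((M' + M * (M' * transform_bound S)) * exp (M * transform_bound S))"
    by (rule density_mult_exp_transform[OF SB S(2) density_on_add[OF g density_mult_transform[OF SB S(2) \<beta> g]] \<beta>])
  have TG: "cauchy_transform ?G z = \<Psi> z * ?e z" for z
    using cauchy_transform_mult_exp[OF SB S(2) g \<beta>, of z] cp by simp
  obtain r where r: "\<And>z. z \<in> S \<Longrightarrow> cmod z \<le> r" using S(2) by (auto simp: bounded_iff)
  have "(LINT \<zeta>|lborel. ?G \<zeta>) = 0"
  proof (rule cauchy_transform_compact_support[OF SB S(2) G])
    fix z :: complex assume "r < cmod z"
    then have "z \<notin> S" using r by force
    then show "cauchy_transform ?G z = 0" unfolding TG by (simp add: \<Psi>0)
  qed
  also have "?G = (\<lambda>z. w z * dbar \<psi> z + \<beta> z * w z * \<psi> z)"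
  proof
    fix z
    show "?G z = w z * dbar \<psi> z + \<beta> z * w z * \<psi> z"
    proof (cases "z \<in> S")
      case True
      then show ?thesis unfolding cp[symmetric] w[OF True] using True by (simp add: glue \<Psi>_def algebra_simps)
    next
      case False
      then have zK: "z \<notin> closure {z. \<psi> z \<noteq> 0}" using test_functionsD(3)[OF \<psi>] by blast
      show ?thesis
        using False test_functionsD(5)[OF \<psi> zK] by (simp add: glue density_on_zero[OF \<beta>])
    qed
  qed
  finally show ?thesis .
qed

lemma factored_solves_dbar_eq:
  assumes S: "open S" "bounded S" and \<beta>: "\<beta> \<in> density_on S M" and F: "F holomorphic_on S"
    and w: "\<And>z. z \<in> S \<Longrightarrow> w z = exp (cauchy_transform \<beta> z) * F z"
    and ae: "AE z in lborel. z \<in> S \<longrightarrow> \<alpha> z * cnj (w z) = \<beta> z * w z"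
  shows "continuous_on S w" "solves_dbar_eq S \<alpha> w"
proof -
  have SB: "S \<in> sets borel" using S by simp
  have "continuous_on S (\<lambda>z. exp (cauchy_transform \<beta> z) * F z)"
    by (intro continuous_on_mult exp_transform_continuous[OF SB S(2) \<beta>] holomorphic_on_imp_continuous_on F)
  then show c: "continuous_on S w" by (rule continuous_on_eq) (simp add: w)
  show "solves_dbar_eq S \<alpha> w"
    using factored_weak_solution[OF S \<beta> F w] by (subst solves_dbar_eq_iff[OF S(1) c \<beta> ae refl c]) blast
qed

lemma solves_dbar_eq_factor:
  assumes S: "open S" "bounded S" and w: "continuous_on S w" "solves_dbar_eq S \<alpha> w"
    and \<alpha>': "\<alpha>' \<in> density_on S M" "AE z in lborel. z \<in> S \<longrightarrow> \<alpha> z = \<alpha>' z"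
  obtains \<beta> F where "\<beta> \<in> density_on S M" "F holomorphic_on S"
    "\<And>z. w z = exp (cauchy_transform \<beta> z) * F z" "\<And>z. \<beta> z * w z = \<alpha>' z * cnj (w z)"
proof -
  have ae: "AE z in lborel. z \<in> S \<longrightarrow> \<alpha> z * cnj (w z) = \<alpha>' z * cnj (w z)"
    using \<alpha>'(2) by eventually_elim simp
  have cw: "continuous_on S (\<lambda>z. cnj (w z))" by (intro continuous_intros w)
  have "(LINT z|lborel. w z * dbar \<psi> z + \<alpha>' z * cnj (w z) * \<psi> z) = 0" if "\<psi> \<in> test_functions S" for \<psi>
    using w(2) that by (subst (asm) solves_dbar_eq_iff[OF S(1) w(1) \<alpha>'(1) ae refl cw]) blast
  note f = solution_factorization[OF S w(1) \<alpha>'(1) this]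
  show ?thesis
    by (rule that[OF f(1,2) _ f(3)]) (simp_all flip: exp_add mult.assoc)
qed

section \<open>Existence of solutions with prescribed holomorphic factor\<close>

text \<open>Solvability of \<open>v - t * K v = g\<close> for all \<open>g\<close> propagates from \<open>t = 0\<close> to \<open>t = 1\<close> in steps whose length
  depends only on the a priori constant \<open>A\<close>; each step is a contraction argument.\<close>

lemma method_of_continuity:
  fixes K :: "'a::{real_normed_vector, complete_space} \<Rightarrow> 'a"
  assumes K: "bounded_linear K" and A: "\<And>t v. 0 \<le> t \<Longrightarrow> t \<le> 1 \<Longrightarrow> norm v \<le> A * norm (v - t *\<^sub>R K v)"
  shows "\<exists>v. v - K v = g"
proof -
  interpret bounded_linear K by (rule K)
  obtain b where b: "0 < b" "\<And>v. norm (K v) \<le> norm v * b" using pos_bounded by blast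
  define P where "P t \<longleftrightarrow> (\<forall>g. \<exists>v. v - t *\<^sub>R K v = g)" for t :: real
  have step: "P t" if t0: "0 \<le> t0" "t0 \<le> 1" "P t0" and t: "\<bar>t - t0\<bar> * (\<bar>A\<bar> * b) \<le> 1/2" for t0 t
    unfolding P_def
  proof
    fix g
    obtain R where R: "\<And>g. R g - t0 *\<^sub>R K (R g) = g" using t0(3) unfolding P_def by metis
    have lipR: "norm (R x - R y) \<le> \<bar>A\<bar> * norm (x - y)" for x y
    proof -
      have "(R x - R y) - t0 *\<^sub>R K (R x - R y) = x - y"
      proof -
        have "(R x - R y) - t0 *\<^sub>R K (R x - R y) = (R x - t0 *\<^sub>R K (R x)) - (R y - t0 *\<^sub>R K (R y))"
          by (simp add: diff scaleR_diff_right)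
        then show ?thesis by (simp only: R)
      qed
      then have "norm (R x - R y) \<le> A * norm (x - y)" using A[OF t0(1,2), of "R x - R y"] by simp
      also have "\<dots> \<le> \<bar>A\<bar> * norm (x - y)" by (intro mult_right_mono) auto
      finally show ?thesis .
    qed
    define \<Phi> where "\<Phi> v = R (g + (t - t0) *\<^sub>R K v)" for v
    have "dist (\<Phi> v) (\<Phi> u) \<le> 1/2 * dist v u" for u v
    proof -
      have "dist (\<Phi> v) (\<Phi> u) \<le> \<bar>A\<bar> * norm ((t - t0) *\<^sub>R K (v - u))"
        unfolding \<Phi>_def dist_norm using lipR[of "g + (t - t0) *\<^sub>R K v" "g + (t - t0) *\<^sub>R K u"]
        by (simp add: diff scaleR_diff_right)
      also have "\<dots> \<le> \<bar>A\<bar> * (\<bar>t - t0\<bar> * (norm (v - u) * b))"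
        using b(2)[of "v - u"] by (intro mult_left_mono) (auto intro: mult_left_mono)
      also have "\<dots> = (\<bar>t - t0\<bar> * (\<bar>A\<bar> * b)) * dist v u" by (simp add: dist_norm mult_ac)
      also have "\<dots> \<le> 1/2 * dist v u" using t by (rule mult_right_mono) simp
      finally show ?thesis .
    qed
    then obtain v where v: "\<Phi> v = v"
      using banach_fix_type[of "1/2" \<Phi>] by auto
    have "v - t0 *\<^sub>R K v = g + (t - t0) *\<^sub>R K v" using R[of "g + (t - t0) *\<^sub>R K v"] v by (simp add: \<Phi>_def)
    then have "v - t *\<^sub>R K v = g" by (simp add: algebra_simps)
    then show "\<exists>v. v - t *\<^sub>R K v = g" ..
  qed
  obtain n where n: "2 * (\<bar>A\<bar> * b) < real n" using reals_Archimedean2 by blast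
  have n0: "0 < real n" using n b by (smt (verit) mult_nonneg_nonneg abs_ge_zero)
  have "P (real k / real n)" if "k \<le> n" for k
    using that
  proof (induction k)
    case 0
    show ?case by (simp add: P_def)
  next
    case (Suc k)
    show ?case
    proof (rule step)
      show "P (real k / real n)" using Suc by simp
      show "\<bar>real (Suc k) / real n - real k / real n\<bar> * (\<bar>A\<bar> * b) \<le> 1/2"
        using n n0 by (simp add: diff_divide_distrib[symmetric] field_simps)
    qed (use Suc n0 in \<open>auto simp: field_simps\<close>)
  qed
  from this[of n] have "P 1" using n0 by simp
  then show ?thesis by (simp add: P_def)
qed

text \<open>The equation \<open>v = 1 + T (\<gamma> * cnj v)\<close> is real-linear in \<open>v\<close>, and the method of continuity applies because of an a priori
  bound: with \<open>\<beta> = t * \<gamma> * cnj v / v\<close> the equation \<open>v = g + T (\<beta> * v)\<close> is complex-linear, it is solved by exponentials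
  of \<open>T \<beta>\<close>, and \<open>\<beta>\<close> is bounded by \<open>M\<close> whatever \<open>v\<close> is. For the solution \<open>v\<close>, the density \<open>\<mu> = \<gamma> * cnj v / v\<close> satisfies
  \<open>v = exp (T \<mu>)\<close>.\<close>

theorem conjugate_equation_solvable:
  assumes Z: "Z \<in> sets borel" "bounded Z" and \<gamma>: "\<gamma> \<in> density_on Z M"
  obtains \<mu> where "\<mu> \<in> density_on Z M"
    "\<And>z. \<mu> z * exp (cauchy_transform \<mu> z) = \<gamma> z * cnj (exp (cauchy_transform \<mu> z))"
proof -
  let ?T = cauchy_transform
  define b where "b = M * transform_bound Z"
  have M0: "0 \<le> M" and tb: "0 \<le> transform_bound Z" using density_on_nonneg[OF \<gamma>] transform_bound_nonneg[OF Z] by auto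
  have dens: "(\<lambda>\<zeta>. \<gamma> \<zeta> * cnj (u \<zeta>)) \<in> density_on Z (M * N)"
    if "continuous_on UNIV u" "\<And>z. cmod (u z) \<le> N" for u N
    using that order_trans[OF norm_ge_zero that(2)]
    by (intro density_on_mult[OF \<gamma>] borel_measurable_continuous_onI continuous_intros) auto
  have quot: "(\<lambda>z. \<gamma> z * cnj (u z) / u z) \<in> density_on Z M" if u: "continuous_on UNIV u" for u
  proof (rule density_onI)
    have [measurable]: "cnj \<in> borel_measurable borel" by (intro borel_measurable_continuous_onI continuous_intros)
    have [measurable]: "u \<in> borel_measurable borel" by (rule borel_measurable_continuous_onI[OF u])
    note [measurable] = density_on_measurable[OF \<gamma>]
    show "(\<lambda>z. \<gamma> z * cnj (u z) / u z) \<in> borel_measurable borel" by measurable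
    show "cmod (\<gamma> z * cnj (u z) / u z) \<le> M" for z
      using density_on_bound[OF \<gamma>, of z] M0 by (cases "u z = 0") (auto simp: norm_mult norm_divide)
  qed (use density_on_zero[OF \<gamma>] in simp)
  let ?ap = "apply_bcontfun :: (complex \<Rightarrow>\<^sub>C complex) \<Rightarrow> _"
  have apc: "continuous_on UNIV (?ap v)" and apb: "cmod (?ap v z) \<le> norm v" for v z
    by (auto intro: continuous_on_apply_bcontfun norm_bounded)
  define K where "K v = Bcontfun (\<lambda>z. ?T (\<lambda>\<zeta>. \<gamma> \<zeta> * cnj (?ap v \<zeta>)) z)" for v
  have dv: "(\<lambda>\<zeta>. \<gamma> \<zeta> * cnj (?ap v \<zeta>)) \<in> density_on Z (M * norm v)" for v by (rule dens[OF apc apb])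
  have Kap: "?ap (K v) = ?T (\<lambda>\<zeta>. \<gamma> \<zeta> * cnj (?ap v \<zeta>))" for v
    unfolding K_def
    by (intro Bcontfun_inverse bcontfun_normI[OF cauchy_transform_continuous[OF Z dv] cauchy_transform_bound[OF Z dv]])
  have bl: "bounded_linear K"
  proof (rule bounded_linear_intro[where K=b])
    show "K (u + v) = K u + K v" for u v
    proof (rule bcontfun_eqI)
      fix z
      show "?ap (K (u + v)) z = ?ap (K u + K v) z"
        unfolding plus_bcontfun.rep_eq Kap cauchy_transform_add[OF Z dv dv, symmetric]
        by (simp add: distrib_left)
    qed
    show "K (r *\<^sub>R u) = r *\<^sub>R K u" for r u
    proof (rule bcontfun_eqI)
      fix z
      have "(\<lambda>\<zeta>. \<gamma> \<zeta> * cnj (?ap (r *\<^sub>R u) \<zeta>)) = (\<lambda>\<zeta>. of_real r * (\<gamma> \<zeta> * cnj (?ap u \<zeta>)))"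
        by (simp add: scaleR_bcontfun.rep_eq scaleR_conv_of_real fun_eq_iff)
      then show "?ap (K (r *\<^sub>R u)) z = ?ap (r *\<^sub>R K u) z"
        by (simp add: scaleR_bcontfun.rep_eq Kap cauchy_transform_cmult[OF Z] scaleR_conv_of_real)
    qed
    show "norm (K u) \<le> norm u * b" for u
      using cauchy_transform_bound[OF Z dv[of u]] by (intro norm_bound) (simp add: Kap b_def mult_ac)
  qed
  have apriori: "norm v \<le> (1 + exp b * (b * exp b)) * norm (v - t *\<^sub>R K v)" if t: "0 \<le> t" "t \<le> 1" for t v
  proof -
    define g where "g = v - t *\<^sub>R K v"
    define f where "f \<zeta> = of_real t * (\<gamma> \<zeta> * cnj (?ap v \<zeta>))" for \<zeta>
    have f: "f \<in> density_on Z (cmod (of_real t) * (M * norm v))" unfolding f_def[abs_def] by (rule density_on_cmult[OF dv])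
    have u: "?ap v z - ?ap g z = ?T f z" for z
      by (simp add: g_def f_def[abs_def] minus_bcontfun.rep_eq scaleR_bcontfun.rep_eq Kap cauchy_transform_cmult[OF Z] scaleR_conv_of_real)
    define \<mu> where "\<mu> \<zeta> = of_real t * (\<gamma> \<zeta> * cnj (?T f \<zeta>) / ?T f \<zeta>)" for \<zeta>
    have "\<mu> \<in> density_on Z (cmod (of_real t) * M)"
      unfolding \<mu>_def[abs_def] by (rule density_on_cmult[OF quot[OF cauchy_transform_continuous[OF Z f]]])
    then have \<mu>: "\<mu> \<in> density_on Z M" by (rule density_on_mono) (use t M0 in \<open>auto simp: mult_left_le_one_le\<close>)
    have \<mu>T: "\<mu> \<zeta> * ?T f \<zeta> = of_real t * (\<gamma> \<zeta> * cnj (?T f \<zeta>))" for \<zeta>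
      by (cases "?T f \<zeta> = 0") (auto simp: \<mu>_def)
    let ?m = "\<lambda>\<zeta>. - \<mu> \<zeta>"
    have m: "?m \<in> density_on Z M" by (rule density_on_uminus[OF \<mu>])
    let ?h = "\<lambda>\<zeta>. of_real t * (\<gamma> \<zeta> * cnj (?ap g \<zeta>))"
    have "?h \<in> density_on Z (cmod (of_real t) * (M * norm g))" by (rule density_on_cmult[OF dv])
    then have h: "?h \<in> density_on Z (M * norm g)"
      by (rule density_on_mono) (use t M0 in \<open>auto simp: mult_left_le_one_le\<close>)
    have key: "?T f z * exp (?T ?m z) = ?T (\<lambda>\<zeta>. ?h \<zeta> * exp (?T ?m \<zeta>)) z" for z
    proof -
      have "(f \<zeta> + ?m \<zeta> * ?T f \<zeta>) = ?h \<zeta>" for \<zeta>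
      proof -
        have "f \<zeta> + ?m \<zeta> * ?T f \<zeta> = of_real t * (\<gamma> \<zeta> * (cnj (?ap v \<zeta>) - cnj (?T f \<zeta>)))"
          using \<mu>T[of \<zeta>] by (simp add: f_def algebra_simps)
        also have "cnj (?ap v \<zeta>) - cnj (?T f \<zeta>) = cnj (?ap g \<zeta>)"
          using u[of \<zeta>] by (metis add_diff_cancel_left' complex_cnj_diff diff_add_cancel)
        finally show ?thesis .
      qed
      then show ?thesis using cauchy_transform_mult_exp[OF Z f m, of z] by simp
    qed
    have "cmod (?T f z) \<le> exp b * (b * exp b) * norm g" for z
    proof -
      have "?T f z = (?T f z * exp (?T ?m z)) * exp (- ?T ?m z)" by (simp add: mult.assoc flip: exp_add)
      then have "cmod (?T f z) = cmod (?T (\<lambda>\<zeta>. ?h \<zeta> * exp (?T ?m \<zeta>)) z) * cmod (exp (- ?T ?m z))"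
        unfolding key by (metis norm_mult)
      also have "\<dots> \<le> (M * norm g * exp b * transform_bound Z) * exp b"
        using cauchy_transform_bound[OF Z density_mult_exp_transform[OF Z h m], of z] exp_transform_bound(2)[OF Z m, of z] M0 tb
        unfolding b_def by (intro mult_mono) auto
      also have "\<dots> = exp b * (b * exp b) * norm g" by (simp add: b_def)
      finally show ?thesis .
    qed
    then have "cmod (?ap v z) \<le> (1 + exp b * (b * exp b)) * norm g" for z
    proof -
      have "?ap v z = ?ap g z + ?T f z" using u[of z] by (simp add: algebra_simps)
      then have "cmod (?ap v z) \<le> cmod (?ap g z) + cmod (?T f z)" by (metis norm_triangle_ineq)
      also have "\<dots> \<le> norm g + exp b * (b * exp b) * norm g" by (intro add_mono apb) fact
      finally show ?thesis by (simp add: algebra_simps)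
    qed
    then show ?thesis unfolding g_def[symmetric] by (rule norm_bound)
  qed
  have "\<exists>v. v - K v = Bcontfun (\<lambda>_. 1)"
    by (rule method_of_continuity[OF bl]) (rule apriori)
  then obtain v where vK: "v - K v = Bcontfun (\<lambda>_. 1)" ..
  have one: "?ap (Bcontfun (\<lambda>_. 1)) = (\<lambda>_. 1)"
    by (rule Bcontfun_inverse) (rule bcontfun_normI[of _ 1], auto)
  have v: "?T (\<lambda>\<zeta>. \<gamma> \<zeta> * cnj (?ap v \<zeta>)) z = ?ap v z - 1" for z
  proof -
    have "?ap (v - K v) z = 1" unfolding vK one ..
    then have "?ap v z - ?T (\<lambda>\<zeta>. \<gamma> \<zeta> * cnj (?ap v \<zeta>)) z = 1"
      unfolding minus_bcontfun.rep_eq Kap .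
    then show ?thesis by (simp only: diff_eq_eq eq_diff_eq add.commute)
  qed
  define \<mu> where "\<mu> \<zeta> = \<gamma> \<zeta> * cnj (?ap v \<zeta>) / ?ap v \<zeta>" for \<zeta>
  have \<mu>: "\<mu> \<in> density_on Z M" unfolding \<mu>_def[abs_def] by (rule quot[OF apc])
  have \<mu>v: "\<gamma> \<zeta> * cnj (?ap v \<zeta>) = \<mu> \<zeta> * ?ap v \<zeta>" for \<zeta> by (cases "?ap v \<zeta> = 0") (auto simp: \<mu>_def)
  let ?m = "\<lambda>\<zeta>. - \<mu> \<zeta>"
  have m: "?m \<in> density_on Z M" by (rule density_on_uminus[OF \<mu>])
  have "(?ap v z - 1) * exp (?T ?m z) = 1 - exp (?T ?m z)" for z
  proof -
    have "(?ap v z - 1) * exp (?T ?m z) =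
      ?T (\<lambda>\<zeta>. (\<gamma> \<zeta> * cnj (?ap v \<zeta>) + ?m \<zeta> * ?T (\<lambda>\<zeta>. \<gamma> \<zeta> * cnj (?ap v \<zeta>)) \<zeta>) * exp (?T ?m \<zeta>)) z"
      unfolding v[symmetric] by (rule cauchy_transform_mult_exp[OF Z dv m])
    also have "\<dots> = ?T (\<lambda>\<zeta>. - (?m \<zeta> * exp (?T ?m \<zeta>))) z"
      by (rule cauchy_transform_cong) (simp only: v, simp add: \<mu>v algebra_simps)
    also have "\<dots> = 1 - exp (?T ?m z)"
      using exp_cauchy_transform[OF Z m, of z] by (simp only: cauchy_transform_uminus) simp
    finally show ?thesis .
  qed
  then have "?ap v z * exp (?T ?m z) = 1" for z by (simp add: algebra_simps)
  then have "?ap v z = exp (?T \<mu> z)" for z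
    by (simp add: cauchy_transform_uminus exp_minus field_simps)
  then show ?thesis using that[OF \<mu>] \<mu>v by simp
qed

text \<open>Factor \<open>w1\<close> as \<open>exp (T \<beta>1) * F\<close> and solve for a density \<open>\<beta>2\<close> such that \<open>exp (T \<beta>2) * F\<close> is a solution for
  \<open>\<alpha>2\<close>: the required relation is the conjugate equation with \<open>\<gamma> = \<alpha>2 * cnj F / F\<close>. Both densities are bounded in terms of the
  coefficients alone, so \<open>M\<close> does not depend on the solution.\<close>

theorem exchange_coefficients:
  assumes S: "open S" "bounded S" and \<alpha>1: "\<alpha>1 \<in> L_inf S" and \<alpha>2: "\<alpha>2 \<in> L_inf S"
  obtains M where "\<And>w1. continuous_on S w1 \<Longrightarrow> solves_dbar_eq S \<alpha>1 w1 \<Longrightarrow>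
    \<exists>\<beta>\<in>density_on S M. \<exists>w2. continuous_on S w2 \<and> solves_dbar_eq S \<alpha>2 w2 \<and>
      (\<forall>z\<in>S. w1 z = exp (cauchy_transform \<beta> z) * w2 z)"
proof -
  have SB: "S \<in> sets borel" using S by simp
  obtain \<alpha>1' M1 where a1: "\<alpha>1' \<in> density_on S M1" "AE z in lborel. z \<in> S \<longrightarrow> \<alpha>1 z = \<alpha>1' z" using L_inf_density[OF \<alpha>1 SB] .
  obtain \<alpha>2' M2 where a2: "\<alpha>2' \<in> density_on S M2" "AE z in lborel. z \<in> S \<longrightarrow> \<alpha>2 z = \<alpha>2' z" using L_inf_density[OF \<alpha>2 SB] .
  show ?thesis
  proof (rule that[of "M1 + M2"])
    fix w1 assume w1: "continuous_on S w1" "solves_dbar_eq S \<alpha>1 w1"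
    obtain \<beta>1 F where \<beta>1: "\<beta>1 \<in> density_on S M1" and F: "F holomorphic_on S"
      and wF: "\<And>z. w1 z = exp (cauchy_transform \<beta>1 z) * F z"
      using solves_dbar_eq_factor[OF S w1 a1] by metis
    let ?\<gamma> = "\<lambda>z. \<alpha>2' z * cnj (F z) / F z"
    have \<gamma>: "?\<gamma> \<in> density_on S M2"
      by (rule conj_quotient_density[OF S(1) holomorphic_on_imp_continuous_on[OF F] a2(1)])
    obtain \<mu> where \<mu>: "\<mu> \<in> density_on S M2"
      and \<mu>e: "\<And>z. \<mu> z * exp (cauchy_transform \<mu> z) = ?\<gamma> z * cnj (exp (cauchy_transform \<mu> z))"
      using conjugate_equation_solvable[OF SB S(2) \<gamma>] by blast
    define w2 where "w2 z = exp (cauchy_transform \<mu> z) * F z" for z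
    have "\<alpha>2' z * cnj (w2 z) = \<mu> z * w2 z" for z
    proof (cases "F z = 0")
      case False
      have "\<mu> z * w2 z = (\<mu> z * exp (cauchy_transform \<mu> z)) * F z" by (simp add: w2_def)
      also have "\<dots> = \<alpha>2' z * cnj (w2 z)" unfolding \<mu>e using False by (simp add: w2_def)
      finally show ?thesis by simp
    qed (simp add: w2_def)
    then have "AE z in lborel. z \<in> S \<longrightarrow> \<alpha>2 z * cnj (w2 z) = \<mu> z * w2 z"
      using a2(2) by (auto elim!: eventually_mono)
    note s = factored_solves_dbar_eq[OF S \<mu> F w2_def this]
    have \<beta>: "(\<lambda>z. \<beta>1 z + - \<mu> z) \<in> density_on S (M1 + M2)" by (rule density_on_add[OF \<beta>1 density_on_uminus[OF \<mu>]])
    have "w1 z = exp (cauchy_transform (\<lambda>z. \<beta>1 z + - \<mu> z) z) * w2 z" for z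
      unfolding cauchy_transform_add[OF SB S(2) \<beta>1 density_on_uminus[OF \<mu>]] cauchy_transform_uminus w2_def wF
      by (simp add: mult.assoc flip: exp_add)
    then show "\<exists>\<beta>\<in>density_on S (M1 + M2). \<exists>w2. continuous_on S w2 \<and> solves_dbar_eq S \<alpha>2 w2 \<and>
      (\<forall>z\<in>S. w1 z = exp (cauchy_transform \<beta> z) * w2 z)" using s \<beta> by blast
  qed
qed

section \<open>Holomorphic changes of variables\<close>

text \<open>The change of variables formula speaks of Cartesian powers of the real line; these maps transport it to
  the complex plane.\<close>

definition of_vec :: "real^2 \<Rightarrow> complex" where "of_vec v = Complex (v $ 1) (v $ 2)"

definition to_vec :: "complex \<Rightarrow> real^2" where "to_vec z = vector [Re z, Im z]"

lemma to_vec_nth [simp]: "to_vec z $ 1 = Re z" "to_vec z $ 2 = Im z"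
  by (simp_all add: to_vec_def)

lemma of_to_vec [simp]: "of_vec (to_vec z) = z" "to_vec (of_vec v) = v"
  by (simp_all add: of_vec_def vec_eq_iff forall_2)

lemma bounded_linear_vec: "bounded_linear of_vec" "bounded_linear to_vec"
  unfolding linear_conv_bounded_linear[symmetric]
  by (auto intro!: linearI simp: of_vec_def vec_eq_iff forall_2 complex_eq_iff)

lemma of_vec_measurable: "of_vec \<in> borel_measurable borel"
  by (intro borel_measurable_continuous_onI linear_continuous_on bounded_linear_vec)

lemma lborel_complex_eq: "(lborel :: complex measure) = distr lborel borel of_vec"
proof (rule lborel_eqI)
  fix l u :: complex assume lu: "\<And>b. b \<in> Basis \<Longrightarrow> l \<bullet> b \<le> u \<bullet> b"
  have B: "(Basis :: (real^2) set) = {axis 1 1, axis 2 1}"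
    by (auto simp: Basis_vec_def UNIV_2)
  have ne: "axis 1 1 \<noteq> (axis 2 1 :: real^2)" by (simp add: axis_eq_axis)
  have "of_vec -` box l u = box (to_vec l) (to_vec u)"
    by (auto simp: in_box_complex_iff mem_box_cart forall_2 of_vec_def)
  then have "emeasure (distr lborel borel of_vec) (box l u) = emeasure lborel (box (to_vec l) (to_vec u))"
    using of_vec_measurable by (subst emeasure_distr) auto
  also have "\<dots> = (\<Prod>b\<in>Basis. (to_vec u - to_vec l) \<bullet> b)"
  proof (rule emeasure_lborel_box)
    fix b :: "real^2" assume "b \<in> Basis"
    then show "to_vec l \<bullet> b \<le> to_vec u \<bullet> b"
      using lu[of 1] lu[of \<i>] by (auto simp: B inner_axis Basis_complex_def)
  qed
  also have "\<dots> = (\<Prod>b\<in>Basis. (u - l) \<bullet> b)"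
    using ne by (simp add: B inner_axis Basis_complex_def)
  finally show "emeasure (distr lborel borel of_vec) (box l u) = (\<Prod>b\<in>Basis. (u - l) \<bullet> b)" .
qed simp

text \<open>The real Jacobian determinant of a holomorphic map is \<open>(cmod (deriv \<phi> z))\<^sup>2\<close>, by the Cauchy-Riemann equations.\<close>

lemma emeasure_injective_image:
  assumes \<phi>: "\<phi> holomorphic_on U" "open U" "bounded U" "inj_on \<phi> U" and bd: "\<And>z. z \<in> U \<Longrightarrow> cmod (deriv \<phi> z) \<le> M"
    and E: "E \<in> sets borel" "E \<subseteq> U" "\<phi> ` E \<in> sets borel"
  shows "emeasure lborel (\<phi> ` E) = (\<integral>\<^sup>+ z. ennreal (indicator E z * (cmod (deriv \<phi> z))\<^sup>2) \<partial>lborel)"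
proof -
  define d where "d z = (if z \<in> U then deriv \<phi> z else 0)" for z
  have dm [measurable]: "d \<in> borel_measurable borel"
    unfolding d_def[abs_def] by (rule borel_extend_continuous[OF \<phi>(2) holomorphic_on_imp_continuous_on[OF holomorphic_deriv[OF \<phi>(1,2)]]])
  note [measurable] = E(1)
  define F where "F z = indicator E z * (cmod (deriv \<phi> z))\<^sup>2" for z
  have F_eq: "F = (\<lambda>z. indicator E z * (cmod (d z))\<^sup>2)" using E(2) by (auto simp: F_def d_def fun_eq_iff indicator_def)
  have Fm [measurable]: "F \<in> borel_measurable borel" unfolding F_eq by measurable
  have Fi: "integrable lborel F"
  proof (rule integrableI_bounded_set[of U _ _ "\<bar>M\<bar>\<^sup>2"])
    show "emeasure lborel U < \<infinity>" by (rule emeasure_bounded_finite[OF \<phi>(3)])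
    show "AE z in lborel. z \<in> U \<longrightarrow> norm (F z) \<le> \<bar>M\<bar>\<^sup>2"
    proof (intro AE_I2 impI)
      fix z assume "z \<in> U"
      then have "(cmod (deriv \<phi> z))\<^sup>2 \<le> \<bar>M\<bar>\<^sup>2" using bd[of z] by (intro power_mono) auto
      then show "norm (F z) \<le> \<bar>M\<bar>\<^sup>2" by (auto simp: F_def indicator_def)
    qed
    show "AE z in lborel. z \<notin> U \<longrightarrow> F z = 0" using E(2) by (auto simp: F_def indicator_def)
  qed (use \<phi>(2) Fm in auto)
  let ?S = "of_vec -` E"
  define g where "g v = to_vec (\<phi> (of_vec v))" for v
  define g' where "g' v h = to_vec (deriv \<phi> (of_vec v) * of_vec h)" for v h
  have S: "?S \<in> sets borel" using measurable_sets_borel[OF of_vec_measurable E(1)] .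
  have der: "(g has_derivative g' v) (at v within ?S)" if "v \<in> ?S" for v
  proof -
    have "(\<phi> has_derivative (*) (deriv \<phi> (of_vec v))) (at (of_vec v))"
      using that E(2) holomorphic_derivI[OF \<phi>(1,2)] unfolding has_field_derivative_def by blast
    then have "((\<lambda>v. \<phi> (of_vec v)) has_derivative (\<lambda>h. deriv \<phi> (of_vec v) * of_vec h)) (at v)"
      by (rule has_derivative_compose[OF bounded_linear_imp_has_derivative[OF bounded_linear_vec(1)]])
    then show ?thesis unfolding g_def[abs_def] g'_def[abs_def]
      by (rule has_derivative_at_withinI[OF bounded_linear.has_derivative[OF bounded_linear_vec(2)]])
  qed
  have inj: "inj_on g ?S"
  proof (rule inj_onI)
    fix x y assume xy: "x \<in> ?S" "y \<in> ?S" "g x = g y"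
    then have "\<phi> (of_vec x) = \<phi> (of_vec y)" unfolding g_def by (metis of_to_vec(1))
    then have "of_vec x = of_vec y" using xy E(2) \<phi>(4) by (auto dest: inj_onD)
    then show "x = y" by (metis of_to_vec(2))
  qed
  have det: "\<bar>det (matrix (g' v))\<bar> = (cmod (deriv \<phi> (of_vec v)))\<^sup>2" for v
  proof -
    have "det (matrix (g' v)) = (Re (deriv \<phi> (of_vec v)))\<^sup>2 + (Im (deriv \<phi> (of_vec v)))\<^sup>2"
      by (simp add: det_2 matrix_def g'_def of_vec_def axis_def power2_eq_square)
    then show ?thesis by (simp add: cmod_power2)
  qed
  have img: "g ` ?S = of_vec -` (\<phi> ` E)"
  proof (intro equalityI subsetI)
    fix v assume "v \<in> g ` ?S"
    then obtain x where x: "of_vec x \<in> E" "v = g x" by auto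
    then have "of_vec v = \<phi> (of_vec x)" by (simp add: g_def)
    then show "v \<in> of_vec -` (\<phi> ` E)" using x(1) by auto
  next
    fix v assume "v \<in> of_vec -` (\<phi> ` E)"
    then obtain x where x: "x \<in> E" "of_vec v = \<phi> x" by auto
    have "g (to_vec x) = to_vec (of_vec v)" unfolding x(2) by (simp add: g_def)
    then have "v = g (to_vec x)" by simp
    then show "v \<in> g ` ?S" using x(1) by auto
  qed
  have ki: "integrable lborel (\<lambda>v. F (of_vec v))" and kI: "(LINT v|lborel. F (of_vec v)) = (LINT z|lborel. F z)"
    using Fi of_vec_measurable integrable_distr_eq[of of_vec lborel borel F] integral_distr[of of_vec lborel borel F]
    by (auto simp flip: lborel_complex_eq)
  have "((\<lambda>v. F (of_vec v)) has_integral (LINT z|lborel. F z)) UNIV"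
    using has_integral_integral_lborel[OF ki] unfolding kI .
  also have "(\<lambda>v. F (of_vec v)) = (\<lambda>v. if v \<in> ?S then \<bar>det (matrix (g' v))\<bar> else 0)"
    by (auto simp: F_def det fun_eq_iff)
  finally have "((\<lambda>v. \<bar>det (matrix (g' v))\<bar>) has_integral (LINT z|lborel. F z)) ?S"
    by (simp only: has_integral_restrict_UNIV)
  moreover have "?S \<in> sets lebesgue" using S by simp
  ultimately have m: "g ` ?S \<in> lmeasurable" "measure lebesgue (g ` ?S) = (LINT z|lborel. F z)"
    using has_measure_differentiable_image[of ?S g g'] der inj by blast+
  have vB: "of_vec -` (\<phi> ` E) \<in> sets borel" using measurable_sets_borel[OF of_vec_measurable E(3)] .
  have "emeasure lborel (\<phi> ` E) = emeasure lborel (of_vec -` (\<phi> ` E))"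
    using of_vec_measurable E(3) by (subst lborel_complex_eq, subst emeasure_distr) auto
  also have "\<dots> = emeasure lebesgue (g ` ?S)" unfolding img using vB by simp
  also have "\<dots> = ennreal (LINT z|lborel. F z)"
    using m emeasure_eq_measure2[OF m(1)] by simp
  also have "\<dots> = (\<integral>\<^sup>+ z. ennreal (F z) \<partial>lborel)"
    by (rule nn_integral_eq_integral[symmetric, OF Fi]) (auto simp: F_def)
  finally show ?thesis by (simp add: F_def)
qed

lemma injective_change_of_variables:
  fixes f :: "complex \<Rightarrow> complex"
  assumes \<phi>: "\<phi> holomorphic_on U" "open U" "bounded U" "inj_on \<phi> U" and bd: "\<And>z. z \<in> U \<Longrightarrow> cmod (deriv \<phi> z) \<le> M"
  defines "p \<equiv> \<lambda>z. if z \<in> U then \<phi> z else 0"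
  defines "d \<equiv> \<lambda>z. if z \<in> U then deriv \<phi> z else 0"
  shows "density lborel (indicator (\<phi> ` U)) = distr (density lborel (\<lambda>z. ennreal ((cmod (d z))\<^sup>2))) borel p"
    and "f \<in> borel_measurable borel \<Longrightarrow>
      (LINT \<omega>|lborel. indicator (\<phi> ` U) \<omega> *\<^sub>R f \<omega>) = (LINT z|lborel. (cmod (d z))\<^sup>2 *\<^sub>R f (p z))"
proof -
  have pm [measurable]: "p \<in> borel_measurable borel"
    unfolding p_def by (rule borel_extend_continuous[OF \<phi>(2) holomorphic_on_imp_continuous_on[OF \<phi>(1)]])
  have dm [measurable]: "d \<in> borel_measurable borel"
    unfolding d_def by (rule borel_extend_continuous[OF \<phi>(2) holomorphic_on_imp_continuous_on[OF holomorphic_deriv[OF \<phi>(1,2)]]])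
  have oU: "open (\<phi> ` U)" by (rule open_mapping_thm3[OF \<phi>(1,2,4)])
  have UB [measurable]: "U \<in> sets borel" "\<phi> ` U \<in> sets borel" using \<phi>(2) oU by auto
  show eq: "density lborel (indicator (\<phi> ` U)) = distr (density lborel (\<lambda>z. ennreal ((cmod (d z))\<^sup>2))) borel p"
  proof (rule measure_eqI)
    fix A assume "A \<in> sets (density lborel (indicator (\<phi> ` U)))"
    then have A [measurable]: "A \<in> sets borel" by simp
    define E where "E = U \<inter> p -` A"
    have E: "E \<in> sets borel" unfolding E_def using measurable_sets_borel[OF pm A] by auto
    have img: "\<phi> ` E = \<phi> ` U \<inter> A" by (auto simp: E_def p_def)
    have "emeasure (density lborel (indicator (\<phi> ` U))) A = emeasure lborel (\<phi> ` U \<inter> A)"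
      by (subst emeasure_density) (auto simp: indicator_inter_arith[symmetric] Int_commute)
    also have "\<dots> = (\<integral>\<^sup>+ z. ennreal (indicator E z * (cmod (deriv \<phi> z))\<^sup>2) \<partial>lborel)"
    proof -
      have "\<phi> ` E \<in> sets borel" unfolding img using UB A by blast
      moreover have "E \<subseteq> U" by (simp add: E_def)
      ultimately show ?thesis unfolding img[symmetric] using emeasure_injective_image[OF \<phi> bd E] by blast
    qed
    also have "\<dots> = (\<integral>\<^sup>+ z. ennreal ((cmod (d z))\<^sup>2) * indicator (p -` A) z \<partial>lborel)"
      by (intro nn_integral_cong) (auto simp: E_def d_def indicator_def)
    also have "\<dots> = emeasure (distr (density lborel (\<lambda>z. ennreal ((cmod (d z))\<^sup>2))) borel p) A"
      using measurable_sets_borel[OF pm A] by (simp add: emeasure_distr emeasure_density)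
    finally show "emeasure (density lborel (indicator (\<phi> ` U))) A =
      emeasure (distr (density lborel (\<lambda>z. ennreal ((cmod (d z))\<^sup>2))) borel p) A" .
  qed simp
  assume f [measurable]: "f \<in> borel_measurable borel"
  have "(LINT \<omega>|lborel. indicator (\<phi> ` U) \<omega> *\<^sub>R f \<omega>) = integral\<^sup>L (density lborel (\<lambda>\<omega>. ennreal (indicator (\<phi> ` U) \<omega>))) f"
    by (subst integral_density) auto
  also have "(\<lambda>\<omega>. ennreal (indicator (\<phi> ` U) \<omega>)) = indicator (\<phi> ` U)" by (auto simp: indicator_def)
  also have "integral\<^sup>L (density lborel (indicator (\<phi> ` U))) f = (LINT z|density lborel (\<lambda>z. ennreal ((cmod (d z))\<^sup>2)). f (p z))"
    unfolding eq by (subst integral_distr) auto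
  also have "\<dots> = (LINT z|lborel. (cmod (d z))\<^sup>2 *\<^sub>R f (p z))"
    by (subst integral_density) auto
  finally show "(LINT \<omega>|lborel. indicator (\<phi> ` U) \<omega> *\<^sub>R f \<omega>) = (LINT z|lborel. (cmod (d z))\<^sup>2 *\<^sub>R f (p z))" .
qed

lemma locally_injective_disc:
  assumes \<phi>: "\<phi> holomorphic_on S" "open S" and z0: "z0 \<in> S" "deriv \<phi> z0 \<noteq> 0"
  obtains r where "0 < r" "cball z0 (3 * r) \<subseteq> S" "inj_on \<phi> (ball z0 (3 * r))"
proof -
  obtain R where R: "R > 0" "ball z0 R \<subseteq> S" "inj_on \<phi> (ball z0 R)"
    using has_complex_derivative_locally_injective[OF \<phi>(1) z0(1) \<phi>(2) z0(2)] by blast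
  have "cball z0 (3 * (R / 6)) \<subseteq> ball z0 R" using R by auto
  moreover have "inj_on \<phi> (ball z0 (3 * (R / 6)))" using R(1) by (intro inj_on_subset[OF R(3)]) auto
  ultimately show ?thesis using R by (intro that[of "R / 6"]) auto
qed

text \<open>The two Cauchy kernels have the same singularity at \<open>\<zeta>\<close>, so their difference extends holomorphically over it. Written as a
  divided difference it is bounded uniformly in \<open>\<zeta>\<close>, which makes it integrable against densities.\<close>

lemma divided_difference_kernel:
  assumes \<phi>: "\<phi> holomorphic_on ball z0 (3 * r)" "inj_on \<phi> (ball z0 (3 * r))" and r: "0 < r"
  obtains \<kappa> C where
    "\<And>\<zeta>. \<zeta> \<in> ball z0 r \<Longrightarrow> \<kappa> \<zeta> holomorphic_on ball z0 r"
    "\<And>z \<zeta>. \<zeta> \<in> ball z0 r \<Longrightarrow> z \<noteq> \<zeta> \<Longrightarrow> \<kappa> \<zeta> z = deriv \<phi> \<zeta> / (\<phi> z - \<phi> \<zeta>) - 1 / (z - \<zeta>)"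
    "\<And>z \<zeta>. \<zeta> \<in> ball z0 r \<Longrightarrow> z \<in> ball z0 r \<Longrightarrow> cmod (\<kappa> \<zeta> z) \<le> C"
proof -
  let ?V = "ball z0 (3 * r)"
  define D where "D \<zeta> z = (if z = \<zeta> then deriv \<phi> \<zeta> else (\<phi> z - \<phi> \<zeta>) / (z - \<zeta>))" for \<zeta> z
  define E where "E \<zeta> z = deriv \<phi> \<zeta> / D \<zeta> z" for \<zeta> z
  define \<kappa> where "\<kappa> \<zeta> z = (if z = \<zeta> then deriv (E \<zeta>) \<zeta> else (E \<zeta> z - E \<zeta> \<zeta>) / (z - \<zeta>))" for \<zeta> z
  have sub: "ball z0 r \<subseteq> ?V" using r by auto
  have nz: "deriv \<phi> \<zeta> \<noteq> 0" if "\<zeta> \<in> ?V" for \<zeta> by (rule holomorphic_injective_imp_regular[OF \<phi>(1) open_ball \<phi>(2) that])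
  have Dnz: "D \<zeta> z \<noteq> 0" if "\<zeta> \<in> ?V" "z \<in> ?V" for \<zeta> z
    using nz[OF that(1)] inj_onD[OF \<phi>(2), of z \<zeta>] that by (auto simp: D_def)
  have Dh: "D \<zeta> holomorphic_on ?V" for \<zeta>
    unfolding D_def[abs_def] by (rule pole_lemma_open[OF \<phi>(1) open_ball])
  have Eh: "E \<zeta> holomorphic_on ?V" if "\<zeta> \<in> ?V" for \<zeta>
    unfolding E_def[abs_def] using Dnz[OF that] by (intro holomorphic_intros Dh) auto
  have \<kappa>h: "\<kappa> \<zeta> holomorphic_on ?V" if "\<zeta> \<in> ?V" for \<zeta>
    unfolding \<kappa>_def[abs_def] by (rule pole_lemma_open[OF Eh[OF that] open_ball])
  have \<kappa>_eq: "\<kappa> \<zeta> z = deriv \<phi> \<zeta> / (\<phi> z - \<phi> \<zeta>) - 1 / (z - \<zeta>)" if "\<zeta> \<in> ?V" "z \<noteq> \<zeta>" for z \<zeta>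
  proof -
    have "E \<zeta> \<zeta> = 1" using nz[OF that(1)] by (simp add: E_def D_def)
    moreover have "E \<zeta> z = deriv \<phi> \<zeta> * (z - \<zeta>) / (\<phi> z - \<phi> \<zeta>)" using that by (simp add: E_def D_def)
    ultimately show ?thesis using that by (simp add: \<kappa>_def diff_divide_distrib)
  qed
  have cont: "continuous_on (cball z0 (2 * r)) \<phi>"
    using r by (intro continuous_on_subset[OF holomorphic_on_imp_continuous_on[OF \<phi>(1)]]) auto
  define A where "A = sphere z0 (2 * r) \<times> cball z0 r"
  have c1: "continuous_on A (\<lambda>x. cmod (\<phi> (fst x) - \<phi> (snd x)))" unfolding A_def
    using r by (intro continuous_intros continuous_on_compose2[OF cont]) auto
  have c2: "compact A" unfolding A_def by (intro compact_Times) auto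
  have c3: "A \<noteq> {}" unfolding A_def using r by simp
  from continuous_attains_inf[OF c2 c3 c1] obtain x where x0: "x \<in> A"
    and x2: "\<forall>y\<in>A. cmod (\<phi> (fst x) - \<phi> (snd x)) \<le> cmod (\<phi> (fst y) - \<phi> (snd y))" by (rule bexE)
  have x: "x \<in> sphere z0 (2 * r) \<times> cball z0 r" using x0 unfolding A_def .
  define \<delta> where "\<delta> = cmod (\<phi> (fst x) - \<phi> (snd x))"
  have xs: "dist z0 (fst x) = 2 * r" "dist z0 (snd x) \<le> r" using x by (auto simp: mem_Times_iff)
  then have "fst x \<noteq> snd x" using r by auto
  moreover have "fst x \<in> ?V" "snd x \<in> ?V" using xs r by auto
  ultimately have "\<phi> (fst x) \<noteq> \<phi> (snd x)" using inj_onD[OF \<phi>(2)] by blast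
  then have \<delta>: "0 < \<delta>" by (simp add: \<delta>_def)
  have "compact (deriv \<phi> ` cball z0 r)"
    using r by (intro compact_continuous_image continuous_on_subset[OF holomorphic_on_imp_continuous_on[OF holomorphic_deriv[OF \<phi>(1) open_ball]]]) auto
  then obtain M where M: "\<And>\<zeta>. \<zeta> \<in> cball z0 r \<Longrightarrow> cmod (deriv \<phi> \<zeta>) \<le> M" by (meson compact_imp_bounded bounded_iff imageI)
  have bound: "cmod (\<kappa> \<zeta> z) \<le> M / \<delta> + 1 / r" if \<zeta>: "\<zeta> \<in> ball z0 r" and z: "z \<in> ball z0 r" for z \<zeta>
  proof (rule maximum_modulus_frontier[of "\<kappa> \<zeta>" "cball z0 (2 * r)"])
    have \<zeta>V: "\<zeta> \<in> ?V" using \<zeta> sub by blast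
    show "\<kappa> \<zeta> holomorphic_on interior (cball z0 (2 * r))"
      using r by (intro holomorphic_on_subset[OF \<kappa>h[OF \<zeta>V]]) auto
    show "continuous_on (closure (cball z0 (2 * r))) (\<kappa> \<zeta>)"
      using r by (intro continuous_on_subset[OF holomorphic_on_imp_continuous_on[OF \<kappa>h[OF \<zeta>V]]]) auto
    fix y assume "y \<in> frontier (cball z0 (2 * r))"
    then have y: "dist z0 y = 2 * r" using r by auto
    have far: "r \<le> cmod (y - \<zeta>)"
      using y \<zeta> dist_triangle[of z0 y \<zeta>] by (auto simp: dist_norm norm_minus_commute)
    then have ne: "y \<noteq> \<zeta>" using r by auto
    have "\<delta> \<le> cmod (\<phi> y - \<phi> \<zeta>)" using bspec[OF x2, of "(y, \<zeta>)"] y \<zeta> by (auto simp: \<delta>_def A_def)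
    then have "cmod (deriv \<phi> \<zeta> / (\<phi> y - \<phi> \<zeta>)) \<le> M / \<delta>"
      unfolding norm_divide using M[of \<zeta>] \<zeta> \<delta> by (intro frac_le) (auto intro: order_trans[OF norm_ge_zero])
    moreover have "cmod (1 / (y - \<zeta>)) \<le> 1 / r" unfolding norm_divide using far r by (intro frac_le) auto
    ultimately show "cmod (\<kappa> \<zeta> y) \<le> M / \<delta> + 1 / r"
      unfolding \<kappa>_eq[OF \<zeta>V ne] by (intro order_trans[OF norm_triangle_ineq4] add_mono)
  qed (use z r in auto)
  show ?thesis
  proof (rule that[of \<kappa> "M / \<delta> + 1 / r"])
    fix \<zeta> assume "\<zeta> \<in> ball z0 r"
    then have \<zeta>V: "\<zeta> \<in> ?V" using sub by blast
    show "\<kappa> \<zeta> holomorphic_on ball z0 r" by (rule holomorphic_on_subset[OF \<kappa>h[OF \<zeta>V] sub])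
    show "\<kappa> \<zeta> z = deriv \<phi> \<zeta> / (\<phi> z - \<phi> \<zeta>) - 1 / (z - \<zeta>)" if "z \<noteq> \<zeta>" for z by (rule \<kappa>_eq[OF \<zeta>V that])
  qed (rule bound)
qed

lemma pullback_density:
  assumes \<phi>: "\<phi> holomorphic_on S" "open S" and bd: "\<And>z. z \<in> S \<Longrightarrow> cmod (deriv \<phi> z) \<le> D"
    and \<beta>: "\<beta> \<in> density_on Z M"
  shows "(\<lambda>z. if z \<in> S then pullback_coeff \<phi> \<beta> z else 0) \<in> density_on S (M * \<bar>D\<bar>)"
proof (rule density_onI)
  have [measurable]: "(\<lambda>z. if z \<in> S then \<phi> z else 0) \<in> borel_measurable borel"
    by (rule borel_extend_continuous[OF \<phi>(2) holomorphic_on_imp_continuous_on[OF \<phi>(1)]])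
  have [measurable]: "(\<lambda>z. if z \<in> S then cnj (deriv \<phi> z) else 0) \<in> borel_measurable borel"
    by (intro borel_extend_continuous[OF \<phi>(2)] continuous_intros holomorphic_on_imp_continuous_on holomorphic_deriv \<phi>)
  note [measurable] = density_on_measurable[OF \<beta>]
  have "(\<lambda>z. if z \<in> S then pullback_coeff \<phi> \<beta> z else 0) =
    (\<lambda>z. \<beta> (if z \<in> S then \<phi> z else 0) * (if z \<in> S then cnj (deriv \<phi> z) else 0))"
    by (auto simp: pullback_coeff_def)
  also have "\<dots> \<in> borel_measurable borel" by measurable
  finally show "(\<lambda>z. if z \<in> S then pullback_coeff \<phi> \<beta> z else 0) \<in> borel_measurable borel" .
  show "cmod (if z \<in> S then pullback_coeff \<phi> \<beta> z else 0) \<le> M * \<bar>D\<bar>" for z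
    using bd[of z] density_on_bound[OF \<beta>, of "\<phi> z"] density_on_nonneg[OF \<beta>]
    by (auto simp: pullback_coeff_def norm_mult intro!: mult_mono)
qed simp

text \<open>Substituting \<open>\<phi>\<close> into the part of the integral over the image of a small disc turns the kernel
  \<open>1 / (\<phi> z - \<omega>)\<close> into \<open>(cmod (deriv \<phi> \<zeta>))\<^sup>2 / (\<phi> z - \<phi> \<zeta>)\<close>, which is \<open>cnj (deriv \<phi> \<zeta>)\<close> times the Cauchy kernel up to a bounded kernel that is holomorphic in
  \<open>z\<close>. The remaining parts of both transforms have densities vanishing near the point in question.\<close>

lemma chain_rule_near_regular_point:
  assumes \<phi>: "\<phi> holomorphic_on S" "open S" "bounded S" and bd: "\<And>z. z \<in> S \<Longrightarrow> cmod (deriv \<phi> z) \<le> D"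
    and Z: "Z \<in> sets borel" "bounded Z" and \<beta>: "\<beta> \<in> density_on Z M"
    and z0: "z0 \<in> S" "deriv \<phi> z0 \<noteq> 0"
  defines "\<beta>' \<equiv> \<lambda>z. if z \<in> S then pullback_coeff \<phi> \<beta> z else 0"
  shows "\<exists>e>0. (\<lambda>z. cauchy_transform \<beta> (\<phi> z) - cauchy_transform \<beta>' z) holomorphic_on ball z0 e"
proof -
  let ?C = "complex_of_real cauchy_mass"
  have C: "?C \<noteq> 0" using cauchy_mass_pos by simp
  obtain r where r: "0 < r" "cball z0 (3 * r) \<subseteq> S" "inj_on \<phi> (ball z0 (3 * r))"
    using locally_injective_disc[OF \<phi>(1,2) z0] by blast
  let ?B = "ball z0 r"
  have BS: "?B \<subseteq> S" "ball z0 (3 * r) \<subseteq> S" using r by (auto simp: subset_eq)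
  have BV: "?B \<subseteq> ball z0 (3 * r)" using r(1) by auto
  have \<phi>B: "\<phi> holomorphic_on ?B" "\<phi> holomorphic_on ball z0 (3 * r)" "inj_on \<phi> ?B"
    using \<phi>(1) BS BV r(3) by (auto intro: holomorphic_on_subset inj_on_subset)
  obtain \<kappa> K where \<kappa>: "\<And>\<zeta>. \<zeta> \<in> ?B \<Longrightarrow> \<kappa> \<zeta> holomorphic_on ?B"
    "\<And>z \<zeta>. \<zeta> \<in> ?B \<Longrightarrow> z \<noteq> \<zeta> \<Longrightarrow> \<kappa> \<zeta> z = deriv \<phi> \<zeta> / (\<phi> z - \<phi> \<zeta>) - 1 / (z - \<zeta>)"
    "\<And>z \<zeta>. \<zeta> \<in> ?B \<Longrightarrow> z \<in> ?B \<Longrightarrow> cmod (\<kappa> \<zeta> z) \<le> K"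
    using divided_difference_kernel[OF \<phi>B(2) r(3,1)] by blast
  have SB: "S \<in> sets borel" using \<phi>(2) by simp
  have oB: "open (\<phi> ` ?B)" by (rule open_mapping_thm3[OF \<phi>B(1) open_ball \<phi>B(3)])
  have [measurable]: "\<phi> ` ?B \<in> sets borel" "?B \<in> sets borel" using oB by auto
  note [measurable] = density_on_measurable[OF \<beta>]
  have \<beta>': "\<beta>' \<in> density_on S (M * \<bar>D\<bar>)" unfolding \<beta>'_def by (rule pullback_density[OF \<phi>(1,2) bd \<beta>])
  note [measurable] = density_on_measurable[OF \<beta>']
  define bi bo where "bi \<omega> = indicator (\<phi> ` ?B) \<omega> * \<beta> \<omega>" and "bo \<omega> = indicator (- \<phi> ` ?B) \<omega> * \<beta> \<omega>" for \<omega>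
  have bi: "bi \<in> density_on Z M" and bo: "bo \<in> density_on Z M"
    unfolding bi_def[abs_def] bo_def[abs_def] using density_onD[OF \<beta>]
    by (auto intro!: density_onI simp: indicator_def)
  define gi go where "gi \<zeta> = indicator ?B \<zeta> * \<beta>' \<zeta>" and "go \<zeta> = indicator (- ?B) \<zeta> * \<beta>' \<zeta>" for \<zeta>
  have gi: "gi \<in> density_on S (M * \<bar>D\<bar>)" and go: "go \<in> density_on S (M * \<bar>D\<bar>)"
    unfolding gi_def[abs_def] go_def[abs_def] using density_onD[OF \<beta>']
    by (auto intro!: density_onI simp: indicator_def)
  have T\<beta>: "cauchy_transform \<beta> \<omega> = cauchy_transform bi \<omega> + cauchy_transform bo \<omega>" for \<omega>
    unfolding cauchy_transform_add[OF Z bi bo, symmetric]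
    by (rule cauchy_transform_cong) (auto simp: bi_def bo_def indicator_def)
  have T\<beta>': "cauchy_transform \<beta>' z = cauchy_transform gi z + cauchy_transform go z" for z
    unfolding cauchy_transform_add[OF SB \<phi>(3) gi go, symmetric]
    by (rule cauchy_transform_cong) (auto simp: gi_def go_def indicator_def)
  have "cauchy_transform bo holomorphic_on \<phi> ` ?B"
    by (rule cauchy_transform_holomorphic[OF Z bo oB]) (simp add: bo_def)
  then have hol1: "(\<lambda>z. cauchy_transform bo (\<phi> z)) holomorphic_on ?B"
    using holomorphic_on_compose[OF \<phi>B(1)] by (simp add: comp_def)
  have hol2: "cauchy_transform go holomorphic_on ?B"
    by (rule cauchy_transform_holomorphic[OF SB \<phi>(3) go open_ball]) (simp add: go_def)
  define k where "k z \<zeta> = (if \<zeta> \<in> ?B then gi \<zeta> * \<kappa> \<zeta> z else 0)" for z \<zeta>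
  have [measurable]: "(\<lambda>z. if z \<in> ?B then \<phi> z else 0) \<in> borel_measurable borel"
    "(\<lambda>z. if z \<in> ?B then deriv \<phi> z else 0) \<in> borel_measurable borel"
    by (intro borel_extend_continuous holomorphic_on_imp_continuous_on holomorphic_deriv \<phi>B open_ball)+
  note [measurable] = density_on_measurable[OF gi]
  define k' where "k' z \<zeta> = gi \<zeta> * ((if \<zeta> \<in> ?B then deriv \<phi> \<zeta> else 0) / (\<phi> z - (if \<zeta> \<in> ?B then \<phi> \<zeta> else 0)) - 1 / (z - \<zeta>))" for z \<zeta>
  have k'm [measurable]: "k' z \<in> borel_measurable borel" for z unfolding k'_def[abs_def] by measurable
  have kk': "k z \<zeta> = k' z \<zeta>" if "\<zeta> \<noteq> z" for z \<zeta>
    using \<kappa>(2)[of \<zeta> z] that by (cases "\<zeta> \<in> ?B") (auto simp: k_def k'_def gi_def)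
  have km: "k z \<in> borel_measurable lborel" for z
  proof -
    have "k z = (\<lambda>\<zeta>. if \<zeta> = z then k z z else k' z \<zeta>)" using kk' by (auto simp: fun_eq_iff)
    also have "\<dots> \<in> borel_measurable lborel" by measurable
    finally show ?thesis .
  qed
  have hol3: "(\<lambda>z. LINT \<zeta>|lborel. k z \<zeta>) holomorphic_on ?B"
  proof (rule holomorphic_integral[OF open_ball _ km])
    show "(\<lambda>z. k z \<zeta>) holomorphic_on ?B" for \<zeta>
      unfolding k_def using \<kappa>(1) by (cases "\<zeta> \<in> ?B") (auto intro!: holomorphic_intros)
    show "cmod (k z \<zeta>) \<le> cmod (gi \<zeta>) * \<bar>K\<bar>" if "z \<in> ?B" for z \<zeta>
      using \<kappa>(3)[OF _ that, of \<zeta>] by (auto simp: k_def norm_mult intro!: mult_left_mono)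
    show "integrable lborel (\<lambda>\<zeta>. cmod (gi \<zeta>) * \<bar>K\<bar>)"
      using density_integrable[OF SB \<phi>(3) gi] by auto
  qed
  have eq: "(LINT \<zeta>|lborel. k z \<zeta>) = ?C * (cauchy_transform bi (\<phi> z) - cauchy_transform gi z)" if z: "z \<in> ?B" for z
  proof -
    define p d where "p \<zeta> = (if \<zeta> \<in> ?B then \<phi> \<zeta> else 0)" and "d \<zeta> = (if \<zeta> \<in> ?B then deriv \<phi> \<zeta> else 0)" for \<zeta>
    have bdB: "cmod (deriv \<phi> \<zeta>) \<le> D" if "\<zeta> \<in> ?B" for \<zeta> using bd BS that by blast
    have fm: "(\<lambda>\<omega>. \<beta> \<omega> / (\<phi> z - \<omega>)) \<in> borel_measurable borel" by measurable
    have pt: "(cmod (d \<zeta>))\<^sup>2 *\<^sub>R (\<beta> (p \<zeta>) / (\<phi> z - p \<zeta>)) = gi \<zeta> * (d \<zeta> / (\<phi> z - p \<zeta>))" for \<zeta>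
    proof (cases "\<zeta> \<in> ?B")
      case True
      then have "\<zeta> \<in> S" using BS by blast
      have "of_real ((cmod (d \<zeta>))\<^sup>2) = d \<zeta> * cnj (d \<zeta>)" by (simp add: complex_norm_square del: of_real_power)
      then show ?thesis using True \<open>\<zeta> \<in> S\<close>
        by (simp add: gi_def \<beta>'_def pullback_coeff_def p_def d_def scaleR_conv_of_real del: of_real_power)
    qed (simp add: gi_def d_def)
    have "?C * cauchy_transform bi (\<phi> z) = (LINT \<omega>|lborel. indicator (\<phi> ` ?B) \<omega> *\<^sub>R (\<beta> \<omega> / (\<phi> z - \<omega>)))"
    proof -
      have "(LINT \<omega>|lborel. bi \<omega> / (\<phi> z - \<omega>)) = (LINT \<omega>|lborel. indicator (\<phi> ` ?B) \<omega> *\<^sub>R (\<beta> \<omega> / (\<phi> z - \<omega>)))"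
        by (rule Bochner_Integration.integral_cong[OF refl]) (auto simp: bi_def indicator_def)
      then show ?thesis using C by (simp add: cauchy_transform_def)
    qed
    also have "\<dots> = (LINT \<zeta>|lborel. (cmod (d \<zeta>))\<^sup>2 *\<^sub>R (\<beta> (p \<zeta>) / (\<phi> z - p \<zeta>)))"
      using injective_change_of_variables(2)[OF \<phi>B(1) open_ball bounded_ball \<phi>B(3) bdB fm] unfolding p_def d_def .
    also have "\<dots> = (LINT \<zeta>|lborel. gi \<zeta> * (d \<zeta> / (\<phi> z - p \<zeta>)))" unfolding pt ..
    finally have 1: "?C * cauchy_transform bi (\<phi> z) = (LINT \<zeta>|lborel. gi \<zeta> * (d \<zeta> / (\<phi> z - p \<zeta>)))" .
    have 2: "?C * cauchy_transform gi z = (LINT \<zeta>|lborel. gi \<zeta> / (z - \<zeta>))" using C by (simp add: cauchy_transform_def)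
    have ae: "AE \<zeta> in lborel. k z \<zeta> + gi \<zeta> / (z - \<zeta>) = gi \<zeta> * (d \<zeta> / (\<phi> z - p \<zeta>))"
      using AE_lborel_singleton[of z]
    proof eventually_elim
      case (elim \<zeta>)
      show ?case unfolding kk'[OF elim] k'_def p_def[symmetric] d_def[symmetric] by (simp add: right_diff_distrib)
    qed
    have ki: "integrable lborel (k z)"
    proof (rule Bochner_Integration.integrable_bound[of lborel "\<lambda>\<zeta>. cmod (gi \<zeta>) * \<bar>K\<bar>", OF _ km])
      show "integrable lborel (\<lambda>\<zeta>. cmod (gi \<zeta>) * \<bar>K\<bar>)" using density_integrable[OF SB \<phi>(3) gi] by auto
      have "norm (k z \<zeta>) \<le> norm (cmod (gi \<zeta>) * \<bar>K\<bar>)" for \<zeta>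
        using \<kappa>(3)[OF _ z, of \<zeta>] by (auto simp: k_def norm_mult abs_mult intro!: mult_left_mono)
      then show "AE \<zeta> in lborel. norm (k z \<zeta>) \<le> norm (cmod (gi \<zeta>) * \<bar>K\<bar>)" by (intro AE_I2)
    qed
    have pm: "p \<in> borel_measurable borel" "d \<in> borel_measurable borel" unfolding p_def[abs_def] d_def[abs_def] by measurable
    note gz = cauchy_integrable[OF SB \<phi>(3) gi, of z]
    have "(LINT \<zeta>|lborel. k z \<zeta>) + (LINT \<zeta>|lborel. gi \<zeta> / (z - \<zeta>)) = (LINT \<zeta>|lborel. k z \<zeta> + gi \<zeta> / (z - \<zeta>))"
      by (rule Bochner_Integration.integral_add[symmetric, OF ki gz])
    also have "\<dots> = (LINT \<zeta>|lborel. gi \<zeta> * (d \<zeta> / (\<phi> z - p \<zeta>)))"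
      by (rule integral_cong_AE[OF _ _ ae]) (use km pm in measurable)
    finally show ?thesis unfolding right_diff_distrib 1 2 by (simp add: algebra_simps)
  qed
  have "(\<lambda>z. (LINT \<zeta>|lborel. k z \<zeta>) / ?C + (cauchy_transform bo (\<phi> z) - cauchy_transform go z)) holomorphic_on ?B"
    using C by (intro holomorphic_intros hol1 hol2 hol3)
  moreover have "(LINT \<zeta>|lborel. k z \<zeta>) / ?C + (cauchy_transform bo (\<phi> z) - cauchy_transform go z)
      = cauchy_transform \<beta> (\<phi> z) - cauchy_transform \<beta>' z" if "z \<in> ?B" for z
    unfolding eq[OF that] T\<beta> T\<beta>' using C by simp
  ultimately have "(\<lambda>z. cauchy_transform \<beta> (\<phi> z) - cauchy_transform \<beta>' z) holomorphic_on ?B"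
    by (rule holomorphic_transform)
  then show ?thesis using r(1) by blast
qed

text \<open>Both sides have the same \<open>dbar\<close> derivative by the chain rule. Zeros of \<open>deriv \<phi>\<close> are isolated when \<open>\<phi>\<close> is not
  constant, and the difference is continuous, so they are removable singularities.\<close>

theorem cauchy_transform_chain_rule:
  assumes \<phi>: "\<phi> holomorphic_on S" "open S" "bounded S" "connected S" and bd: "\<And>z. z \<in> S \<Longrightarrow> cmod (deriv \<phi> z) \<le> D"
    and Z: "Z \<in> sets borel" "bounded Z" and \<beta>: "\<beta> \<in> density_on Z M"
  defines "\<beta>' \<equiv> \<lambda>z. if z \<in> S then pullback_coeff \<phi> \<beta> z else 0"
  shows "(\<lambda>z. cauchy_transform \<beta> (\<phi> z) - cauchy_transform \<beta>' z) holomorphic_on S" (is "?u holomorphic_on S")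
proof (cases "\<exists>w\<in>S. deriv \<phi> w \<noteq> 0")
  case False
  then have d0: "\<And>z. z \<in> S \<Longrightarrow> deriv \<phi> z = 0" by blast
  then have "\<beta>' = (\<lambda>_. 0)" by (auto simp: \<beta>'_def pullback_coeff_def fun_eq_iff)
  then have 0: "cauchy_transform \<beta>' z = 0" for z by (simp add: cauchy_transform_def)
  have "(\<phi> has_field_derivative 0) (at z)" if "z \<in> S" for z
    using holomorphic_derivI[OF \<phi>(1,2) that] d0[OF that] by simp
  then obtain c where c: "\<And>z. z \<in> S \<Longrightarrow> \<phi> z = c"
    using DERIV_zero_connected_constant[OF \<phi>(4,2) finite.emptyI holomorphic_on_imp_continuous_on[OF \<phi>(1)]] by blast
  have "?u z = cauchy_transform \<beta> c" if "z \<in> S" for z using 0 c[OF that] by simp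
  then show ?thesis by (intro holomorphic_transform[OF holomorphic_on_const[of "cauchy_transform \<beta> c"]]) auto
next
  case True
  then obtain w where w: "w \<in> S" "deriv \<phi> w \<noteq> 0" by blast
  have SB: "S \<in> sets borel" using \<phi>(2) by simp
  have \<beta>': "\<beta>' \<in> density_on S (M * \<bar>D\<bar>)" unfolding \<beta>'_def by (rule pullback_density[OF \<phi>(1,2) bd \<beta>])
  have "continuous_on S (\<lambda>z. cauchy_transform \<beta> (\<phi> z))"
    by (rule continuous_on_compose2[OF cauchy_transform_continuous[OF Z \<beta>] holomorphic_on_imp_continuous_on[OF \<phi>(1)]]) simp
  moreover have "continuous_on S (cauchy_transform \<beta>')"
    by (rule continuous_on_subset[OF cauchy_transform_continuous[OF SB \<phi>(3) \<beta>']]) simp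
  ultimately have cont: "continuous_on S ?u" by (intro continuous_intros)
  have reg: "\<exists>e>0. ?u holomorphic_on ball z e" if "z \<in> S" "deriv \<phi> z \<noteq> 0" for z
    unfolding \<beta>'_def by (rule chain_rule_near_regular_point[OF \<phi>(1-3) bd Z \<beta> that])
  show ?thesis
  proof (rule holomorphic_onI_local[OF \<phi>(2)])
    fix z assume z: "z \<in> S"
    show "\<exists>e>0. ?u holomorphic_on ball z e"
    proof (cases "deriv \<phi> z = 0")
      case True
      obtain r where r: "0 < r" "ball z r \<subseteq> S" "\<And>y. y \<in> ball z r - {z} \<Longrightarrow> deriv \<phi> y \<noteq> 0"
        using isolated_zeros[OF holomorphic_deriv[OF \<phi>(1,2)] \<phi>(2,4) z True w] by blast
      have "?u holomorphic_on ball z r - {z}"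
      proof (rule holomorphic_onI_local)
        fix y assume y: "y \<in> ball z r - {z}"
        then show "\<exists>e>0. ?u holomorphic_on ball y e" using r reg[of y] by blast
      qed auto
      then have "?u holomorphic_on ball z r"
        by (intro no_isolated_singularity[of "ball z r" ?u "{z}"] continuous_on_subset[OF cont r(2)]) auto
      then show ?thesis using r(1) by blast
    qed (rule reg[OF z])
  qed
qed

section \<open>Composition of solutions with holomorphic maps\<close>

text \<open>If the derivative exceeded the bound \<open>M\<close> of its weak counterpart at a point, then, after a rotation, its real
  part would exceed \<open>M\<close> on a disc; integration by parts against a plateau function on this disc is contradictory.\<close>

lemma W1_inf_deriv_bounded:
  assumes W: "\<phi> \<in> W1_inf S" and \<phi>: "\<phi> holomorphic_on S" "open S"
  obtains M where "\<And>z. z \<in> S \<Longrightarrow> cmod (deriv \<phi> z) \<le> M"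
proof -
  have SB: "S \<in> sets borel" using \<phi>(2) by simp
  obtain g where g: "g \<in> L_inf S"
    and weak: "\<And>\<psi>. \<psi> \<in> test_functions S \<Longrightarrow> (LINT z|lebesgue_on S. \<phi> z * dx \<psi> z) = - (LINT z|lebesgue_on S. g z * \<psi> z)"
    using W unfolding W1_inf_def by blast
  obtain g' M where g': "g' \<in> density_on S M" "AE z in lborel. z \<in> S \<longrightarrow> g z = g' z" using L_inf_density[OF g SB] .
  have c\<phi>: "continuous_on S \<phi>" "continuous_on S (deriv \<phi>)"
    using \<phi> holomorphic_on_imp_continuous_on holomorphic_deriv by blast+
  have "cmod (deriv \<phi> z0) \<le> M" if z0: "z0 \<in> S" for z0
  proof (rule ccontr)
    assume big: "\<not> cmod (deriv \<phi> z0) \<le> M"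
    then have nz: "deriv \<phi> z0 \<noteq> 0" using density_on_nonneg[OF g'(1)] by auto
    define u where "u = cnj (deriv \<phi> z0) / of_real (cmod (deriv \<phi> z0))"
    have u1: "cmod u = 1" using nz by (simp add: u_def norm_divide)
    have "u * deriv \<phi> z0 = of_real (cmod (deriv \<phi> z0))"
      using nz complex_norm_square[of "deriv \<phi> z0"] by (simp add: u_def field_simps power2_eq_square)
    then have "M < Re (u * deriv \<phi> z0)" using big by simp
    moreover have "continuous_on S (\<lambda>z. Re (u * deriv \<phi> z))" by (intro continuous_intros c\<phi>)
    then have "isCont (\<lambda>z. Re (u * deriv \<phi> z)) z0" using \<phi>(2) z0 continuous_on_eq_continuous_at by blast
    then have "((\<lambda>z. Re (u * deriv \<phi> z)) \<longlongrightarrow> Re (u * deriv \<phi> z0)) (at z0)" by (simp add: isCont_def)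
    ultimately have "\<forall>\<^sub>F z in at z0. M < Re (u * deriv \<phi> z)" by (intro order_tendstoD(1))
    then obtain e1 where e1': "e1 > 0" "\<And>z. z \<noteq> z0 \<Longrightarrow> dist z z0 < e1 \<Longrightarrow> M < Re (u * deriv \<phi> z)"
      unfolding eventually_at by blast
    have e1: "e1 > 0" "\<And>z. dist z z0 < e1 \<Longrightarrow> M < Re (u * deriv \<phi> z)"
    proof -
      fix z assume "dist z z0 < e1"
      then show "M < Re (u * deriv \<phi> z)" using e1'(2)[of z] \<open>M < Re (u * deriv \<phi> z0)\<close> by (cases "z = z0") auto
    qed (rule e1')
    obtain e2 where e2: "e2 > 0" "cball z0 e2 \<subseteq> S" using \<phi>(2) z0 open_contains_cball by blast
    define \<rho> where "\<rho> = min e1 e2 / 4"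
    have \<rho>: "0 < \<rho>" "4 * \<rho> \<le> e1" "4 * \<rho> \<le> e2" using e1 e2 by (auto simp: \<rho>_def)
    have sub: "cball z0 (2 * \<rho>) \<subseteq> S" using e2 \<rho> by (auto simp: subset_iff)
    define \<kappa> where "\<kappa> z = complex_of_real (bump z0 \<rho> z)" for z
    have \<kappa>: "\<kappa> \<in> test_functions S" unfolding \<kappa>_def[abs_def] by (rule bump_as_test_function[OF \<rho>(1) sub])
    note t = test_functionsD[OF \<kappa>]
    let ?K = "closure {z. \<kappa> z \<noteq> 0}"
    have KB: "?K \<in> sets borel" "bounded ?K" using t(2) by (auto intro: compact_imp_bounded)
    have KZ: "?K \<subseteq> cball z0 (2 * \<rho>)"
      using test_functionsD(3)[OF bump_as_test_function[OF \<rho>(1) order_refl]] unfolding \<kappa>_def .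
    obtain B where B: "\<kappa> \<in> density_on ?K B" "dx \<kappa> \<in> density_on ?K B" using test_density[OF \<kappa>] by blast
    obtain N1 where N1: "(\<lambda>z. \<phi> z * dx \<kappa> z) \<in> density_on ?K N1" using density_compact_product[OF t(2,3) \<phi>(2) c\<phi>(1) B(2)] .
    obtain N2 where N2: "(\<lambda>z. deriv \<phi> z * \<kappa> z) \<in> density_on ?K N2" using density_compact_product[OF t(2,3) \<phi>(2) c\<phi>(2) B(1)] .
    have N3: "(\<lambda>z. \<kappa> z * g' z) \<in> density_on ?K (B * M)"
      using density_on_bound[OF g'(1)] density_on_nonneg[OF g'(1)] by (intro density_on_mult[OF B(1) density_on_measurable[OF g'(1)]]) auto
    have C1: "C_diff (Suc 0) \<kappa>" using \<kappa> unfolding test_functions_def by blast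
    define \<Psi> where "\<Psi> = (\<lambda>z. if z \<in> S then \<phi> z * \<kappa> z else 0)"
    note glue = C_diff_glue_holomorphic[OF \<phi> C1 test_function_vanishes_near[OF \<kappa>], folded \<Psi>_def]
    have "\<Psi> z = 0" if "z \<notin> ?K" for z using t(4)[OF that] by (simp add: \<Psi>_def)
    then have "{z. \<Psi> z \<noteq> 0} \<subseteq> ?K" by blast
    then have "\<Psi> \<in> C1_compact" using glue(1) bounded_subset[OF KB(2)] unfolding C1_compact_def by blast
    then have "0 = (LINT z|lborel. dx \<Psi> z)" by (rule integral_dx_dbar(2)[symmetric])
    also have "\<dots> = (LINT z|lborel. \<phi> z * dx \<kappa> z + deriv \<phi> z * \<kappa> z)"
    proof (rule Bochner_Integration.integral_cong[OF refl])
      fix z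
      show "dx \<Psi> z = \<phi> z * dx \<kappa> z + deriv \<phi> z * \<kappa> z"
      proof (cases "z \<in> S")
        case False
        then have zK: "z \<notin> ?K" using t(3) by blast
        show ?thesis using False t(4)[OF zK] t(6)[OF zK] by (simp add: glue(2))
      qed (simp add: glue(2))
    qed
    also have "\<dots> = (LINT z|lborel. \<phi> z * dx \<kappa> z) + (LINT z|lborel. deriv \<phi> z * \<kappa> z)"
      by (rule Bochner_Integration.integral_add[OF density_integrable[OF KB N1] density_integrable[OF KB N2]])
    also have "(LINT z|lborel. \<phi> z * dx \<kappa> z) = (LINT z|lebesgue_on S. \<phi> z * dx \<kappa> z)"
      using t(3) density_on_zero[OF N1] by (intro integral_lebesgue_on_AE_eq[OF SB density_on_measurable[OF N1], symmetric]) auto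
    also have "\<dots> = - (LINT z|lebesgue_on S. g z * \<kappa> z)" by (rule weak[OF \<kappa>])
    also have "(LINT z|lebesgue_on S. g z * \<kappa> z) = (LINT z|lborel. \<kappa> z * g' z)"
    proof (rule integral_lebesgue_on_AE_eq[OF SB density_on_measurable[OF N3]])
      show "\<kappa> z * g' z = 0" if "z \<notin> S" for z using density_on_zero[OF g'(1) that] by simp
      show "AE z in lborel. z \<in> S \<longrightarrow> g z * \<kappa> z = \<kappa> z * g' z" using g'(2) by eventually_elim auto
    qed
    finally have "(LINT z|lborel. deriv \<phi> z * \<kappa> z) - (LINT z|lborel. \<kappa> z * g' z) = 0" by simp
    then have i0: "(LINT z|lborel. deriv \<phi> z * \<kappa> z - \<kappa> z * g' z) = 0"
      by (subst Bochner_Integration.integral_diff[OF density_integrable[OF KB N2] density_integrable[OF KB N3]])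
    have ii: "integrable lborel (\<lambda>z. deriv \<phi> z * \<kappa> z - \<kappa> z * g' z)"
      by (intro Bochner_Integration.integrable_diff density_integrable[OF KB N2] density_integrable[OF KB N3])
    define h where "h z = Re (u * (deriv \<phi> z * \<kappa> z - \<kappa> z * g' z))" for z
    have hi: "integrable lborel h" unfolding h_def[abs_def] by (intro integrable_Re integrable_mult_right ii)
    have "(LINT z|lborel. h z) = Re (LINT z|lborel. u * (deriv \<phi> z * \<kappa> z - \<kappa> z * g' z))"
      unfolding h_def by (intro integral_Re integrable_mult_right ii)
    then have h0: "(LINT z|lborel. h z) = 0" by (simp only: integral_mult_right_zero i0) simp
    have h_eq: "h z = bump z0 \<rho> z * (Re (u * deriv \<phi> z) - Re (u * g' z))" for z
    proof -
      have rr: "Re (of_real b * (x - y)) = b * (Re x - Re y)" for b x y by (simp add: algebra_simps)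
      have "u * (deriv \<phi> z * \<kappa> z - \<kappa> z * g' z) = of_real (bump z0 \<rho> z) * (u * deriv \<phi> z - u * g' z)"
        unfolding \<kappa>_def by (simp only: right_diff_distrib mult_ac)
      then show ?thesis unfolding h_def by (simp only: rr)
    qed
    have pos: "0 < Re (u * deriv \<phi> z) - Re (u * g' z)" if "z \<in> cball z0 (2 * \<rho>)" for z
    proof -
      have "Re (u * g' z) \<le> cmod (u * g' z)" by (rule complex_Re_le_cmod)
      also have "\<dots> \<le> M" using u1 density_on_bound[OF g'(1)] by (simp add: norm_mult)
      finally show ?thesis using e1(2)[of z] that \<rho> by (auto simp: dist_commute)
    qed
    have hn: "0 \<le> h z" for z
    proof (cases "z \<in> cball z0 (2 * \<rho>)")
      case True
      then show ?thesis unfolding h_eq using pos[OF True] bump_range(1) by (simp add: less_imp_le)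
    next
      case False
      then have "z \<notin> ?K" using KZ by blast
      then have "\<kappa> z = 0" by (rule t(4))
      then show ?thesis by (simp add: h_def)
    qed
    have "AE z in lborel. h z = 0"
      using h0 hn integral_nonneg_eq_0_iff_AE[OF hi] by auto
    then have "AE z in lborel. z \<notin> ball z0 \<rho>"
    proof eventually_elim
      case (elim z)
      show ?case
      proof
        assume z: "z \<in> ball z0 \<rho>"
        then have "bump z0 \<rho> z = 1" using bump_eq_1[OF \<rho>(1)] by auto
        moreover have "z \<in> cball z0 (2 * \<rho>)" using z \<rho> by auto
        ultimately show False using elim pos[of z] unfolding h_eq by simp
      qed
    qed
    then have "emeasure lborel (ball z0 \<rho>) = 0" by (subst (asm) AE_iff_measurable[of "ball z0 \<rho>"]) auto
    then show False using \<rho>(1) by (simp add: emeasure_ball unit_ball_vol_2)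
  qed
  then show ?thesis using that by blast
qed

text \<open>Near a regular point \<open>\<phi>\<close> is injective with nonvanishing Jacobian determinant, so preimages of null sets are null. Critical
  points are excluded; there the pulled back coefficient vanishes anyway.\<close>

lemma AE_pullback:
  assumes \<phi>: "\<phi> holomorphic_on S" "open S" and P: "AE \<omega> in lborel. P \<omega>"
  shows "AE z in lborel. z \<in> S \<longrightarrow> deriv \<phi> z \<noteq> 0 \<longrightarrow> P (\<phi> z)"
proof -
  obtain N where N: "N \<in> null_sets lborel" "{\<omega>. \<not> P \<omega>} \<subseteq> N" using P unfolding eventually_ae_filter by auto
  have Nb: "N \<in> sets borel" using N by auto
  define E where "E = {z \<in> S. deriv \<phi> z \<noteq> 0 \<and> \<phi> z \<in> N}"
  have "negligible E"
    unfolding locally_negligible_alt[of E]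
  proof
    fix z0 assume "z0 \<in> E"
    then have z0: "z0 \<in> S" "deriv \<phi> z0 \<noteq> 0" by (auto simp: E_def)
    obtain r where r: "0 < r" "cball z0 (3 * r) \<subseteq> S" "inj_on \<phi> (ball z0 (3 * r))"
      using locally_injective_disc[OF \<phi> z0] by blast
    let ?B = "ball z0 r"
    have B: "?B \<subseteq> S" "?B \<subseteq> ball z0 (3 * r)" "cball z0 r \<subseteq> S" using r by (auto simp: subset_iff)
    have \<phi>B: "\<phi> holomorphic_on ?B" "inj_on \<phi> ?B" using \<phi>(1) B r(3) by (auto intro: holomorphic_on_subset inj_on_subset)
    have "compact (deriv \<phi> ` cball z0 r)"
      by (intro compact_continuous_image continuous_on_subset[OF holomorphic_on_imp_continuous_on[OF holomorphic_deriv[OF \<phi>]] B(3)]) auto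
    then obtain M where "\<And>z. z \<in> cball z0 r \<Longrightarrow> cmod (deriv \<phi> z) \<le> M" by (meson compact_imp_bounded bounded_iff imageI)
    then have M: "\<And>z. z \<in> ?B \<Longrightarrow> cmod (deriv \<phi> z) \<le> M" by auto
    define p d where "p = (\<lambda>z. if z \<in> ?B then \<phi> z else 0)" and "d = (\<lambda>z. if z \<in> ?B then deriv \<phi> z else 0)"
    have pm [measurable]: "p \<in> borel_measurable borel"
      unfolding p_def by (rule borel_extend_continuous[OF open_ball holomorphic_on_imp_continuous_on[OF \<phi>B(1)]])
    have dm [measurable]: "d \<in> borel_measurable borel"
      unfolding d_def by (rule borel_extend_continuous[OF open_ball holomorphic_on_imp_continuous_on[OF holomorphic_deriv[OF \<phi>B(1) open_ball]]])
    have "open (\<phi> ` ?B)" by (rule open_mapping_thm3[OF \<phi>B(1) open_ball \<phi>B(2)])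
    then have [measurable]: "\<phi> ` ?B \<in> sets borel" by simp
    note [measurable] = Nb measurable_sets_borel[OF pm Nb]
    have "density lborel (indicator (\<phi> ` ?B)) = distr (density lborel (\<lambda>z. ennreal ((cmod (d z))\<^sup>2))) borel p"
      unfolding p_def d_def by (rule injective_change_of_variables(1)[OF \<phi>B(1) open_ball bounded_ball \<phi>B(2) M])
    from arg_cong[OF this, of "\<lambda>\<mu>. emeasure \<mu> N"]
    have "(\<integral>\<^sup>+ \<omega>. indicator (\<phi> ` ?B) \<omega> * indicator N \<omega> \<partial>lborel) = (\<integral>\<^sup>+ z. ennreal ((cmod (d z))\<^sup>2) * indicator (p -` N) z \<partial>lborel)"
      using Nb by (simp add: emeasure_density emeasure_distr)
    moreover have "(\<integral>\<^sup>+ \<omega>. indicator (\<phi> ` ?B) \<omega> * indicator N \<omega> \<partial>lborel) \<le> (\<integral>\<^sup>+ \<omega>. indicator N \<omega> \<partial>lborel)"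
      by (intro nn_integral_mono) (auto simp: indicator_def)
    moreover have "(\<integral>\<^sup>+ \<omega>. indicator N \<omega> \<partial>lborel) = 0" using N(1) by (simp add: null_setsD1)
    ultimately have "(\<integral>\<^sup>+ z. ennreal ((cmod (d z))\<^sup>2) * indicator (p -` N) z \<partial>lborel) = 0" by simp
    then have "AE z in lborel. ennreal ((cmod (d z))\<^sup>2) * indicator (p -` N) z = 0"
      by (subst (asm) nn_integral_0_iff_AE) auto
    then have "AE z in lborel. z \<notin> E \<inter> ?B"
      by eventually_elim (auto simp: E_def p_def d_def indicator_def split: if_splits)
    then obtain N0 where N0': "N0 \<in> null_sets lborel" "{z \<in> space lborel. \<not> z \<notin> E \<inter> ?B} \<subseteq> N0"
      unfolding eventually_ae_filter by blast
    then have N0: "N0 \<in> null_sets lborel" "E \<inter> ?B \<subseteq> N0" by auto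
    then have "negligible N0" by (simp add: negligible_iff_null_sets null_sets_completionI)
    then have "negligible (E \<inter> ?B)" using N0(2) by (rule negligible_subset)
    moreover have "openin (top_of_set E) (E \<inter> ?B)" by (simp add: openin_open_Int)
    ultimately show "\<exists>U. openin (top_of_set E) U \<and> z0 \<in> U \<and> negligible U"
      using \<open>z0 \<in> E\<close> r(1) by (intro exI[of _ "E \<inter> ?B"]) auto
  qed
  then have "AE z in lebesgue. z \<notin> E" unfolding negligible_iff_null_sets by (rule AE_not_in)
  then have "AE z in lborel. z \<notin> E" by (simp only: AE_completion_iff)
  then show ?thesis by eventually_elim (use N(2) in \<open>auto simp: E_def\<close>)
qed

context
  fixes \<phi> :: "complex \<Rightarrow> complex" and S1 S2 :: "complex set" and D :: real and \<alpha> :: "complex \<Rightarrow> complex"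
  assumes S1: "open S1" "bounded S1" "connected S1" and S2: "open S2" "bounded S2"
    and \<phi>: "\<phi> holomorphic_on S1" "\<phi> ` S1 \<subseteq> S2" and bd: "\<And>z. z \<in> S1 \<Longrightarrow> cmod (deriv \<phi> z) \<le> D"
    and \<alpha>: "\<alpha> \<in> L_inf S2"
begin

lemma pullback_AE:
  assumes "AE z in lborel. z \<in> S2 \<longrightarrow> \<alpha> z = \<alpha>' z"
  shows "AE z in lborel. z \<in> S1 \<longrightarrow> pullback_coeff \<phi> \<alpha> z = pullback_coeff \<phi> \<alpha>' z"
  using AE_pullback[OF \<phi>(1) S1(1) assms]
  by eventually_elim (use \<phi>(2) in \<open>auto simp: pullback_coeff_def\<close>)

lemma pullback_L_inf: "pullback_coeff \<phi> \<alpha> \<in> L_inf S1"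
proof -
  have B: "S1 \<in> sets borel" "S2 \<in> sets borel" using S1 S2 by auto
  obtain \<alpha>' M where a: "\<alpha>' \<in> density_on S2 M" "AE z in lborel. z \<in> S2 \<longrightarrow> \<alpha> z = \<alpha>' z" using L_inf_density[OF \<alpha> B(2)] .
  have ae: "AE z in lborel. z \<in> S1 \<longrightarrow> pullback_coeff \<phi> \<alpha> z = (if z \<in> S1 then pullback_coeff \<phi> \<alpha>' z else 0)"
    using pullback_AE[OF a(2)] by eventually_elim auto
  show ?thesis by (rule density_L_inf[OF B(1) pullback_density[OF \<phi>(1) S1(1) bd a(1)] ae])
qed

text \<open>Writing \<open>w = exp (T \<beta>) * F\<close>, the chain rule for transforms shows that \<open>w \<circ> \<phi>\<close> is \<open>exp (T \<beta>')\<close> times a holomorphic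
  function, where \<open>\<beta>'\<close> is the pulled back density.\<close>

theorem composition_solves_dbar_eq:
  assumes w: "continuous_on S2 w" "solves_dbar_eq S2 \<alpha> w"
  shows "continuous_on S1 (w \<circ> \<phi>)" "solves_dbar_eq S1 (pullback_coeff \<phi> \<alpha>) (w \<circ> \<phi>)"
proof -
  have B: "S1 \<in> sets borel" "S2 \<in> sets borel" using S1 S2 by auto
  obtain \<alpha>' M where a: "\<alpha>' \<in> density_on S2 M" "AE z in lborel. z \<in> S2 \<longrightarrow> \<alpha> z = \<alpha>' z" using L_inf_density[OF \<alpha> B(2)] .
  obtain \<beta> F where \<beta>: "\<beta> \<in> density_on S2 M" and F: "F holomorphic_on S2"
    and wF: "\<And>z. w z = exp (cauchy_transform \<beta> z) * F z" and \<beta>w: "\<And>z. \<beta> z * w z = \<alpha>' z * cnj (w z)"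
    using solves_dbar_eq_factor[OF S2 w a] by metis
  let ?b = "\<lambda>z. if z \<in> S1 then pullback_coeff \<phi> \<beta> z else 0"
  let ?h = "\<lambda>z. cauchy_transform \<beta> (\<phi> z) - cauchy_transform ?b z"
  have b: "?b \<in> density_on S1 (M * \<bar>D\<bar>)" by (rule pullback_density[OF \<phi>(1) S1(1) bd \<beta>])
  have h: "?h holomorphic_on S1" by (rule cauchy_transform_chain_rule[OF \<phi>(1) S1 bd B(2) S2(2) \<beta>])
  have "(F \<circ> \<phi>) holomorphic_on S1"
    by (rule holomorphic_on_compose[OF \<phi>(1) holomorphic_on_subset[OF F \<phi>(2)]])
  then have G: "(\<lambda>z. exp (?h z) * F (\<phi> z)) holomorphic_on S1" unfolding comp_def by (intro holomorphic_intros h)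
  have eq: "(w \<circ> \<phi>) z = exp (cauchy_transform ?b z) * (exp (?h z) * F (\<phi> z))" for z
    by (simp add: wF mult.assoc[symmetric] flip: exp_add)
  have ae: "AE z in lborel. z \<in> S1 \<longrightarrow> pullback_coeff \<phi> \<alpha> z * cnj ((w \<circ> \<phi>) z) = ?b z * (w \<circ> \<phi>) z"
    using pullback_AE[OF a(2)]
  proof eventually_elim
    case (elim z)
    have "\<alpha>' (\<phi> z) * cnj (w (\<phi> z)) * cnj (deriv \<phi> z) = \<beta> (\<phi> z) * w (\<phi> z) * cnj (deriv \<phi> z)" by (simp only: \<beta>w)
    then show ?case using elim by (auto simp: pullback_coeff_def mult_ac)
  qed
  show "continuous_on S1 (w \<circ> \<phi>)" "solves_dbar_eq S1 (pullback_coeff \<phi> \<alpha>) (w \<circ> \<phi>)"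
    using factored_solves_dbar_eq[OF S1(1,2) b G eq ae] by blast+
qed

end

section \<open>Point evaluations\<close>

lemma arc_set_integrable:
  fixes f :: "complex \<Rightarrow> real"
  assumes E: "compact E" "emeasure arc_length E < \<infinity>" and f: "continuous_on E f"
  shows "set_integrable arc_length E f"
proof -
  have EB: "E \<in> sets borel" using E(1) by (simp add: borel_compact)
  obtain B where B: "\<And>z. z \<in> E \<Longrightarrow> norm (f z) \<le> B"
    using compact_imp_bounded[OF compact_continuous_image[OF f E(1)]] by (meson bounded_iff imageI)
  have m: "(\<lambda>z. indicator E z *\<^sub>R f z) \<in> borel_measurable arc_length"
    using borel_measurable_continuous_on_indicator[OF EB f] by (simp add: measurable_cong_sets[OF sets_arc_length refl])
  show ?thesis unfolding set_integrable_def
  proof (rule integrableI_bounded_set[of E _ _ "\<bar>B\<bar>", OF _ m E(2)])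
    have "norm (indicator E z *\<^sub>R f z) \<le> \<bar>B\<bar>" if "z \<in> E" for z using B[OF that] that by simp
    then show "AE z in arc_length. z \<in> E \<longrightarrow> norm (indicator E z *\<^sub>R f z) \<le> \<bar>B\<bar>" by (intro AE_I2 impI)
  qed (use EB in auto)
qed

text \<open>Arc length is a Hausdorff measure, so its integrals can be approximated from above by weighted sums over coverings. The set is cut into
  the level sets of \<open>f\<close>, rounded down to multiples of a small \<open>h\<close>; each level set is covered efficiently by sets of small diameter, these
  are enlarged to open discs, and compactness leaves finitely many. Pairs of indices stand for the level and the position in the covering.\<close>

lemma weighted_cover:
  fixes f :: "complex \<Rightarrow> real"
  assumes E: "compact E" "emeasure arc_length E < \<infinity>" and f: "continuous_on E f" "\<And>z. z \<in> E \<Longrightarrow> 0 \<le> f z"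
    and \<delta>: "0 < \<delta>" and \<eta>: "0 < \<eta>"
  obtains I :: "(nat \<times> nat) set" and c :: "nat \<times> nat \<Rightarrow> complex" and r :: "nat \<times> nat \<Rightarrow> real" where
    "finite I" "\<And>k. k \<in> I \<Longrightarrow> c k \<in> E" "\<And>k. k \<in> I \<Longrightarrow> 0 < r k" "\<And>k. k \<in> I \<Longrightarrow> r k \<le> \<delta>"
    "E \<subseteq> (\<Union>k\<in>I. ball (c k) (r k))" "(\<Sum>k\<in>I. r k * f (c k)) \<le> (LINT z:E|arc_length. f z) + \<eta>"
proof -
  have EB: "E \<in> sets borel" using E(1) by (simp add: borel_compact)
  define L where "L = measure arc_length E"
  have L0: "0 \<le> L" by (simp add: L_def)
  \<comment> \<open>Rounding down to multiples of \<open>h\<close> changes the integral by at most \<open>\<eta> / 2\<close>.\<close>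
  define h where "h = \<eta> / (2 * (L + 1))"
  have h: "0 < h" "h * L \<le> \<eta> / 2" using \<eta> L0 by (auto simp: h_def field_simps)
  obtain B where B: "\<And>z. z \<in> E \<Longrightarrow> norm (f z) \<le> B"
    using compact_imp_bounded[OF compact_continuous_image[OF f(1) E(1)]] by (meson bounded_iff imageI)
  define lev where "lev z = nat \<lfloor>f z / h\<rfloor>" for z
  have lev: "real (lev z) * h \<le> f z" "f z \<le> (real (lev z) + 1) * h" if "z \<in> E" for z
  proof -
    have "0 \<le> f z / h" using f(2)[OF that] h(1) by simp
    then have "real (lev z) = of_int \<lfloor>f z / h\<rfloor>" unfolding lev_def by simp
    then have "real (lev z) \<le> f z / h" "f z / h \<le> real (lev z) + 1" by linarith+
    then show "real (lev z) * h \<le> f z" "f z \<le> (real (lev z) + 1) * h" using h(1) by (simp_all add: field_simps)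
  qed
  define J where "J = Suc (nat \<lfloor>B / h\<rfloor>)"
  have levJ: "lev z < J" if "z \<in> E" for z
  proof -
    have "f z / h \<le> B / h" using B[OF that] h(1) by (intro divide_right_mono) auto
    then have "lev z \<le> nat \<lfloor>B / h\<rfloor>" unfolding lev_def by (intro nat_mono floor_mono)
    then show ?thesis by (simp add: J_def)
  qed
  define A where "A j = {z \<in> E. lev z = j}" for j
  have AB: "A j \<in> sets borel" for j
  proof -
    have [measurable]: "(\<lambda>z. if z \<in> E then f z else 0) \<in> borel_measurable borel"
      by (intro borel_measurable_continuous_on_if EB f(1) continuous_on_const)
    note [measurable] = EB
    have "A j = {z \<in> space borel. z \<in> E \<and> nat \<lfloor>(if z \<in> E then f z else 0) / h\<rfloor> = j}" by (auto simp: A_def lev_def)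
    also have "\<dots> \<in> sets borel" by measurable
    finally show ?thesis .
  qed
  have AE: "A j \<subseteq> E" for j by (auto simp: A_def)
  have Afin: "emeasure arc_length (A j) < \<infinity>" for j
    using emeasure_mono[OF AE, of arc_length j] EB E(2) by (auto intro: le_less_trans)
  define Lj where "Lj j = measure arc_length (A j)" for j
  have Lj: "outer_length (A j) = ennreal (Lj j)" for j
    using Afin[of j] AB[of j] by (simp add: Lj_def emeasure_arc_length[symmetric] emeasure_eq_ennreal_measure less_top)
  have indi: "integrable arc_length (indicator (A j) :: complex \<Rightarrow> real)" for j
    using Afin AB by (intro integrable_real_indicator) auto
  have sumL: "(\<Sum>j<J. (real j + 1) * h * Lj j) \<le> (LINT z:E|arc_length. f z) + h * L"
  proof -
    have fi: "set_integrable arc_length E f" by (rule arc_set_integrable[OF E f(1)])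
    have hi: "set_integrable arc_length E (\<lambda>_. h)" by (rule arc_set_integrable[OF E continuous_on_const])
    have "(\<Sum>j<J. (real j + 1) * h * Lj j) = (LINT z|arc_length. (\<Sum>j<J. (real j + 1) * h * indicator (A j) z))"
      using indi AB by (subst Bochner_Integration.integral_sum) (auto simp: Lj_def)
    also have "\<dots> \<le> (LINT z:E|arc_length. f z + h)"
      unfolding set_lebesgue_integral_def
    proof (rule integral_mono)
      show "integrable arc_length (\<lambda>z. \<Sum>j<J. (real j + 1) * h * indicator (A j) z)"
        using indi by (intro Bochner_Integration.integrable_sum integrable_mult_right)
      show "integrable arc_length (\<lambda>z. indicator E z *\<^sub>R (f z + h))"
        using set_integral_add(1)[OF fi hi] by (simp add: set_integrable_def)
      show "(\<Sum>j<J. (real j + 1) * h * indicator (A j) z) \<le> indicator E z *\<^sub>R (f z + h)" for z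
      proof (cases "z \<in> E")
        case True
        have "(\<Sum>j<J. (real j + 1) * h * indicator (A j) z) = (\<Sum>j<J. if j = lev z then (real (lev z) + 1) * h else 0)"
          by (rule sum.cong) (auto simp: A_def indicator_def True)
        also have "\<dots> = (real (lev z) + 1) * h" using levJ[OF True] by simp
        finally show ?thesis using lev(1)[OF True] True by (simp add: algebra_simps)
      qed (auto simp: A_def)
    qed
    also have "\<dots> = (LINT z:E|arc_length. f z) + (LINT z:E|arc_length. h)" by (rule set_integral_add(2)[OF fi hi])
    also have "(LINT z:E|arc_length. h) = h * L"
      using EB by (simp add: set_lebesgue_integral_def L_def)
    finally show ?thesis .
  qed
  define \<tau> where "\<tau> = min (\<delta> / 2) (\<eta> / (6 * (real J * real J * h + 1)))"
  have q: "0 < real J * real J * h + 1" using h(1) by (simp add: add_nonneg_pos)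
  have \<tau>: "0 < \<tau>" "\<tau> \<le> \<delta> / 2"
    unfolding \<tau>_def using \<delta> \<eta> q by (simp, intro min.cobounded1)
  have \<tau>J: "real J * real J * h * (3 * \<tau>) \<le> \<eta> / 2"
  proof -
    have "real J * real J * h * (3 * \<tau>) \<le> (real J * real J * h + 1) * (3 * (\<eta> / (6 * (real J * real J * h + 1))))"
    proof (rule mult_mono)
      show "3 * \<tau> \<le> 3 * (\<eta> / (6 * (real J * real J * h + 1)))"
        unfolding \<tau>_def by (intro mult_left_mono min.cobounded2) simp
    qed (use q \<tau>(1) in auto)
    also have "\<dots> = \<eta> / 2" using q by (simp add: field_simps)
    finally show ?thesis .
  qed
  define Q where "Q j C \<longleftrightarrow> A j \<subseteq> (\<Union>i::nat. C i) \<and> (\<forall>i. bounded (C i) \<and> diameter (C i) \<le> \<delta> / 2) \<and>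
      (\<Sum>i. ennreal (diameter (C i))) < ennreal (Lj j + \<tau>)" for j C
  have exQ: "\<exists>C. Q j C" for j
  proof -
    have "length_premeasure (\<delta> / 2) (A j) \<le> outer_length (A j)"
      unfolding outer_length_def using \<delta> by (intro SUP_upper) auto
    also have "\<dots> < ennreal (Lj j + \<tau>)" unfolding Lj using \<tau>(1) by (intro ennreal_lessI) (simp_all add: Lj_def add_nonneg_pos)
    finally have "length_premeasure (\<delta> / 2) (A j) < ennreal (Lj j + \<tau>)" .
    from this[unfolded length_premeasure_def INF_less_iff] show ?thesis unfolding Q_def by blast
  qed
  define C where "C j = (SOME C. Q j C)" for j
  have CQ: "Q j (C j)" for j unfolding C_def by (rule someI_ex[OF exQ])
  have C: "\<And>j. A j \<subseteq> (\<Union>i::nat. C j i)" "\<And>j i. bounded (C j i)" "\<And>j i. diameter (C j i) \<le> \<delta> / 2"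
    "\<And>j. (\<Sum>i. ennreal (diameter (C j i))) < ennreal (Lj j + \<tau>)" using CQ unfolding Q_def by blast+
  define r where "r k = diameter (C (fst k) (snd k)) + \<tau> * (1/2) ^ snd k" for k
  define c where "c k = (SOME x. x \<in> C (fst k) (snd k) \<inter> A (fst k))" for k
  define Idx where "Idx = {k. fst k < J \<and> C (fst k) (snd k) \<inter> A (fst k) \<noteq> {}}"
  have c: "c k \<in> C (fst k) (snd k) \<inter> A (fst k)" if "k \<in> Idx" for k
  proof -
    have "\<exists>x. x \<in> C (fst k) (snd k) \<inter> A (fst k)" using that unfolding Idx_def by blast
    from someI_ex[OF this] show ?thesis unfolding c_def .
  qed
  have diam0: "0 \<le> diameter (C j i)" for j i by (rule diameter_ge_0[OF C(2)])
  have r0: "0 < r k" for k unfolding r_def using diam0 \<tau>(1) by (intro add_nonneg_pos) auto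
  have r\<delta>: "r k \<le> \<delta>" for k
  proof -
    have "\<tau> * (1/2) ^ snd k \<le> \<tau> * 1" using \<tau>(1) by (intro mult_left_mono power_le_one) auto
    then show ?thesis unfolding r_def using C(3)[of "fst k" "snd k"] \<tau>(2) by linarith
  qed
  have "E \<subseteq> (\<Union>k\<in>Idx. ball (c k) (r k))"
  proof
    fix x assume x: "x \<in> E"
    then have xA: "x \<in> A (lev x)" by (simp add: A_def)
    then obtain i where i: "x \<in> C (lev x) i" using C(1) by blast
    have k: "(lev x, i) \<in> Idx" using xA i levJ[OF x] by (auto simp: Idx_def)
    have "dist (c (lev x, i)) x \<le> diameter (C (lev x) i)"
      using c[OF k] i by (intro diameter_bounded_bound C(2)) auto
    also have "\<dots> < r (lev x, i)" using \<tau>(1) by (simp add: r_def)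
    finally show "x \<in> (\<Union>k\<in>Idx. ball (c k) (r k))" using k by auto
  qed
  then obtain I where I: "I \<subseteq> Idx" "finite I" "E \<subseteq> (\<Union>k\<in>I. ball (c k) (r k))"
    using compactE_image[OF E(1), of Idx "\<lambda>k. ball (c k) (r k)"] by auto
  obtain n where n: "I \<subseteq> {..<J} \<times> {..<n}"
  proof -
    obtain n where "\<forall>i\<in>snd ` I. i < n" using finite_nat_set_iff_bounded[of "snd ` I"] I(2) by auto
    then have "I \<subseteq> {..<J} \<times> {..<n}" using I(1) by (auto simp: Idx_def)
    then show ?thesis using that by blast
  qed
  have row: "(\<Sum>i<n. r (j, i)) \<le> Lj j + 3 * \<tau>" for j
  proof -
    have "ennreal (\<Sum>i<n. diameter (C j i)) = (\<Sum>i<n. ennreal (diameter (C j i)))" using diam0 by (simp add: sum_ennreal)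
    also have "\<dots> \<le> (\<Sum>i. ennreal (diameter (C j i)))" by (intro sum_le_suminf) auto
    also have "\<dots> \<le> ennreal (Lj j + \<tau>)" using C(4)[of j] by simp
    finally have 1: "(\<Sum>i<n. diameter (C j i)) \<le> Lj j + \<tau>" using \<tau>(1) by (subst (asm) ennreal_le_iff) (auto simp: Lj_def)
    have "(\<Sum>i<n. (1/2::real) ^ i) \<le> (\<Sum>i. (1/2::real) ^ i)" by (intro sum_le_suminf summable_geometric) auto
    also have "\<dots> = 2" by (subst suminf_geometric) auto
    finally have "\<tau> * (\<Sum>i<n. (1/2::real) ^ i) \<le> \<tau> * 2" using \<tau>(1) by (intro mult_left_mono) auto
    then show ?thesis using 1 by (simp add: r_def sum.distrib sum_distrib_left)
  qed
  have "(\<Sum>k\<in>I. r k * f (c k)) \<le> (\<Sum>k\<in>I. (real (fst k) + 1) * h * r k)"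
  proof (rule sum_mono)
    fix k assume "k \<in> I"
    then have "c k \<in> A (fst k)" using c I(1) by blast
    then have "f (c k) \<le> (real (fst k) + 1) * h" using lev(2)[of "c k"] by (auto simp: A_def)
    then show "r k * f (c k) \<le> (real (fst k) + 1) * h * r k"
      using r0[of k] by (simp add: mult.commute mult_left_mono)
  qed
  also have "\<dots> \<le> (\<Sum>k\<in>{..<J} \<times> {..<n}. (real (fst k) + 1) * h * r k)"
    using n h(1) r0 by (intro sum_mono2) (auto intro!: mult_nonneg_nonneg simp: less_imp_le)
  also have "\<dots> = (\<Sum>j<J. (real j + 1) * h * (\<Sum>i<n. r (j, i)))"
    by (simp add: sum.cartesian_product' sum_distrib_left sum.cartesian_product[symmetric] split_def)
  also have "\<dots> \<le> (\<Sum>j<J. (real j + 1) * h * (Lj j + 3 * \<tau>))"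
    using h(1) by (intro sum_mono mult_left_mono row) auto
  also have "\<dots> = (\<Sum>j<J. (real j + 1) * h * Lj j) + (\<Sum>j<J. (real j + 1) * h * (3 * \<tau>))"
    by (simp add: distrib_left sum.distrib)
  also have "(\<Sum>j<J. (real j + 1) * h * (3 * \<tau>)) \<le> (\<Sum>j<J. real J * h * (3 * \<tau>))"
    using h(1) \<tau>(1) by (intro sum_mono mult_right_mono) auto
  also have "\<dots> = real J * real J * h * (3 * \<tau>)" by simp
  finally have "(\<Sum>k\<in>I. r k * f (c k)) \<le> (LINT z:E|arc_length. f z) + \<eta>"
    using sumL \<tau>J h(2) by linarith
  then show ?thesis using that[of I c r] I c r0 r\<delta> AE by blast
qed

text \<open>By scaling, the \<open>dbar\<close> derivative of a plateau of radius \<open>\<rho>\<close> is bounded by this number divided by \<open>\<rho>\<close>.\<close>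

definition bump_slope :: real where
  "bump_slope = (SUP z. cmod (dbar (\<lambda>z. complex_of_real (bump 0 1 z)) z))"

lemma dbar_bump_le:
  assumes \<rho>: "0 < \<rho>"
  shows "cmod (dbar (\<lambda>z. complex_of_real (bump a \<rho> z)) z) \<le> bump_slope / \<rho>" "0 \<le> bump_slope"
proof -
  let ?b = "\<lambda>z. complex_of_real (bump 0 1 z)" and ?s = "\<lambda>z. (z - a) / of_real \<rho>"
  have t: "?b \<in> test_functions UNIV" by (rule bump_as_test_function) auto
  obtain B where B: "dbar ?b \<in> density_on (closure {z. ?b z \<noteq> 0}) B" using test_density[OF t] by blast
  have sup: "cmod (dbar ?b w) \<le> bump_slope" for w
    unfolding bump_slope_def
  proof (rule cSUP_upper)
    show "bdd_above (range (\<lambda>w. cmod (dbar ?b w)))"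
      by (rule bdd_aboveI[of _ B]) (use density_on_bound[OF B] in blast)
  qed simp
  show "0 \<le> bump_slope" using order_trans[OF norm_ge_zero sup] .
  have eq: "(\<lambda>z. complex_of_real (bump a \<rho> z)) = (\<lambda>z. ?b (?s z))"
    using \<rho> by (simp add: fun_eq_iff bump_eq norm_divide power_divide)
  have "(?b has_derivative (\<lambda>h. of_real (Re h) * dx ?b (?s z) + of_real (Im h) * dy ?b (?s z))) (at (?s z))"
    by (rule has_derivative_dx_dy[OF C1_compactD(1)[OF test_functionsD(1)[OF t]]])
  moreover have "(?s has_derivative (\<lambda>h. h / of_real \<rho>)) (at z)"
    using \<rho> by (auto intro!: derivative_eq_intros)
  ultimately have "((\<lambda>z. ?b (?s z)) has_derivative (\<lambda>h. of_real (Re (h / of_real \<rho>)) * dx ?b (?s z) + of_real (Im (h / of_real \<rho>)) * dy ?b (?s z))) (at z)"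
    by (rule has_derivative_compose[rotated])
  then have "((\<lambda>z. ?b (?s z)) has_derivative (\<lambda>h. of_real (Re h) * (dx ?b (?s z) / of_real \<rho>) + of_real (Im h) * (dy ?b (?s z) / of_real \<rho>))) (at z)"
    by (rule has_derivative_eq_rhs) (simp add: fun_eq_iff)
  note dbar_s = dx_dy_eqI(4)[OF this]
  have "dbar (\<lambda>z. ?b (?s z)) z = dbar ?b (?s z) / of_real \<rho>"
    unfolding dbar_s dbar_def[of ?b] by (simp add: add_divide_distrib mult.commute)
  then have "cmod (dbar (\<lambda>z. complex_of_real (bump a \<rho> z)) z) = cmod (dbar ?b (?s z)) / \<rho>"
    unfolding eq using \<rho> by (simp add: norm_divide)
  also have "\<dots> \<le> bump_slope / \<rho>" using sup \<rho> by (intro divide_right_mono) auto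
  finally show "cmod (dbar (\<lambda>z. complex_of_real (bump a \<rho> z)) z) \<le> bump_slope / \<rho>" .
qed

lemma dbar_bump_zero:
  assumes \<rho>: "0 < \<rho>" and z: "z \<notin> ball a (2 * \<rho>)"
  shows "dbar (\<lambda>z. complex_of_real (bump a \<rho> z)) z = 0"
proof (rule dx_dy_zero(4)[of "- cball a (3/2 * \<rho>)"])
  show "z \<in> - cball a (3/2 * \<rho>)" using z \<rho> by (auto simp: not_less)
  show "complex_of_real (bump a \<rho> w) = 0" if "w \<in> - cball a (3/2 * \<rho>)" for w
    using bump_eq_0[OF \<rho>, of a w] that by auto
qed auto

text \<open>A cut-off that removes all the discs at once. Since every factor lies between 0 and 1, the Leibniz rule bounds its
  \<open>dbar\<close> derivative by the sum of the derivatives of the factors, however much the discs overlap.\<close>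

lemma excision_product:
  fixes c :: "'i \<Rightarrow> complex" and r :: "'i \<Rightarrow> real"
  assumes "finite I" "\<And>k. k \<in> I \<Longrightarrow> 0 < r k"
  defines "p \<equiv> \<lambda>I z. (\<Prod>k\<in>I. 1 - bump (c k) (r k) z)"
  shows "p I \<in> smooth_real" "0 \<le> p I z" "p I z \<le> 1"
    "cmod (dbar (\<lambda>z. complex_of_real (p I z)) z) \<le> (\<Sum>k\<in>I. bump_slope / r k * indicator (ball (c k) (2 * r k)) z)"
proof -
  show rng: "0 \<le> p J z" "p J z \<le> 1" for J
    unfolding p_def using bump_range[of "c _" "r _" z] by (auto intro!: prod_nonneg prod_le_1)
  have "p I \<in> smooth_real \<and>
    cmod (dbar (\<lambda>z. complex_of_real (p I z)) z) \<le> (\<Sum>k\<in>I. bump_slope / r k * indicator (ball (c k) (2 * r k)) z)"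
    using assms(1,2)
  proof (induction I)
    case empty
    have "dbar (\<lambda>z. 1::complex) z = 0" using dx_dy_eqI(4)[of "\<lambda>_. 1" 0 0 z] by simp
    then show ?case by (simp add: p_def smooth_const)
  next
    case (insert k I)
    let ?b = "\<lambda>z. complex_of_real (bump (c k) (r k) z)" and ?q = "\<lambda>z. complex_of_real (p I z)"
    have rk: "0 < r k" using insert by simp
    have IH: "p I \<in> smooth_real" "cmod (dbar ?q z) \<le> (\<Sum>k\<in>I. bump_slope / r k * indicator (ball (c k) (2 * r k)) z)"
      using insert by auto
    have diff: "(\<lambda>z. complex_of_real (f z)) differentiable at z" if "f \<in> smooth_real" for f
    proof -
      have "C_diff (Suc 0) (\<lambda>z. Complex (f z) 0)" by (rule C_diff_smooth[OF that smooth_const])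
      then show ?thesis by (simp add: complex_of_real_def)
    qed
    have pk: "p (insert k I) = (\<lambda>z. (1 - bump (c k) (r k) z) * p I z)" using insert by (simp add: p_def fun_eq_iff)
    have d1: "dbar (\<lambda>z. complex_of_real (1 - bump (c k) (r k) z)) z = - dbar ?b z"
    proof -
      have "((\<lambda>z. 1 - ?b z) has_derivative (\<lambda>h. 0 - (of_real (Re h) * dx ?b z + of_real (Im h) * dy ?b z))) (at z)"
        by (intro has_derivative_diff has_derivative_const has_derivative_dx_dy diff smooth_bump)
      then have "((\<lambda>z. 1 - ?b z) has_derivative (\<lambda>h. of_real (Re h) * (- dx ?b z) + of_real (Im h) * (- dy ?b z))) (at z)"
        by (rule has_derivative_eq_rhs) (simp add: fun_eq_iff)
      note d = dx_dy_eqI(4)[OF this]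
      have "dbar (\<lambda>z. 1 - ?b z) z = - dbar ?b z"
        unfolding d dbar_def[of ?b] by (simp add: field_simps)
      then show ?thesis by simp
    qed
    have "dbar (\<lambda>z. complex_of_real (p (insert k I) z)) z
        = of_real (1 - bump (c k) (r k) z) * dbar ?q z + (- dbar ?b z) * of_real (p I z)"
      unfolding pk of_real_mult d1[symmetric]
      by (rule dbar_mult(4)) (intro diff smooth_diff smooth_const smooth_bump IH)+
    then have "cmod (dbar (\<lambda>z. complex_of_real (p (insert k I) z)) z)
        \<le> cmod (of_real (1 - bump (c k) (r k) z)) * cmod (dbar ?q z) + cmod (dbar ?b z) * cmod (of_real (p I z))"
      by (metis norm_triangle_ineq norm_mult norm_minus_cancel)
    also have "\<dots> \<le> 1 * cmod (dbar ?q z) + cmod (dbar ?b z) * 1"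
      using bump_range[of "c k" "r k" z] rng[of I] by (intro add_mono mult_mono) (auto simp del: of_real_diff)
    also have "\<dots> \<le> (\<Sum>k\<in>insert k I. bump_slope / r k * indicator (ball (c k) (2 * r k)) z)"
      using IH(2) dbar_bump_le(1)[OF rk, of "c k" z] dbar_bump_zero[OF rk, of z "c k"] insert
      by (cases "z \<in> ball (c k) (2 * r k)") (auto simp: sum.insert)
    finally have "cmod (dbar (\<lambda>z. complex_of_real (p (insert k I) z)) z) \<le> (\<Sum>k\<in>insert k I. bump_slope / r k * indicator (ball (c k) (2 * r k)) z)" .
    moreover have "p (insert k I) \<in> smooth_real"
      unfolding pk by (intro smooth_mult smooth_diff smooth_const smooth_bump IH)
    ultimately show ?case by blast
  qed
  then show "p I \<in> smooth_real"
    "cmod (dbar (\<lambda>z. complex_of_real (p I z)) z) \<le> (\<Sum>k\<in>I. bump_slope / r k * indicator (ball (c k) (2 * r k)) z)" by auto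
qed

text \<open>The Cauchy-Pompeiu formula for \<open>F\<close> times the cut-off. Its \<open>dbar\<close> derivative lives on the discs of radius \<open>2 * r k\<close>, of area
  \<open>4 * pi * (r k)\<^sup>2\<close>, where it is at most \<open>bump_slope / r k\<close> times \<open>m k\<close>, and the Cauchy kernel is at most \<open>2 / d\<close> there.\<close>

lemma excised_cauchy_estimate:
  assumes F: "F holomorphic_on \<Delta>" "open \<Delta>" "bounded \<Delta>" and z: "z \<in> \<Delta>"
    and I: "finite I" "\<And>k. k \<in> I \<Longrightarrow> 0 < r k" "\<And>k. k \<in> I \<Longrightarrow> 4 * r k \<le> d" "\<And>k. k \<in> I \<Longrightarrow> d \<le> dist z (c k)"
    and cover: "frontier \<Delta> \<subseteq> (\<Union>k\<in>I. ball (c k) (r k))"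
    and Fb: "\<And>k \<zeta>. k \<in> I \<Longrightarrow> \<zeta> \<in> \<Delta> \<Longrightarrow> \<zeta> \<in> ball (c k) (2 * r k) \<Longrightarrow> cmod (F \<zeta>) \<le> m k" and d: "0 < d" and m0: "\<And>k. k \<in> I \<Longrightarrow> 0 \<le> m k"
  shows "cmod (F z) \<le> 8 * pi * bump_slope / (d * cauchy_mass) * (\<Sum>k\<in>I. r k * m k)"
proof -
  define p where "p z = (\<Prod>k\<in>I. 1 - bump (c k) (r k) z)" for z
  note ex = excision_product[of I r c, OF I(1,2), folded p_def]
  let ?P = "\<lambda>z. complex_of_real (p z)"
  have PC: "C_diff (Suc 0) ?P" using C_diff_smooth[OF ex(1) smooth_const[of 0], of "Suc 0"] by (simp add: complex_of_real_def)
  have p0: "p w = 0" if k: "k \<in> I" "w \<in> ball (c k) (r k)" for w k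
  proof -
    have "1 - bump (c k) (r k) w = 0" using bump_eq_1[OF I(2)[OF k(1)], of "c k" w] k(2) by auto
    then show ?thesis unfolding p_def using I(1) k(1) by (intro prod_zero) auto
  qed
  have van: "\<exists>e>0. \<forall>w\<in>ball y e \<inter> \<Delta>. ?P w = 0" if y: "y \<notin> \<Delta>" for y
  proof (cases "y \<in> closure \<Delta>")
    case True
    then have "y \<in> frontier \<Delta>" using y F(2) by (simp add: frontier_def interior_open)
    then obtain k where k: "k \<in> I" "y \<in> ball (c k) (r k)" using cover by blast
    then obtain e where "e > 0" "ball y e \<subseteq> ball (c k) (r k)"
      using open_contains_ball[of "ball (c k) (r k)"] by blast
    then show ?thesis using p0[OF k(1)] by (intro exI[of _ e]) auto
  next
    case False
    then obtain e where "e > 0" "ball y e \<subseteq> - closure \<Delta>"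
      using open_contains_ball[of "- closure \<Delta>"] by (metis ComplI closed_closure open_Compl)
    then show ?thesis using closure_subset[of \<Delta>] by (intro exI[of _ e]) auto
  qed
  define \<Psi> where "\<Psi> = (\<lambda>z. if z \<in> \<Delta> then F z * ?P z else 0)"
  note glue = C_diff_glue_holomorphic[OF F(1,2) PC van, folded \<Psi>_def]
  have "{z. \<Psi> z \<noteq> 0} \<subseteq> \<Delta>" by (auto simp: \<Psi>_def)
  then have \<Psi>: "\<Psi> \<in> C1_compact" using glue(1) bounded_subset[OF F(3)] unfolding C1_compact_def by blast
  have "1 - bump (c k) (r k) z = 1" if k: "k \<in> I" for k
    using bump_eq_0[OF I(2)[OF k], of "c k" z] I(2-4)[OF k] by (simp add: dist_commute)
  then have "p z = 1" unfolding p_def by simp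
  then have "F z = \<Psi> z" using z by (simp add: \<Psi>_def)
  also have "\<dots> = cauchy_transform (dbar \<Psi>) z" by (rule cauchy_pompeiu[OF \<Psi>])
  finally have Fz: "F z = cauchy_transform (dbar \<Psi>) z" .
  define M where "M k = bump_slope / r k * m k * (2 / d)" for k
  have bnd: "cmod (dbar \<Psi> \<zeta> / (z - \<zeta>)) \<le> (\<Sum>k\<in>I. M k * indicator (ball (c k) (2 * r k)) \<zeta>)" for \<zeta>
  proof (cases "\<zeta> \<in> \<Delta>")
    case True
    have "cmod (dbar \<Psi> \<zeta> / (z - \<zeta>)) = cmod (dbar ?P \<zeta>) * (cmod (F \<zeta>) / cmod (z - \<zeta>))"
      using True by (simp add: glue(3) norm_mult norm_divide)
    also have "\<dots> \<le> (\<Sum>k\<in>I. bump_slope / r k * indicator (ball (c k) (2 * r k)) \<zeta>) * (cmod (F \<zeta>) / cmod (z - \<zeta>))"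
      by (intro mult_right_mono ex(4)) auto
    also have "\<dots> = (\<Sum>k\<in>I. bump_slope / r k * indicator (ball (c k) (2 * r k)) \<zeta> * (cmod (F \<zeta>) / cmod (z - \<zeta>)))"
      by (rule sum_distrib_right)
    also have "\<dots> \<le> (\<Sum>k\<in>I. M k * indicator (ball (c k) (2 * r k)) \<zeta>)"
    proof (rule sum_mono)
      fix k assume k: "k \<in> I"
      show "bump_slope / r k * indicator (ball (c k) (2 * r k)) \<zeta> * (cmod (F \<zeta>) / cmod (z - \<zeta>)) \<le> M k * indicator (ball (c k) (2 * r k)) \<zeta>"
      proof (cases "\<zeta> \<in> ball (c k) (2 * r k)")
        case in_ball: True
        then have "d \<le> cmod (z - \<zeta>) + 2 * r k"
          using I(4)[OF k] dist_triangle[of z "c k" \<zeta>] by (auto simp: dist_norm norm_minus_commute)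
        then have "d / 2 \<le> cmod (z - \<zeta>)" using I(3)[OF k] by linarith
        then have "cmod (F \<zeta>) / cmod (z - \<zeta>) \<le> m k / (d / 2)"
          using Fb[OF k True in_ball] d m0[OF k] by (intro frac_le) auto
        then have "bump_slope / r k * (cmod (F \<zeta>) / cmod (z - \<zeta>)) \<le> bump_slope / r k * (m k / (d / 2))"
          using dbar_bump_le(2)[of 1] I(2)[OF k] by (intro mult_left_mono) auto
        then show ?thesis using in_ball by (simp add: M_def mult_ac)
      qed simp
    qed
    finally show ?thesis .
  next
    case False
    then have "dbar \<Psi> \<zeta> = 0" by (simp add: glue(3))
    moreover have "0 \<le> (\<Sum>k\<in>I. M k * indicator (ball (c k) (2 * r k)) \<zeta>)"
      unfolding M_def using dbar_bump_le(2)[of 1] I(2) d m0 by (intro sum_nonneg mult_nonneg_nonneg) (auto simp: less_imp_le)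
    ultimately show ?thesis by simp
  qed
  have ball_fin: "emeasure lborel (ball (c k) (2 * r k)) < \<infinity>" for k by (rule emeasure_bounded_finite) simp
  have Mi: "integrable lborel (\<lambda>\<zeta>. M k * indicator (ball (c k) (2 * r k)) \<zeta>)" for k
    using ball_fin by (intro integrable_mult_right integrable_real_indicator) auto
  obtain R B where R: "dbar \<Psi> \<in> density_on (cball 0 R) B" using dbar_density[OF \<Psi>] by blast
  have "cmod (LINT \<zeta>|lborel. dbar \<Psi> \<zeta> / (z - \<zeta>)) \<le> (LINT \<zeta>|lborel. (\<Sum>k\<in>I. M k * indicator (ball (c k) (2 * r k)) \<zeta>))"
    by (intro Bochner_Integration.integral_norm_bound_integral cauchy_integrable[OF _ _ R] Bochner_Integration.integrable_sum Mi bnd) auto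
  also have "\<dots> = (\<Sum>k\<in>I. M k * measure lborel (ball (c k) (2 * r k)))"
    by (subst Bochner_Integration.integral_sum[OF Mi]) simp
  also have "\<dots> = (\<Sum>k\<in>I. 8 * pi * bump_slope / d * (r k * m k))"
  proof (rule sum.cong[OF refl])
    fix k assume k: "k \<in> I"
    have "measure lborel (ball (c k) (2 * r k)) = pi * (2 * r k)\<^sup>2"
      using I(2)[OF k] emeasure_ball[of "2 * r k" "c k"] by (simp add: measure_def unit_ball_vol_2)
    then show "M k * measure lborel (ball (c k) (2 * r k)) = 8 * pi * bump_slope / d * (r k * m k)"
      using I(2)[OF k] d by (simp add: M_def field_simps power2_eq_square)
  qed
  also have "\<dots> = 8 * pi * bump_slope / d * (\<Sum>k\<in>I. r k * m k)" by (rule sum_distrib_left[symmetric])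
  finally have "cmod (LINT \<zeta>|lborel. dbar \<Psi> \<zeta> / (z - \<zeta>)) / cauchy_mass \<le> 8 * pi * bump_slope / d * (\<Sum>k\<in>I. r k * m k) / cauchy_mass"
    using cauchy_mass_pos by (intro divide_right_mono) auto
  then show ?thesis unfolding Fz cauchy_transform_def using cauchy_mass_pos by (simp add: norm_divide)
qed

text \<open>A substitute for the Cauchy integral formula that uses no parametrization of the frontier: only its length is
  finite. The discs of the weighted cover shrink, and uniform continuity of \<open>F\<close> makes the maxima over them comparable with the values at their
  centres.\<close>

theorem boundary_mean_estimate:
  assumes F: "F holomorphic_on \<Omega>" "open \<Omega>" and \<Delta>: "open \<Delta>" "bounded \<Delta>" "closure \<Delta> \<subseteq> \<Omega>"
    and len: "emeasure arc_length (frontier \<Delta>) < \<infinity>" and z: "z \<in> \<Delta>"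
    and d: "0 < d" "\<And>y. y \<in> frontier \<Delta> \<Longrightarrow> d \<le> dist z y"
  shows "cmod (F z) \<le> 8 * pi * bump_slope / (d * cauchy_mass) * (LINT y:frontier \<Delta>|arc_length. cmod (F y))"
proof -
  let ?E = "frontier \<Delta>" and ?Q = "8 * pi * bump_slope / (d * cauchy_mass)"
  have Q0: "0 \<le> ?Q" using dbar_bump_le(2)[of 1] d cauchy_mass_pos by simp
  have E: "compact ?E" using \<Delta>(2) by (simp add: compact_frontier_bounded)
  have ES: "?E \<subseteq> closure \<Delta>" by (simp add: frontier_def)
  have Fc: "continuous_on (closure \<Delta>) F" by (rule continuous_on_subset[OF holomorphic_on_imp_continuous_on[OF F(1)] \<Delta>(3)])
  have uc: "uniformly_continuous_on (closure \<Delta>) F"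
    using Fc \<Delta>(2) by (intro compact_uniformly_continuous) (auto simp: compact_closure)
  define L where "L = measure arc_length ?E"
  have L0: "0 \<le> L" by (simp add: L_def)
  have step: "cmod (F z) \<le> ?Q * (LINT y:?E|arc_length. cmod (F y)) + \<eta> * (?Q * (L + 1))" if \<eta>: "0 < \<eta>" for \<eta>
  proof -
    obtain \<delta>0 where \<delta>0: "\<delta>0 > 0" "\<And>x y. x \<in> closure \<Delta> \<Longrightarrow> y \<in> closure \<Delta> \<Longrightarrow> dist x y < \<delta>0 \<Longrightarrow> dist (F x) (F y) < \<eta>"
      using uc \<eta> unfolding uniformly_continuous_on_def by (metis dist_commute)
    \<comment> \<open>Doubled discs stay at distance \<open>d / 2\<close> from \<open>z\<close>, and \<open>F\<close> varies by less than \<open>\<eta>\<close> on them.\<close>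
    define \<delta> where "\<delta> = min (d / 4) (\<delta>0 / 2)"
    have \<delta>: "0 < \<delta>" "4 * \<delta> \<le> d" "2 * \<delta> \<le> \<delta>0" using d \<delta>0 by (auto simp: \<delta>_def)
    have fc: "continuous_on ?E (\<lambda>y. cmod (F y))" by (intro continuous_intros continuous_on_subset[OF Fc ES])
    have fc1: "continuous_on ?E (\<lambda>y. cmod (F y) + \<eta>)" by (intro continuous_intros fc)
    have f0: "0 \<le> cmod (F y) + \<eta>" for y using \<eta> by (simp add: add_nonneg_nonneg)
    obtain I :: "(nat \<times> nat) set" and c r where I: "finite I" "\<And>k. k \<in> I \<Longrightarrow> c k \<in> ?E" "\<And>k. k \<in> I \<Longrightarrow> 0 < r k" "\<And>k. k \<in> I \<Longrightarrow> r k \<le> \<delta>"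
      "?E \<subseteq> (\<Union>k\<in>I. ball (c k) (r k))" "(\<Sum>k\<in>I. r k * (cmod (F (c k)) + \<eta>)) \<le> (LINT y:?E|arc_length. cmod (F y) + \<eta>) + \<eta>"
      using weighted_cover[OF E len fc1 f0 \<delta>(1) \<eta>] by blast
    have "cmod (F z) \<le> ?Q * (\<Sum>k\<in>I. r k * (cmod (F (c k)) + \<eta>))"
    proof (rule excised_cauchy_estimate[OF _ \<Delta>(1,2) z I(1,3) _ _ I(5) _ d(1)])
      show "F holomorphic_on \<Delta>" using \<Delta>(3) closure_subset by (intro holomorphic_on_subset[OF F(1)]) blast
      show "4 * r k \<le> d" if "k \<in> I" for k using I(4)[OF that] \<delta>(2) by linarith
      show "d \<le> dist z (c k)" if "k \<in> I" for k by (rule d(2)[OF I(2)[OF that]])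
      show "cmod (F \<zeta>) \<le> cmod (F (c k)) + \<eta>" if k: "k \<in> I" "\<zeta> \<in> \<Delta>" "\<zeta> \<in> ball (c k) (2 * r k)" for k \<zeta>
      proof -
        have "dist (F \<zeta>) (F (c k)) < \<eta>"
          using k I(2,4)[OF k(1)] \<delta>(3) ES closure_subset[of \<Delta>] by (intro \<delta>0(2)) (auto simp: dist_commute)
        then show ?thesis using norm_triangle_ineq2[of "F \<zeta>" "F (c k)"] by (simp add: dist_norm)
      qed
    qed (use f0 in auto)
    also have "\<dots> \<le> ?Q * ((LINT y:?E|arc_length. cmod (F y) + \<eta>) + \<eta>)" by (rule mult_left_mono[OF I(6) Q0])
    also have "(LINT y:?E|arc_length. cmod (F y) + \<eta>) = (LINT y:?E|arc_length. cmod (F y)) + (LINT y:?E|arc_length. \<eta>)"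
      by (rule set_integral_add(2)[OF arc_set_integrable[OF E len fc] arc_set_integrable[OF E len continuous_on_const]])
    also have "(LINT y:?E|arc_length. \<eta>) = \<eta> * L"
      using E by (simp add: set_lebesgue_integral_def L_def borel_compact)
    finally show ?thesis by (simp only: algebra_simps)
  qed
  show ?thesis
  proof (rule field_le_epsilon)
    fix e :: real assume e: "0 < e"
    let ?\<eta> = "e / (?Q * (L + 1) + 1)"
    have q: "0 < ?Q * (L + 1) + 1" using Q0 L0 by (intro add_nonneg_pos mult_nonneg_nonneg) auto
    have "?\<eta> * (?Q * (L + 1)) \<le> ?\<eta> * (?Q * (L + 1) + 1)" using e q by (intro mult_left_mono) auto
    also have "\<dots> = e" using q by simp
    finally show "cmod (F z) \<le> ?Q * (LINT y:?E|arc_length. cmod (F y)) + e"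
      using step[of ?\<eta>] e q by (smt (verit) divide_pos_pos)
  qed
qed

section \<open>Generalized Hardy spaces\<close>

lemma exhaustion_facts:
  assumes ex: "rectifiable_exhaustion \<Omega> \<Delta>" and b: "bounded \<Omega>"
  shows "open (\<Delta> n)" "bounded (\<Delta> n)" "closure (\<Delta> n) \<subseteq> \<Omega>" "compact (frontier (\<Delta> n))" "frontier (\<Delta> n) \<subseteq> \<Omega>"
    "emeasure arc_length (frontier (\<Delta> n)) < \<infinity>"
proof -
  show 1: "open (\<Delta> n)" "closure (\<Delta> n) \<subseteq> \<Omega>" using ex by (auto simp: rectifiable_exhaustion_def domain_set_def)
  then have "bounded (closure (\<Delta> n))" using b bounded_subset by blast
  then show 2: "bounded (\<Delta> n)" by (rule bounded_subset[OF _ closure_subset])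
  then show "compact (frontier (\<Delta> n))" by (simp add: compact_frontier_bounded)
  show "frontier (\<Delta> n) \<subseteq> \<Omega>" using 1(2) by (auto simp: frontier_def)
  have "\<exists>L::real. \<forall>n. emeasure arc_length (frontier (\<Delta> n)) \<le> ennreal L"
    using ex unfolding rectifiable_exhaustion_def by (elim conjE)
  then obtain L :: real where "\<forall>n. emeasure arc_length (frontier (\<Delta> n)) \<le> ennreal L" ..
  then have "emeasure arc_length (frontier (\<Delta> n)) \<le> ennreal L" ..
  also have "ennreal L < \<infinity>" by simp
  finally show "emeasure arc_length (frontier (\<Delta> n)) < \<infinity>" .
qed

lemma lp_norm_powr:
  assumes "0 < p" shows "lp_norm p w C powr p = (LINT z:C|arc_length. cmod (w z) powr p)" "0 \<le> lp_norm p w C"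
proof -
  have "0 \<le> (LINT z:C|arc_length. cmod (w z) powr p)"
    unfolding set_lebesgue_integral_def by (intro Bochner_Integration.integral_nonneg) auto
  then show "lp_norm p w C powr p = (LINT z:C|arc_length. cmod (w z) powr p)"
    using assms by (simp add: lp_norm_def powr_powr)
qed (simp add: lp_norm_def)

lemma powr_le_imp_le:
  fixes x y p :: real
  assumes "0 < p" "0 \<le> x" "0 \<le> y" "x powr p \<le> y powr p" shows "x \<le> y"
  using assms powr_less_mono2[of p y x] by (meson not_le)

context
  fixes p :: real and E :: "complex set"
  assumes p: "0 < p" and E: "compact E" "emeasure arc_length E < \<infinity>"
begin

lemma lp_integrable:
  assumes "continuous_on E w" shows "set_integrable arc_length E (\<lambda>z. cmod (w z) powr p)"
  using p by (intro arc_set_integrable[OF E] continuous_on_powr' continuous_intros assms) auto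

lemma lp_norm_mono:
  assumes u: "continuous_on E u" and v: "continuous_on E v" and c: "0 \<le> c" and le: "\<And>z. z \<in> E \<Longrightarrow> cmod (u z) \<le> c * cmod (v z)"
  shows "lp_norm p u E \<le> c * lp_norm p v E"
proof (rule powr_le_imp_le[OF p])
  have "lp_norm p u E powr p \<le> (LINT z:E|arc_length. c powr p * cmod (v z) powr p)"
    unfolding lp_norm_powr(1)[OF p]
  proof (rule set_integral_mono[OF lp_integrable[OF u] set_integrable_mult_right[OF lp_integrable[OF v]]])
    show "cmod (u z) powr p \<le> c powr p * cmod (v z) powr p" if "z \<in> E" for z
      using powr_mono2[of p "cmod (u z)" "c * cmod (v z)"] le[OF that] p c by (simp add: powr_mult)
  qed
  also have "\<dots> = (c * lp_norm p v E) powr p"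
    using c lp_norm_powr[OF p, of v E] by (simp add: powr_mult)
  finally show "lp_norm p u E powr p \<le> (c * lp_norm p v E) powr p" .
qed (use lp_norm_powr(2)[OF p] c in auto)

text \<open>Minkowski's inequality up to a constant factor, which is harmless for statements about convergence.\<close>

lemma lp_norm_quasi_triangle:
  assumes p1: "1 < p" and u: "continuous_on E u" and a: "continuous_on E a" and b: "continuous_on E b"
    and le: "\<And>z. z \<in> E \<Longrightarrow> cmod (u z) \<le> cmod (a z) + cmod (b z)"
  shows "lp_norm p u E \<le> 4 * (lp_norm p a E + lp_norm p b E)"
proof (rule powr_le_imp_le[OF p])
  let ?a = "lp_norm p a E" and ?b = "lp_norm p b E"
  define m where "m = max ?a ?b"
  have m: "0 \<le> m" "?a \<le> m" "?b \<le> m" "m \<le> ?a + ?b"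
    using lp_norm_powr(2)[OF p, of a E] lp_norm_powr(2)[OF p, of b E] by (auto simp: m_def)
  have "lp_norm p u E powr p \<le> (LINT z:E|arc_length. 2 powr p * cmod (a z) powr p + 2 powr p * cmod (b z) powr p)"
    unfolding lp_norm_powr(1)[OF p]
  proof (rule set_integral_mono[OF lp_integrable[OF u]])
    show "set_integrable arc_length E (\<lambda>z. 2 powr p * cmod (a z) powr p + 2 powr p * cmod (b z) powr p)"
      by (intro set_integral_add set_integrable_mult_right lp_integrable a b)
    show "cmod (u z) powr p \<le> 2 powr p * cmod (a z) powr p + 2 powr p * cmod (b z) powr p" if "z \<in> E" for z
    proof -
      have "cmod (u z) \<le> 2 * max (cmod (a z)) (cmod (b z))" using le[OF that] by linarith
      then have "cmod (u z) powr p \<le> (2 * max (cmod (a z)) (cmod (b z))) powr p" using p by (intro powr_mono2) auto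
      also have "\<dots> = 2 powr p * max (cmod (a z)) (cmod (b z)) powr p" by (simp add: powr_mult)
      also have "\<dots> \<le> 2 powr p * cmod (a z) powr p + 2 powr p * cmod (b z) powr p" by (cases "cmod (a z) \<le> cmod (b z)") auto
      finally show ?thesis .
    qed
  qed
  also have "\<dots> = 2 powr p * (?a powr p + ?b powr p)"
    using lp_integrable[OF a] lp_integrable[OF b] unfolding lp_norm_powr(1)[OF p]
    by (subst set_integral_add(2)) (auto intro: set_integrable_mult_right simp: distrib_left)
  also have "\<dots> \<le> 2 powr p * (2 powr 1 * m powr p)"
    using powr_mono2[of p ?a m] powr_mono2[of p ?b m] lp_norm_powr(2)[OF p] m p by (intro mult_left_mono) auto
  also have "\<dots> \<le> 2 powr p * (2 powr p * m powr p)"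
    using p1 by (intro mult_left_mono mult_right_mono powr_mono) auto
  also have "\<dots> = (4 * m) powr p" using m by (simp add: powr_mult[symmetric])
  also have "\<dots> \<le> (4 * (?a + ?b)) powr p" using m p by (intro powr_mono2) auto
  finally show "lp_norm p u E powr p \<le> (4 * (?a + ?b)) powr p" .
qed (use lp_norm_powr(2)[OF p] in auto)

text \<open>The factor \<open>L + 1\<close> dominates the factor \<open>L powr (1 - 1/p)\<close> of Hoelder's inequality for every \<open>p\<close>.\<close>

lemma mean_le_lp_norm:
  assumes p1: "1 < p" and w: "continuous_on E w" and L: "measure arc_length E \<le> L"
  shows "(LINT z:E|arc_length. cmod (w z)) \<le> (L + 1) * lp_norm p w E"
proof -
  have L0: "0 \<le> L" using L measure_nonneg order_trans by blast
  have ci: "set_integrable arc_length E (\<lambda>z. cmod (w z))" by (intro arc_set_integrable[OF E] continuous_intros w)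
  have EB: "E \<in> sets borel" using E by (simp add: borel_compact)
  have key: "(LINT z:E|arc_length. cmod (w z)) \<le> (L + 1) * t" if t: "lp_norm p w E < t" for t
  proof -
    have t0: "0 < t" using t lp_norm_powr(2)[OF p, of w E] by linarith
    have ti: "set_integrable arc_length E (\<lambda>_. t)" by (rule arc_set_integrable[OF E continuous_on_const])
    note wi = set_integrable_mult_right[OF lp_integrable[OF w], of "t powr (1 - p)"]
    have "(LINT z:E|arc_length. cmod (w z)) \<le> (LINT z:E|arc_length. t + t powr (1 - p) * cmod (w z) powr p)"
    proof (rule set_integral_mono[OF ci set_integral_add(1)[OF ti wi]])
      fix z
      show "cmod (w z) \<le> t + t powr (1 - p) * cmod (w z) powr p"
      proof (cases "cmod (w z) \<le> t")
        case True
        then show ?thesis by (simp add: add_increasing2)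
      next
        case False
        then have "cmod (w z) powr (1 - p) \<le> t powr (1 - p)" using t0 p1 by (intro powr_mono2') auto
        then have "cmod (w z) powr (1 - p) * cmod (w z) powr p \<le> t powr (1 - p) * cmod (w z) powr p" by (intro mult_right_mono) auto
        moreover have "cmod (w z) powr (1 - p) * cmod (w z) powr p = cmod (w z)" using False t0 by (simp flip: powr_add)
        ultimately show ?thesis using t0 by linarith
      qed
    qed
    also have "\<dots> = t * measure arc_length E + t powr (1 - p) * lp_norm p w E powr p"
      unfolding lp_norm_powr(1)[OF p] set_integral_add(2)[OF ti wi] using EB by (simp add: set_lebesgue_integral_def)
    also have "\<dots> \<le> t * L + t powr (1 - p) * t powr p"
      using t0 t L lp_norm_powr(2)[OF p] p by (intro add_mono mult_left_mono powr_mono2) auto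
    also have "t powr (1 - p) * t powr p = t" using t0 by (simp flip: powr_add)
    finally show ?thesis by (simp add: algebra_simps)
  qed
  have "(LINT z:E|arc_length. cmod (w z)) \<le> (L + 1) * lp_norm p w E + e" if e: "0 < e" for e
  proof -
    have "(L + 1) * (lp_norm p w E + e / (L + 1)) = (L + 1) * lp_norm p w E + e" using L0 by (simp add: field_simps)
    moreover have "lp_norm p w E < lp_norm p w E + e / (L + 1)" using e L0 by simp
    ultimately show ?thesis using key by metis
  qed
  then show ?thesis by (rule field_le_epsilon)
qed

end

lemma G_spaceD:
  assumes "w \<in> G_space p \<Omega> \<Delta> \<alpha>"
  shows "continuous_on \<Omega> w" "solves_dbar_eq \<Omega> \<alpha> w" "lp_norm p w (frontier (\<Delta> n)) \<le> G_norm p \<Delta> w"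
  using assms unfolding G_space_def G_norm_def by (auto intro: cSUP_upper)

lemma G_norm_leI: "(\<And>n. lp_norm p w (frontier (\<Delta> n)) \<le> C) \<Longrightarrow> G_norm p \<Delta> w \<le> C"
  unfolding G_norm_def by (intro cSUP_least) auto

lemma G_norm_nonneg: "0 < p \<Longrightarrow> w \<in> G_space p \<Omega> \<Delta> \<alpha> \<Longrightarrow> 0 \<le> G_norm p \<Delta> w"
  using G_spaceD(3)[of w p \<Omega> \<Delta> \<alpha> 0] lp_norm_powr(2)[of p w "frontier (\<Delta> 0)"] by linarith

lemma solves_dbar_eq_iff_density:
  assumes S: "open S" and w: "continuous_on S w" and a: "\<alpha>' \<in> density_on S M" "AE z in lborel. z \<in> S \<longrightarrow> \<alpha> z = \<alpha>' z"
  shows "solves_dbar_eq S \<alpha> w \<longleftrightarrow> (\<forall>\<psi>\<in>test_functions S. (LINT z|lborel. w z * dbar \<psi> z + \<alpha>' z * cnj (w z) * \<psi> z) = 0)"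
proof (rule solves_dbar_eq_iff[OF S w a(1) _ refl])
  show "AE z in lborel. z \<in> S \<longrightarrow> \<alpha> z * cnj (w z) = \<alpha>' z * cnj (w z)" using a(2) by eventually_elim simp
  show "continuous_on S (\<lambda>z. cnj (w z))" by (intro continuous_intros w)
qed

lemma weak_integrand_density:
  assumes S: "open S" and w: "continuous_on S w" and a: "\<alpha>' \<in> density_on S M" and \<psi>: "\<psi> \<in> test_functions S"
  shows "\<exists>N. (\<lambda>z. w z * dbar \<psi> z + \<alpha>' z * cnj (w z) * \<psi> z) \<in> density_on (closure {z. \<psi> z \<noteq> 0}) N"
proof -
  let ?K = "closure {z. \<psi> z \<noteq> 0}"
  note t = test_functionsD[OF \<psi>]
  obtain B where B: "\<psi> \<in> density_on ?K B" "dbar \<psi> \<in> density_on ?K B" using test_density[OF \<psi>] by blast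
  obtain N1 where N1: "(\<lambda>z. w z * dbar \<psi> z) \<in> density_on ?K N1" using density_compact_product[OF t(2,3) S w B(2)] .
  have cw: "continuous_on S (\<lambda>z. cnj (w z))" by (intro continuous_intros w)
  obtain N2 where N2: "(\<lambda>z. cnj (w z) * \<psi> z) \<in> density_on ?K N2" using density_compact_product[OF t(2,3) S cw B(1)] .
  have N3: "(\<lambda>z. cnj (w z) * \<psi> z * \<alpha>' z) \<in> density_on ?K (N2 * M)"
    using density_on_bound[OF a] density_on_nonneg[OF a] by (intro density_on_mult[OF N2 density_on_measurable[OF a]]) auto
  from density_on_add[OF N1 N3] show ?thesis by (intro exI[of _ "N1 + N2 * M"]) (simp add: mult_ac)
qed

lemma solves_dbar_eq_diff:
  assumes S: "open S" and \<alpha>: "\<alpha> \<in> L_inf S" and u: "continuous_on S u" "solves_dbar_eq S \<alpha> u"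
    and v: "continuous_on S v" "solves_dbar_eq S \<alpha> v"
  shows "solves_dbar_eq S \<alpha> (\<lambda>z. u z - v z)"
proof -
  obtain \<alpha>' M where a: "\<alpha>' \<in> density_on S M" "AE z in lborel. z \<in> S \<longrightarrow> \<alpha> z = \<alpha>' z"
    using L_inf_density[OF \<alpha>] S by (metis borel_open)
  have uv: "continuous_on S (\<lambda>z. u z - v z)" by (intro continuous_intros u v)
  have "(LINT z|lborel. (u z - v z) * dbar \<psi> z + \<alpha>' z * cnj (u z - v z) * \<psi> z) = 0" if \<psi>: "\<psi> \<in> test_functions S" for \<psi>
  proof -
    let ?K = "closure {z. \<psi> z \<noteq> 0}"
    let ?f = "\<lambda>w z. w z * dbar \<psi> z + \<alpha>' z * cnj (w z) * \<psi> z"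
    have KB: "?K \<in> sets borel" "bounded ?K" using test_functionsD(2)[OF \<psi>] by (auto intro: compact_imp_bounded)
    have i: "integrable lborel (?f w)" if "continuous_on S w" for w
      using weak_integrand_density[OF S that a(1) \<psi>] density_integrable[OF KB] by blast
    have z: "(LINT z|lborel. ?f w z) = 0" if "continuous_on S w" "solves_dbar_eq S \<alpha> w" for w
      using solves_dbar_eq_iff_density[OF S that(1) a] that(2) \<psi> by blast
    have "(LINT z|lborel. (u z - v z) * dbar \<psi> z + \<alpha>' z * cnj (u z - v z) * \<psi> z) = (LINT z|lborel. ?f u z - ?f v z)"
      by (rule Bochner_Integration.integral_cong[OF refl]) (simp add: algebra_simps)
    also have "\<dots> = (LINT z|lborel. ?f u z) - (LINT z|lborel. ?f v z)"
      by (rule Bochner_Integration.integral_diff[OF i[OF u(1)] i[OF v(1)]])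
    also have "\<dots> = 0" using z[OF u] z[OF v] by simp
    finally show ?thesis .
  qed
  then show ?thesis using solves_dbar_eq_iff_density[OF S uv a] by blast
qed

text \<open>Dominated convergence in the weak formulation; a test function only sees a compact subset of \<open>S\<close>.\<close>

lemma solves_dbar_eq_limit:
  assumes S: "open S" and \<alpha>: "\<alpha> \<in> L_inf S" and w: "\<And>k. continuous_on S (w k)" "\<And>k. solves_dbar_eq S \<alpha> (w k)"
    and g: "continuous_on S g" and lim: "\<And>z. z \<in> S \<Longrightarrow> (\<lambda>k. w k z) \<longlonglongrightarrow> g z"
    and bd: "\<And>K. compact K \<Longrightarrow> K \<subseteq> S \<Longrightarrow> \<exists>B. \<forall>k. \<forall>z\<in>K. cmod (w k z) \<le> B"
  shows "solves_dbar_eq S \<alpha> g"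
proof -
  obtain \<alpha>' M where a: "\<alpha>' \<in> density_on S M" "AE z in lborel. z \<in> S \<longrightarrow> \<alpha> z = \<alpha>' z"
    using L_inf_density[OF \<alpha>] S by (metis borel_open)
  have "(LINT z|lborel. g z * dbar \<psi> z + \<alpha>' z * cnj (g z) * \<psi> z) = 0" if \<psi>: "\<psi> \<in> test_functions S" for \<psi>
  proof -
    let ?K = "closure {z. \<psi> z \<noteq> 0}"
    let ?f = "\<lambda>w z. w z * dbar \<psi> z + \<alpha>' z * cnj (w z) * \<psi> z"
    note t = test_functionsD[OF \<psi>]
    have KB: "?K \<in> sets borel" "bounded ?K" using t(2) by (auto intro: compact_imp_bounded)
    obtain B where B: "\<And>k z. z \<in> ?K \<Longrightarrow> cmod (w k z) \<le> B" using bd[OF t(2,3)] by blast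
    obtain N where N: "\<psi> \<in> density_on ?K N" "dbar \<psi> \<in> density_on ?K N" using test_density[OF \<psi>] by blast
    note N0 = density_on_nonneg[OF N(1)] and M0 = density_on_nonneg[OF a(1)]
    have z: "(LINT z|lborel. ?f (w k) z) = 0" for k
      using solves_dbar_eq_iff_density[OF S w(1) a] w(2) \<psi> by blast
    have "(\<lambda>k. LINT z|lborel. ?f (w k) z) \<longlonglongrightarrow> (LINT z|lborel. ?f g z)"
    proof (rule integral_dominated_convergence[where w="\<lambda>z. (\<bar>B\<bar> * N + M * \<bar>B\<bar> * N) * indicator ?K z"])
      show "?f g \<in> borel_measurable lborel"
        using weak_integrand_density[OF S g a(1) \<psi>] density_on_measurable by force
      show "?f (w k) \<in> borel_measurable lborel" for k
        using weak_integrand_density[OF S w(1) a(1) \<psi>] density_on_measurable by force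
      show "integrable lborel (\<lambda>z. (\<bar>B\<bar> * N + M * \<bar>B\<bar> * N) * indicator ?K z)"
        using emeasure_lborel_bounded_finite[OF KB(2)] KB(1) by (intro integrable_mult_right integrable_real_indicator) auto
      show "AE z in lborel. (\<lambda>k. ?f (w k) z) \<longlonglongrightarrow> ?f g z"
      proof (rule AE_I2)
        fix z
        show "(\<lambda>k. ?f (w k) z) \<longlonglongrightarrow> ?f g z"
        proof (cases "z \<in> S")
          case True
          show ?thesis by (intro tendsto_intros lim True)
        next
          case False
          then have zK: "z \<notin> ?K" using t(3) by blast
          show ?thesis using t(4)[OF zK] t(5)[OF zK] by simp
        qed
      qed
      show "AE z in lborel. norm (?f (w k) z) \<le> (\<bar>B\<bar> * N + M * \<bar>B\<bar> * N) * indicator ?K z" for k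
      proof (rule AE_I2)
        fix z
        show "norm (?f (w k) z) \<le> (\<bar>B\<bar> * N + M * \<bar>B\<bar> * N) * indicator ?K z"
        proof (cases "z \<in> ?K")
          case True
          have "norm (?f (w k) z) \<le> cmod (w k z) * cmod (dbar \<psi> z) + cmod (\<alpha>' z) * cmod (w k z) * cmod (\<psi> z)"
            by (rule order_trans[OF norm_triangle_ineq]) (simp add: norm_mult)
          also have "\<dots> \<le> \<bar>B\<bar> * N + M * \<bar>B\<bar> * N"
            using B[OF True, of k] density_on_bound[OF N(1)] density_on_bound[OF N(2)] density_on_bound[OF a(1)] M0 N0
            by (intro add_mono mult_mono) auto
          finally show ?thesis using True by simp
        next
          case False
          then show ?thesis using t(4)[OF False] t(5)[OF False] by simp
        qed
      qed
    qed
    then show ?thesis by (simp add: z LIMSEQ_const_iff)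
  qed
  then show ?thesis using solves_dbar_eq_iff_density[OF S g a] by blast
qed

context
  fixes p :: real and \<Omega> :: "complex set" and \<Delta> :: "nat \<Rightarrow> complex set"
  assumes p: "1 < p" and \<Omega>: "open \<Omega>" "bounded \<Omega>" and ex: "rectifiable_exhaustion \<Omega> \<Delta>"
begin

lemma frontier_continuous: "continuous_on \<Omega> w \<Longrightarrow> continuous_on (frontier (\<Delta> n)) w"
  by (rule continuous_on_subset[OF _ exhaustion_facts(5)[OF ex \<Omega>(2)]])

text \<open>Membership is decided by the equation and by the size of the modulus, so that it passes between solutions for different coefficients that differ by bounded factors.\<close>

lemma G_space_dominated:
  assumes v: "v \<in> G_space p \<Omega> \<Delta> \<alpha>'" and w: "continuous_on \<Omega> w" "solves_dbar_eq \<Omega> \<alpha> w"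
    and c: "0 \<le> c" and le: "\<And>z. z \<in> \<Omega> \<Longrightarrow> cmod (w z) \<le> c * cmod (v z)"
  shows "w \<in> G_space p \<Omega> \<Delta> \<alpha>" "G_norm p \<Delta> w \<le> c * G_norm p \<Delta> v"
proof -
  have p0: "0 < p" using p by simp
  have *: "lp_norm p w (frontier (\<Delta> n)) \<le> c * G_norm p \<Delta> v" for n
  proof -
    have "lp_norm p w (frontier (\<Delta> n)) \<le> c * lp_norm p v (frontier (\<Delta> n))"
      using le exhaustion_facts(5)[OF ex \<Omega>(2), of n]
      by (intro lp_norm_mono[OF p0 exhaustion_facts(4,6)[OF ex \<Omega>(2)]] frontier_continuous w G_spaceD(1)[OF v] c) auto
    also have "\<dots> \<le> c * G_norm p \<Delta> v" by (intro mult_left_mono G_spaceD(3)[OF v] c)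
    finally show ?thesis .
  qed
  then have "bdd_above (range (\<lambda>n. lp_norm p w (frontier (\<Delta> n))))" by (rule bdd_aboveI2)
  then show "w \<in> G_space p \<Omega> \<Delta> \<alpha>" using w unfolding G_space_def by blast
  show "G_norm p \<Delta> w \<le> c * G_norm p \<Delta> v" by (rule G_norm_leI[OF *])
qed

lemma G_space_diff:
  assumes \<alpha>: "\<alpha> \<in> L_inf \<Omega>" and u: "u \<in> G_space p \<Omega> \<Delta> \<alpha>" and v: "v \<in> G_space p \<Omega> \<Delta> \<alpha>"
  shows "(\<lambda>z. u z - v z) \<in> G_space p \<Omega> \<Delta> \<alpha>"
proof -
  have p0: "0 < p" using p by simp
  note cu = G_spaceD(1)[OF u] and cv = G_spaceD(1)[OF v]
  have "lp_norm p (\<lambda>z. u z - v z) (frontier (\<Delta> n)) \<le> 4 * (G_norm p \<Delta> u + G_norm p \<Delta> v)" for n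
  proof -
    have "lp_norm p (\<lambda>z. u z - v z) (frontier (\<Delta> n)) \<le> 4 * (lp_norm p u (frontier (\<Delta> n)) + lp_norm p v (frontier (\<Delta> n)))"
      by (intro lp_norm_quasi_triangle[OF p0 exhaustion_facts(4,6)[OF ex \<Omega>(2)] p] frontier_continuous cu cv continuous_intros norm_triangle_ineq4)
    also have "\<dots> \<le> 4 * (G_norm p \<Delta> u + G_norm p \<Delta> v)" using G_spaceD(3)[OF u, of n] G_spaceD(3)[OF v, of n] by simp
    finally show ?thesis .
  qed
  then have "bdd_above (range (\<lambda>n. lp_norm p (\<lambda>z. u z - v z) (frontier (\<Delta> n))))" by (rule bdd_aboveI2)
  then show ?thesis
    unfolding G_space_def using solves_dbar_eq_diff[OF \<Omega>(1) \<alpha> cu G_spaceD(2)[OF u] cv G_spaceD(2)[OF v]] cu cv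
    by (auto intro: continuous_on_diff)
qed

text \<open>The estimate of \<open>F\<close> by its mean over the frontier of one \<open>\<Delta> n\<close> containing \<open>K\<close>, carried over to \<open>w = exp (T \<beta>) * F\<close> by the uniform
  bounds for the exponential.\<close>

theorem point_evaluation_bounded:
  assumes \<alpha>: "\<alpha> \<in> L_inf \<Omega>" and K: "compact K" "K \<subseteq> \<Omega>"
  obtains C where "\<And>w z. w \<in> G_space p \<Omega> \<Delta> \<alpha> \<Longrightarrow> z \<in> K \<Longrightarrow> cmod (w z) \<le> C * G_norm p \<Delta> w"
proof -
  have p0: "0 < p" using p by simp
  have \<Omega>B: "\<Omega> \<in> sets borel" using \<Omega> by simp
  have "\<forall>K. compact K \<and> K \<subseteq> \<Omega> \<longrightarrow> (\<forall>\<^sub>F n in sequentially. K \<subseteq> \<Delta> n)"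
    using ex unfolding rectifiable_exhaustion_def by (elim conjE)
  then have "\<forall>\<^sub>F n in sequentially. K \<subseteq> \<Delta> n" using K by simp
  then obtain n where n: "K \<subseteq> \<Delta> n" by (auto simp: eventually_sequentially)
  note f = exhaustion_facts[OF ex \<Omega>(2), of n]
  let ?E = "frontier (\<Delta> n)"
  have "K \<inter> ?E = {}" using n f(1) by (auto simp: frontier_def interior_open)
  then obtain d where d: "0 < d" "\<And>x y. x \<in> K \<Longrightarrow> y \<in> ?E \<Longrightarrow> d \<le> dist x y"
    using separate_compact_closed[OF K(1), of ?E] by auto
  define L where "L = measure arc_length ?E"
  let ?Q = "8 * pi * bump_slope / (d * cauchy_mass)"
  have Q0: "0 \<le> ?Q" using dbar_bump_le(2)[of 1] d cauchy_mass_pos by simp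
  obtain \<alpha>' M where a: "\<alpha>' \<in> density_on \<Omega> M" "AE z in lborel. z \<in> \<Omega> \<longrightarrow> \<alpha> z = \<alpha>' z" using L_inf_density[OF \<alpha> \<Omega>B] .
  let ?A = "exp (M * transform_bound \<Omega>)"
  show ?thesis
  proof (rule that[of "?A * (?Q * (?A * (L + 1)))"])
    fix w z assume w: "w \<in> G_space p \<Omega> \<Delta> \<alpha>" and z: "z \<in> K"
    note wc = G_spaceD(1)[OF w]
    obtain \<beta> F where \<beta>: "\<beta> \<in> density_on \<Omega> M" and F: "F holomorphic_on \<Omega>" and wF: "\<And>z. w z = exp (cauchy_transform \<beta> z) * F z"
      using solves_dbar_eq_factor[OF \<Omega> wc G_spaceD(2)[OF w] a] by metis
    note eb = exp_transform_bound[OF \<Omega>B \<Omega>(2) \<beta>]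
    have Fc: "continuous_on ?E F" by (intro frontier_continuous holomorphic_on_imp_continuous_on F)
    have Fw: "cmod (F y) \<le> ?A * cmod (w y)" for y
    proof -
      have "F y = exp (- cauchy_transform \<beta> y) * w y" unfolding wF by (simp add: mult.assoc[symmetric] flip: exp_add)
      then show ?thesis using eb(2)[of y] by (simp add: norm_mult mult_right_mono)
    qed
    have "(LINT y:?E|arc_length. cmod (F y)) \<le> (L + 1) * lp_norm p F ?E"
      by (rule mean_le_lp_norm[OF p0 f(4,6) p Fc]) (simp add: L_def)
    also have "\<dots> \<le> (L + 1) * (?A * lp_norm p w ?E)"
      using Fw by (intro mult_left_mono lp_norm_mono[OF p0 f(4,6) Fc frontier_continuous[OF wc]]) (auto simp: L_def)
    also have "\<dots> \<le> (L + 1) * (?A * G_norm p \<Delta> w)"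
      by (intro mult_left_mono G_spaceD(3)[OF w]) (auto simp: L_def)
    finally have mean: "(LINT y:?E|arc_length. cmod (F y)) \<le> (L + 1) * (?A * G_norm p \<Delta> w)" .
    have "cmod (F z) \<le> ?Q * (LINT y:?E|arc_length. cmod (F y))"
      using z n d by (intro boundary_mean_estimate[OF F \<Omega>(1) f(1,2,3,6)]) auto
    also have "\<dots> \<le> ?Q * ((L + 1) * (?A * G_norm p \<Delta> w))" by (rule mult_left_mono[OF mean Q0])
    finally have "cmod (exp (cauchy_transform \<beta> z)) * cmod (F z) \<le> ?A * (?Q * ((L + 1) * (?A * G_norm p \<Delta> w)))"
      using eb(1)[of z] by (intro mult_mono) auto
    then show "cmod (w z) \<le> ?A * (?Q * (?A * (L + 1))) * G_norm p \<Delta> w"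
      unfolding wF norm_mult by (simp only: mult_ac)
  qed
qed

end

section \<open>Transfer of compactness\<close>

lemma exp_lipschitz:
  assumes "cmod a \<le> A" "cmod b \<le> A" shows "cmod (exp a - exp b) \<le> exp A * cmod (a - b)"
proof (rule field_differentiable_bound[of "cball 0 A" exp exp])
  show "(exp has_field_derivative exp z) (at z within cball 0 A)" for z :: complex
    by (rule DERIV_subset[OF DERIV_exp]) simp
  show "cmod (exp z) \<le> exp A" if "z \<in> cball 0 A" for z
    using norm_exp[of z] that by (auto intro: order_trans)
qed (use assms in auto)

text \<open>The theorem of Arzela and Ascoli: the bound and the modulus of continuity of a transform depend only on the bound of its density.\<close>

lemma transform_subsequence:
  assumes Z: "Z \<in> sets borel" "bounded Z" and \<beta>: "\<And>k::nat. \<beta> k \<in> density_on Z M"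
  obtains s r where "continuous_on (closure Z) s" "strict_mono (r :: nat \<Rightarrow> nat)"
    "\<And>e. 0 < e \<Longrightarrow> \<exists>N. \<forall>n\<ge>N. \<forall>x\<in>closure Z. cmod (cauchy_transform (\<beta> (r n)) x - s x) < e"
proof -
  let ?B = "M * transform_bound Z"
  have B0: "0 \<le> ?B" using density_on_nonneg[OF \<beta>] transform_bound_nonneg[OF Z] by simp
  have comp: "compact (closure Z)" using Z(2) by (simp add: compact_closure)
  have bd: "norm (cauchy_transform (\<beta> n) x) \<le> ?B" for n x by (rule cauchy_transform_bound[OF Z \<beta>])
  have eq: "\<exists>d. 0 < d \<and> (\<forall>n y. y \<in> closure Z \<and> norm (x - y) < d \<longrightarrow> norm (cauchy_transform (\<beta> n) x - cauchy_transform (\<beta> n) y) < e)"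
    if e: "0 < e" for x e
  proof -
    define d where "d = (e / (?B + 1))\<^sup>2"
    have q: "0 < e / (?B + 1)" using e B0 by simp
    have "0 < d" unfolding d_def by (rule zero_less_power[OF q])
    moreover have "norm (cauchy_transform (\<beta> n) x - cauchy_transform (\<beta> n) y) < e" if y: "norm (x - y) < d" for n y
    proof -
      have "sqrt (cmod (x - y)) < e / (?B + 1)"
        using real_sqrt_less_mono[OF y] q unfolding d_def real_sqrt_abs by linarith
      then have "(?B + 1) * sqrt (cmod (x - y)) < e" using B0 by (simp add: field_simps)
      moreover have "norm (cauchy_transform (\<beta> n) x - cauchy_transform (\<beta> n) y) \<le> ?B * sqrt (cmod (x - y))"
        by (rule cauchy_transform_holder[OF Z \<beta>])
      moreover have "?B * sqrt (cmod (x - y)) \<le> (?B + 1) * sqrt (cmod (x - y))" by (intro mult_right_mono) auto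
      ultimately show ?thesis by linarith
    qed
    ultimately show ?thesis by blast
  qed
  obtain s r where s: "continuous_on (closure Z) s" "strict_mono (r :: nat \<Rightarrow> nat)"
    "\<And>e. 0 < e \<Longrightarrow> \<exists>N. \<forall>n x. n \<ge> N \<and> x \<in> closure Z \<longrightarrow> norm (cauchy_transform (\<beta> (r n)) x - s x) < e"
    proof (rule Arzela_Ascoli[of "closure Z" "\<lambda>n. cauchy_transform (\<beta> n)" ?B, OF comp bd eq], goal_cases)
      case 2 show ?case by (rule that[OF 2(2-4)])
    qed
  show ?thesis
  proof (rule that[OF s(1,2)])
    fix e :: real assume "0 < e"
    from s(3)[OF this] show "\<exists>N. \<forall>n\<ge>N. \<forall>x\<in>closure Z. cmod (cauchy_transform (\<beta> (r n)) x - s x) < e" by blast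
  qed
qed

lemma compact_operatorD:
  assumes "compact_operator X nX Y nY T"
  shows "\<And>f. f \<in> X \<Longrightarrow> T f \<in> Y"
    "\<And>f. (\<And>k. f k \<in> X) \<Longrightarrow> bdd_above (range (\<lambda>k. nX (f k))) \<Longrightarrow>
      \<exists>g\<in>Y. \<exists>r. strict_mono (r :: nat \<Rightarrow> nat) \<and> (\<lambda>k. nY (\<lambda>z. T (f (r k)) z - g z)) \<longlonglongrightarrow> 0"
  using assms unfolding compact_operator_def by blast+

lemma compact_operatorI:
  assumes "\<And>f. f \<in> X \<Longrightarrow> T f \<in> Y"
    "\<And>f. (\<And>k. f k \<in> X) \<Longrightarrow> bdd_above (range (\<lambda>k. nX (f k))) \<Longrightarrow>
      \<exists>g\<in>Y. \<exists>r. strict_mono (r :: nat \<Rightarrow> nat) \<and> (\<lambda>k. nY (\<lambda>z. T (f (r k)) z - g z)) \<longlonglongrightarrow> 0"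
  shows "compact_operator X nX Y nY T"
  unfolding compact_operator_def
proof (intro conjI allI impI)
  show "T ` X \<subseteq> Y" using assms(1) by blast
  fix f :: "nat \<Rightarrow> complex \<Rightarrow> complex"
  assume f: "range f \<subseteq> X \<and> bdd_above (range (\<lambda>k. nX (f k)))"
  then have fX: "f k \<in> X" for k by blast
  have fb: "bdd_above (range (\<lambda>k. nX (f k)))" using f ..
  show "\<exists>g\<in>Y. \<exists>r. strict_mono r \<and> (\<lambda>k. nY (\<lambda>z. T (f (r k)) z - g z)) \<longlonglongrightarrow> 0"
    by (rule assms(2)[OF fX fb])
qed

text \<open>A bounded sequence of solutions for \<open>\<alpha>1\<close> is \<open>exp (T (\<beta> k))\<close> times a bounded sequence of solutions for \<open>\<alpha>2\<close>. Compactness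
  of the operator handles the second factors, Arzela and Ascoli the first ones; the product of the limits is again a solution because norm
  convergence implies pointwise convergence with local bounds.\<close>

theorem compactness_transfer:
  assumes p: "1 < p"
    and \<Omega>1: "open \<Omega>1" "bounded \<Omega>1" "connected \<Omega>1" and \<Omega>2: "open \<Omega>2" "bounded \<Omega>2"
    and ex1: "rectifiable_exhaustion \<Omega>1 \<Delta>1" and ex2: "rectifiable_exhaustion \<Omega>2 \<Delta>2"
    and \<phi>: "\<phi> holomorphic_on \<Omega>1" "\<phi> ` \<Omega>1 \<subseteq> \<Omega>2" "\<phi> \<in> W1_inf \<Omega>1"
    and \<alpha>1: "\<alpha>1 \<in> L_inf \<Omega>2" and \<alpha>2: "\<alpha>2 \<in> L_inf \<Omega>2"
    and comp: "compact_operator (G_space p \<Omega>2 \<Delta>2 \<alpha>2) (G_norm p \<Delta>2)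
      (G_space p \<Omega>1 \<Delta>1 (pullback_coeff \<phi> \<alpha>2)) (G_norm p \<Delta>1) (composition_operator \<phi>)"
  shows "compact_operator (G_space p \<Omega>2 \<Delta>2 \<alpha>1) (G_norm p \<Delta>2)
      (G_space p \<Omega>1 \<Delta>1 (pullback_coeff \<phi> \<alpha>1)) (G_norm p \<Delta>1) (composition_operator \<phi>)"
proof -
  have p0: "0 < p" using p by simp
  have \<Omega>2B: "\<Omega>2 \<in> sets borel" using \<Omega>2 by simp
  let ?X1 = "G_space p \<Omega>2 \<Delta>2 \<alpha>1" and ?X2 = "G_space p \<Omega>2 \<Delta>2 \<alpha>2"
  let ?Y1 = "G_space p \<Omega>1 \<Delta>1 (pullback_coeff \<phi> \<alpha>1)" and ?Y2 = "G_space p \<Omega>1 \<Delta>1 (pullback_coeff \<phi> \<alpha>2)"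
  let ?nX = "G_norm p \<Delta>2" and ?nY = "G_norm p \<Delta>1"
  obtain D where D: "\<And>z. z \<in> \<Omega>1 \<Longrightarrow> cmod (deriv \<phi> z) \<le> D" proof (rule W1_inf_deriv_bounded[OF \<phi>(3,1) \<Omega>1(1)], goal_cases)
    case 1 show ?case by (rule that[OF 1(2)])
  qed
  obtain M where M: "\<And>w1. continuous_on \<Omega>2 w1 \<Longrightarrow> solves_dbar_eq \<Omega>2 \<alpha>1 w1 \<Longrightarrow>
    \<exists>\<beta>\<in>density_on \<Omega>2 M. \<exists>w2. continuous_on \<Omega>2 w2 \<and> solves_dbar_eq \<Omega>2 \<alpha>2 w2 \<and>
      (\<forall>z\<in>\<Omega>2. w1 z = exp (cauchy_transform \<beta> z) * w2 z)"
    proof (rule exchange_coefficients[OF \<Omega>2 \<alpha>1 \<alpha>2], goal_cases)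
      case 1 show ?case by (rule that[OF 1(2)])
    qed
  define A where "A = M * transform_bound \<Omega>2"
  have exA: "0 \<le> exp A" by simp
  have in\<Omega>2: "\<phi> z \<in> \<Omega>2" if "z \<in> \<Omega>1" for z using \<phi>(2) that by blast
  have L1: "pullback_coeff \<phi> \<alpha>1 \<in> L_inf \<Omega>1" by (rule pullback_L_inf[OF \<Omega>1 \<Omega>2 \<phi>(1,2) D \<alpha>1])
  have L2: "pullback_coeff \<phi> \<alpha>2 \<in> L_inf \<Omega>1" by (rule pullback_L_inf[OF \<Omega>1 \<Omega>2 \<phi>(1,2) D \<alpha>2])
  have exch: "\<exists>\<beta> w2. \<beta> \<in> density_on \<Omega>2 M \<and> w2 \<in> ?X2 \<and> ?nX w2 \<le> exp A * ?nX w1 \<and>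
      (\<forall>z\<in>\<Omega>2. w1 z = exp (cauchy_transform \<beta> z) * w2 z)" if w1: "w1 \<in> ?X1" for w1
  proof -
    obtain \<beta> w2 where b: "\<beta> \<in> density_on \<Omega>2 M" and w2: "continuous_on \<Omega>2 w2" "solves_dbar_eq \<Omega>2 \<alpha>2 w2"
      and eq: "\<And>z. z \<in> \<Omega>2 \<Longrightarrow> w1 z = exp (cauchy_transform \<beta> z) * w2 z"
      using M[OF G_spaceD(1,2)[OF w1]] by blast
    have "cmod (w2 z) \<le> exp A * cmod (w1 z)" if "z \<in> \<Omega>2" for z
    proof -
      have "w2 z = exp (- cauchy_transform \<beta> z) * w1 z"
        unfolding eq[OF that] by (simp add: mult.assoc[symmetric] flip: exp_add)
      then show ?thesis
        using exp_transform_bound(2)[OF \<Omega>2B \<Omega>2(2) b, of z] by (simp add: norm_mult mult_right_mono A_def)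
    qed
    from G_space_dominated[OF p \<Omega>2 ex2 w1 w2 exA this] show ?thesis using b eq by blast
  qed
  show ?thesis
  proof (rule compact_operatorI)
    fix w1 assume w1: "w1 \<in> ?X1"
    obtain \<beta> w2 where b: "\<beta> \<in> density_on \<Omega>2 M" and w2: "w2 \<in> ?X2"
      and eq: "\<And>z. z \<in> \<Omega>2 \<Longrightarrow> w1 z = exp (cauchy_transform \<beta> z) * w2 z" using exch[OF w1] by blast
    have v: "w2 \<circ> \<phi> \<in> ?Y2" using compact_operatorD(1)[OF comp w2] by (simp add: composition_operator_def)
    have "cmod ((w1 \<circ> \<phi>) z) \<le> exp A * cmod ((w2 \<circ> \<phi>) z)" if "z \<in> \<Omega>1" for z
      using exp_transform_bound(1)[OF \<Omega>2B \<Omega>2(2) b, of "\<phi> z"] eq[OF in\<Omega>2[OF that]]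
      by (simp add: norm_mult mult_right_mono A_def)
    from G_space_dominated(1)[OF p \<Omega>1(1,2) ex1 v composition_solves_dbar_eq[OF \<Omega>1 \<Omega>2 \<phi>(1,2) D \<alpha>1 G_spaceD(1,2)[OF w1]] exA this]
    show "composition_operator \<phi> w1 \<in> ?Y1" by (simp add: composition_operator_def comp_def)
  next
    fix f :: "nat \<Rightarrow> complex \<Rightarrow> complex"
    assume f: "\<And>k. f k \<in> ?X1" and fb: "bdd_above (range (\<lambda>k. ?nX (f k)))"
    obtain Bf where Bf: "\<And>k. ?nX (f k) \<le> Bf" using fb by (auto simp: bdd_above_def)
    have Bf0: "0 \<le> Bf" using Bf[of 0] G_norm_nonneg[OF p0 f[of 0]] by linarith
    define Q where "Q k b w \<longleftrightarrow> b \<in> density_on \<Omega>2 M \<and> w \<in> ?X2 \<and> ?nX w \<le> exp A * ?nX (f k) \<and>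
      (\<forall>z\<in>\<Omega>2. f k z = exp (cauchy_transform b z) * w z)" for k b w
    have "\<forall>k. \<exists>b w. Q k b w"
    proof
      show "\<exists>b w. Q k b w" for k unfolding Q_def by (rule exch[OF f])
    qed
    then have "\<exists>\<beta> w. \<forall>k. Q k (\<beta> k) (w k)" by (simp only: choice_iff)
    then obtain \<beta> w where Q: "\<And>k. Q k (\<beta> k) (w k)" by blast
    have \<beta>: "\<beta> k \<in> density_on \<Omega>2 M" and w: "w k \<in> ?X2" and wn: "?nX (w k) \<le> exp A * ?nX (f k)"
      and fw: "z \<in> \<Omega>2 \<Longrightarrow> f k z = exp (cauchy_transform (\<beta> k) z) * w k z" for k z
      using Q[of k] unfolding Q_def by blast+
    have "?nX (w k) \<le> exp A * Bf" for k using wn[of k] mult_left_mono[OF Bf[of k] exA] by linarith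
    then have "bdd_above (range (\<lambda>k. ?nX (w k)))" by (rule bdd_aboveI2)
    from compact_operatorD(2)[OF comp w this] obtain g2 r1 where g2: "g2 \<in> ?Y2" and r1: "strict_mono (r1 :: nat \<Rightarrow> nat)"
      and conv: "(\<lambda>k. ?nY (\<lambda>z. composition_operator \<phi> (w (r1 k)) z - g2 z)) \<longlonglongrightarrow> 0" by blast
    obtain s r2 where s: "continuous_on (closure \<Omega>2) s" and r2: "strict_mono (r2 :: nat \<Rightarrow> nat)"
      and unif: "\<And>e. 0 < e \<Longrightarrow> \<exists>N. \<forall>n\<ge>N. \<forall>x\<in>closure \<Omega>2. cmod (cauchy_transform (\<beta> (r1 (r2 n))) x - s x) < e"
      proof (rule transform_subsequence[OF \<Omega>2B \<Omega>2(2), of "\<lambda>k. \<beta> (r1 k)" M, OF \<beta>], goal_cases)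
        case 1 show ?case by (rule that[OF 1(2-4)])
      qed
    define q where "q = r1 \<circ> r2"
    have q: "strict_mono q" unfolding q_def by (rule strict_mono_o[OF r1 r2])
    define S where "S k = cauchy_transform (\<beta> (q k))" for k
    have Sb: "cmod (S k x) \<le> A" for k x unfolding S_def A_def by (rule cauchy_transform_bound[OF \<Omega>2B \<Omega>2(2) \<beta>])
    have Su: "\<exists>N. \<forall>n\<ge>N. \<forall>x\<in>\<Omega>2. cmod (S n x - s x) < e" if e: "0 < e" for e
    proof -
      obtain N where "\<forall>n\<ge>N. \<forall>x\<in>closure \<Omega>2. cmod (cauchy_transform (\<beta> (r1 (r2 n))) x - s x) < e" using unif[OF e] ..
      then have "\<forall>n\<ge>N. \<forall>x\<in>\<Omega>2. cmod (S n x - s x) < e"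
        using closure_subset[of \<Omega>2] unfolding S_def q_def comp_def by blast
      then show ?thesis ..
    qed
    have Sl: "(\<lambda>k. S k x) \<longlonglongrightarrow> s x" if "x \<in> \<Omega>2" for x
    proof (rule LIMSEQ_I)
      fix e :: real assume "0 < e"
      from Su[OF this] obtain N where N: "\<forall>n\<ge>N. \<forall>x\<in>\<Omega>2. cmod (S n x - s x) < e" ..
      then have "\<forall>n\<ge>N. cmod (S n x - s x) < e" using that by simp
      then show "\<exists>N. \<forall>n\<ge>N. cmod (S n x - s x) < e" ..
    qed
    have sb: "cmod (s x) \<le> A" if "x \<in> \<Omega>2" for x
      by (rule Lim_bounded[OF tendsto_norm[OF Sl[OF that]]]) (use Sb in auto)
    define u where "u k = w (q k) \<circ> \<phi>" for k
    have u: "u k \<in> ?Y2" for k unfolding u_def using compact_operatorD(1)[OF comp w] by (simp add: composition_operator_def)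
    have ud: "(\<lambda>z. u k z - g2 z) \<in> ?Y2" for k by (rule G_space_diff[OF p \<Omega>1(1,2) ex1 L2 u g2])
    have uconv: "(\<lambda>k. ?nY (\<lambda>z. u k z - g2 z)) \<longlonglongrightarrow> 0"
      using LIMSEQ_subseq_LIMSEQ[OF conv r2] unfolding u_def q_def composition_operator_def comp_def .
    \<comment> \<open>The candidate for the limit: the product of the limits of the two factors.\<close>
    define g1 where "g1 z = exp (s (\<phi> z)) * g2 z" for z
    define v where "v k = f (q k) \<circ> \<phi>" for k
    have vc: "continuous_on \<Omega>1 (v k)" and vs: "solves_dbar_eq \<Omega>1 (pullback_coeff \<phi> \<alpha>1) (v k)" for k
      unfolding v_def using composition_solves_dbar_eq[OF \<Omega>1 \<Omega>2 \<phi>(1,2) D \<alpha>1 G_spaceD(1,2)[OF f]] by auto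
    have v_eq: "v k z = exp (S k (\<phi> z)) * u k z" if "z \<in> \<Omega>1" for k z
      unfolding v_def u_def S_def comp_def by (rule fw[OF in\<Omega>2[OF that]])
    have eb: "cmod (exp (S k x)) \<le> exp A" for k x using norm_exp[of "S k x"] Sb[of k x] by (auto intro: order_trans)
    have \<phi>c: "continuous_on \<Omega>1 \<phi>" by (rule holomorphic_on_imp_continuous_on[OF \<phi>(1)])
    have "continuous_on \<Omega>1 (\<lambda>z. s (\<phi> z))"
      by (rule continuous_on_compose2[OF s \<phi>c]) (use \<phi>(2) closure_subset[of \<Omega>2] in blast)
    then have g1c: "continuous_on \<Omega>1 g1"
      unfolding g1_def[abs_def] by (intro continuous_intros G_spaceD(1)[OF g2])
    have split: "v k z - g1 z = exp (S k (\<phi> z)) * (u k z - g2 z) + (exp (S k (\<phi> z)) - exp (s (\<phi> z))) * g2 z"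
      if "z \<in> \<Omega>1" for k z unfolding v_eq[OF that] g1_def by (simp add: algebra_simps)
    have vlim: "(\<lambda>k. v k z) \<longlonglongrightarrow> g1 z" if z: "z \<in> \<Omega>1" for z
    proof -
      have zc: "compact {z}" "{z} \<subseteq> \<Omega>1" using z by auto
      obtain C where C: "\<And>w x. w \<in> ?Y2 \<Longrightarrow> x \<in> {z} \<Longrightarrow> cmod (w x) \<le> C * ?nY w"
        proof (rule point_evaluation_bounded[OF p \<Omega>1(1,2) ex1 L2 zc], goal_cases)
          case 1 show ?case by (rule that[OF 1(2)])
        qed
      have "cmod (u k z - g2 z) \<le> C * ?nY (\<lambda>z. u k z - g2 z)" for k by (rule C[OF ud]) simp
      then have "\<forall>\<^sub>F k in sequentially. cmod (u k z - g2 z) \<le> C * ?nY (\<lambda>z. u k z - g2 z)"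
        by (intro always_eventually allI)
      then have "(\<lambda>k. u k z - g2 z) \<longlonglongrightarrow> 0"
        by (rule Lim_null_comparison[OF _ tendsto_mult_right_zero[OF uconv]])
      then have "(\<lambda>k. u k z) \<longlonglongrightarrow> g2 z" by (rule LIM_zero_cancel)
      then have "(\<lambda>k. exp (S k (\<phi> z)) * u k z) \<longlonglongrightarrow> exp (s (\<phi> z)) * g2 z"
        by (intro tendsto_intros Sl in\<Omega>2 z)
      then show ?thesis unfolding v_eq[OF z] g1_def .
    qed
    have vbd: "\<exists>B. \<forall>k. \<forall>z\<in>K. cmod (v k z) \<le> B" if K: "compact K" "K \<subseteq> \<Omega>1" for K
    proof -
      have KK: "compact (\<phi> ` K)" "\<phi> ` K \<subseteq> \<Omega>2"
        using K \<phi>(2) by (auto intro!: compact_continuous_image continuous_on_subset[OF \<phi>c])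
      obtain C where C: "\<And>w x. w \<in> ?X1 \<Longrightarrow> x \<in> \<phi> ` K \<Longrightarrow> cmod (w x) \<le> C * ?nX w"
        proof (rule point_evaluation_bounded[OF p \<Omega>2 ex2 \<alpha>1 KK], goal_cases)
          case 1 show ?case by (rule that[OF 1(2)])
        qed
      have vB: "cmod (v k z) \<le> \<bar>C\<bar> * Bf" if "z \<in> K" for k z
      proof -
        have "cmod (v k z) \<le> C * ?nX (f (q k))" unfolding v_def comp_def using that by (intro C f) auto
        also have "\<dots> \<le> \<bar>C\<bar> * Bf" using Bf[of "q k"] G_norm_nonneg[OF p0 f[of "q k"]] by (intro mult_mono) auto
        finally show ?thesis .
      qed
      show ?thesis by (intro exI[of _ "\<bar>C\<bar> * Bf"] allI ballI vB)
    qed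
    have g1s: "solves_dbar_eq \<Omega>1 (pullback_coeff \<phi> \<alpha>1) g1"
      by (rule solves_dbar_eq_limit[OF \<Omega>1(1) L1 vc vs g1c vlim vbd])
    have "cmod (g1 z) \<le> exp A * cmod (g2 z)" if "z \<in> \<Omega>1" for z
      using norm_exp[of "s (\<phi> z)"] sb[OF in\<Omega>2[OF that]] unfolding g1_def norm_mult
      by (intro mult_right_mono) (auto intro: order_trans)
    from G_space_dominated(1)[OF p \<Omega>1(1,2) ex1 g2 g1c g1s exA this] have g1: "g1 \<in> ?Y1" .
    have "(\<lambda>k. ?nY (\<lambda>z. v k z - g1 z)) \<longlonglongrightarrow> 0"
    proof (rule LIMSEQ_I)
      fix e :: real assume e: "0 < e"
      let ?G = "?nY g2"
      have G0: "0 \<le> ?G" by (rule G_norm_nonneg[OF p0 g2])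
      \<comment> \<open>The factor 4 of the quasi-triangle inequality leaves \<open>e / 2\<close> for each of the two error terms.\<close>
      define \<epsilon> where "\<epsilon> = e / (8 * (?G + 1))"
      have \<epsilon>: "0 < \<epsilon>" using e G0 by (simp add: \<epsilon>_def)
      have \<epsilon>G: "4 * (\<epsilon> * ?G) < e / 2"
        using e G0 unfolding \<epsilon>_def by (simp add: field_simps)
      obtain N1 where N1: "\<And>n x. N1 \<le> n \<Longrightarrow> x \<in> \<Omega>2 \<Longrightarrow> cmod (S n x - s x) < \<epsilon> / exp A"
        using Su[of "\<epsilon> / exp A"] \<epsilon> by auto
      have "0 < e / (8 * exp A)" using e by simp
      from LIMSEQ_D[OF uconv this] obtain N2 where N2: "\<And>n. N2 \<le> n \<Longrightarrow> \<bar>?nY (\<lambda>z. u n z - g2 z)\<bar> < e / (8 * exp A)"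
        by auto
      have "\<bar>?nY (\<lambda>z. v n z - g1 z)\<bar> < e" if n: "max N1 N2 \<le> n" for n
      proof -
        let ?d = "\<lambda>z. u n z - g2 z"
        have dc: "continuous_on \<Omega>1 ?d" by (rule G_spaceD(1)[OF ud])
        have g2c: "continuous_on \<Omega>1 g2" by (rule G_spaceD(1)[OF g2])
        have "?nY (\<lambda>z. v n z - g1 z) \<le> 4 * (exp A * ?nY ?d + \<epsilon> * ?G)"
        proof (rule G_norm_leI)
          fix m
          note fr = exhaustion_facts(4,6)[OF ex1 \<Omega>1(2), of m]
          have sub: "z \<in> \<Omega>1" if "z \<in> frontier (\<Delta>1 m)" for z using exhaustion_facts(5)[OF ex1 \<Omega>1(2), of m] that by blast
          note fc = frontier_continuous[OF p \<Omega>1(1,2) ex1, of _ m]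
          have c1: "continuous_on (frontier (\<Delta>1 m)) (\<lambda>z. of_real (exp A) * ?d z)"
            and c2: "continuous_on (frontier (\<Delta>1 m)) (\<lambda>z. of_real \<epsilon> * g2 z)" by (intro continuous_intros fc dc g2c)+
          have "lp_norm p (\<lambda>z. v n z - g1 z) (frontier (\<Delta>1 m)) \<le>
            4 * (lp_norm p (\<lambda>z. of_real (exp A) * ?d z) (frontier (\<Delta>1 m)) + lp_norm p (\<lambda>z. of_real \<epsilon> * g2 z) (frontier (\<Delta>1 m)))"
          proof (rule lp_norm_quasi_triangle[OF p0 fr p _ c1 c2])
            show "continuous_on (frontier (\<Delta>1 m)) (\<lambda>z. v n z - g1 z)" by (intro continuous_intros fc vc g1c)
            fix z assume "z \<in> frontier (\<Delta>1 m)"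
            then have z: "z \<in> \<Omega>1" by (rule sub)
            have "cmod (exp (S n (\<phi> z)) - exp (s (\<phi> z))) \<le> exp A * cmod (S n (\<phi> z) - s (\<phi> z))"
              by (rule exp_lipschitz[OF Sb sb[OF in\<Omega>2[OF z]]])
            also have "\<dots> \<le> exp A * (\<epsilon> / exp A)"
              using N1[of n "\<phi> z"] n in\<Omega>2[OF z] by (intro mult_left_mono) auto
            finally have 1: "cmod (exp (S n (\<phi> z)) - exp (s (\<phi> z))) \<le> \<epsilon>" by simp
            have "cmod (v n z - g1 z) \<le> cmod (exp (S n (\<phi> z))) * cmod (?d z) + cmod (exp (S n (\<phi> z)) - exp (s (\<phi> z))) * cmod (g2 z)"
              unfolding split[OF z] by (rule order_trans[OF norm_triangle_ineq]) (simp add: norm_mult)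
            also have "\<dots> \<le> exp A * cmod (?d z) + \<epsilon> * cmod (g2 z)"
              by (intro add_mono mult_right_mono eb 1) auto
            also have "\<dots> = cmod (of_real (exp A) * ?d z) + cmod (of_real \<epsilon> * g2 z)" using \<epsilon> by (simp only: norm_mult norm_of_real) simp
            finally show "cmod (v n z - g1 z) \<le> cmod (of_real (exp A) * ?d z) + cmod (of_real \<epsilon> * g2 z)" .
          qed
          also have "lp_norm p (\<lambda>z. of_real (exp A) * ?d z) (frontier (\<Delta>1 m)) \<le> exp A * lp_norm p ?d (frontier (\<Delta>1 m))"
            by (rule lp_norm_mono[OF p0 fr c1 fc[OF dc]]) (simp_all only: norm_mult norm_of_real abs_exp_cancel exA order_refl)
          also have "\<dots> \<le> exp A * ?nY ?d" by (intro mult_left_mono G_spaceD(3)[OF ud] exA)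
          also have "lp_norm p (\<lambda>z. of_real \<epsilon> * g2 z) (frontier (\<Delta>1 m)) \<le> \<epsilon> * lp_norm p g2 (frontier (\<Delta>1 m))"
            using \<epsilon> by (intro lp_norm_mono[OF p0 fr c2 fc[OF g2c]]) (auto simp: norm_mult)
          also have "\<dots> \<le> \<epsilon> * ?G" using \<epsilon> by (intro mult_left_mono G_spaceD(3)[OF g2]) auto
          finally show "lp_norm p (\<lambda>z. v n z - g1 z) (frontier (\<Delta>1 m)) \<le> 4 * (exp A * ?nY ?d + \<epsilon> * ?G)" by simp
        qed
        also have "\<dots> = 4 * exp A * ?nY ?d + 4 * (\<epsilon> * ?G)" by simp
        also have "4 * exp A * ?nY ?d < 4 * exp A * (e / (8 * exp A))"
          using N2[of n] n by (intro mult_strict_left_mono) auto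
        also have "4 * exp A * (e / (8 * exp A)) = e / 2" by simp
        finally have "?nY (\<lambda>z. v n z - g1 z) < e" using \<epsilon>G by simp
        moreover have "0 \<le> ?nY (\<lambda>z. v n z - g1 z)"
        proof (rule G_norm_nonneg[OF p0 G_space_diff[OF p \<Omega>1(1,2) ex1 L1 _ g1]])
          have "cmod (v n z) \<le> exp A * cmod (u n z)" if "z \<in> \<Omega>1" for z
            unfolding v_eq[OF that] norm_mult by (intro mult_right_mono eb) simp
          from G_space_dominated(1)[OF p \<Omega>1(1,2) ex1 u vc vs exA this] show "v n \<in> ?Y1" .
        qed
        ultimately show ?thesis by simp
      qed
      then show "\<exists>no. \<forall>n\<ge>no. norm (?nY (\<lambda>z. v n z - g1 z) - 0) < e" by (intro exI[of _ "max N1 N2"]) simp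
    qed
    then have lim: "(\<lambda>k. ?nY (\<lambda>z. composition_operator \<phi> (f (q k)) z - g1 z)) \<longlonglongrightarrow> 0"
      unfolding v_def composition_operator_def .
    show "\<exists>g\<in>?Y1. \<exists>r. strict_mono r \<and> (\<lambda>k. ?nY (\<lambda>z. composition_operator \<phi> (f (r k)) z - g z)) \<longlonglongrightarrow> 0"
      by (intro bexI[of _ g1] exI[of _ q] conjI g1 q lim)
  qed
qed

lemma compact_operator_equivalent_norm:
  assumes eqv: "equivalently_normed X n1 Y n2" and n1: "\<And>f. f \<in> X \<Longrightarrow> 0 \<le> n1 f"
    and diff: "\<And>u v. u \<in> X \<Longrightarrow> v \<in> X \<Longrightarrow> (\<lambda>z. u z - v z) \<in> X"
  shows "compact_operator X n1 X n1 T \<longleftrightarrow> compact_operator Y n2 Y n2 T"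
proof -
  obtain c C where XY: "X = Y" and c: "0 < c" and le: "\<And>f. f \<in> X \<Longrightarrow> c * n1 f \<le> n2 f" "\<And>f. f \<in> X \<Longrightarrow> n2 f \<le> C * n1 f"
    using eqv unfolding equivalently_normed_def by blast
  have n2: "0 \<le> n2 f" if "f \<in> X" for f using le(1)[OF that] n1[OF that] c by (smt (verit) mult_nonneg_nonneg)
  have transfer: "compact_operator X na X na T \<Longrightarrow> compact_operator X nb X nb T"
    if a0: "\<And>f. f \<in> X \<Longrightarrow> 0 \<le> na f" and b0: "\<And>f. f \<in> X \<Longrightarrow> 0 \<le> nb f"
      and ab: "\<And>f. f \<in> X \<Longrightarrow> na f \<le> K1 * nb f" and ba: "\<And>f. f \<in> X \<Longrightarrow> nb f \<le> K2 * na f" for na nb K1 K2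
  proof (rule compact_operatorI)
    assume comp: "compact_operator X na X na T"
    show T: "T f \<in> X" if "f \<in> X" for f by (rule compact_operatorD(1)[OF comp that])
    fix f :: "nat \<Rightarrow> complex \<Rightarrow> complex" assume f: "\<And>k. f k \<in> X" and b: "bdd_above (range (\<lambda>k. nb (f k)))"
    obtain B where B: "\<And>k. nb (f k) \<le> B" using b by (auto simp: bdd_above_def)
    have "na (f k) \<le> \<bar>K1\<bar> * B" for k
    proof -
      have "na (f k) \<le> K1 * nb (f k)" by (rule ab[OF f])
      also have "\<dots> \<le> \<bar>K1\<bar> * B" using B[of k] b0[OF f[of k]] by (intro mult_mono) auto
      finally show ?thesis .
    qed
    then have "bdd_above (range (\<lambda>k. na (f k)))" by (rule bdd_aboveI2)
    from compact_operatorD(2)[OF comp f this] obtain g r where g: "g \<in> X" "strict_mono (r :: nat \<Rightarrow> nat)"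
      and lim: "(\<lambda>k. na (\<lambda>z. T (f (r k)) z - g z)) \<longlonglongrightarrow> 0" by blast
    have d: "(\<lambda>z. T (f (r k)) z - g z) \<in> X" for k by (intro diff T f g)
    have limb: "(\<lambda>k. nb (\<lambda>z. T (f (r k)) z - g z)) \<longlonglongrightarrow> 0"
    proof (rule tendsto_sandwich[OF _ _ tendsto_const])
      show "(\<lambda>k. K2 * na (\<lambda>z. T (f (r k)) z - g z)) \<longlonglongrightarrow> 0" by (rule tendsto_mult_right_zero[OF lim])
    qed (use b0[OF d] ba[OF d] in \<open>auto intro: always_eventually\<close>)
    show "\<exists>g\<in>X. \<exists>r. strict_mono r \<and> (\<lambda>k. nb (\<lambda>z. T (f (r k)) z - g z)) \<longlonglongrightarrow> 0"
      by (intro bexI[of _ g] exI[of _ r] conjI g limb)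
  qed
  have inv: "n1 f \<le> (1 / c) * n2 f" if "f \<in> X" for f using le(1)[OF that] c by (simp add: field_simps)
  show ?thesis unfolding XY[symmetric]
    by (rule iffI[OF transfer[of n1 n2 "1 / c" C, OF n1 n2 inv le(2)] transfer[of n2 n1 C "1 / c", OF n2 n1 le(2) inv]])
qed

theorem proposition6:
  fixes p :: real
  assumes "1 < p"
  shows
    "(\<forall>\<Omega>1 \<Omega>2 \<Delta>1 \<Delta>2 \<phi> \<alpha>1 \<alpha>2.
        dini_smooth_domain \<Omega>1 \<and> dini_smooth_domain \<Omega>2 \<and>
        rectifiable_exhaustion \<Omega>1 \<Delta>1 \<and> rectifiable_exhaustion \<Omega>2 \<Delta>2 \<and>
        \<phi> holomorphic_on \<Omega>1 \<and> \<phi> ` \<Omega>1 \<subseteq> \<Omega>2 \<and> \<phi> \<in> W1_inf \<Omega>1 \<and>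
        \<alpha>1 \<in> L_inf \<Omega>2 \<and> \<alpha>2 \<in> L_inf \<Omega>2 \<longrightarrow>
        (compact_operator (G_space p \<Omega>2 \<Delta>2 \<alpha>1) (G_norm p \<Delta>2)
           (G_space p \<Omega>1 \<Delta>1 (pullback_coeff \<phi> \<alpha>1)) (G_norm p \<Delta>1) (composition_operator \<phi>) \<longleftrightarrow>
         compact_operator (G_space p \<Omega>2 \<Delta>2 \<alpha>2) (G_norm p \<Delta>2)
           (G_space p \<Omega>1 \<Delta>1 (pullback_coeff \<phi> \<alpha>2)) (G_norm p \<Delta>1) (composition_operator \<phi>)))
     \<and>
     (\<forall>\<Delta> \<phi> \<alpha>.
        rectifiable_exhaustion (ball 0 1) \<Delta> \<and>
        \<phi> holomorphic_on ball 0 1 \<and> \<phi> ` ball 0 1 \<subseteq> ball 0 1 \<and> \<phi> \<in> W1_inf (ball 0 1) \<and>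
        \<alpha> \<in> L_inf (ball 0 1) \<longrightarrow>
        (compact_operator (G_space p (ball 0 1) \<Delta> \<alpha>) (G_norm p \<Delta>)
           (G_space p (ball 0 1) \<Delta> (pullback_coeff \<phi> \<alpha>)) (G_norm p \<Delta>) (composition_operator \<phi>) \<longleftrightarrow>
         compact_operator (G_space p (ball 0 1) \<Delta> (\<lambda>_. 0)) (G_norm p \<Delta>)
           (G_space p (ball 0 1) \<Delta> (\<lambda>_. 0)) (G_norm p \<Delta>) (composition_operator \<phi>))
        \<and>
        (equivalently_normed (G_space p (ball 0 1) \<Delta> (\<lambda>_. 0)) (G_norm p \<Delta>)
           (hardy_space p) (hardy_norm p) \<longrightarrow>
         (compact_operator (G_space p (ball 0 1) \<Delta> \<alpha>) (G_norm p \<Delta>)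
            (G_space p (ball 0 1) \<Delta> (pullback_coeff \<phi> \<alpha>)) (G_norm p \<Delta>) (composition_operator \<phi>) \<longleftrightarrow>
          compact_operator (hardy_space p) (hardy_norm p)
            (hardy_space p) (hardy_norm p) (composition_operator \<phi>))))"
proof (intro conjI allI impI)
  fix \<Omega>1 \<Omega>2 \<Delta>1 \<Delta>2 \<phi> \<alpha>1 \<alpha>2
  assume h: "dini_smooth_domain \<Omega>1 \<and> dini_smooth_domain \<Omega>2 \<and>
        rectifiable_exhaustion \<Omega>1 \<Delta>1 \<and> rectifiable_exhaustion \<Omega>2 \<Delta>2 \<and>
        \<phi> holomorphic_on \<Omega>1 \<and> \<phi> ` \<Omega>1 \<subseteq> \<Omega>2 \<and> \<phi> \<in> W1_inf \<Omega>1 \<and>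
        \<alpha>1 \<in> L_inf \<Omega>2 \<and> \<alpha>2 \<in> L_inf \<Omega>2"
  then have \<Omega>1: "open \<Omega>1" "bounded \<Omega>1" "connected \<Omega>1" and \<Omega>2: "open \<Omega>2" "bounded \<Omega>2"
    unfolding dini_smooth_domain_def domain_set_def by simp_all
  have ex: "rectifiable_exhaustion \<Omega>1 \<Delta>1" "rectifiable_exhaustion \<Omega>2 \<Delta>2"
    and \<phi>: "\<phi> holomorphic_on \<Omega>1" "\<phi> ` \<Omega>1 \<subseteq> \<Omega>2" "\<phi> \<in> W1_inf \<Omega>1"
    and \<alpha>: "\<alpha>1 \<in> L_inf \<Omega>2" "\<alpha>2 \<in> L_inf \<Omega>2" using h by simp_all
  show "compact_operator (G_space p \<Omega>2 \<Delta>2 \<alpha>1) (G_norm p \<Delta>2)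
           (G_space p \<Omega>1 \<Delta>1 (pullback_coeff \<phi> \<alpha>1)) (G_norm p \<Delta>1) (composition_operator \<phi>) \<longleftrightarrow>
         compact_operator (G_space p \<Omega>2 \<Delta>2 \<alpha>2) (G_norm p \<Delta>2)
           (G_space p \<Omega>1 \<Delta>1 (pullback_coeff \<phi> \<alpha>2)) (G_norm p \<Delta>1) (composition_operator \<phi>)"
    using compactness_transfer[OF assms \<Omega>1 \<Omega>2 ex \<phi> \<alpha>] compactness_transfer[OF assms \<Omega>1 \<Omega>2 ex \<phi> \<alpha>(2,1)] by (rule iffI[rotated])
next
  fix \<Delta> \<phi> \<alpha>
  let ?D = "ball (0::complex) 1"
  assume h: "rectifiable_exhaustion ?D \<Delta> \<and> \<phi> holomorphic_on ?D \<and> \<phi> ` ?D \<subseteq> ?D \<and> \<phi> \<in> W1_inf ?D \<and> \<alpha> \<in> L_inf ?D"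
  then have ex: "rectifiable_exhaustion ?D \<Delta>"
    and \<phi>: "\<phi> holomorphic_on ?D" "\<phi> ` ?D \<subseteq> ?D" "\<phi> \<in> W1_inf ?D" and \<alpha>: "\<alpha> \<in> L_inf ?D" by simp_all
  have disc: "open ?D" "bounded ?D" "connected ?D" by simp_all
  have 0: "(\<lambda>_. 0) \<in> L_inf ?D" by (auto simp: L_inf_def)
  have pull0: "pullback_coeff \<phi> (\<lambda>_. 0) = (\<lambda>_. 0)" by (simp add: fun_eq_iff pullback_coeff_def)
  show *: "compact_operator (G_space p ?D \<Delta> \<alpha>) (G_norm p \<Delta>)
           (G_space p ?D \<Delta> (pullback_coeff \<phi> \<alpha>)) (G_norm p \<Delta>) (composition_operator \<phi>) \<longleftrightarrow>
         compact_operator (G_space p ?D \<Delta> (\<lambda>_. 0)) (G_norm p \<Delta>)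
           (G_space p ?D \<Delta> (\<lambda>_. 0)) (G_norm p \<Delta>) (composition_operator \<phi>)"
    using compactness_transfer[OF assms disc disc(1,2) ex ex \<phi> \<alpha> 0] compactness_transfer[OF assms disc disc(1,2) ex ex \<phi> 0 \<alpha>]
    unfolding pull0 by (rule iffI[rotated])
  assume eqv: "equivalently_normed (G_space p ?D \<Delta> (\<lambda>_. 0)) (G_norm p \<Delta>) (hardy_space p) (hardy_norm p)"
  have "0 < p" using assms by simp
  from * compact_operator_equivalent_norm[OF eqv G_norm_nonneg[OF this] G_space_diff[OF assms disc(1,2) ex 0]]
  show "compact_operator (G_space p ?D \<Delta> \<alpha>) (G_norm p \<Delta>)
            (G_space p ?D \<Delta> (pullback_coeff \<phi> \<alpha>)) (G_norm p \<Delta>) (composition_operator \<phi>) \<longleftrightarrow>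
          compact_operator (hardy_space p) (hardy_norm p) (hardy_space p) (hardy_norm p) (composition_operator \<phi>)"
    by (rule trans)
qed

end
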